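(* Let $M$ be a compact manifold, let $F$ be a compact Polish space, let $h:\pi_1(M)\to\operatorname{Homeo}(F)$ be a homomorphism with image $G$, and suppose that $G$ acts freely on $F$ and preserves a regular probability measure $\Lambda$ on $F$. Let $\mathcal F$ be the lamination on $\widetilde M\times_hF$ obtained by suspension of $h$, with the transverse invariant measure $\Lambda$, and assume that $\operatorname{Cat}(\mathcal F,\Lambda)=0$ (so that the secondary $\Lambda$-category is defined). If $\operatorname{Cat}_{\mathrm{II}}(\mathcal F,\Lambda)\neq\operatorname{growth}(G)$, then $G$ is not a Rohlin group.
   Context: **Suspension.** $\widetilde M$ is the universal cover of $M$; $\widetilde M\times_hF$ is the quotient of $\widetilde M\times F$ by the diagonal action of $\pi_1(M)$ (deck transformations on $\widetilde M$, $h$ on $F$), foliated by the images of the sets $\widetilde M\times\{y\}$, $y\in F$. Each fiber over $M$ is a complete transversal homeomorphic to $F$, on which the holonomy is given by $G=h(\pi_1(M))$; hence a $G$-invariant measure on $F$ is a transverse invariant measure. **Rohlin groups.** Let $G$ be a locally compact, second countable, Hausdorff topological group acting on a standard Borel space $Y$ with an invariant probability measure $\Lambda$, and let $E\subset G$ be Borel. A Borel set $V\subset Y$ is an $E$-base if $EV=\bigcup_{f\in E}f(V)$ is Borel, $\Lambda(EV)>0$ and the sets $f(V)$, $f\in E$, are pairwise disjoint; then $EV$ is called an $E$-tower. A relatively compact set $E\subset G$ is a Rohlin set if, for every free action of $G$ on a standard Borel space $Y$ with an invariant probability measure $\Lambda$ and every $\varepsilon>0$, there is an $E$-tower $EV\subset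 Y$ with $\Lambda(EV)>1-\varepsilon$. $G$ is a Rohlin group if every compact $K\subset G$ is contained in a Rohlin set. Here $G=h(\pi_1(M))$ is considered as a discrete group. **Laminations.** A foliated chart of a Polish space $X$ is a pair $(U,\varphi)$ with $U\subset X$ open and $\varphi:U\to B^n\times S$ a homeomorphism, where $B^n$ is an open ball of $\mathbb R^n$ and $S$ is Polish; its plaques are the sets corresponding to $B^n\times\{s\}$. A foliated atlas is a family of foliated charts $(U_i,\varphi_i)$ covering $X$ whose changes of coordinates are locally of the form $(x,s)\mapsto(f_{ij}(x,s),g_{ij}(s))$; a lamination $\mathcal F$ is a maximal foliated atlas. The plaques form a base of the leaf topology, whose connected components are the leaves. A foliated atlas is regular if: (a) it is locally finite; (b) if a plaque $P$ of a chart $U_i$ meets another chart $U_j$, then $P\cap U_j$ is contained in only one plaque of $U_j$; (c) if $U_i\cap U_j\ne\emptyset$, there is a foliated chart $(V,\psi)$ with $U_i\cup U_j\subset V$, $\varphi_i=\psi|_{U_i}$, $\varphi_j=\psi|_{U_j}$. A transverse invariant measure is a measure on a complete transversal invariant by holonomy; it extends to all transverse sets (measurable sets meeting each leaf in a countable set), invariantly under measurable transformations keeping each point in its leaf. A measure is regular if the measure of each measurable set $B$ is the infimum of the measures of open sets containing $B$ and the supremum of the measures of compact sets contained in $B$. **$\Lambda$-category.** For $U\subset X$ open, $\mathcal F_U$ is the restriction of $\mathcal F$ to $U$, and $U\times\mathbb R$ is foliated by the products of leaves of $\mathcal F_U$ with $\mathbb R$. A tangential deformation of $U$ is a continuous foliated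 map (taking leaves into leaves) $H:U\times\mathbb R\to X$ with $H(-,0)$ the inclusion. It is a tangential contraction if $H(-,1)$ is constant on each leaf of $\mathcal F_U$; then $U$ is called tangentially categorical, and $H(U\times\{1\})$ is a transverse set. Put $\tau_\Lambda(U)=\inf_H\Lambda(H(U\times\{1\}))$ over tangential contractions $H$ of $U$, and $\operatorname{Cat}(\mathcal F,\Lambda)=\inf_{\mathcal V}\sum_{U\in\mathcal V}\tau_\Lambda(U)$ over coverings $\mathcal V$ of $X$ by tangentially categorical open sets. **Secondary $\Lambda$-category** ($X$ compact, $\Lambda$ regular and finite on compact sets, $\operatorname{Cat}(\mathcal F,\Lambda)=0$). Fix a finite regular atlas $\mathcal U$. A chain of plaques is a finite sequence of plaques of charts of $\mathcal U$, each meeting the next one; its length is its number of elements plus one. The length of a path in a leaf is the minimum length of a chain of plaques covering it; the length of a tangential deformation is the supremum of the lengths of the leafwise paths $t\mapsto H(x,t)$, $t\in[0,1]$. $\operatorname{Cat}(\mathcal F,\Lambda,n,\mathcal U)$ is defined like $\operatorname{Cat}(\mathcal F,\Lambda)$ using only tangential contractions of length $\le n$; it is regarded as a non-increasing sequence of positive numbers converging to $0$ (with $1/\infty=0$). **Growth types.** For non-decreasing $g,k:\mathbb N\to[0,\infty)$, $\mathbb N=\{1,2,\dots\}$, write $g\preceq k$ if there are $B\in\mathbb N$, $A>0$ with $g(n)\le A\,k(Bn)$ for all $n$; $g\simeq k$ means $g\preceq k\preceq g$. Classes $[g]$ are growth types. $\operatorname{Cat}_{\mathrm{II}}(\mathcal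 F,\Lambda)=[1/\operatorname{Cat}(\mathcal F,\Lambda,n,\mathcal U)]$, which does not depend on the finite regular atlas $\mathcal U$. For a finitely generated group $G$ with finite symmetric generating set $S$ (containing the identity and closed under inverses), $S_n$ is the set of products of at most $n$ elements of $S$, and $\operatorname{growth}(G)=[\#S_n]$, independent of $S$.
   Formalization: In condition (c) of a regular atlas, φ_i = ψ|U_i is read up to a foliated change of coordinates (plaques of U_i are traces of plaques of V); read literally, no finite regular atlas exists on the compact suspension when dim M ≥ 1. *)

theory Defs
  imports
    "HOL-Analysis.Analysis"
    "HOL-Probability.Probability_Measure"
    "HOL-Algebra.Bij"
    "HOL-Algebra.Generated_Groups"
begin

section \<open>Topological and measure-theoretic preliminaries\<close>

definition Polish_space :: "'a topology \<Rightarrow> bool" where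
  "Polish_space X \<longleftrightarrow> completely_metrizable_space X \<and> second_countable X"

definition borel_of :: "'a topology \<Rightarrow> 'a measure" where
  "borel_of X = sigma (topspace X) {U. openin X U}"

definition standard_borel :: "'a measure \<Rightarrow> bool" where
  "standard_borel Y \<longleftrightarrow>
     (\<exists>T. Polish_space T \<and> topspace T = space Y \<and> sets Y = sets (borel_of T))"

definition regular_measure :: "'a topology \<Rightarrow> 'a measure \<Rightarrow> bool" where
  "regular_measure X \<nu> \<longleftrightarrow>
     (\<forall>B\<in>sets \<nu>.
        emeasure \<nu> B = (INF U\<in>{U. openin X U \<and> B \<subseteq> U}. emeasure \<nu> U) \<and>
        emeasure \<nu> B = (SUP K\<in>{K. compactin X K \<and> K \<subseteq> B}. emeasure \<nu> K))"

definition quotient_topology :: "'a topology \<Rightarrow> ('a \<times> 'a) set \<Rightarrow> 'a set topology" where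
  "quotient_topology Z r =
     topology (\<lambda>W. W \<subseteq> topspace Z // r \<and> openin Z {z \<in> topspace Z. r `` {z} \<in> W})"

lemma openin_quotient_topology:
  "openin (quotient_topology Z r) W \<longleftrightarrow>
     W \<subseteq> topspace Z // r \<and> openin Z {z \<in> topspace Z. r `` {z} \<in> W}"
proof -
  let ?P = "\<lambda>W. W \<subseteq> topspace Z // r \<and> openin Z {z \<in> topspace Z. r `` {z} \<in> W}"
  have "istopology ?P"
    unfolding istopology_def
  proof (intro conjI allI impI)
    fix S T assume "?P S" "?P T"
    then have "openin Z ({z \<in> topspace Z. r `` {z} \<in> S} \<inter> {z \<in> topspace Z. r `` {z} \<in> T})"
      by blast
    moreover have "{z \<in> topspace Z. r `` {z} \<in> S} \<inter> {z \<in> topspace Z. r `` {z} \<in> T}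
                   = {z \<in> topspace Z. r `` {z} \<in> S \<inter> T}"
      by blast
    ultimately show "openin Z {z \<in> topspace Z. r `` {z} \<in> S \<inter> T}" by simp
    show "S \<inter> T \<subseteq> topspace Z // r" using \<open>?P S\<close> by blast
  next
    fix K assume K: "\<forall>W\<in>K. ?P W"
    then have "openin Z (\<Union>W\<in>K. {z \<in> topspace Z. r `` {z} \<in> W})"
      by blast
    moreover have "(\<Union>W\<in>K. {z \<in> topspace Z. r `` {z} \<in> W}) = {z \<in> topspace Z. r `` {z} \<in> \<Union>K}"
      by blast
    ultimately show "openin Z {z \<in> topspace Z. r `` {z} \<in> \<Union>K}" by simp
    show "\<Union>K \<subseteq> topspace Z // r" using K by blast
  qed
  then show ?thesis
    by (simp add: quotient_topology_def topology_inverse')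
qed

text \<open>Open balls of Euclidean \<open>n\<close>-space, which is modelled by \<^const>\<open>Euclidean_space\<close>: the sequences
  of reals that vanish from index \<open>n\<close> on.\<close>

definition euclidean_ball :: "nat \<Rightarrow> (nat \<Rightarrow> real) \<Rightarrow> real \<Rightarrow> (nat \<Rightarrow> real) set" where
  "euclidean_ball n c r = {x \<in> topspace (Euclidean_space n). (\<Sum>i<n. (x i - c i)\<^sup>2) < r\<^sup>2}"

definition is_euclidean_ball :: "nat \<Rightarrow> (nat \<Rightarrow> real) set \<Rightarrow> bool" where
  "is_euclidean_ball n B \<longleftrightarrow>
     (\<exists>c\<in>topspace (Euclidean_space n). \<exists>r>0. B = euclidean_ball n c r)"

text \<open>Compact topological manifolds without boundary.\<close>

definition compact_manifold :: "nat \<Rightarrow> 'a topology \<Rightarrow> bool" where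
  "compact_manifold n X \<longleftrightarrow>
     compact_space X \<and> Hausdorff_space X \<and> second_countable X \<and>
     (\<forall>x\<in>topspace X. \<exists>U V. openin X U \<and> x \<in> U \<and> openin (Euclidean_space n) V \<and>
        subtopology X U homeomorphic_space subtopology (Euclidean_space n) V)"


section \<open>Laminations\<close>

text \<open>A chart \<open>\<phi> : U \<rightarrow> B \<times> S\<close> is recorded together with its ball \<open>B\<close> and its transversal \<open>S\<close>.
  A Polish space has at most the cardinality of the continuum, so asking the points of \<open>S\<close> to be
  reals, with an \<^emph>\<open>arbitrary\<close> Polish topology on an arbitrary set of reals, is no restriction.\<close>

record 'x chart =
  chart_dom :: "'x set"
  chart_map :: "'x \<Rightarrow> (nat \<Rightarrow> real) \<times> real"
  chart_ball :: "(nat \<Rightarrow> real) set"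
  chart_trans :: "real topology"

definition foliated_chart :: "nat \<Rightarrow> 'x topology \<Rightarrow> 'x chart \<Rightarrow> bool" where
  "foliated_chart n X c \<longleftrightarrow>
     openin X (chart_dom c) \<and> is_euclidean_ball n (chart_ball c) \<and> Polish_space (chart_trans c) \<and>
     homeomorphic_map (subtopology X (chart_dom c))
       (prod_topology (subtopology (Euclidean_space n) (chart_ball c)) (chart_trans c))
       (chart_map c)"

definition plaques :: "'x chart \<Rightarrow> 'x set set" where
  "plaques c = {{x \<in> chart_dom c. snd (chart_map c x) = s} | s. s \<in> topspace (chart_trans c)}"

text \<open>The change of coordinates from \<open>a\<close> to \<open>b\<close> is locally of the form
  \<open>(x, s) \<mapsto> (f (x, s), g s)\<close>.\<close>

definition foliated_change :: "'x topology \<Rightarrow> 'x chart \<Rightarrow> 'x chart \<Rightarrow> bool" where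
  "foliated_change X a b \<longleftrightarrow>
     (\<forall>q \<in> chart_dom a \<inter> chart_dom b. \<exists>W f g.
        openin X W \<and> q \<in> W \<and> W \<subseteq> chart_dom a \<inter> chart_dom b \<and>
        (\<forall>w\<in>W. chart_map b w = (f (chart_map a w), g (snd (chart_map a w)))))"

definition foliated_atlas :: "nat \<Rightarrow> 'x topology \<Rightarrow> 'x chart set \<Rightarrow> bool" where
  "foliated_atlas n X \<A> \<longleftrightarrow>
     (\<forall>a\<in>\<A>. foliated_chart n X a) \<and> (\<Union>a\<in>\<A>. chart_dom a) = topspace X \<and>
     (\<forall>a\<in>\<A>. \<forall>b\<in>\<A>. foliated_change X a b)"

text \<open>The maximal atlas (that is, the lamination) containing a given foliated atlas.\<close>

definition lamination_of :: "nat \<Rightarrow> 'x topology \<Rightarrow> 'x chart set \<Rightarrow> 'x chart set" where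
  "lamination_of n X \<A> =
     {c. foliated_chart n X c \<and> (\<forall>a\<in>\<A>. foliated_change X a c \<and> foliated_change X c a)}"

definition leaf_topology :: "'x chart set \<Rightarrow> 'x topology" where
  "leaf_topology \<F> = topology_generated_by (\<Union>c\<in>\<F>. plaques c)"

definition leaves :: "'x chart set \<Rightarrow> 'x set set" where
  "leaves \<F> = connected_components_of (leaf_topology \<F>)"

definition restrict_lamination :: "'x chart set \<Rightarrow> 'x set \<Rightarrow> 'x chart set" where
  "restrict_lamination \<F> U = {c \<in> \<F>. chart_dom c \<subseteq> U}"

text \<open>Regular atlases of the lamination \<open>\<F>\<close>. In the last condition the charts \<open>a\<close> and \<open>b\<close> are
  restrictions of the chart \<open>v\<close> as foliated charts, i.e. up to a change of coordinates
  \<open>(x, s) \<mapsto> (f (x, s), g s)\<close> with \<open>g\<close> injective: the plaques of \<open>a\<close> are exactly the traces on its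
  domain of the plaques of \<open>v\<close>. Literal equality of the coordinate maps would make all charts of the
  atlas agree on overlaps, which is impossible on a compact space as soon as \<open>n > 0\<close>.\<close>

definition chart_restricts :: "'x chart \<Rightarrow> 'x chart \<Rightarrow> bool" where
  "chart_restricts v a \<longleftrightarrow>
     chart_dom a \<subseteq> chart_dom v \<and>
     (\<forall>x\<in>chart_dom a. \<forall>y\<in>chart_dom a.
        snd (chart_map a x) = snd (chart_map a y) \<longleftrightarrow> snd (chart_map v x) = snd (chart_map v y))"

definition regular_atlas :: "nat \<Rightarrow> 'x topology \<Rightarrow> 'x chart set \<Rightarrow> 'x chart set \<Rightarrow> bool" where
  "regular_atlas n X \<F> \<U> \<longleftrightarrow>
     foliated_atlas n X \<U> \<and> \<U> \<subseteq> \<F> \<and>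
     (\<forall>x\<in>topspace X. \<exists>W. openin X W \<and> x \<in> W \<and> finite {a \<in> \<U>. chart_dom a \<inter> W \<noteq> {}}) \<and>
     (\<forall>a\<in>\<U>. \<forall>b\<in>\<U>. \<forall>P\<in>plaques a. P \<inter> chart_dom b \<noteq> {} \<longrightarrow>
        (\<exists>!Q. Q \<in> plaques b \<and> P \<inter> chart_dom b \<subseteq> Q)) \<and>
     (\<forall>a\<in>\<U>. \<forall>b\<in>\<U>. chart_dom a \<inter> chart_dom b \<noteq> {} \<longrightarrow>
        (\<exists>v\<in>\<F>. chart_restricts v a \<and> chart_restricts v b))"


section \<open>Transverse invariant measures\<close>

definition transverse_set :: "'x topology \<Rightarrow> 'x chart set \<Rightarrow> 'x set \<Rightarrow> bool" where
  "transverse_set X \<F> T \<longleftrightarrow> T \<in> sets (borel_of X) \<and> (\<forall>L\<in>leaves \<F>. countable (T \<inter> L))"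

text \<open>A transverse invariant measure in its extended form, as a set function on all transverse sets
  (its values on other sets are irrelevant). It is determined by its restriction to the measurable
  subsets of any one complete transversal.\<close>

definition transverse_invariant_measure ::
    "'x topology \<Rightarrow> 'x chart set \<Rightarrow> ('x set \<Rightarrow> ennreal) \<Rightarrow> bool" where
  "transverse_invariant_measure X \<F> \<mu> \<longleftrightarrow>
     \<mu> {} = 0 \<and>
     (\<forall>T :: nat \<Rightarrow> 'x set. (\<forall>i. transverse_set X \<F> (T i)) \<and> disjoint_family T \<longrightarrow>
        \<mu> (\<Union>i. T i) = (\<Sum>i. \<mu> (T i))) \<and>
     (\<forall>T T' f. transverse_set X \<F> T \<and> transverse_set X \<F> T' \<and> bij_betw f T T' \<and>
        f \<in> restrict_space (borel_of X) T \<rightarrow>\<^sub>M restrict_space (borel_of X) T' \<and>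
        inv_into T f \<in> restrict_space (borel_of X) T' \<rightarrow>\<^sub>M restrict_space (borel_of X) T \<and>
        (\<forall>x\<in>T. \<exists>L\<in>leaves \<F>. x \<in> L \<and> f x \<in> L) \<longrightarrow> \<mu> T = \<mu> T')"


section \<open>Tangential contractions and the \<open>\<Lambda>\<close>-category\<close>

definition tangential_deformation ::
    "'x topology \<Rightarrow> 'x chart set \<Rightarrow> 'x set \<Rightarrow> ('x \<times> real \<Rightarrow> 'x) \<Rightarrow> bool" where
  "tangential_deformation X \<F> U H \<longleftrightarrow>
     openin X U \<and>
     continuous_map (prod_topology (subtopology X U) euclideanreal) X H \<and>
     (\<forall>L\<in>leaves (restrict_lamination \<F> U). \<exists>L'\<in>leaves \<F>. H ` (L \<times> UNIV) \<subseteq> L') \<and>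
     (\<forall>x\<in>U. H (x, 0) = x)"

definition tangential_contractions ::
    "'x topology \<Rightarrow> 'x chart set \<Rightarrow> 'x set \<Rightarrow> ('x \<times> real \<Rightarrow> 'x) set" where
  "tangential_contractions X \<F> U =
     {H. tangential_deformation X \<F> U H \<and>
         (\<forall>L\<in>leaves (restrict_lamination \<F> U). \<exists>z. \<forall>x\<in>L. H (x, 1) = z)}"

text \<open>The category computed with an arbitrary class \<open>C U\<close> of admissible contractions of each \<open>U\<close>;
  only sets \<open>U\<close> with \<open>C U \<noteq> {}\<close> may be used in the coverings.\<close>

definition tau_using ::
    "('x set \<Rightarrow> ennreal) \<Rightarrow> ('x set \<Rightarrow> ('x \<times> real \<Rightarrow> 'x) set) \<Rightarrow> 'x set \<Rightarrow> ennreal" where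
  "tau_using \<mu> C U = (INF H\<in>C U. \<mu> (H ` (U \<times> {1})))"

definition Cat_using ::
    "'x topology \<Rightarrow> ('x set \<Rightarrow> ennreal) \<Rightarrow> ('x set \<Rightarrow> ('x \<times> real \<Rightarrow> 'x) set) \<Rightarrow> ennreal" where
  "Cat_using X \<mu> C =
     (INF \<V>\<in>{\<V>. (\<forall>U\<in>\<V>. openin X U \<and> C U \<noteq> {}) \<and> \<Union>\<V> = topspace X}.
        (\<Sum>\<^sub>\<infinity>U\<in>\<V>. tau_using \<mu> C U))"

definition Cat :: "'x topology \<Rightarrow> 'x chart set \<Rightarrow> ('x set \<Rightarrow> ennreal) \<Rightarrow> ennreal" where
  "Cat X \<F> \<mu> = Cat_using X \<mu> (tangential_contractions X \<F>)"


section \<open>Secondary \<open>\<Lambda>\<close>-category\<close>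

definition plaque_chain :: "'x chart set \<Rightarrow> 'x set list \<Rightarrow> bool" where
  "plaque_chain \<U> Ps \<longleftrightarrow>
     Ps \<noteq> [] \<and> set Ps \<subseteq> (\<Union>c\<in>\<U>. plaques c) \<and>
     (\<forall>i. Suc i < length Ps \<longrightarrow> Ps ! i \<inter> Ps ! Suc i \<noteq> {})"

text \<open>The length of a leafwise path, given by its image \<open>A\<close>.\<close>

definition leaf_path_length :: "'x chart set \<Rightarrow> 'x set \<Rightarrow> enat" where
  "leaf_path_length \<U> A =
     Inf {enat (length Ps + 1) | Ps. plaque_chain \<U> Ps \<and> A \<subseteq> \<Union>(set Ps)}"

definition deformation_length :: "'x chart set \<Rightarrow> 'x set \<Rightarrow> ('x \<times> real \<Rightarrow> 'x) \<Rightarrow> enat" where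
  "deformation_length \<U> U H = (SUP x\<in>U. leaf_path_length \<U> ((\<lambda>t. H (x, t)) ` {0..1}))"

definition Cat_bounded ::
    "'x topology \<Rightarrow> 'x chart set \<Rightarrow> ('x set \<Rightarrow> ennreal) \<Rightarrow> nat \<Rightarrow> 'x chart set \<Rightarrow> ennreal" where
  "Cat_bounded X \<F> \<mu> n \<U> =
     Cat_using X \<mu> (\<lambda>U. {H \<in> tangential_contractions X \<F> U. deformation_length \<U> U H \<le> enat n})"

text \<open>Growth types. Growth functions take values in \<^typ>\<open>ennreal\<close>, so that reciprocals obey
  \<open>1 / \<infinity> = 0\<close>; any function equivalent to a finite-valued one is finite-valued. The value at \<open>0\<close>
  is ignored.\<close>

definition growth_le :: "(nat \<Rightarrow> ennreal) \<Rightarrow> (nat \<Rightarrow> ennreal) \<Rightarrow> bool" where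
  "growth_le g k \<longleftrightarrow>
     (\<exists>B::nat. B \<ge> 1 \<and> (\<exists>A::real. A > 0 \<and> (\<forall>n\<ge>1. g n \<le> ennreal A * k (B * n))))"

definition growth_type :: "(nat \<Rightarrow> ennreal) \<Rightarrow> (nat \<Rightarrow> ennreal) set" where
  "growth_type g = {k. mono_on {1..} k \<and> growth_le g k \<and> growth_le k g}"

definition Cat_II ::
    "'x topology \<Rightarrow> 'x chart set \<Rightarrow> ('x set \<Rightarrow> ennreal) \<Rightarrow> 'x chart set \<Rightarrow> (nat \<Rightarrow> ennreal) set" where
  "Cat_II X \<F> \<mu> \<U> = growth_type (\<lambda>n. inverse (Cat_bounded X \<F> \<mu> n \<U>))"

definition symmetric_generating_set :: "('g, 'b) monoid_scheme \<Rightarrow> 'g set \<Rightarrow> bool" where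
  "symmetric_generating_set G S \<longleftrightarrow>
     S \<subseteq> carrier G \<and> \<one>\<^bsub>G\<^esub> \<in> S \<and> (\<forall>s\<in>S. inv\<^bsub>G\<^esub> s \<in> S) \<and> generate G S = carrier G"

definition word_ball :: "('g, 'b) monoid_scheme \<Rightarrow> 'g set \<Rightarrow> nat \<Rightarrow> 'g set" where
  "word_ball G S n = {foldr (\<lambda>a b. a \<otimes>\<^bsub>G\<^esub> b) xs \<one>\<^bsub>G\<^esub> | xs. set xs \<subseteq> S \<and> length xs \<le> n}"

definition group_growth :: "('g, 'b) monoid_scheme \<Rightarrow> 'g set \<Rightarrow> (nat \<Rightarrow> ennreal) set" where
  "group_growth G S = growth_type (\<lambda>n. of_nat (card (word_ball G S n)))"


section \<open>Rohlin groups\<close>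

text \<open>Here \<open>TG\<close> is the topology of the group \<open>G\<close>.\<close>

definition free_pmp_action ::
    "('g, 'b) monoid_scheme \<Rightarrow> 'g topology \<Rightarrow> 'y measure \<Rightarrow> ('g \<Rightarrow> 'y \<Rightarrow> 'y) \<Rightarrow> bool" where
  "free_pmp_action G TG Y act \<longleftrightarrow>
     standard_borel Y \<and> prob_space Y \<and>
     (\<lambda>(g, y). act g y) \<in> borel_of TG \<Otimes>\<^sub>M Y \<rightarrow>\<^sub>M Y \<and>
     (\<forall>y\<in>space Y. act \<one>\<^bsub>G\<^esub> y = y) \<and>
     (\<forall>g\<in>carrier G. \<forall>k\<in>carrier G. \<forall>y\<in>space Y. act (g \<otimes>\<^bsub>G\<^esub> k) y = act g (act k y)) \<and>
     (\<forall>g\<in>carrier G. \<forall>y\<in>space Y. act g y = y \<longrightarrow> g = \<one>\<^bsub>G\<^esub>) \<and>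
     (\<forall>g\<in>carrier G. \<forall>B\<in>sets Y. emeasure Y (act g ` B) = emeasure Y B)"

definition base_of_tower :: "'y measure \<Rightarrow> ('g \<Rightarrow> 'y \<Rightarrow> 'y) \<Rightarrow> 'g set \<Rightarrow> 'y set \<Rightarrow> bool" where
  "base_of_tower Y act E V \<longleftrightarrow>
     V \<in> sets Y \<and> (\<Union>f\<in>E. act f ` V) \<in> sets Y \<and> emeasure Y (\<Union>f\<in>E. act f ` V) > 0 \<and>
     disjoint_family_on (\<lambda>f. act f ` V) E"

text \<open>Up to Borel isomorphism every standard Borel space has a set of reals as its underlying set,
  so the quantification over \<open>Y\<close> below ranges over all standard Borel spaces.\<close>

definition Rohlin_set :: "('g, 'b) monoid_scheme \<Rightarrow> 'g topology \<Rightarrow> 'g set \<Rightarrow> bool" where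
  "Rohlin_set G TG E \<longleftrightarrow>
     E \<in> sets (borel_of TG) \<and> compactin TG (TG closure_of E) \<and>
     (\<forall>(Y :: real measure) act \<epsilon>. free_pmp_action G TG Y act \<and> \<epsilon> > 0 \<longrightarrow>
        (\<exists>V. base_of_tower Y act E V \<and> measure Y (\<Union>f\<in>E. act f ` V) > 1 - \<epsilon>))"

definition Rohlin_group :: "('g, 'b) monoid_scheme \<Rightarrow> 'g topology \<Rightarrow> bool" where
  "Rohlin_group G TG \<longleftrightarrow> (\<forall>K. compactin TG K \<longrightarrow> (\<exists>E. Rohlin_set G TG E \<and> K \<subseteq> E))"


section \<open>Fundamental group, deck transformations and suspensions\<close>

definition loops_at :: "'m::topological_space set \<Rightarrow> 'm \<Rightarrow> (real \<Rightarrow> 'm) set" where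
  "loops_at M x0 = {\<gamma>. path \<gamma> \<and> path_image \<gamma> \<subseteq> M \<and> pathstart \<gamma> = x0 \<and> pathfinish \<gamma> = x0}"

definition loop_homotopy ::
    "'m::topological_space set \<Rightarrow> 'm \<Rightarrow> ((real \<Rightarrow> 'm) \<times> (real \<Rightarrow> 'm)) set" where
  "loop_homotopy M x0 =
     {(\<alpha>, \<beta>). \<alpha> \<in> loops_at M x0 \<and> \<beta> \<in> loops_at M x0 \<and> homotopic_paths M \<alpha> \<beta>}"

definition fundamental_group ::
    "'m::topological_space set \<Rightarrow> 'm \<Rightarrow> (real \<Rightarrow> 'm) set monoid" where
  "fundamental_group M x0 =
     \<lparr>carrier = loops_at M x0 // loop_homotopy M x0,
      mult = (\<lambda>A B. \<Union>\<alpha>\<in>A. \<Union>\<beta>\<in>B. loop_homotopy M x0 `` {\<alpha> +++ \<beta>}),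
      one = loop_homotopy M x0 `` {\<lambda>t. x0}\<rparr>"

definition homeo_group :: "'f topology \<Rightarrow> ('f \<Rightarrow> 'f) monoid" where
  "homeo_group F =
     (BijGroup (topspace F))
       \<lparr>carrier := {f \<in> Bij (topspace F). homeomorphic_map F F f}\<rparr>"

definition deck_transformations ::
    "'u::topological_space set \<Rightarrow> ('u \<Rightarrow> 'm) \<Rightarrow> ('u \<Rightarrow> 'u) set" where
  "deck_transformations Mt p =
     {T \<in> Bij Mt. homeomorphic_map (top_of_set Mt) (top_of_set Mt) T \<and> (\<forall>u\<in>Mt. p (T u) = p u)}"

text \<open>The deck transformation given by the class \<open>c\<close> of a loop at \<open>p u0\<close>: it takes \<open>u0\<close> to the
  end point of the lift at \<open>u0\<close> of a loop in \<open>c\<close>. With products of loops read from left to right,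
  this is a left action of the fundamental group.\<close>

definition deck_of ::
    "'u::topological_space set \<Rightarrow> ('u \<Rightarrow> 'm) \<Rightarrow> 'u \<Rightarrow> (real \<Rightarrow> 'm) set \<Rightarrow> 'u \<Rightarrow> 'u" where
  "deck_of Mt p u0 c =
     (THE T. T \<in> deck_transformations Mt p \<and>
        (\<exists>\<sigma>. path \<sigma> \<and> path_image \<sigma> \<subseteq> Mt \<and> pathstart \<sigma> = u0 \<and> pathfinish \<sigma> = T u0 \<and> p \<circ> \<sigma> \<in> c))"

definition diagonal_rel ::
    "'m::topological_space set \<Rightarrow> 'u::topological_space set \<Rightarrow> ('u \<Rightarrow> 'm) \<Rightarrow> 'u \<Rightarrow> 'f topology \<Rightarrow>
     ((real \<Rightarrow> 'm) set \<Rightarrow> 'f \<Rightarrow> 'f) \<Rightarrow> (('u \<times> 'f) \<times> ('u \<times> 'f)) set" where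
  "diagonal_rel M Mt p u0 F h =
     {((u, y), (deck_of Mt p u0 c u, h c y)) | u y c.
        u \<in> Mt \<and> y \<in> topspace F \<and> c \<in> carrier (fundamental_group M (p u0))}"

definition suspension_proj ::
    "'m::topological_space set \<Rightarrow> 'u::topological_space set \<Rightarrow> ('u \<Rightarrow> 'm) \<Rightarrow> 'u \<Rightarrow> 'f topology \<Rightarrow>
     ((real \<Rightarrow> 'm) set \<Rightarrow> 'f \<Rightarrow> 'f) \<Rightarrow> 'u \<times> 'f \<Rightarrow> ('u \<times> 'f) set" where
  "suspension_proj M Mt p u0 F h z = diagonal_rel M Mt p u0 F h `` {z}"

definition suspension_space ::
    "'m::topological_space set \<Rightarrow> 'u::topological_space set \<Rightarrow> ('u \<Rightarrow> 'm) \<Rightarrow> 'u \<Rightarrow> 'f topology \<Rightarrow>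
     ((real \<Rightarrow> 'm) set \<Rightarrow> 'f \<Rightarrow> 'f) \<Rightarrow> ('u \<times> 'f) set topology" where
  "suspension_space M Mt p u0 F h =
     quotient_topology (prod_topology (top_of_set Mt) F) (diagonal_rel M Mt p u0 F h)"

text \<open>The charts of the suspension induced by \<open>W \<times> F\<close>, for \<open>W\<close> an open coordinate ball of the
  universal cover on which \<open>p\<close> is injective; the plaques are the images of the sets
  \<open>W \<times> {y}\<close>. The homeomorphism \<open>\<theta>\<close> only moves \<open>F\<close> to a copy with real points.\<close>

definition suspension_atlas ::
    "nat \<Rightarrow> 'm::topological_space set \<Rightarrow> 'u::topological_space set \<Rightarrow> ('u \<Rightarrow> 'm) \<Rightarrow> 'u \<Rightarrow>
     'f topology \<Rightarrow> ((real \<Rightarrow> 'm) set \<Rightarrow> 'f \<Rightarrow> 'f) \<Rightarrow> ('u \<times> 'f) set chart set" where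
  "suspension_atlas n M Mt p u0 F h =
     {c. foliated_chart n (suspension_space M Mt p u0 F h) c \<and>
         (\<exists>W \<psi> \<theta>. openin (top_of_set Mt) W \<and> inj_on p W \<and>
            homeomorphic_map (top_of_set W) (subtopology (Euclidean_space n) (chart_ball c)) \<psi> \<and>
            homeomorphic_map F (chart_trans c) \<theta> \<and>
            chart_dom c = suspension_proj M Mt p u0 F h ` (W \<times> topspace F) \<and>
            (\<forall>w\<in>W. \<forall>y\<in>topspace F.
               chart_map c (suspension_proj M Mt p u0 F h (w, y)) = (\<psi> w, \<theta> y)))}"

definition suspension_lamination ::
    "nat \<Rightarrow> 'm::topological_space set \<Rightarrow> 'u::topological_space set \<Rightarrow> ('u \<Rightarrow> 'm) \<Rightarrow> 'u \<Rightarrow>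
     'f topology \<Rightarrow> ((real \<Rightarrow> 'm) set \<Rightarrow> 'f \<Rightarrow> 'f) \<Rightarrow> ('u \<times> 'f) set chart set" where
  "suspension_lamination n M Mt p u0 F h =
     lamination_of n (suspension_space M Mt p u0 F h) (suspension_atlas n M Mt p u0 F h)"

text \<open>\<open>\<mu>\<close> is the extension to all transverse sets of the invariant measure \<open>\<nu>\<close> of \<open>F\<close>, where \<open>F\<close> is
  identified with each of the fibers, the images of the sets \<open>{u} \<times> F\<close>.\<close>

definition suspension_transverse_measure ::
    "nat \<Rightarrow> 'm::topological_space set \<Rightarrow> 'u::topological_space set \<Rightarrow> ('u \<Rightarrow> 'm) \<Rightarrow> 'u \<Rightarrow>
     'f topology \<Rightarrow> ((real \<Rightarrow> 'm) set \<Rightarrow> 'f \<Rightarrow> 'f) \<Rightarrow> 'f measure \<Rightarrow> (('u \<times> 'f) set set \<Rightarrow> ennreal) \<Rightarrow>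
     bool" where
  "suspension_transverse_measure n M Mt p u0 F h \<nu> \<mu> \<longleftrightarrow>
     transverse_invariant_measure (suspension_space M Mt p u0 F h)
       (suspension_lamination n M Mt p u0 F h) \<mu> \<and>
     (\<forall>u\<in>Mt. \<forall>B\<in>sets \<nu>. \<mu> (suspension_proj M Mt p u0 F h ` ({u} \<times> B)) = emeasure \<nu> B)"

end

theory Submission
  imports Defs
begin

text \<open>For a free action the secondary category is the growth of the group: \<open>Cat_II_eq_growth\<close> shows that
  \<open>Cat_II X \<L> \<mu> \<U> = group_growth G S\<close>. So the two growth types cannot differ, and the theorem follows. The
  two inequalities between the growth types are comparisons of the category for contractions of length at most
  \<open>n\<close> with the reciprocal of the number of elements of the word balls \<open>Sn k\<close>.

  \<^emph>\<open>Lower bound.\<close> A plaque displaces the fibre coordinate by an element of a fixed word ball, because \<open>M\<close> and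
  the fibre are compact (\<open>plaque_displacement\<close>). So two points of the fibre over \<open>u0\<close> that are taken to one
  point by a contraction of length at most \<open>m\<close> differ by an element of \<open>Sn (r * m)\<close> (\<open>common_endpoint\<close>), and the
  contraction is at most \<open>card (Sn (r * m))\<close> to one on this fibre. By invariance of the measure its end then has
  at least the measure of the part of the fibre in its domain, divided by this number (\<open>contraction_lower\<close>); and
  the domains of a covering contain a total measure of at least 1 of the fibre (\<open>lower_bound\<close>).

  \<^emph>\<open>Upper bound.\<close> The usual argument takes a Rohlin tower and contracts the fibre onto its base. A maximal
  Borel set whose translates by \<open>Sn k\<close> are disjoint does the same work: it has measure at most
  \<open>1 / card (Sn k)\<close>, and by maximality its translates by \<open>Sn (k + k)\<close> fill the fibre (\<open>separated_set\<close>). That the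
  radius is doubled does not change a growth type. By regularity of the measure the fibre consists,
  up to an open set of small measure, of disjoint open sets that are taken close to the separated set by elements
  of \<open>Sn (k + k)\<close> (\<open>open_partition\<close>). These elements are realized by paths of the universal cover which are
  covered by chains of plaques of length linear in \<open>k\<close> (\<open>word_paths\<close>), and a box over a small ball is contracted
  to one fibre and moved along these paths (\<open>contraction_exists\<close>). Finitely many such boxes cover the suspension,
  and the measures of their ends have a sum of order \<open>1 / card (Sn k)\<close> (\<open>upper_bound\<close>).\<close>

section \<open>Lifting in covering spaces\<close>

text \<open>A sheet is given together with the union of the other sheets, which is open: so a connected set over
  \<open>V\<close> that meets a sheet lies in it.\<close>

lemma evenly_covered:
  assumes "covering_space C p S" "s \<in> S"
  obtains V where "s \<in> V" "openin (top_of_set S) V"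
    "\<And>e. \<lbrakk>e \<in> C; p e \<in> V\<rbrakk> \<Longrightarrow> \<exists>N q. e \<in> N \<and> openin (top_of_set C) N \<and> homeomorphism N V p q \<and>
        openin (top_of_set C) (C \<inter> p -` V - N)"
proof -
  obtain V v where V: "s \<in> V" "openin (top_of_set S) V" "\<Union>v = C \<inter> p -` V"
      "\<forall>u\<in>v. openin (top_of_set C) u" "pairwise disjnt v" "\<forall>u\<in>v. \<exists>q. homeomorphism u V p q"
    using assms unfolding covering_space_def by metis
  show ?thesis
  proof (rule that[OF V(1,2)])
    fix e assume "e \<in> C" "p e \<in> V"
    then obtain N where N: "N \<in> v" "e \<in> N" using V(3) by blast
    have eq: "C \<inter> p -` V - N = \<Union>(v - {N})"
    proof -
      have "u \<inter> N = {}" if "u \<in> v - {N}" for u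
        using pairwiseD[OF V(5), of u N] that N by (auto simp: disjnt_def)
      then show ?thesis unfolding V(3)[symmetric] by blast
    qed
    have "openin (top_of_set C) (C \<inter> p -` V - N)"
      unfolding eq using V(4) by blast
    then show "\<exists>N q. e \<in> N \<and> openin (top_of_set C) N \<and> homeomorphism N V p q \<and>
        openin (top_of_set C) (C \<inter> p -` V - N)"
      using N V(4,6) by blast
  qed
qed

lemma openin_preimage_on:
  assumes "continuous_on A g" "g ` A \<subseteq> C" "openin (top_of_set C) N"
  shows "openin (top_of_set A) (A \<inter> g -` N)"
  using assms by (metis continuous_openin_preimage image_subset_iff_funcset)

text \<open>If the values of both lifts at a point lie in one sheet, the lifts agree near the point; otherwise they
  differ near it. Hence the set of agreement is open and closed.\<close>

lemma covering_lift_unique: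
  fixes g1 g2 :: "'a::topological_space \<Rightarrow> 'u::topological_space"
  assumes cov: "covering_space C p S" and A: "connected A"
    and g1: "continuous_on A g1" "g1 ` A \<subseteq> C" and g2: "continuous_on A g2" "g2 ` A \<subseteq> C"
    and eq: "\<And>x. x \<in> A \<Longrightarrow> p (g1 x) = p (g2 x)" and a: "a \<in> A" "g1 a = g2 a" and x: "x \<in> A"
  shows "g1 x = g2 x"
proof -
  define E where "E = {x \<in> A. g1 x = g2 x}"
  have pC: "p e \<in> S" if "e \<in> C" for e using cov that by (auto simp: covering_space_def)
  have "\<exists>T. openin (top_of_set A) T \<and> z \<in> T \<and> (\<forall>x\<in>T. (g1 x = g2 x) = (g1 z = g2 z))"
    if z: "z \<in> A" for z
  proof -
    have "g1 z \<in> C" using g1 z by blast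
    then obtain V where V: "p (g1 z) \<in> V"
      "\<And>e. \<lbrakk>e \<in> C; p e \<in> V\<rbrakk> \<Longrightarrow> \<exists>N q. e \<in> N \<and> openin (top_of_set C) N \<and> homeomorphism N V p q \<and>
        openin (top_of_set C) (C \<inter> p -` V - N)"
      using evenly_covered[OF cov pC] by (smt (verit, best))
    obtain N q where N: "g1 z \<in> N" "openin (top_of_set C) N" "homeomorphism N V p q"
        "openin (top_of_set C) (C \<inter> p -` V - N)"
      using V(2)[OF \<open>g1 z \<in> C\<close> V(1)] by blast
    have inj: "inj_on p N" using N(3) by (metis homeomorphism_apply1 inj_on_inverseI)
    show ?thesis
    proof (cases "g2 z \<in> N")
      case True
      show ?thesis
        by (rule exI[of _ "(A \<inter> g1 -` N) \<inter> (A \<inter> g2 -` N)"])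
          (use z N True inj eq openin_preimage_on[OF g1 N(2)] openin_preimage_on[OF g2 N(2)]
            in \<open>auto intro: openin_Int dest: inj_onD\<close>)
    next
      case False
      have "g2 z \<in> C \<inter> p -` V - N" using z g2 False V(1) eq by auto
      then show ?thesis
        by (intro exI[of _ "(A \<inter> g1 -` N) \<inter> (A \<inter> g2 -` (C \<inter> p -` V - N))"])
          (use z N False openin_preimage_on[OF g1 N(2)] openin_preimage_on[OF g2 N(4)] in \<open>fastforce intro: openin_Int\<close>)
    qed
  qed note * = this
  have o: "openin (top_of_set A) E" "openin (top_of_set A) (A - E)"
  proof -
    show "openin (top_of_set A) E"
      unfolding openin_subopen[of _ E]
    proof
      fix z assume "z \<in> E"
      then obtain T where "openin (top_of_set A) T" "z \<in> T" "\<forall>x\<in>T. g1 x = g2 x"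
        using *[of z] by (auto simp: E_def)
      moreover from this(1) have "T \<subseteq> A" by (rule openin_imp_subset)
      ultimately show "\<exists>T. openin (top_of_set A) T \<and> z \<in> T \<and> T \<subseteq> E"
        by (intro exI[of _ T]) (auto simp: E_def)
    qed
    show "openin (top_of_set A) (A - E)"
      unfolding openin_subopen[of _ "A - E"]
    proof
      fix z assume "z \<in> A - E"
      then obtain T where "openin (top_of_set A) T" "z \<in> T" "\<forall>x\<in>T. g1 x \<noteq> g2 x"
        using *[of z] by (auto simp: E_def)
      moreover from this(1) have "T \<subseteq> A" by (rule openin_imp_subset)
      ultimately show "\<exists>T. openin (top_of_set A) T \<and> z \<in> T \<and> T \<subseteq> A - E"
        by (intro exI[of _ T]) (auto simp: E_def)
    qed
  qed
  then have "closedin (top_of_set A) E"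
    by (simp add: closedin_def E_def)
  then have "E = {} \<or> E = A" using A o(1) by (simp add: connected_clopen)
  then show ?thesis using a x by (auto simp: E_def)
qed

lemma connected_in_sheet:
  assumes "connected A" "A \<subseteq> C \<inter> p -` V" "openin (top_of_set C) N"
    "openin (top_of_set C) (C \<inter> p -` V - N)" "a \<in> A" "a \<in> N"
  shows "A \<subseteq> N"
proof -
  have AC: "A \<subseteq> C" using assms(2) by blast
  have 1: "openin (top_of_set A) (A \<inter> N)"
    using openin_subtopology_Int2[OF assms(3), of A] AC
    by (metis inf.absorb_iff2 subtopology_subtopology)
  have 2: "openin (top_of_set A) (A \<inter> (C \<inter> p -` V - N))"
    using openin_subtopology_Int2[OF assms(4), of A] AC
    by (metis inf.absorb_iff2 subtopology_subtopology)
  have "A - (A \<inter> N) = A \<inter> (C \<inter> p -` V - N)" using assms(2) by blast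
  then have "closedin (top_of_set A) (A \<inter> N)" using 2 by (simp add: closedin_def)
  then have "A \<inter> N = {} \<or> A \<inter> N = A" using assms(1) 1 by (simp add: connected_clopen)
  then show ?thesis using assms by blast
qed

lemma nhd_01:
  assumes f: "continuous_on {0..1} f" "f ` {0..1} \<subseteq> S" and x: "x \<in> {0..1::real}"
    and V: "f x \<in> V" "openin (top_of_set S) V"
  obtains d where "d > 0" "\<And>t. \<lbrakk>t \<in> {0..1}; \<bar>t - x\<bar> < d\<rbrakk> \<Longrightarrow> f t \<in> V"
proof -
  have "openin (top_of_set {0..1}) ({0..1} \<inter> f -` V)"
    using f V by (intro openin_preimage_on)
  then obtain d where "d > 0" "\<And>t. \<lbrakk>t \<in> {0..1}; dist t x < d\<rbrakk> \<Longrightarrow> t \<in> {0..1} \<inter> f -` V"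
    unfolding openin_euclidean_subtopology_iff using x V by blast
  then show thesis using that by (auto simp: dist_real_def)
qed

text \<open>Lifts over short intervals come from the local inverses of the covering map, and lifts over adjacent
  intervals fit together.\<close>

lemma covering_path_lift:
  fixes f :: "real \<Rightarrow> 'm::topological_space"
  assumes cov: "covering_space C p S" and f: "path f" "path_image f \<subseteq> S" and a: "a \<in> C" "p a = pathstart f"
  obtains k where "path k" "path_image k \<subseteq> C" "pathstart k = a" "\<And>t. t \<in> {0..1} \<Longrightarrow> p (k t) = f t"
proof -
  have cf: "continuous_on {0..1} f" "f ` {0..1} \<subseteq> S" using f by (auto simp: path_def path_image_def)
  define P where "P s t \<longleftrightarrow> (0 \<le> s \<longrightarrow> t \<le> 1 \<longrightarrow> s \<le> t \<longrightarrow> (\<forall>a\<in>C. p a = f s \<longrightarrow>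
     (\<exists>k. continuous_on {s..t} k \<and> k ` {s..t} \<subseteq> C \<and> k s = a \<and> (\<forall>x\<in>{s..t}. p (k x) = f x))))" for s t
  have "P 0 1"
  using zero_le_one[where 'a=real]
  proof (induction rule: Bolzano)
    case (trans s t r)
    show ?case unfolding P_def
    proof (intro impI ballI)
      fix e assume e: "0 \<le> s" "r \<le> 1" "s \<le> r" "e \<in> C" "p e = f s"
      obtain k where k: "continuous_on {s..t} k" "k ` {s..t} \<subseteq> C" "k s = e" "\<forall>x\<in>{s..t}. p (k x) = f x"
        using trans(1) e trans(3,4) unfolding P_def by auto
      have "k t \<in> C" "p (k t) = f t" using k trans by auto
      then obtain l where l: "continuous_on {t..r} l" "l ` {t..r} \<subseteq> C" "l t = k t" "\<forall>x\<in>{t..r}. p (l x) = f x"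
        using trans(2) e trans(3,4) unfolding P_def by auto
      define m where "m x = (if x \<le> t then k x else l x)" for x
      have "{s..r} = {s..t} \<union> {t..r}" using trans by auto
      moreover have "continuous_on ({s..t} \<union> {t..r}) m" unfolding m_def
        by (intro continuous_on_cases) (use k l in auto)
      ultimately have "continuous_on {s..r} m" by simp
      moreover have "m ` {s..r} \<subseteq> C" "m s = e" "\<forall>x\<in>{s..r}. p (m x) = f x"
        using k l trans by (auto simp: m_def)
      ultimately show "\<exists>k. continuous_on {s..r} k \<and> k ` {s..r} \<subseteq> C \<and> k s = e \<and> (\<forall>x\<in>{s..r}. p (k x) = f x)"
        by blast
    qed
  next
    case (local x)
    then have x: "x \<in> {0..1}" by auto
    then have "f x \<in> S" using cf by auto
    then obtain V where V: "f x \<in> V" "openin (top_of_set S) V"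
      "\<And>e. \<lbrakk>e \<in> C; p e \<in> V\<rbrakk> \<Longrightarrow> \<exists>N q. e \<in> N \<and> openin (top_of_set C) N \<and> homeomorphism N V p q \<and>
        openin (top_of_set C) (C \<inter> p -` V - N)"
      using evenly_covered[OF cov] by blast
    obtain d where d: "d > 0" "\<And>t. \<lbrakk>t \<in> {0..1}; \<bar>t - x\<bar> < d\<rbrakk> \<Longrightarrow> f t \<in> V"
      using nhd_01[OF cf x V(1,2)] by blast
    show ?case
    proof (intro exI[of _ d] conjI allI impI d(1))
      fix s t assume st: "s \<le> x \<and> x \<le> t \<and> t - s < d"
      show "P s t" unfolding P_def
      proof (intro impI ballI)
        fix e assume e: "0 \<le> s" "t \<le> 1" "s \<le> t" "e \<in> C" "p e = f s"
        have fV: "f ` {s..t} \<subseteq> V" using d(2) st e by fastforce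
        then have "p e \<in> V" using e by auto
        then obtain N q where N: "e \<in> N" "openin (top_of_set C) N" "homeomorphism N V p q"
          using V(3) e by blast
        have "continuous_on {s..t} (q \<circ> f)"
          using fV N(3) cf(1) e
          by (intro continuous_on_compose) (auto intro: continuous_on_subset simp: homeomorphism_def)
        moreover have "(q \<circ> f) ` {s..t} \<subseteq> C"
          using fV N(2,3) openin_imp_subset by (fastforce simp: homeomorphism_def)
        moreover have "(q \<circ> f) s = e" using N e by (metis comp_apply homeomorphism_apply1)
        moreover have "\<forall>x\<in>{s..t}. p ((q \<circ> f) x) = f x"
          using fV N(3) by (metis comp_apply homeomorphism_apply2 image_subset_iff)
        ultimately show "\<exists>k. continuous_on {s..t} k \<and> k ` {s..t} \<subseteq> C \<and> k s = e \<and> (\<forall>x\<in>{s..t}. p (k x) = f x)"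
          by blast
      qed
    qed
  qed
  then show thesis using a that unfolding P_def path_def path_image_def pathstart_def by auto
qed

text \<open>Homotopic paths have lifts with equal end points: the end point of the lift at \<open>a\<close> of the
  stage \<open>s\<close> of the homotopy is a locally constant function of \<open>s\<close>.\<close>

lemma covering_monodromy:
  fixes f1 f2 :: "real \<Rightarrow> 'm::topological_space"
  assumes cov: "covering_space C p S" and hom: "homotopic_paths S f1 f2"
    and k1: "path k1" "path_image k1 \<subseteq> C" "\<And>t. t \<in> {0..1} \<Longrightarrow> p (k1 t) = f1 t"
    and k2: "path k2" "path_image k2 \<subseteq> C" "\<And>t. t \<in> {0..1} \<Longrightarrow> p (k2 t) = f2 t"
    and st: "pathstart k1 = pathstart k2"
  shows "pathfinish k1 = pathfinish k2"
proof -
  obtain h where ch: "continuous_on ({0..1} \<times> {0..1}) h" and hS: "h \<in> ({0..1} \<times> {0..1}) \<rightarrow> S"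
    and h0: "\<And>x. x \<in> {0..1} \<Longrightarrow> h (0::real, x::real) = f1 x"
    and h1: "\<And>x. x \<in> {0..1} \<Longrightarrow> h (1, x) = f2 x"
    and hs: "\<And>t. t \<in> {0..1} \<Longrightarrow> h (t, 0) = f1 0" "\<And>t. t \<in> {0..1} \<Longrightarrow> h (t, 1) = f1 1"
    using hom unfolding homotopic_paths by (auto simp: pathstart_def pathfinish_def)
  let ?a = "pathstart k1"
  have aC: "?a \<in> C" using k1 by (meson pathstart_in_path_image subsetD)
  have pa: "p ?a = f1 0" using k1(3)[of 0] by (simp add: pathstart_def)
  define lift where "lift s k \<longleftrightarrow> continuous_on {0..1} k \<and> k ` {0..1} \<subseteq> C \<and>
      (\<forall>t\<in>{0..1}. p (k t) = h (s, t))" for s k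
  have ex: "\<exists>k. lift s k \<and> k 0 = ?a" if "s \<in> {0..1}" for s
  proof -
    have "path (\<lambda>t. h (s, t))" unfolding path_def
      using that by (intro continuous_on_compose2[OF ch] continuous_intros) auto
    moreover have "path_image (\<lambda>t. h (s, t)) \<subseteq> S" using that hS by (auto simp: path_image_def)
    moreover have "p ?a = pathstart (\<lambda>t. h (s, t))" using hs that pa by (simp add: pathstart_def)
    ultimately show ?thesis
      using covering_path_lift[OF cov, of "\<lambda>t. h (s, t)" ?a] aC
      unfolding lift_def path_def path_image_def pathstart_def by metis
  qed
  \<comment> \<open>Along a fixed lift \<open>k\<close>, lifts of nearby stages that start near \<open>k t0\<close> end near \<open>k t1\<close>.\<close>
  define Q where "Q x k t0 t1 \<longleftrightarrow> (0 \<le> t0 \<longrightarrow> t1 \<le> 1 \<longrightarrow> t0 \<le> t1 \<longrightarrow>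
     (\<forall>O1. openin (top_of_set C) O1 \<longrightarrow> k t1 \<in> O1 \<longrightarrow>
       (\<exists>O0 d. openin (top_of_set C) O0 \<and> k t0 \<in> O0 \<and> d > 0 \<and>
         (\<forall>s\<in>{0..1}. \<forall>\<kappa>. \<bar>s - x\<bar> < d \<longrightarrow> lift s \<kappa> \<longrightarrow> \<kappa> t0 \<in> O0 \<longrightarrow> \<kappa> t1 \<in> O1))))"
    for x k and t0 t1 :: real
  have Q: "Q x k 0 1" if x: "x \<in> {0..1}" and k: "lift x k" for x k
  using zero_le_one[where 'a=real]
  proof (induction rule: Bolzano)
    case (trans a b c)
    show ?case unfolding Q_def
    proof (intro impI allI)
      fix O2 assume as: "0 \<le> a" "c \<le> 1" "a \<le> c" "openin (top_of_set C) O2" "k c \<in> O2"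
      obtain O1 d1 where 1: "openin (top_of_set C) O1" "k b \<in> O1" "d1 > 0"
        "\<And>s \<kappa>. s\<in>{0..1} \<Longrightarrow> \<bar>s - x\<bar> < d1 \<Longrightarrow> lift s \<kappa> \<Longrightarrow> \<kappa> b \<in> O1 \<Longrightarrow> \<kappa> c \<in> O2"
        using trans as unfolding Q_def by (meson order_trans)
      obtain O0 d0 where 0: "openin (top_of_set C) O0" "k a \<in> O0" "d0 > 0"
        "\<And>s \<kappa>. s\<in>{0..1} \<Longrightarrow> \<bar>s - x\<bar> < d0 \<Longrightarrow> lift s \<kappa> \<Longrightarrow> \<kappa> a \<in> O0 \<Longrightarrow> \<kappa> b \<in> O1"
        using trans as 1(1,2) unfolding Q_def by (meson order_trans)
      show "\<exists>O0 d. openin (top_of_set C) O0 \<and> k a \<in> O0 \<and> d > 0 \<and>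
         (\<forall>s\<in>{0..1}. \<forall>\<kappa>. \<bar>s - x\<bar> < d \<longrightarrow> lift s \<kappa> \<longrightarrow> \<kappa> a \<in> O0 \<longrightarrow> \<kappa> c \<in> O2)"
        by (rule exI[of _ O0], rule exI[of _ "min d0 d1"]) (use 0 1 in auto)
    qed
  next
    case (local y)
    then have y: "y \<in> {0..1}" by auto
    have kS: "k y \<in> C" "p (k y) = h (x, y)" using k y by (auto simp: lift_def)
    have "h (x, y) \<in> S" using hS x y by auto
    then obtain V where V: "h (x, y) \<in> V" "openin (top_of_set S) V"
      "\<And>e. \<lbrakk>e \<in> C; p e \<in> V\<rbrakk> \<Longrightarrow> \<exists>N q. e \<in> N \<and> openin (top_of_set C) N \<and> homeomorphism N V p q \<and>
        openin (top_of_set C) (C \<inter> p -` V - N)"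
      using evenly_covered[OF cov] by blast
    obtain N q where N: "k y \<in> N" "openin (top_of_set C) N" "homeomorphism N V p q"
        "openin (top_of_set C) (C \<inter> p -` V - N)"
      using V kS by metis
    have "openin (top_of_set ({0..1} \<times> {0..1})) (({0..1} \<times> {0..1}) \<inter> h -` V)"
      using openin_preimage_on[OF ch _ V(2)] hS by blast
    then obtain e1 where e1: "e1 > 0" "\<And>z. \<lbrakk>z \<in> {0..1} \<times> {0..1}; dist z (x, y) < e1\<rbrakk> \<Longrightarrow> h z \<in> V"
      unfolding openin_euclidean_subtopology_iff using x y V(1) by (metis (no_types, lifting) IntD2 IntI SigmaI vimage_eq)
    have hV: "h (s, t) \<in> V" if "s \<in> {0..1}" "t \<in> {0..1}" "\<bar>s - x\<bar> < e1/2" "\<bar>t - y\<bar> < e1/2" for s t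
    proof (rule e1(2))
      have "dist (s, t) (x, y) \<le> \<bar>s - x\<bar> + \<bar>t - y\<bar>"
        unfolding dist_Pair_Pair dist_real_def by (simp add: sqrt_sum_squares_le_sum_abs)
      then show "dist (s, t) (x, y) < e1" using that by linarith
    qed (use that in auto)
    show ?case
    proof (intro exI[of _ "e1/2"] conjI allI impI)
      show "e1/2 > 0" using e1 by auto
      fix a b assume ab: "a \<le> y \<and> y \<le> b \<and> b - a < e1/2"
      show "Q x k a b" unfolding Q_def
      proof (intro impI allI)
        fix O1 assume as: "0 \<le> a" "b \<le> 1" "a \<le> b" "openin (top_of_set C) O1" "k b \<in> O1"
        have stay: "\<kappa> ` {a..b} \<subseteq> N" if l: "lift s \<kappa>" "s \<in> {0..1}" "\<bar>s - x\<bar> < e1/2" "\<exists>t\<in>{a..b}. \<kappa> t \<in> N" for s \<kappa>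
        proof -
          have sub: "{a..b} \<subseteq> {0..1}" using as by auto
          have "connected (\<kappa> ` {a..b})"
            using l(1) sub unfolding lift_def by (metis connected_Icc connected_continuous_image continuous_on_subset)
          moreover have "\<kappa> ` {a..b} \<subseteq> C \<inter> p -` V"
          proof clarify
            fix t assume t: "t \<in> {a..b}"
            then have "t \<in> {0..1}" using sub by auto
            moreover have "t \<le> b" "a \<le> t" using t by auto
            then have "\<bar>t - y\<bar> < e1/2" using ab unfolding abs_less_iff by linarith
            ultimately have "t \<in> {0..1}" "\<bar>t - y\<bar> < e1/2" by blast+
            then show "\<kappa> t \<in> C \<inter> p -` V" using hV[of s t] l by (auto simp: lift_def)
          qed
          ultimately show ?thesis using connected_in_sheet[OF _ _ N(2,4)] l(4) by blast
        qed
        have kN: "k ` {a..b} \<subseteq> N"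
        proof (rule stay[OF k x])
          show "\<exists>t\<in>{a..b}. k t \<in> N" using N(1) ab by (intro bexI[of _ y]) auto
        qed (use e1 in auto)
        have kb: "k b \<in> N" "k a \<in> N" using kN as by auto
        have op: "openin (top_of_set S) (p ` (N \<inter> O1))"
        proof -
          have "openin (top_of_set N) (N \<inter> O1)"
            using as(4) N(2) by (metis inf.absorb_iff2 openin_imp_subset openin_subtopology_Int2 subtopology_subtopology)
          then have "openin (top_of_set V) (p ` (N \<inter> O1))"
            using N(3) homeomorphism_imp_open_map by blast
          then show ?thesis using V(2) openin_trans by blast
        qed
        have hb: "h (x, b) \<in> p ` (N \<inter> O1)"
        proof -
          have "b \<in> {0..1}" using as by auto
          then have "p (k b) = h (x, b)" using k unfolding lift_def by blast
          then show ?thesis using kb as by (metis IntI imageI)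
        qed
        have "continuous_on {0..1} (\<lambda>s. h (s, b))"
          by (intro continuous_on_compose2[OF ch] continuous_intros) (use as in auto)
        moreover have "(\<lambda>s. h (s, b)) ` {0..1} \<subseteq> S" using hS as by auto
        ultimately obtain d where d: "d > 0" "\<And>s. \<lbrakk>s \<in> {0..1}; \<bar>s - x\<bar> < d\<rbrakk> \<Longrightarrow> h (s, b) \<in> p ` (N \<inter> O1)"
          using nhd_01[where f="\<lambda>s. h (s, b)", OF _ _ x hb op] by blast
        show "\<exists>O0 d. openin (top_of_set C) O0 \<and> k a \<in> O0 \<and> d > 0 \<and>
         (\<forall>s\<in>{0..1}. \<forall>\<kappa>. \<bar>s - x\<bar> < d \<longrightarrow> lift s \<kappa> \<longrightarrow> \<kappa> a \<in> O0 \<longrightarrow> \<kappa> b \<in> O1)"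
        proof (intro exI[of _ N] exI[of _ "min d (e1/2)"] conjI ballI allI impI)
          fix s \<kappa> assume s: "s \<in> {0..1}" "\<bar>s - x\<bar> < min d (e1/2)" "lift s \<kappa>" "\<kappa> a \<in> N"
          have "\<kappa> ` {a..b} \<subseteq> N"
            by (rule stay[OF s(3,1)]) (use s as in \<open>auto intro!: bexI[of _ a]\<close>)
          then have "\<kappa> b \<in> N" using as by auto
          moreover have "p (\<kappa> b) \<in> p ` (N \<inter> O1)" using d(2) s as unfolding lift_def by auto
          moreover have "inj_on p N" using N(3) by (metis homeomorphism_apply1 inj_on_inverseI)
          ultimately show "\<kappa> b \<in> O1" by (auto dest: inj_onD)
        qed (use N kb d e1 in auto)
      qed
    qed
  qed
  define R where "R s t \<longleftrightarrow> (0 \<le> s \<longrightarrow> t \<le> 1 \<longrightarrow> s \<le> t \<longrightarrow>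
     (\<forall>\<kappa> \<kappa>'. lift s \<kappa> \<longrightarrow> lift t \<kappa>' \<longrightarrow> \<kappa> 0 = ?a \<longrightarrow> \<kappa>' 0 = ?a \<longrightarrow> \<kappa> 1 = \<kappa>' 1))" for s t
  have "R 0 1"
  using zero_le_one[where 'a=real]
  proof (induction rule: Bolzano)
    case (trans a b c)
    then show ?case unfolding R_def using ex[of b] by (smt (verit) atLeastAtMost_iff)
  next
    case (local x)
    then have x: "x \<in> {0..1}" by auto
    then obtain k where k: "lift x k" "k 0 = ?a" using ex by blast
    have k1C: "k 1 \<in> C" "p (k 1) = f1 1" using k hs x by (auto simp: lift_def)
    then have "f1 1 \<in> S" using covering_space_imp_surjective[OF cov] by (metis imageI)
    then obtain V where V: "f1 1 \<in> V"
      "\<And>e. \<lbrakk>e \<in> C; p e \<in> V\<rbrakk> \<Longrightarrow> \<exists>N q. e \<in> N \<and> openin (top_of_set C) N \<and> homeomorphism N V p q \<and>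
        openin (top_of_set C) (C \<inter> p -` V - N)"
      using evenly_covered[OF cov] by metis
    then obtain N q where N: "k 1 \<in> N" "openin (top_of_set C) N" "homeomorphism N V p q"
      using k1C by metis
    obtain d where d: "d > 0" "\<And>s \<kappa>. s \<in> {0..1} \<Longrightarrow> \<bar>s - x\<bar> < d \<Longrightarrow> lift s \<kappa> \<Longrightarrow> \<kappa> 0 = ?a \<Longrightarrow> \<kappa> 1 \<in> N"
      using Q[OF x k(1)] N(1,2) k(2) unfolding Q_def by (metis order_refl zero_le_one)
    have eq: "\<kappa> 1 = k 1" if "s \<in> {0..1}" "\<bar>s - x\<bar> < d" "lift s \<kappa>" "\<kappa> 0 = ?a" for s \<kappa>
    proof -
      have "\<kappa> 1 \<in> N" using d that by blast
      moreover have "p (\<kappa> 1) = p (k 1)" using that k1C hs by (auto simp: lift_def)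
      ultimately show ?thesis using N by (metis homeomorphism_apply1)
    qed
    show ?case
    proof (intro exI[of _ d] conjI allI impI d(1))
      fix a b assume "a \<le> x \<and> x \<le> b \<and> b - a < d"
      then show "R a b" unfolding R_def using eq[of a] eq[of b] x by auto
    qed
  qed
  moreover have "lift 0 k1" "lift 1 k2"
    using k1 k2 h0 h1 by (auto simp: lift_def path_def path_image_def)
  ultimately show ?thesis using st unfolding R_def pathfinish_def pathstart_def by auto
qed

section \<open>Paths in simply connected spaces\<close>

text \<open>A free homotopy between two constant loops moves the base point along a path.\<close>

lemma simply_connected_imp_path_connected_general:
  assumes "simply_connected S" shows "path_connected S"
  unfolding path_connected_def
proof (intro ballI)
  fix a b assume ab: "a \<in> S" "b \<in> S"
  have "homotopic_loops S (\<lambda>t. a) (\<lambda>t. b)"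
    using assms[unfolded simply_connected_def, rule_format, of "\<lambda>t. a" "\<lambda>t. b"] ab
    by (auto simp: path_def path_image_def pathstart_def pathfinish_def)
  then obtain h where h: "continuous_on ({0..1} \<times> {0..1}) h" "h \<in> ({0..1} \<times> {0..1}) \<rightarrow> S"
    "\<And>x. x \<in> {0..1} \<Longrightarrow> h (0::real, x::real) = a" "\<And>x. x \<in> {0..1} \<Longrightarrow> h (1, x) = b"
    unfolding homotopic_loops by auto
  have "path (\<lambda>s. h (s, 0))" unfolding path_def
    by (intro continuous_on_compose2[OF h(1)] continuous_intros) auto
  moreover have "path_image (\<lambda>s. h (s, 0)) \<subseteq> S" using h(2) by (auto simp: path_image_def)
  ultimately show "\<exists>g. path g \<and> path_image g \<subseteq> S \<and> pathstart g = a \<and> pathfinish g = b"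
    using h(3,4) by (intro exI[of _ "\<lambda>s. h (s, 0)"]) (auto simp: pathstart_def pathfinish_def)
qed

text \<open>Reparametrizations of a path are homotopic because the interval is convex; the constant and inverse
  laws for the composition of paths are special cases.\<close>

lemma homotopic_paths_compose_interval:
  fixes f g :: "real \<Rightarrow> real"
  assumes p: "path p" "path_image p \<subseteq> S" and f: "path f" "path_image f \<subseteq> {0..1}"
    and g: "path g" "path_image g \<subseteq> {0..1}"
    and eq: "pathstart g = pathstart f" "pathfinish g = pathfinish f"
  shows "homotopic_paths S (p \<circ> f) (p \<circ> g)"
proof (rule homotopic_paths_continuous_image)
  show "homotopic_paths {0..1} f g"
  proof (rule homotopic_paths_linear[OF f(1) g(1) eq])
    fix t :: real assume "t \<in> {0..1}"
    then show "closed_segment (f t) (g t) \<subseteq> {0..1}"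
      using f(2) g(2) unfolding path_image_def image_subset_iff
      by (intro closed_segment_subset) auto
  qed
qed (use p in \<open>auto simp: path_def path_image_def\<close>)

lemma compose_linepath_interval:
  "p \<circ> linepath 0 1 = p" "p \<circ> linepath 1 0 = reversepath p" "p \<circ> linepath x x = (\<lambda>_. p x)" for x :: real
  by (auto simp: linepath_def reversepath_def fun_eq_iff algebra_simps)

lemma homotopic_paths_join_const:
  assumes "path p" "path_image p \<subseteq> S" "b = pathfinish p"
  shows "homotopic_paths S (p +++ (\<lambda>_. b)) p"
  using homotopic_paths_compose_interval[OF assms(1,2), of "linepath 0 1 +++ linepath 1 1" "linepath 0 1"] assms(3)
  by (simp add: path_compose_join compose_linepath_interval path_image_join closed_segment_eq_real_ivl pathfinish_def[of p, symmetric])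

lemma homotopic_paths_const_join:
  assumes "path p" "path_image p \<subseteq> S" "a = pathstart p"
  shows "homotopic_paths S ((\<lambda>_. a) +++ p) p"
  using homotopic_paths_compose_interval[OF assms(1,2), of "linepath 0 0 +++ linepath 0 1" "linepath 0 1"] assms(3)
  by (simp add: path_compose_join compose_linepath_interval path_image_join closed_segment_eq_real_ivl pathstart_def[of p, symmetric])

lemma homotopic_paths_join_reverse:
  assumes "path p" "path_image p \<subseteq> S"
  shows "homotopic_paths S (p +++ reversepath p) (\<lambda>_. pathstart p)"
  using homotopic_paths_compose_interval[OF assms, of "linepath 0 1 +++ linepath 1 0" "linepath 0 0"]
  by (simp add: path_compose_join compose_linepath_interval path_image_join closed_segment_eq_real_ivl pathstart_def[of p, symmetric])

lemma homotopic_paths_reverse_join: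
  assumes "path p" "path_image p \<subseteq> S"
  shows "homotopic_paths S (reversepath p +++ p) (\<lambda>_. pathfinish p)"
  using homotopic_paths_join_reverse[of "reversepath p" S] assms by simp

lemma const_path [simp]:
  "path (\<lambda>_. a)" "path_image (\<lambda>_. a) = {a}" "pathstart (\<lambda>_. a) = a" "pathfinish (\<lambda>_. a) = a"
  by (auto simp: path_def path_image_def pathstart_def pathfinish_def)

text \<open>Going along the side \<open>{0} \<times> [0, 1]\<close> of a square is homotopic to going around the three other
  sides; under a free homotopy to a constant loop these three sides become \<open>\<delta>\<close>, the constant path
  and the reverse of \<open>\<delta>\<close>.\<close>

lemma homotopic_loops_const_imp_homotopic_paths:
  assumes "homotopic_loops S \<gamma> (\<lambda>t. a)"
  shows "homotopic_paths S \<gamma> (\<lambda>_. pathstart \<gamma>)"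
proof -
  obtain h where h: "continuous_on ({0..1} \<times> {0..1}) h" "h \<in> ({0..1} \<times> {0..1}) \<rightarrow> S"
    "\<And>x. x \<in> {0..1} \<Longrightarrow> h (0::real, x::real) = \<gamma> x" "\<And>x. x \<in> {0..1} \<Longrightarrow> h (1, x) = a"
    "\<And>t. t \<in> {0..1} \<Longrightarrow> h (t, 1) = h (t, 0)"
    using assms unfolding homotopic_loops by (auto simp: pathstart_def pathfinish_def)
  have \<gamma>: "path \<gamma>" "path_image \<gamma> \<subseteq> S"
    using assms homotopic_loops_imp_path homotopic_loops_imp_subset by blast+
  let ?Q = "{0..1::real} \<times> {0..1::real}"
  let ?l = "linepath (0::real, 0::real) (1, 0)" and ?t = "linepath (1::real, 0::real) (1, 1)"
    and ?r = "linepath (1::real, 1::real) (0, 1)" and ?e = "linepath (0::real, 0::real) (0, 1)"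
  define \<delta> where "\<delta> s = h (s, 0)" for s
  have Q: "convex ?Q" by (intro convex_Times convex_real_interval)
  have cs: "closed_segment u v \<subseteq> ?Q" if "u \<in> ?Q" "v \<in> ?Q" for u v
    using that Q by (simp add: closed_segment_subset)
  have lin: "path_image ?l \<subseteq> ?Q" "path_image ?t \<subseteq> ?Q" "path_image ?r \<subseteq> ?Q" "path_image ?e \<subseteq> ?Q"
    unfolding path_image_linepath by (rule cs; simp)+
  have im: "path_image (?l +++ (?t +++ ?r)) \<subseteq> ?Q"
    using lin by (intro subset_path_image_join)
  have "homotopic_paths ?Q ?e (?l +++ (?t +++ ?r))"
  proof (rule homotopic_paths_linear)
    fix t :: real assume "t \<in> {0..1}"
    then have "?e t \<in> ?Q" "(?l +++ (?t +++ ?r)) t \<in> ?Q"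
      using lin(4) im by (auto simp: path_image_def image_subset_iff)
    then show "closed_segment (?e t) ((?l +++ (?t +++ ?r)) t) \<subseteq> ?Q" by (rule cs)
  qed auto
  then have e1: "homotopic_paths S (h \<circ> ?e) (h \<circ> (?l +++ (?t +++ ?r)))"
    using h(1,2) homotopic_paths_continuous_image by blast
  have e2: "homotopic_paths S \<gamma> (h \<circ> ?e)"
    by (rule homotopic_paths_eq) (use \<gamma> h(3) in \<open>auto simp: linepath_def\<close>)
  have \<delta>: "path \<delta>" "path_image \<delta> \<subseteq> S" "pathfinish \<delta> = a" "pathstart \<delta> = pathstart \<gamma>"
  proof -
    show "path \<delta>" unfolding path_def \<delta>_def
      by (intro continuous_on_compose2[OF h(1)] continuous_intros) auto
    show "path_image \<delta> \<subseteq> S" using h(2) by (auto simp: path_image_def \<delta>_def)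
  qed (use h(3,4) in \<open>auto simp: \<delta>_def pathstart_def pathfinish_def\<close>)
  have aS: "a \<in> S" using \<delta> by (metis pathfinish_in_path_image subsetD)
  have rd: "homotopic_paths S (h \<circ> ?r) (reversepath \<delta>)"
  proof (rule homotopic_paths_sym, rule homotopic_paths_eq)
    fix t :: real assume "t \<in> {0..1}"
    then show "reversepath \<delta> t = (h \<circ> ?r) t"
      using h(5)[of "1 - t"] by (simp add: linepath_def reversepath_def \<delta>_def)
  qed (use \<delta> in auto)
  have td: "homotopic_paths S (h \<circ> ?t) (\<lambda>_. a)"
  proof (rule homotopic_paths_sym, rule homotopic_paths_eq)
    fix t :: real assume "t \<in> {0..1}"
    then show "a = (h \<circ> ?t) t" using h(4)[of t] by (simp add: linepath_def)
  qed (use aS in auto)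
  have ld: "homotopic_paths S (h \<circ> ?l) \<delta>"
  proof (rule homotopic_paths_sym, rule homotopic_paths_eq)
    fix t :: real
    show "\<delta> t = (h \<circ> ?l) t" by (simp add: linepath_def \<delta>_def)
  qed (use \<delta> in auto)
  have "homotopic_paths S ((h \<circ> ?t) +++ (h \<circ> ?r)) ((\<lambda>_. a) +++ reversepath \<delta>)"
    by (rule homotopic_paths_join[OF td rd]) (simp add: pathfinish_def pathstart_def linepath_def)
  also have "homotopic_paths S ((\<lambda>_. a) +++ reversepath \<delta>) (reversepath \<delta>)"
    by (rule homotopic_paths_const_join) (use \<delta> in auto)
  finally have "homotopic_paths S ((h \<circ> ?l) +++ ((h \<circ> ?t) +++ (h \<circ> ?r))) (\<delta> +++ reversepath \<delta>)"
    by (intro homotopic_paths_join[OF ld]) (auto simp: pathfinish_def pathstart_def linepath_def joinpaths_def)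
  also have "homotopic_paths S (\<delta> +++ reversepath \<delta>) (\<lambda>_. pathstart \<gamma>)"
    using homotopic_paths_join_reverse[of \<delta> S] \<delta> by simp
  finally show ?thesis
    by (rule homotopic_paths_trans[OF homotopic_paths_trans[OF e2 e1[unfolded path_compose_join]]])
qed

text \<open>The loop that follows \<open>\<sigma>\<close> and returns along \<open>\<tau>\<close> is null-homotopic; composing it with \<open>\<tau>\<close> gives
  \<open>\<sigma>\<close> on the one hand and \<open>\<tau>\<close> on the other.\<close>

lemma simply_connected_homotopic_paths:
  assumes S: "simply_connected S" and \<sigma>: "path \<sigma>" "path_image \<sigma> \<subseteq> S" and \<tau>: "path \<tau>" "path_image \<tau> \<subseteq> S"
    and eq: "pathstart \<sigma> = pathstart \<tau>" "pathfinish \<sigma> = pathfinish \<tau>"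
  shows "homotopic_paths S \<sigma> \<tau>"
proof -
  let ?a = "pathstart \<sigma>" and ?b = "pathfinish \<sigma>"
  have aS: "?a \<in> S" using \<sigma> by (meson pathstart_in_path_image subsetD)
  have "homotopic_loops S (\<sigma> +++ reversepath \<tau>) (\<lambda>t. ?a)"
    by (rule S[unfolded simply_connected_def, rule_format])
      (use \<sigma> \<tau> eq aS in \<open>auto simp: subset_path_image_join\<close>)
  then have 1: "homotopic_paths S (\<sigma> +++ reversepath \<tau>) (\<lambda>_. ?a)"
    using homotopic_loops_const_imp_homotopic_paths by fastforce
  have "homotopic_paths S \<sigma> (\<sigma> +++ (\<lambda>_. ?b))"
    by (rule homotopic_paths_sym, rule homotopic_paths_join_const) (use \<sigma> in auto)
  also have "homotopic_paths S (\<sigma> +++ (\<lambda>_. ?b)) (\<sigma> +++ (reversepath \<tau> +++ \<tau>))"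
  proof (rule homotopic_paths_join)
    show "homotopic_paths S (\<lambda>_. ?b) (reversepath \<tau> +++ \<tau>)"
      using homotopic_paths_reverse_join[OF \<tau>] eq by (simp add: homotopic_paths_sym)
  qed (use \<sigma> in auto)
  also have "homotopic_paths S (\<sigma> +++ (reversepath \<tau> +++ \<tau>)) ((\<sigma> +++ reversepath \<tau>) +++ \<tau>)"
    by (rule homotopic_paths_assoc) (use \<sigma> \<tau> eq in auto)
  also have "homotopic_paths S ((\<sigma> +++ reversepath \<tau>) +++ \<tau>) ((\<lambda>_. ?a) +++ \<tau>)"
    by (rule homotopic_paths_join[OF 1]) (use \<tau> in auto)
  also have "homotopic_paths S ((\<lambda>_. ?a) +++ \<tau>) \<tau>"
    by (rule homotopic_paths_const_join) (use \<tau> eq in auto)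
  finally show ?thesis .
qed

lemma path_connectedE:
  assumes "path_connected S" "a \<in> S" "b \<in> S"
  obtains g where "path g" "path_image g \<subseteq> S" "pathstart g = a" "pathfinish g = b"
  using assms unfolding path_connected_def by blast

definition locally_path_connected_space :: "'u::topological_space set \<Rightarrow> bool" where
  "locally_path_connected_space C \<longleftrightarrow> (\<forall>u\<in>C. \<forall>O'. openin (top_of_set C) O' \<longrightarrow> u \<in> O' \<longrightarrow>
     (\<exists>N. openin (top_of_set C) N \<and> u \<in> N \<and> N \<subseteq> O' \<and> path_connected N))"

text \<open>The lift of the covering map along itself that takes \<open>u1\<close> to \<open>u2\<close>: a point is joined to
  \<open>u1\<close> by a path, which is projected and lifted again from \<open>u2\<close>.\<close>

lemma deck_map_exists:
  fixes p :: "'u::topological_space \<Rightarrow> 'm::topological_space"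
  assumes cov: "covering_space C p S" and sc: "simply_connected C" and lpc: "locally_path_connected_space C"
    and u: "u1 \<in> C" "u2 \<in> C" "p u1 = p u2"
  obtains T where "continuous_on C T" "T ` C \<subseteq> C" "\<And>u. u \<in> C \<Longrightarrow> p (T u) = p u" "T u1 = u2"
proof -
  have cp: "continuous_on C p" "p ` C = S" using cov by (auto simp: covering_space_def)
  define rel where "rel u w \<longleftrightarrow> (\<exists>\<sigma> k. path \<sigma> \<and> path_image \<sigma> \<subseteq> C \<and> pathstart \<sigma> = u1 \<and> pathfinish \<sigma> = u \<and>
      path k \<and> path_image k \<subseteq> C \<and> pathstart k = u2 \<and> pathfinish k = w \<and> (\<forall>t\<in>{0..1}. p (k t) = p (\<sigma> t)))" for u w
  have pl: "path (p \<circ> \<sigma>)" "path_image (p \<circ> \<sigma>) \<subseteq> S" if "path \<sigma>" "path_image \<sigma> \<subseteq> C" for \<sigma>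
  proof -
    show "path (p \<circ> \<sigma>)" using that cp(1) by (meson continuous_on_subset path_continuous_image)
    show "path_image (p \<circ> \<sigma>) \<subseteq> S" using that cp(2) by (auto simp: path_image_compose)
  qed
  have ex: "\<exists>w. rel u w" if uC: "u \<in> C" for u
  proof -
    obtain \<sigma> where \<sigma>: "path \<sigma>" "path_image \<sigma> \<subseteq> C" "pathstart \<sigma> = u1" "pathfinish \<sigma> = u"
      using path_connectedE[OF simply_connected_imp_path_connected_general[OF sc] u(1) uC] .
    obtain k where "path k" "path_image k \<subseteq> C" "pathstart k = u2" "\<And>t. t \<in> {0..1} \<Longrightarrow> p (k t) = (p \<circ> \<sigma>) t"
      by (rule covering_path_lift[OF cov pl[OF \<sigma>(1,2)] u(2)]) (use \<sigma> u in \<open>auto simp: pathstart_def\<close>)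
    then show ?thesis using \<sigma> unfolding rel_def
      by (intro exI[of _ "pathfinish k"] exI[of _ \<sigma>] exI[of _ k]) auto
  qed
  have uniq: "w = w'" if r: "rel u w" "rel u w'" for u w w'
  proof -
    obtain \<sigma> k where 1: "path \<sigma>" "path_image \<sigma> \<subseteq> C" "pathstart \<sigma> = u1" "pathfinish \<sigma> = u"
      "path k" "path_image k \<subseteq> C" "pathstart k = u2" "pathfinish k = w" "\<forall>t\<in>{0..1}. p (k t) = p (\<sigma> t)"
      using r(1) unfolding rel_def by blast
    obtain \<sigma>' k' where 2: "path \<sigma>'" "path_image \<sigma>' \<subseteq> C" "pathstart \<sigma>' = u1" "pathfinish \<sigma>' = u"
      "path k'" "path_image k' \<subseteq> C" "pathstart k' = u2" "pathfinish k' = w'" "\<forall>t\<in>{0..1}. p (k' t) = p (\<sigma>' t)"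
      using r(2) unfolding rel_def by blast
    have "homotopic_paths C \<sigma> \<sigma>'"
      by (rule simply_connected_homotopic_paths[OF sc]) (use 1 2 in auto)
    then have "homotopic_paths S (p \<circ> \<sigma>) (p \<circ> \<sigma>')"
      using cp by (intro homotopic_paths_continuous_image) auto
    then show ?thesis using covering_monodromy[OF cov, of "p \<circ> \<sigma>" "p \<circ> \<sigma>'" k k'] 1 2 by auto
  qed
  define T where "T u = (SOME w. rel u w)" for u
  have T: "rel u w \<longleftrightarrow> w = T u" if "u \<in> C" for u w
    using ex[OF that] uniq unfolding T_def by (metis someI)
  have TC: "T u \<in> C \<and> p (T u) = p u" if uC: "u \<in> C" for u
  proof -
    obtain \<sigma> k where 1: "path \<sigma>" "path_image \<sigma> \<subseteq> C" "pathstart \<sigma> = u1" "pathfinish \<sigma> = u"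
      "path k" "path_image k \<subseteq> C" "pathstart k = u2" "pathfinish k = T u" "\<forall>t\<in>{0..1}. p (k t) = p (\<sigma> t)"
      using T[OF uC, of "T u"] unfolding rel_def by blast
    have "T u \<in> path_image k" using 1(8) by (metis pathfinish_in_path_image)
    moreover have "p (T u) = p u" using 1(4,8) bspec[OF 1(9), of 1] by (auto simp: pathfinish_def)
    ultimately show ?thesis using 1 by auto
  qed
  have "\<exists>N. openin (top_of_set C) N \<and> u \<in> N \<and> continuous_on N T" if uC: "u \<in> C" for u
  proof -
    have "p u \<in> S" using cp uC by auto
    then obtain V where V: "p u \<in> V" "openin (top_of_set S) V"
      "\<And>e. \<lbrakk>e \<in> C; p e \<in> V\<rbrakk> \<Longrightarrow> \<exists>N q. e \<in> N \<and> openin (top_of_set C) N \<and> homeomorphism N V p q \<and>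
        openin (top_of_set C) (C \<inter> p -` V - N)"
      using evenly_covered[OF cov] by blast
    obtain N' q where N': "T u \<in> N'" "openin (top_of_set C) N'" "homeomorphism N' V p q"
      using V(3)[of "T u"] TC[OF uC] V(1) by auto
    have "openin (top_of_set C) (C \<inter> p -` V)" using cp V(2) by (intro openin_preimage_on) auto
    then obtain N where N: "openin (top_of_set C) N" "u \<in> N" "N \<subseteq> C \<inter> p -` V" "path_connected N"
      using lpc uC V(1) unfolding locally_path_connected_space_def by (metis IntI vimageI)
    have Tq: "T w = (q \<circ> p) w" if w: "w \<in> N" for w
    proof -
      obtain \<sigma> k where 1: "path \<sigma>" "path_image \<sigma> \<subseteq> C" "pathstart \<sigma> = u1" "pathfinish \<sigma> = u"
        "path k" "path_image k \<subseteq> C" "pathstart k = u2" "pathfinish k = T u" "\<forall>t\<in>{0..1}. p (k t) = p (\<sigma> t)"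
        using T[OF uC, of "T u"] unfolding rel_def by blast
      obtain \<tau> where \<tau>: "path \<tau>" "path_image \<tau> \<subseteq> N" "pathstart \<tau> = u" "pathfinish \<tau> = w"
        using path_connectedE[OF N(4,2) w] .
      have \<tau>V: "p ` path_image \<tau> \<subseteq> V" "path_image \<tau> \<subseteq> C" using \<tau> N by auto
      have "q ` V = N'" using N'(3) by (simp add: homeomorphism_def)
      then have qC: "q ` V \<subseteq> C" using N'(2) openin_imp_subset by metis
      have "continuous_on (path_image \<tau>) (q \<circ> p)"
        using N'(3) \<tau>V cp(1)
        by (intro continuous_on_compose) (auto intro: continuous_on_subset simp: homeomorphism_def)
      then have pq: "path ((q \<circ> p) \<circ> \<tau>)" using \<tau>(1) path_continuous_image by blast
      have start: "pathstart ((q \<circ> p) \<circ> \<tau>) = T u"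
        using \<tau> N'(1,3) TC[OF uC] by (simp add: pathstart_compose) (metis homeomorphism_apply1)
      have wC: "w \<in> C" using w N by auto
      have "rel w ((q \<circ> p) w)" unfolding rel_def
      proof (rule exI[of _ "\<sigma> +++ \<tau>"], rule exI[of _ "k +++ ((q \<circ> p) \<circ> \<tau>)"], intro conjI ballI)
        show "path_image (k +++ (q \<circ> p \<circ> \<tau>)) \<subseteq> C"
        proof (rule subset_path_image_join[OF 1(6)])
          have "q (p z) \<in> C" if "z \<in> path_image \<tau>" for z
            using that \<tau>V(1) qC unfolding image_subset_iff by blast
          then show "path_image (q \<circ> p \<circ> \<tau>) \<subseteq> C" unfolding path_image_compose by auto
        qed
        show "p ((k +++ (q \<circ> p \<circ> \<tau>)) t) = p ((\<sigma> +++ \<tau>) t)" if t: "t \<in> {0..1}" for t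
        proof (cases "t \<le> 1/2")
          case False
          then have "2 * t - 1 \<in> {0..1}" using t by auto
          then have "p (\<tau> (2 * t - 1)) \<in> V" using \<tau>V by (auto simp: path_image_def)
          then show ?thesis using False N'(3) by (simp add: joinpaths_def homeomorphism_apply2)
        qed (use 1 t in \<open>auto simp: joinpaths_def\<close>)
      qed (use 1 \<tau> pq start \<tau>V in \<open>auto simp: subset_path_image_join pathfinish_compose\<close>)
      then show ?thesis using T[OF wC] by simp
    qed
    have "continuous_on N (q \<circ> p)"
      using N'(3) N(3) cp(1)
      by (intro continuous_on_compose) (auto intro: continuous_on_subset simp: homeomorphism_def)
    then have "continuous_on N T" using Tq by (simp cong: continuous_on_cong)
    then show ?thesis using N by blast
  qed
  then obtain NN where NN: "\<And>u. u \<in> C \<Longrightarrow> openin (top_of_set C) (NN u) \<and> u \<in> NN u \<and> continuous_on (NN u) T"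
    by metis
  have "continuous_map (top_of_set C) euclidean T"
  proof (rule pasting_lemma[where I=C and T=NN and f="\<lambda>_. T"])
    fix i assume "i \<in> C"
    then show "continuous_map (subtopology (top_of_set C) (NN i)) euclidean T"
      using NN[of i] by (simp add: subtopology_subtopology) (metis continuous_on_subset inf_le2)
  qed (use NN in auto)
  then have "continuous_on C T" by simp
  moreover have "T u1 = u2"
  proof -
    have "rel u1 u2" unfolding rel_def
      by (rule exI[of _ "\<lambda>_. u1"], rule exI[of _ "\<lambda>_. u2"]) (use u in auto)
    then show ?thesis using T[OF u(1)] by simp
  qed
  ultimately show thesis using that TC by blast
qed

section \<open>Deck transformations and the fundamental group\<close>

lemma openin_homeomorphic_map_top_of_set:
  assumes "f ` C \<subseteq> C" "g ` C \<subseteq> C" "continuous_on C f" "continuous_on C g"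
    "\<And>u. u \<in> C \<Longrightarrow> g (f u) = u" "\<And>u. u \<in> C \<Longrightarrow> f (g u) = u"
  shows "homeomorphic_map (top_of_set C) (top_of_set C) f"
  unfolding homeomorphic_map_maps homeomorphic_maps_def
  by (rule exI[of _ g]) (use assms in \<open>auto simp: image_subset_iff\<close>)

locale universal_covering =
  fixes M :: "'m::topological_space set" and Mt :: "'u::topological_space set" and p :: "'u \<Rightarrow> 'm" and u0 :: 'u
  assumes cover: "covering_space Mt p M" and sc: "simply_connected Mt" and u0: "u0 \<in> Mt"
    and lpc: "locally_path_connected_space Mt"
begin

abbreviation "\<Gamma> \<equiv> fundamental_group M (p u0)"
abbreviation "D \<equiv> deck_transformations Mt p"
abbreviation "T \<equiv> deck_of Mt p u0"
abbreviation "LL \<equiv> loop_homotopy M (p u0)"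

lemma cont_p: "continuous_on Mt p" and p_image: "p ` Mt = M"
  using cover by (auto simp: covering_space_def)

lemma path_connected_Mt: "path_connected Mt"
  by (rule simply_connected_imp_path_connected_general[OF sc])

lemma connected_Mt: "connected Mt"
  using path_connected_Mt path_connected_imp_connected by blast

lemma deckD:
  assumes "\<tau> \<in> D"
  shows "continuous_on Mt \<tau>" "\<tau> ` Mt = Mt" "\<And>u. u \<in> Mt \<Longrightarrow> \<tau> u \<in> Mt" "\<And>u. u \<in> Mt \<Longrightarrow> p (\<tau> u) = p u"
    "\<And>O'. openin (top_of_set Mt) O' \<Longrightarrow> openin (top_of_set Mt) (\<tau> ` O')" "\<tau> \<in> Bij Mt"
proof -
  have h: "homeomorphic_map (top_of_set Mt) (top_of_set Mt) \<tau>" "\<forall>u\<in>Mt. p (\<tau> u) = p u" and B: "\<tau> \<in> Bij Mt"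
    using assms by (auto simp: deck_transformations_def)
  show "continuous_on Mt \<tau>" using homeomorphic_imp_continuous_map[OF h(1)] by simp
  show im: "\<tau> ` Mt = Mt" using homeomorphic_imp_surjective_map[OF h(1)] by simp
  then show "\<And>u. u \<in> Mt \<Longrightarrow> \<tau> u \<in> Mt" by blast
  show "\<And>u. u \<in> Mt \<Longrightarrow> p (\<tau> u) = p u" using h by blast
  show "\<And>O'. openin (top_of_set Mt) O' \<Longrightarrow> openin (top_of_set Mt) (\<tau> ` O')"
    using homeomorphic_imp_open_map[OF h(1)] by (simp add: open_map_def)
  show "\<tau> \<in> Bij Mt" by (rule B)
qed

lemma lift_identity:
  assumes "continuous_on Mt f" "f ` Mt \<subseteq> Mt" "\<And>u. u \<in> Mt \<Longrightarrow> p (f u) = p u" "v \<in> Mt" "f v = v" "u \<in> Mt"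
  shows "f u = u"
  by (rule covering_lift_unique[OF cover connected_Mt, of f "\<lambda>u. u" v u]) (use assms in auto)

lemma deck_eqI:
  assumes "\<tau> \<in> D" "\<sigma> \<in> D" "v \<in> Mt" "\<tau> v = \<sigma> v"
  shows "\<tau> = \<sigma>"
proof (rule extensionalityI)
  show "\<tau> \<in> extensional Mt" "\<sigma> \<in> extensional Mt"
    using deckD(6)[OF assms(1)] deckD(6)[OF assms(2)] by (auto simp: Bij_def)
  fix u assume u: "u \<in> Mt"
  show "\<tau> u = \<sigma> u"
    by (rule covering_lift_unique[OF cover connected_Mt deckD(1)[OF assms(1)] _ deckD(1)[OF assms(2)] _ _ assms(3,4) u])
      (use deckD(2,4)[OF assms(1)] deckD(2,4)[OF assms(2)] in auto)
qed

lemma deckI: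
  assumes f: "continuous_on Mt f" "f ` Mt \<subseteq> Mt" "\<And>u. u \<in> Mt \<Longrightarrow> p (f u) = p u"
    and g: "continuous_on Mt g" "g ` Mt \<subseteq> Mt"
    and fg: "\<And>u. u \<in> Mt \<Longrightarrow> g (f u) = u" "\<And>u. u \<in> Mt \<Longrightarrow> f (g u) = u"
  shows "restrict f Mt \<in> D"
proof -
  have "bij_betw f Mt Mt"
    by (rule bij_betw_byWitness[of _ g]) (use assms in auto)
  then have "restrict f Mt \<in> Bij Mt" by (auto simp: Bij_def)
  moreover have "homeomorphic_map (top_of_set Mt) (top_of_set Mt) f"
    by (rule openin_homeomorphic_map_top_of_set[of f Mt g]) (use assms in auto)
  then have "homeomorphic_map (top_of_set Mt) (top_of_set Mt) (restrict f Mt)"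
    by (rule homeomorphic_map_eq) auto
  ultimately show ?thesis using f by (auto simp: deck_transformations_def)
qed

text \<open>The lifts of the covering map that take \<open>u1\<close> to \<open>u2\<close> and \<open>u2\<close> to \<open>u1\<close> are inverse to each other, since
  their composites fix a point.\<close>

lemma deck_transitive:
  assumes "u1 \<in> Mt" "u2 \<in> Mt" "p u1 = p u2"
  obtains \<tau> where "\<tau> \<in> D" "\<tau> u1 = u2"
proof -
  obtain f where f: "continuous_on Mt f" "f ` Mt \<subseteq> Mt" "\<And>u. u \<in> Mt \<Longrightarrow> p (f u) = p u" "f u1 = u2"
    by (rule deck_map_exists[OF cover sc lpc assms]) (rule that)
  obtain g where g: "continuous_on Mt g" "g ` Mt \<subseteq> Mt" "\<And>u. u \<in> Mt \<Longrightarrow> p (g u) = p u" "g u2 = u1"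
    by (rule deck_map_exists[OF cover sc lpc assms(2,1) assms(3)[symmetric]]) (rule that)
  have c: "continuous_on Mt (g \<circ> f)" "continuous_on Mt (f \<circ> g)"
    using f(1,2) g(1,2) by (meson continuous_on_compose continuous_on_subset)+
  have "(g \<circ> f) u = u" if "u \<in> Mt" for u
    by (rule lift_identity[OF _ _ _ assms(1) _ that])
      (use f g assms c in \<open>auto simp: image_subset_iff\<close>)
  moreover have "(f \<circ> g) u = u" if "u \<in> Mt" for u
    by (rule lift_identity[OF _ _ _ assms(2) _ that])
      (use f g assms c in \<open>auto simp: image_subset_iff\<close>)
  ultimately have "restrict f Mt \<in> D"
    using f g by (intro deckI[of f g]) auto
  then show thesis using that[of "restrict f Mt"] f(4) assms(1) by simp
qed

lemma deck_compose:
  assumes "\<tau> \<in> D" "\<sigma> \<in> D"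
  shows "compose Mt \<tau> \<sigma> \<in> D"
proof -
  have h: "homeomorphic_map (top_of_set Mt) (top_of_set Mt) \<tau>" "homeomorphic_map (top_of_set Mt) (top_of_set Mt) \<sigma>"
    using assms by (auto simp: deck_transformations_def)
  then have "homeomorphic_map (top_of_set Mt) (top_of_set Mt) (\<tau> \<circ> \<sigma>)" by (metis homeomorphic_map_compose)
  then have "homeomorphic_map (top_of_set Mt) (top_of_set Mt) (compose Mt \<tau> \<sigma>)"
    by (rule homeomorphic_map_eq) (auto simp: compose_def)
  moreover have "compose Mt \<tau> \<sigma> \<in> Bij Mt" using assms deckD(6) compose_Bij by blast
  ultimately show ?thesis using deckD(3,4) assms by (auto simp: deck_transformations_def compose_def)
qed

lemma deck_id: "(\<lambda>u\<in>Mt. u) \<in> D"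
  by (rule deckI[of _ "\<lambda>u. u"]) auto

lemma equiv_LL: "equiv (loops_at M (p u0)) LL"
proof (rule equivI)
  show "LL \<subseteq> loops_at M (p u0) \<times> loops_at M (p u0)" by (auto simp: loop_homotopy_def)
  show "refl_on (loops_at M (p u0)) LL"
    by (auto simp: refl_on_def loop_homotopy_def loops_at_def)
  show "sym LL" by (auto simp: sym_def loop_homotopy_def intro: homotopic_paths_sym)
  show "trans LL" by (auto simp: trans_def loop_homotopy_def intro: homotopic_paths_trans)
qed

abbreviation cls :: "(real \<Rightarrow> 'm) \<Rightarrow> (real \<Rightarrow> 'm) set" where "cls \<alpha> \<equiv> LL `` {\<alpha>}"

lemma carrier_\<Gamma>: "carrier \<Gamma> = loops_at M (p u0) // LL"
  by (simp add: fundamental_group_def)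

lemma homotopic_in_cls:
  assumes "\<alpha> \<in> loops_at M (p u0)" "homotopic_paths M \<alpha> \<beta>"
  shows "\<beta> \<in> loops_at M (p u0)" "\<beta> \<in> cls \<alpha>"
proof -
  show "\<beta> \<in> loops_at M (p u0)"
    using assms(1) homotopic_paths_imp_path[OF assms(2)] homotopic_paths_imp_subset[OF assms(2)]
      homotopic_paths_imp_pathstart[OF assms(2)] homotopic_paths_imp_pathfinish[OF assms(2)]
    by (auto simp: loops_at_def)
  then show "\<beta> \<in> cls \<alpha>" using assms by (simp add: loop_homotopy_def)
qed

lemma cls_eq: "\<alpha> \<in> loops_at M (p u0) \<Longrightarrow> homotopic_paths M \<alpha> \<beta> \<Longrightarrow> cls \<alpha> = cls \<beta>"
  using homotopic_in_cls(2)[of \<alpha> \<beta>] equiv_class_eq[OF equiv_LL, of \<alpha> \<beta>] by simp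

lemma carrier_iff: "A \<in> carrier \<Gamma> \<longleftrightarrow> (\<exists>\<alpha>\<in>loops_at M (p u0). A = cls \<alpha>)"
  unfolding carrier_\<Gamma> quotient_def by auto

lemma cls_in: "\<alpha> \<in> loops_at M (p u0) \<Longrightarrow> cls \<alpha> \<in> carrier \<Gamma>"
  unfolding carrier_\<Gamma> by (rule quotientI)

lemma mem_carrier:
  assumes "A \<in> carrier \<Gamma>" "\<alpha> \<in> A" shows "\<alpha> \<in> loops_at M (p u0)" "A = cls \<alpha>"
proof -
  obtain \<beta> where \<beta>: "\<beta> \<in> loops_at M (p u0)" "A = cls \<beta>" using assms(1) unfolding carrier_iff by blast
  then have "(\<beta>, \<alpha>) \<in> LL" using assms by simp
  then show "\<alpha> \<in> loops_at M (p u0)" "A = cls \<alpha>"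
    using \<beta> equiv_class_eq[OF equiv_LL] by (auto simp: loop_homotopy_def)
qed

lemma loop_join: "\<alpha> \<in> loops_at M (p u0) \<Longrightarrow> \<beta> \<in> loops_at M (p u0) \<Longrightarrow> \<alpha> +++ \<beta> \<in> loops_at M (p u0)"
  by (auto simp: loops_at_def subset_path_image_join)

lemma mult_cls:
  assumes "\<alpha> \<in> loops_at M (p u0)" "\<beta> \<in> loops_at M (p u0)"
  shows "cls \<alpha> \<otimes>\<^bsub>\<Gamma>\<^esub> cls \<beta> = cls (\<alpha> +++ \<beta>)"
proof -
  have "cls (\<alpha>' +++ \<beta>') = cls (\<alpha> +++ \<beta>)" if "\<alpha>' \<in> cls \<alpha>" "\<beta>' \<in> cls \<beta>" for \<alpha>' \<beta>'
  proof (rule cls_eq[symmetric, OF loop_join[OF assms]])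
    show "homotopic_paths M (\<alpha> +++ \<beta>) (\<alpha>' +++ \<beta>')"
      using that assms by (intro homotopic_paths_join) (auto simp: loop_homotopy_def loops_at_def)
  qed
  moreover have "\<alpha> \<in> cls \<alpha>" "\<beta> \<in> cls \<beta>" using assms equiv_class_self[OF equiv_LL] by auto
  then have "cls \<alpha> \<noteq> {}" "cls \<beta> \<noteq> {}" by blast+
  moreover have "cls \<alpha> \<otimes>\<^bsub>\<Gamma>\<^esub> cls \<beta> = (\<Union>\<alpha>'\<in>cls \<alpha>. \<Union>\<beta>'\<in>cls \<beta>. cls (\<alpha>' +++ \<beta>'))"
    by (simp add: fundamental_group_def)
  ultimately show ?thesis by (simp only: UN_constant if_False cong: SUP_cong)
qed

lemma const_loop: "(\<lambda>_. p u0) \<in> loops_at M (p u0)"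
  using u0 p_image by (auto simp: loops_at_def)

lemma one_\<Gamma>: "\<one>\<^bsub>\<Gamma>\<^esub> = cls (\<lambda>_. p u0)"
  by (simp add: fundamental_group_def)

lemma group_\<Gamma>: "group \<Gamma>"
proof (rule groupI)
  show "\<one>\<^bsub>\<Gamma>\<^esub> \<in> carrier \<Gamma>" unfolding one_\<Gamma> by (rule cls_in[OF const_loop])
next
  fix A B assume "A \<in> carrier \<Gamma>" "B \<in> carrier \<Gamma>"
  then obtain \<alpha> \<beta> where 1: "\<alpha> \<in> loops_at M (p u0)" "A = cls \<alpha>" "\<beta> \<in> loops_at M (p u0)" "B = cls \<beta>"
    unfolding carrier_iff by blast
  show "A \<otimes>\<^bsub>\<Gamma>\<^esub> B \<in> carrier \<Gamma>"
    unfolding 1(2,4) mult_cls[OF 1(1,3)] by (rule cls_in[OF loop_join[OF 1(1,3)]])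
next
  fix A B C assume "A \<in> carrier \<Gamma>" "B \<in> carrier \<Gamma>" "C \<in> carrier \<Gamma>"
  then obtain \<alpha> \<beta> \<gamma> where 1: "\<alpha> \<in> loops_at M (p u0)" "A = cls \<alpha>" "\<beta> \<in> loops_at M (p u0)" "B = cls \<beta>"
    "\<gamma> \<in> loops_at M (p u0)" "C = cls \<gamma>" unfolding carrier_iff by blast
  have "homotopic_paths M (\<alpha> +++ (\<beta> +++ \<gamma>)) ((\<alpha> +++ \<beta>) +++ \<gamma>)"
    by (rule homotopic_paths_assoc) (use 1 in \<open>auto simp: loops_at_def\<close>)
  then have "cls (\<alpha> +++ (\<beta> +++ \<gamma>)) = cls ((\<alpha> +++ \<beta>) +++ \<gamma>)"
    by (rule cls_eq[rotated]) (use 1 loop_join in auto)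
  then show "A \<otimes>\<^bsub>\<Gamma>\<^esub> B \<otimes>\<^bsub>\<Gamma>\<^esub> C = A \<otimes>\<^bsub>\<Gamma>\<^esub> (B \<otimes>\<^bsub>\<Gamma>\<^esub> C)"
    unfolding 1(2,4,6) mult_cls[OF 1(1,3)] mult_cls[OF 1(3,5)] mult_cls[OF loop_join[OF 1(1,3)] 1(5)]
      mult_cls[OF 1(1) loop_join[OF 1(3,5)]] by (rule sym)
next
  fix A assume "A \<in> carrier \<Gamma>"
  then obtain \<alpha> where 1: "\<alpha> \<in> loops_at M (p u0)" "A = cls \<alpha>" unfolding carrier_iff by blast
  have "homotopic_paths M ((\<lambda>_. p u0) +++ \<alpha>) \<alpha>"
    by (rule homotopic_paths_const_join) (use 1 in \<open>auto simp: loops_at_def\<close>)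
  then have "cls ((\<lambda>_. p u0) +++ \<alpha>) = cls \<alpha>"
    by (rule cls_eq[rotated]) (use 1 loop_join const_loop in auto)
  then show "\<one>\<^bsub>\<Gamma>\<^esub> \<otimes>\<^bsub>\<Gamma>\<^esub> A = A"
    unfolding one_\<Gamma> 1(2) mult_cls[OF const_loop 1(1)] .
  have r: "reversepath \<alpha> \<in> loops_at M (p u0)" using 1 by (auto simp: loops_at_def)
  have "homotopic_paths M (reversepath \<alpha> +++ \<alpha>) (\<lambda>_. p u0)"
    using homotopic_paths_reverse_join[of \<alpha> M] 1 by (simp add: loops_at_def)
  then have "cls (reversepath \<alpha> +++ \<alpha>) = cls (\<lambda>_. p u0)"
    by (rule cls_eq[rotated]) (use 1 loop_join r in auto)
  then show "\<exists>B\<in>carrier \<Gamma>. B \<otimes>\<^bsub>\<Gamma>\<^esub> A = \<one>\<^bsub>\<Gamma>\<^esub>"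
    unfolding one_\<Gamma> 1(2) mult_cls[OF r 1(1), symmetric] using cls_in[OF r] by blast
qed

lemma deck_of_witness_unique:
  assumes A: "A \<in> carrier \<Gamma>"
    and \<sigma>: "path \<sigma>" "path_image \<sigma> \<subseteq> Mt" "pathstart \<sigma> = u0" "p \<circ> \<sigma> \<in> A"
    and \<tau>: "path \<tau>" "path_image \<tau> \<subseteq> Mt" "pathstart \<tau> = u0" "p \<circ> \<tau> \<in> A"
  shows "pathfinish \<sigma> = pathfinish \<tau>"
proof -
  have "p \<circ> \<tau> \<in> cls (p \<circ> \<sigma>)" using mem_carrier[OF A \<sigma>(4)] \<tau> by simp
  then have "homotopic_paths M (p \<circ> \<sigma>) (p \<circ> \<tau>)" by (simp add: loop_homotopy_def)
  then show ?thesis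
    by (rule covering_monodromy[OF cover]) (use \<sigma> \<tau> in auto)
qed

lemma deck_of_eqI:
  assumes A: "A \<in> carrier \<Gamma>" and \<tau>: "\<tau> \<in> D"
    and \<sigma>: "path \<sigma>" "path_image \<sigma> \<subseteq> Mt" "pathstart \<sigma> = u0" "pathfinish \<sigma> = \<tau> u0" "p \<circ> \<sigma> \<in> A"
  shows "T A = \<tau>"
  unfolding deck_of_def
proof (rule the_equality)
  show "\<tau> \<in> D \<and> (\<exists>\<sigma>. path \<sigma> \<and> path_image \<sigma> \<subseteq> Mt \<and> pathstart \<sigma> = u0 \<and> pathfinish \<sigma> = \<tau> u0 \<and> p \<circ> \<sigma> \<in> A)"
    using \<tau> \<sigma> by blast
  fix \<rho> assume "\<rho> \<in> D \<and> (\<exists>\<sigma>. path \<sigma> \<and> path_image \<sigma> \<subseteq> Mt \<and> pathstart \<sigma> = u0 \<and> pathfinish \<sigma> = \<rho> u0 \<and> p \<circ> \<sigma> \<in> A)"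
  then obtain \<sigma>' where r: "\<rho> \<in> D" "path \<sigma>'" "path_image \<sigma>' \<subseteq> Mt" "pathstart \<sigma>' = u0"
    "pathfinish \<sigma>' = \<rho> u0" "p \<circ> \<sigma>' \<in> A" by blast
  have "pathfinish \<sigma>' = pathfinish \<sigma>"
    by (rule deck_of_witness_unique[OF A r(2,3,4,6) \<sigma>(1,2,3,5)])
  then have "\<rho> u0 = \<tau> u0" using r \<sigma> by simp
  then show "\<rho> = \<tau>" using deck_eqI[OF r(1) \<tau> u0] by blast
qed

lemma deck_of_witness:
  assumes A: "A \<in> carrier \<Gamma>"
  obtains \<sigma> where "T A \<in> D" "path \<sigma>" "path_image \<sigma> \<subseteq> Mt" "pathstart \<sigma> = u0" "pathfinish \<sigma> = T A u0" "p \<circ> \<sigma> \<in> A"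
proof -
  obtain \<alpha> where \<alpha>: "\<alpha> \<in> loops_at M (p u0)" "A = cls \<alpha>" using A unfolding carrier_iff by blast
  have \<alpha>': "path \<alpha>" "path_image \<alpha> \<subseteq> M" "pathstart \<alpha> = p u0" "pathfinish \<alpha> = p u0"
    using \<alpha> by (auto simp: loops_at_def)
  obtain \<sigma> where \<sigma>: "path \<sigma>" "path_image \<sigma> \<subseteq> Mt" "pathstart \<sigma> = u0" "\<And>t. t \<in> {0..1} \<Longrightarrow> p (\<sigma> t) = \<alpha> t"
    by (rule covering_path_lift[OF cover \<alpha>'(1,2) u0 \<alpha>'(3)[symmetric]]) (rule that)
  have "homotopic_paths M \<alpha> (p \<circ> \<sigma>)"
    by (rule homotopic_paths_eq) (use \<alpha>' \<sigma> in auto)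
  then have pA: "p \<circ> \<sigma> \<in> A" using homotopic_in_cls(2)[OF \<alpha>(1)] \<alpha>(2) by simp
  have f: "pathfinish \<sigma> \<in> Mt" using \<sigma> by (meson pathfinish_in_path_image subsetD)
  have "p u0 = p (pathfinish \<sigma>)" using \<sigma>(4)[of 1] \<alpha>' by (simp add: pathfinish_def)
  then obtain \<tau> where \<tau>: "\<tau> \<in> D" "\<tau> u0 = pathfinish \<sigma>" using deck_transitive[OF u0 f] by blast
  have "T A = \<tau>" by (rule deck_of_eqI[OF A \<tau>(1) \<sigma>(1,2,3) \<tau>(2)[symmetric] pA])
  then show thesis using that[of \<sigma>] \<tau> \<sigma> pA by simp
qed

lemma deck_of_deck: "A \<in> carrier \<Gamma> \<Longrightarrow> T A \<in> D"
  using deck_of_witness by blast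

lemma deck_of_one: "T \<one>\<^bsub>\<Gamma>\<^esub> = (\<lambda>u\<in>Mt. u)"
proof (rule deck_of_eqI[OF _ deck_id])
  show "\<one>\<^bsub>\<Gamma>\<^esub> \<in> carrier \<Gamma>" using group_\<Gamma> group.is_monoid monoid.one_closed by blast
  have "p \<circ> (\<lambda>_::real. u0) = (\<lambda>_. p u0)" by auto
  then show "p \<circ> (\<lambda>_. u0) \<in> \<one>\<^bsub>\<Gamma>\<^esub>"
    unfolding one_\<Gamma> using equiv_class_self[OF equiv_LL const_loop] by simp
qed (use u0 in auto)

text \<open>If \<open>\<alpha>\<close> and \<open>\<beta>\<close> lift to paths from \<open>u0\<close> to \<open>T A u0\<close> and \<open>T B u0\<close>, the lift of their product follows the
  first lift and then the image of the second one under \<open>T A\<close>.\<close>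

lemma deck_of_mult:
  assumes A: "A \<in> carrier \<Gamma>" and B: "B \<in> carrier \<Gamma>" and u: "u \<in> Mt"
  shows "T (A \<otimes>\<^bsub>\<Gamma>\<^esub> B) u = T A (T B u)"
proof -
  obtain \<sigma> where \<sigma>: "T A \<in> D" "path \<sigma>" "path_image \<sigma> \<subseteq> Mt" "pathstart \<sigma> = u0" "pathfinish \<sigma> = T A u0" "p \<circ> \<sigma> \<in> A"
    using deck_of_witness[OF A] .
  obtain \<tau> where \<tau>: "T B \<in> D" "path \<tau>" "path_image \<tau> \<subseteq> Mt" "pathstart \<tau> = u0" "pathfinish \<tau> = T B u0" "p \<circ> \<tau> \<in> B"
    using deck_of_witness[OF B] .
  have p\<tau>: "path (T A \<circ> \<tau>)" using path_continuous_image[OF \<tau>(2)] deckD(1)[OF \<sigma>(1)] \<tau>(3) continuous_on_subset by blast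
  have i\<tau>: "path_image (T A \<circ> \<tau>) \<subseteq> Mt" using \<tau>(3) deckD(2)[OF \<sigma>(1)] by (auto simp: path_image_compose)
  have lA: "p \<circ> \<sigma> \<in> loops_at M (p u0)" "A = cls (p \<circ> \<sigma>)" and lB: "p \<circ> \<tau> \<in> loops_at M (p u0)" "B = cls (p \<circ> \<tau>)"
    using mem_carrier A B \<sigma> \<tau> by blast+
  have "homotopic_paths M (p \<circ> \<tau>) (p \<circ> (T A \<circ> \<tau>))"
  proof (rule homotopic_paths_eq)
    fix t :: real assume "t \<in> {0..1}"
    then have "\<tau> t \<in> Mt" using \<tau>(3) by (auto simp: path_image_def)
    then show "(p \<circ> \<tau>) t = (p \<circ> (T A \<circ> \<tau>)) t" using deckD(4)[OF \<sigma>(1)] by simp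
  qed (use lB in \<open>auto simp: loops_at_def\<close>)
  then have "homotopic_paths M ((p \<circ> \<sigma>) +++ (p \<circ> \<tau>)) ((p \<circ> \<sigma>) +++ (p \<circ> (T A \<circ> \<tau>)))"
    using lA lB by (intro homotopic_paths_join) (auto simp: loops_at_def)
  then have h: "homotopic_paths M ((p \<circ> \<sigma>) +++ (p \<circ> \<tau>)) (p \<circ> (\<sigma> +++ (T A \<circ> \<tau>)))"
    by (simp only: path_compose_join)
  have AB: "A \<otimes>\<^bsub>\<Gamma>\<^esub> B = cls ((p \<circ> \<sigma>) +++ (p \<circ> \<tau>))" using lA lB mult_cls by metis
  then have ABc: "A \<otimes>\<^bsub>\<Gamma>\<^esub> B \<in> carrier \<Gamma>" using cls_in loop_join lA(1) lB(1) by metis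
  have "T (A \<otimes>\<^bsub>\<Gamma>\<^esub> B) = compose Mt (T A) (T B)"
  proof (rule deck_of_eqI[OF ABc deck_compose[OF \<sigma>(1) \<tau>(1)], of "\<sigma> +++ (T A \<circ> \<tau>)"])
    show "p \<circ> (\<sigma> +++ (T A \<circ> \<tau>)) \<in> A \<otimes>\<^bsub>\<Gamma>\<^esub> B"
      unfolding AB by (rule homotopic_in_cls(2)[OF loop_join[OF lA(1) lB(1)] h])
  qed (use \<sigma> \<tau> p\<tau> i\<tau> u0 in \<open>auto simp: subset_path_image_join pathstart_compose pathfinish_compose compose_def\<close>)
  then show ?thesis using u by (simp add: compose_def)
qed

lemma deck_of_free:
  assumes A: "A \<in> carrier \<Gamma>" and u: "u \<in> Mt" "T A u = u"
  shows "A = \<one>\<^bsub>\<Gamma>\<^esub>"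
proof -
  obtain \<sigma> where \<sigma>: "T A \<in> D" "path \<sigma>" "path_image \<sigma> \<subseteq> Mt" "pathstart \<sigma> = u0" "pathfinish \<sigma> = T A u0" "p \<circ> \<sigma> \<in> A"
    using deck_of_witness[OF A] .
  have "T A = (\<lambda>u\<in>Mt. u)" using deck_eqI[OF \<sigma>(1) deck_id u(1)] u by simp
  then have "pathfinish \<sigma> = u0" using \<sigma> u0 by simp
  then have "homotopic_paths Mt \<sigma> (\<lambda>_. u0)"
    by (intro simply_connected_homotopic_paths[OF sc]) (use \<sigma> u0 in auto)
  then have "homotopic_paths M (p \<circ> \<sigma>) (p \<circ> (\<lambda>_. u0))"
    using cont_p p_image by (intro homotopic_paths_continuous_image) auto
  moreover have "p \<circ> (\<lambda>_::real. u0) = (\<lambda>_. p u0)" by auto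
  ultimately have "cls (p \<circ> \<sigma>) = cls (\<lambda>_. p u0)"
    using cls_eq mem_carrier(1)[OF A \<sigma>(6)] by metis
  then show ?thesis using mem_carrier(2)[OF A \<sigma>(6)] one_\<Gamma> by simp
qed

lemma deck_of_surj:
  assumes \<tau>: "\<tau> \<in> D"
  obtains A where "A \<in> carrier \<Gamma>" "T A = \<tau>"
proof -
  have "\<tau> u0 \<in> Mt" using deckD(3)[OF \<tau>] u0 .
  then obtain \<sigma> where \<sigma>: "path \<sigma>" "path_image \<sigma> \<subseteq> Mt" "pathstart \<sigma> = u0" "pathfinish \<sigma> = \<tau> u0"
    using path_connectedE[OF path_connected_Mt u0] by blast
  have "path (p \<circ> \<sigma>)" using \<sigma> cont_p continuous_on_subset path_continuous_image by blast
  then have l: "p \<circ> \<sigma> \<in> loops_at M (p u0)"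
    using \<sigma> p_image deckD(4)[OF \<tau> u0] by (auto simp: loops_at_def path_image_compose pathstart_compose pathfinish_compose)
  have "T (cls (p \<circ> \<sigma>)) = \<tau>"
    by (rule deck_of_eqI[OF cls_in[OF l] \<tau> \<sigma>]) (use equiv_class_self[OF equiv_LL l] in simp)
  then show thesis using that cls_in[OF l] by blast
qed

end

section \<open>Coordinate balls of coverings of manifolds\<close>

lemma Euclidean_space_eq: "Euclidean_space n = top_of_set (topspace (Euclidean_space n))"
  by (simp add: Euclidean_space_def euclidean_product_topology)

lemma euclidean_ball_subset: "euclidean_ball n c r \<subseteq> topspace (Euclidean_space n)"
  by (auto simp: euclidean_ball_def)

lemma subtopology_Euclidean_space:
  "B \<subseteq> topspace (Euclidean_space n) \<Longrightarrow> subtopology (Euclidean_space n) B = top_of_set B"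
  by (metis Euclidean_space_eq inf.absorb2 subtopology_subtopology)

lemma continuous_on_coordinate: "continuous_on S (\<lambda>x :: nat \<Rightarrow> real. x i)"
  by (rule continuous_on_product_then_coordinatewise[OF continuous_on_id])

lemma openin_euclidean_ball: "openin (Euclidean_space n) (euclidean_ball n c r)"
proof -
  have "continuous_on (topspace (Euclidean_space n)) (\<lambda>x. \<Sum>i<n. (x i - c i)\<^sup>2)"
    by (intro continuous_intros continuous_on_coordinate)
  then have "openin (top_of_set (topspace (Euclidean_space n)))
      (topspace (Euclidean_space n) \<inter> (\<lambda>x. \<Sum>i<n. (x i - c i)\<^sup>2) -` {..<r\<^sup>2})"
    by (rule continuous_openin_preimage_gen) auto
  moreover have "topspace (Euclidean_space n) \<inter> (\<lambda>x. \<Sum>i<n. (x i - c i)\<^sup>2) -` {..<r\<^sup>2} = euclidean_ball n c r"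
    by (auto simp: euclidean_ball_def)
  ultimately show ?thesis by (metis Euclidean_space_eq)
qed

lemma euclidean_ball_in_open:
  assumes V: "openin (Euclidean_space n) V" and x: "x \<in> V"
  obtains r where "r > 0" "euclidean_ball n x r \<subseteq> V"
proof -
  let ?E = "{f :: nat \<Rightarrow> real. \<forall>i\<ge>n. f i = 0}"
  obtain O' where O': "openin (powertop_real UNIV) O'" "V = O' \<inter> ?E"
    using V unfolding Euclidean_space_def openin_subtopology by blast
  have xE: "\<forall>i\<ge>n. x i = 0" "x \<in> O'" using x O' by auto
  obtain X where X: "x \<in> Pi\<^sub>E UNIV X" "\<And>i. open (X i)" "Pi\<^sub>E UNIV X \<subseteq> O'"
    using product_topology_open_contains_basis[OF O'(1) xE(2)] by auto
  have "\<exists>e>0. \<forall>z. \<bar>z - x i\<bar> < e \<longrightarrow> z \<in> X i" for i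
    using X(1) X(2)[of i] unfolding open_dist dist_real_def by (auto simp: PiE_iff)
  then obtain e where e: "\<And>i. e i > 0" "\<And>i z. \<bar>z - x i\<bar> < e i \<Longrightarrow> z \<in> X i" by metis
  define r where "r = Min (insert 1 (e ` {..<n}))"
  have r: "r > 0" "\<And>i. i < n \<Longrightarrow> r \<le> e i" unfolding r_def using e(1) by auto
  have "y \<in> V" if y: "y \<in> euclidean_ball n x r" for y
  proof -
    have yE: "\<forall>i\<ge>n. y i = 0" and s: "(\<Sum>i<n. (y i - x i)\<^sup>2) < r\<^sup>2"
      using y by (auto simp: euclidean_ball_def topspace_Euclidean_space)
    have "y i \<in> X i" for i
    proof (cases "i < n")
      case True
      have "(y i - x i)\<^sup>2 \<le> (\<Sum>i<n. (y i - x i)\<^sup>2)"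
        by (rule member_le_sum) (use True in auto)
      then have "\<bar>y i - x i\<bar>\<^sup>2 < r\<^sup>2" using s by simp
      then have "\<bar>y i - x i\<bar> < r" using r(1) power2_less_imp_less by fastforce
      then show ?thesis using e(2) r(2)[OF True] by fastforce
    next
      case False
      then have "y i = x i" using yE xE(1) by auto
      then show ?thesis using X(1) by (auto simp: PiE_iff)
    qed
    then show ?thesis using X(3) O'(2) yE by (auto simp: PiE_iff)
  qed
  then show thesis using that r(1) by blast
qed

definition segment_to :: "(nat \<Rightarrow> real) \<Rightarrow> real \<Rightarrow> (nat \<Rightarrow> real) \<Rightarrow> nat \<Rightarrow> real" where
  "segment_to c t x i = (1 - t) * x i + t * c i"

lemma continuous_segment_to: "continuous_on S (\<lambda>(t, x). segment_to c t x)"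
  unfolding segment_to_def case_prod_unfold
  by (rule continuous_on_coordinatewise_then_product)
    (intro continuous_intros continuous_on_compose2[OF continuous_on_coordinate], auto)

lemma segment_to_simps [simp]: "segment_to c 0 x = x" "segment_to c 1 x = c"
  by (auto simp: segment_to_def)

lemma segment_to_in_ball:
  assumes "c \<in> topspace (Euclidean_space n)" "x \<in> euclidean_ball n c r" "t \<in> {0..1}"
  shows "segment_to c t x \<in> euclidean_ball n c r"
proof -
  have "(segment_to c t x i - c i)\<^sup>2 = (1 - t)\<^sup>2 * (x i - c i)\<^sup>2" for i
    by (simp add: segment_to_def power2_eq_square algebra_simps)
  then have "(\<Sum>i<n. (segment_to c t x i - c i)\<^sup>2) = (1 - t)\<^sup>2 * (\<Sum>i<n. (x i - c i)\<^sup>2)"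
    by (simp add: sum_distrib_left)
  also have "\<dots> \<le> 1 * (\<Sum>i<n. (x i - c i)\<^sup>2)"
    by (intro mult_right_mono) (use assms in \<open>auto simp: power_le_one_iff abs_le_iff sum_nonneg power2_le_iff_abs_le\<close>)
  finally show ?thesis
    using assms by (auto simp: euclidean_ball_def topspace_Euclidean_space segment_to_def)
qed

lemma center_in_euclidean_ball:
  "c \<in> topspace (Euclidean_space n) \<Longrightarrow> r > 0 \<Longrightarrow> c \<in> euclidean_ball n c r"
  by (auto simp: euclidean_ball_def)

definition coordinate_ball ::
    "nat \<Rightarrow> 'u::topological_space set \<Rightarrow> ('u \<Rightarrow> 'm) \<Rightarrow> 'u set \<Rightarrow> ('u \<Rightarrow> nat \<Rightarrow> real) \<Rightarrow> ((nat \<Rightarrow> real) \<Rightarrow> 'u) \<Rightarrow>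
     (nat \<Rightarrow> real) \<Rightarrow> real \<Rightarrow> bool" where
  "coordinate_ball n C p W \<psi> \<phi> c r \<longleftrightarrow>
     openin (top_of_set C) W \<and> inj_on p W \<and> c \<in> topspace (Euclidean_space n) \<and> r > 0 \<and>
     homeomorphism W (euclidean_ball n c r) \<psi> \<phi>"

definition radial :: "('u \<Rightarrow> nat \<Rightarrow> real) \<Rightarrow> ((nat \<Rightarrow> real) \<Rightarrow> 'u) \<Rightarrow> (nat \<Rightarrow> real) \<Rightarrow> 'u \<Rightarrow> real \<Rightarrow> 'u" where
  "radial \<psi> \<phi> c w t = \<phi> (segment_to c t (\<psi> w))"

lemma radial:
  assumes "coordinate_ball n C p W \<psi> \<phi> c r"
  shows "continuous_on (W \<times> {0..1}) (\<lambda>(w, t). radial \<psi> \<phi> c w t)"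
    "\<And>w t. w \<in> W \<Longrightarrow> t \<in> {0..1} \<Longrightarrow> radial \<psi> \<phi> c w t \<in> W"
    "\<And>w. w \<in> W \<Longrightarrow> radial \<psi> \<phi> c w 0 = w" "\<And>w. radial \<psi> \<phi> c w 1 = \<phi> c" "\<phi> c \<in> W"
proof -
  let ?B = "euclidean_ball n c r"
  have c: "c \<in> topspace (Euclidean_space n)" "r > 0" and hom: "homeomorphism W ?B \<psi> \<phi>"
    using assms by (auto simp: coordinate_ball_def)
  have hom': "continuous_on W \<psi>" "\<psi> ` W = ?B" "continuous_on ?B \<phi>" "\<phi> ` ?B = W" "\<And>w. w \<in> W \<Longrightarrow> \<phi> (\<psi> w) = w"
    using hom by (auto simp: homeomorphism_def)
  have in_B: "segment_to c t (\<psi> w) \<in> ?B" if "w \<in> W" "t \<in> {0..1}" for w t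
    using segment_to_in_ball[OF c(1) _ that(2)] that(1) hom'(2) by blast
  show "\<And>w t. w \<in> W \<Longrightarrow> t \<in> {0..1} \<Longrightarrow> radial \<psi> \<phi> c w t \<in> W"
    unfolding radial_def using in_B hom'(4) by blast
  have "continuous_on (W \<times> {0..1::real}) (\<lambda>z. (snd z, \<psi> (fst z)))"
    by (intro continuous_intros continuous_on_compose2[OF hom'(1)]) auto
  then have "continuous_on (W \<times> {0..1::real}) ((\<lambda>(t, x). segment_to c t x) \<circ> (\<lambda>z. (snd z, \<psi> (fst z))))"
    by (rule continuous_on_compose[OF _ continuous_segment_to])
  then have "continuous_on (W \<times> {0..1}) (\<lambda>z. segment_to c (snd z) (\<psi> (fst z)))"
    by (simp add: comp_def)
  then have "continuous_on (W \<times> {0..1}) (\<lambda>z. \<phi> (segment_to c (snd z) (\<psi> (fst z))))"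
    by (rule continuous_on_compose2[OF hom'(3)]) (use in_B in auto)
  then show "continuous_on (W \<times> {0..1}) (\<lambda>(w, t). radial \<psi> \<phi> c w t)"
    by (simp add: radial_def case_prod_unfold)
  show "\<phi> c \<in> W" using center_in_euclidean_ball[OF c] hom'(4) by blast
qed (use assms in \<open>auto simp: radial_def coordinate_ball_def homeomorphism_def\<close>)

lemma coordinate_ball_path_connected:
  assumes "coordinate_ball n C p W \<psi> \<phi> c r"
  shows "path_connected W"
proof -
  note r = radial[OF assms]
  have p: "path (radial \<psi> \<phi> c w)" "path_image (radial \<psi> \<phi> c w) \<subseteq> W"
      "pathstart (radial \<psi> \<phi> c w) = w" "pathfinish (radial \<psi> \<phi> c w) = \<phi> c" if "w \<in> W" for w
  proof -
    have "continuous_on {0..1} ((\<lambda>(w, t). radial \<psi> \<phi> c w t) \<circ> Pair w)"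
      by (intro continuous_on_compose continuous_intros continuous_on_subset[OF r(1)]) (use that in auto)
    then show "path (radial \<psi> \<phi> c w)" by (simp add: path_def comp_def)
  qed (use that r in \<open>auto simp: path_image_def pathstart_def pathfinish_def\<close>)
  show ?thesis unfolding path_connected_def
  proof (intro ballI)
    fix v w assume vw: "v \<in> W" "w \<in> W"
    show "\<exists>g. path g \<and> path_image g \<subseteq> W \<and> pathstart g = v \<and> pathfinish g = w"
      by (rule exI[of _ "radial \<psi> \<phi> c v +++ reversepath (radial \<psi> \<phi> c w)"])
        (use p[OF vw(1)] p[OF vw(2)] in \<open>auto simp: subset_path_image_join\<close>)
  qed
qed

text \<open>The composite of the covering map with a chart of the manifold is a chart of the covering space.\<close>

lemma coordinate_ball_exists:
  assumes man: "compact_manifold n (top_of_set M)" and cov: "covering_space C p M"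
    and O': "openin (top_of_set C) O'" and u: "u \<in> O'"
  obtains W \<psi> \<phi> c r where "coordinate_ball n C p W \<psi> \<phi> c r" "u \<in> W" "W \<subseteq> O'"
proof -
  have uC: "u \<in> C" using O' u openin_imp_subset by blast
  then have "p u \<in> M" using covering_space_imp_surjective[OF cov] by blast
  then obtain U V where UV: "openin (top_of_set M) U" "p u \<in> U" "openin (Euclidean_space n) V"
      "subtopology (top_of_set M) U homeomorphic_space subtopology (Euclidean_space n) V"
    using man unfolding compact_manifold_def by auto
  have VE: "V \<subseteq> topspace (Euclidean_space n)" using UV(3) openin_subset by blast
  have UM: "U \<subseteq> M" using UV(1) openin_imp_subset by blast
  have "top_of_set U homeomorphic_space top_of_set V"
    using UV(4) subtopology_Euclidean_space[OF VE] UM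
    by (metis inf.absorb2 subtopology_subtopology)
  then obtain f g where fg: "homeomorphism U V f g"
    unfolding homeomorphic_space_def homeomorphic_maps_def homeomorphism_def
    by (auto simp: Pi_iff image_subset_iff) (metis (no_types, lifting) image_eqI subsetI subset_antisym image_subset_iff)
  obtain T X q where T: "u \<in> T" "openin (top_of_set C) T" "p u \<in> X" "openin (top_of_set M) X" "homeomorphism T X p q"
    using covering_space_local_homeomorphism[OF cov uC] .
  have cp: "continuous_on C p" using cov covering_space_imp_continuous by blast
  have pM: "p ` C \<subseteq> M" using covering_space_imp_surjective[OF cov] by blast
  define N where "N = T \<inter> O' \<inter> (C \<inter> p -` U)"
  have oN: "openin (top_of_set C) N" unfolding N_def
    by (intro openin_Int T O' openin_preimage_on[OF cp pM UV(1)])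
  have uN: "u \<in> N" using T u uC UV by (simp add: N_def)
  have NC: "N \<subseteq> C" "N \<subseteq> T" "N \<subseteq> O'" "p ` N \<subseteq> U" by (auto simp: N_def)
  have TC: "T \<subseteq> C" using T openin_imp_subset by blast
  have "openin (top_of_set T) N"
    by (rule openin_subset_trans[OF oN NC(2) TC])
  then have "openin (top_of_set X) (p ` N)" using homeomorphism_imp_open_map[OF T(5)] by blast
  then have "openin (top_of_set M) (p ` N)" using T(4) openin_trans by blast
  then have "openin (top_of_set U) (p ` N)" using openin_subset_trans NC(4) UM by blast
  then have "openin (top_of_set V) (f ` p ` N)" using homeomorphism_imp_open_map[OF fg] by blast
  then have oB: "openin (Euclidean_space n) (f ` p ` N)"
    using UV(3) Euclidean_space_eq openin_trans by metis
  obtain r where r: "r > 0" "euclidean_ball n (f (p u)) r \<subseteq> f ` p ` N"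
    using euclidean_ball_in_open[OF oB, of "f (p u)"] uN by blast
  let ?c = "f (p u)" and ?B = "euclidean_ball n (f (p u)) r"
  have cE: "?c \<in> topspace (Euclidean_space n)" using oB uN openin_subset by blast
  have cB: "?c \<in> ?B" by (rule center_in_euclidean_ball[OF cE r(1)])
  define W where "W = N \<inter> (f \<circ> p) -` ?B"
  have cfp: "continuous_on N (f \<circ> p)"
    using cp NC fg by (intro continuous_on_compose) (auto intro: continuous_on_subset simp: homeomorphism_def)
  have fpE: "(f \<circ> p) ` N \<subseteq> topspace (Euclidean_space n)" using oB openin_subset by (metis image_comp)
  have "openin (top_of_set N) W" unfolding W_def
    by (rule openin_preimage_on[OF cfp fpE]) (metis openin_euclidean_ball Euclidean_space_eq)
  then have oW: "openin (top_of_set C) W" using oN openin_trans by blast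
  have WN: "W \<subseteq> N" by (auto simp: W_def)
  have inj: "p x = p y \<Longrightarrow> x = y" if "x \<in> T" "y \<in> T" for x y
    using T(5) that by (metis homeomorphism_apply1)
  have qp: "q (p x) = x" if "x \<in> T" for x using T(5) that by (rule homeomorphism_apply1)
  have gf: "g (f z) = z" if "z \<in> U" for z using fg that by (rule homeomorphism_apply1)
  have im: "(f \<circ> p) ` W = ?B" using r(2) by (auto simp: W_def)
  have inv_fp: "(q \<circ> g) ((f \<circ> p) w) = w" if "w \<in> W" for w
  proof -
    have "w \<in> T" "p w \<in> U" using that WN NC by blast+
    then show ?thesis by (simp add: qp gf)
  qed
  have gB: "g ` ?B \<subseteq> p ` N"
  proof clarify
    fix b assume "b \<in> ?B"
    then obtain x where "x \<in> N" "b = f (p x)" using r(2) by blast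
    moreover from this have "p x \<in> U" using NC by blast
    ultimately show "g b \<in> p ` N" by (simp add: gf)
  qed
  have "p ` T = X" "f ` U = V" using T(5) fg by (simp_all add: homeomorphism_def)
  then have pNX: "p ` N \<subseteq> X" and fpN: "f ` p ` N \<subseteq> V" using image_mono NC(2,4) by metis+
  have fN: "?B \<subseteq> V" by (rule order_trans[OF r(2) fpN])
  have cqg: "continuous_on ?B (q \<circ> g)"
  proof (rule continuous_on_compose)
    show "continuous_on ?B g" using fg fN by (auto simp: homeomorphism_def intro: continuous_on_subset)
    show "continuous_on (g ` ?B) q"
      using T(5) gB pNX unfolding homeomorphism_def by (meson continuous_on_subset order_trans)
  qed
  have "homeomorphism W ?B (f \<circ> p) (q \<circ> g)"
  proof (rule homeomorphismI[OF continuous_on_subset[OF cfp WN] cqg])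
    show "(f \<circ> p) ` W \<subseteq> ?B" using im by simp
    show "(q \<circ> g) ` ?B \<subseteq> W" using im inv_fp by (smt (verit) image_iff image_subset_iff)
    fix y assume "y \<in> ?B"
    then obtain w where "w \<in> W" "y = (f \<circ> p) w" using im by blast
    then show "(f \<circ> p) ((q \<circ> g) y) = y" using inv_fp by metis
  qed (rule inv_fp)
  moreover have "inj_on p W" using inj WN NC(2) by (auto simp: inj_on_def)
  ultimately have "coordinate_ball n C p W (f \<circ> p) (q \<circ> g) ?c r"
    using oW cE r(1) by (simp add: coordinate_ball_def)
  moreover have "u \<in> W" using uN cB by (simp add: W_def)
  ultimately show thesis using that WN NC(3) by blast
qed

lemma group_homeo_group: "group (homeo_group F)"
proof -
  let ?S = "{f \<in> Bij (topspace F). homeomorphic_map F F f}"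
  have "subgroup ?S (BijGroup (topspace F))"
  proof (rule group.subgroupI[OF group_BijGroup])
    show "?S \<subseteq> carrier (BijGroup (topspace F))" by (auto simp: BijGroup_def)
    have "homeomorphic_map F F (\<lambda>x\<in>topspace F. x)"
      by (rule homeomorphic_map_eq[of _ _ id]) auto
    then show "?S \<noteq> {}" using id_Bij by blast
  next
    fix a assume a: "a \<in> ?S"
    then obtain g where g: "homeomorphic_maps F F a g" by (auto simp: homeomorphic_map_maps)
    have gI: "inv_into (topspace F) a y = g y" if y: "y \<in> topspace F" for y
    proof -
      have "g y \<in> topspace F" "a (g y) = y" using g y by (auto simp: homeomorphic_maps_def continuous_map_def)
      moreover have "inj_on a (topspace F)" using a by (auto simp: Bij_def bij_betw_def)
      ultimately show ?thesis by (metis inv_into_f_f)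
    qed
    have "homeomorphic_map F F g" using g homeomorphic_maps_map by blast
    then have "homeomorphic_map F F (\<lambda>x\<in>topspace F. inv_into (topspace F) a x)"
      by (rule homeomorphic_map_eq) (simp add: gI)
    moreover have "inv\<^bsub>BijGroup (topspace F)\<^esub> a = (\<lambda>x\<in>topspace F. inv_into (topspace F) a x)"
      using a by (intro inv_BijGroup) auto
    moreover have "(\<lambda>x\<in>topspace F. inv_into (topspace F) a x) \<in> Bij (topspace F)"
      using a by (intro restrict_inv_into_Bij) auto
    ultimately show "inv\<^bsub>BijGroup (topspace F)\<^esub> a \<in> ?S" by simp
  next
    fix a b assume ab: "a \<in> ?S" "b \<in> ?S"
    then have "homeomorphic_map F F (a \<circ> b)" using homeomorphic_map_compose by blast
    then have "homeomorphic_map F F (compose (topspace F) a b)"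
      by (rule homeomorphic_map_eq) (simp add: compose_def)
    then show "a \<otimes>\<^bsub>BijGroup (topspace F)\<^esub> b \<in> ?S"
      using ab compose_Bij by (auto simp: BijGroup_def)
  qed
  then have "group (BijGroup (topspace F) \<lparr>carrier := ?S\<rparr>)"
    by (rule subgroup.subgroup_is_group[OF _ group_BijGroup])
  then show ?thesis by (simp add: homeo_group_def)
qed

lemma homeo_group_mult:
  assumes "a \<in> carrier (homeo_group F)" "b \<in> carrier (homeo_group F)" "y \<in> topspace F"
  shows "(a \<otimes>\<^bsub>homeo_group F\<^esub> b) y = a (b y)"
  using assms by (simp add: homeo_group_def BijGroup_def compose_def)

lemma homeo_group_one: "y \<in> topspace F \<Longrightarrow> \<one>\<^bsub>homeo_group F\<^esub> y = y"
  by (simp add: homeo_group_def BijGroup_def)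

locale suspension =
  fixes n :: nat and M :: "'m::topological_space set" and Mt :: "'u::topological_space set"
    and p :: "'u \<Rightarrow> 'm" and u0 :: 'u and F :: "'f topology" and h :: "(real \<Rightarrow> 'm) set \<Rightarrow> 'f \<Rightarrow> 'f"
  assumes manifold: "compact_manifold n (top_of_set M)"
    and cover: "covering_space Mt p M" and sc: "simply_connected Mt" and u0: "u0 \<in> Mt"
    and compact_F: "compact_space F" and polish_F: "Polish_space F"
    and h_hom: "h \<in> hom (fundamental_group M (p u0)) (homeo_group F)"
begin

lemma lpc: "locally_path_connected_space Mt"
  unfolding locally_path_connected_space_def
proof (intro ballI allI impI)
  fix u O' assume "u \<in> Mt" "openin (top_of_set Mt) O'" "u \<in> O'"
  then obtain W \<psi> \<phi> c r where W: "coordinate_ball n Mt p W \<psi> \<phi> c r" "u \<in> W" "W \<subseteq> O'"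
    using coordinate_ball_exists[OF manifold cover] by metis
  then show "\<exists>N. openin (top_of_set Mt) N \<and> u \<in> N \<and> N \<subseteq> O' \<and> path_connected N"
    using coordinate_ball_path_connected[OF W(1)] by (auto simp: coordinate_ball_def)
qed

sublocale universal_covering M Mt p u0
  by unfold_locales (rule cover sc u0 lpc)+

lemma group_hom_h: "group_hom \<Gamma> (homeo_group F) h"
  by (intro group_hom.intro group_hom_axioms.intro group_\<Gamma> group_homeo_group h_hom)

lemma h_carrier: "c \<in> carrier \<Gamma> \<Longrightarrow> h c \<in> carrier (homeo_group F)"
  using h_hom by (auto simp: hom_def)

lemma h_homeo: "c \<in> carrier \<Gamma> \<Longrightarrow> homeomorphic_map F F (h c)"
  using h_carrier by (auto simp: homeo_group_def)

lemma h_in: "c \<in> carrier \<Gamma> \<Longrightarrow> y \<in> topspace F \<Longrightarrow> h c y \<in> topspace F"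
  using homeomorphic_imp_surjective_map[OF h_homeo] by blast

lemma h_mult:
  assumes "c \<in> carrier \<Gamma>" "d \<in> carrier \<Gamma>" "y \<in> topspace F"
  shows "h (c \<otimes>\<^bsub>\<Gamma>\<^esub> d) y = h c (h d y)"
  using assms homeo_group_mult[OF h_carrier h_carrier] h_hom by (simp add: hom_def)

lemma h_one: "y \<in> topspace F \<Longrightarrow> h \<one>\<^bsub>\<Gamma>\<^esub> y = y"
  using group_hom.hom_one[OF group_hom_h] homeo_group_one by metis

lemma T_in: "c \<in> carrier \<Gamma> \<Longrightarrow> u \<in> Mt \<Longrightarrow> T c u \<in> Mt"
  using deckD(3)[OF deck_of_deck] by blast

lemma p_T: "c \<in> carrier \<Gamma> \<Longrightarrow> u \<in> Mt \<Longrightarrow> p (T c u) = p u"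
  using deckD(4)[OF deck_of_deck] by blast

lemma T_one: "u \<in> Mt \<Longrightarrow> T \<one>\<^bsub>\<Gamma>\<^esub> u = u"
  by (simp add: deck_of_one)

lemma inv_simps:
  assumes "c \<in> carrier \<Gamma>"
  shows "inv\<^bsub>\<Gamma>\<^esub> c \<in> carrier \<Gamma>"
    "u \<in> Mt \<Longrightarrow> T (inv\<^bsub>\<Gamma>\<^esub> c) (T c u) = u" "u \<in> Mt \<Longrightarrow> T c (T (inv\<^bsub>\<Gamma>\<^esub> c) u) = u"
    "y \<in> topspace F \<Longrightarrow> h (inv\<^bsub>\<Gamma>\<^esub> c) (h c y) = y" "y \<in> topspace F \<Longrightarrow> h c (h (inv\<^bsub>\<Gamma>\<^esub> c) y) = y"
proof -
  interpret \<Gamma>: group \<Gamma> by (rule group_\<Gamma>)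
  show i: "inv\<^bsub>\<Gamma>\<^esub> c \<in> carrier \<Gamma>" using assms by simp
  note li = \<Gamma>.l_inv[OF assms] and ri = \<Gamma>.r_inv[OF assms]
  show "T (inv\<^bsub>\<Gamma>\<^esub> c) (T c u) = u" if "u \<in> Mt"
    using deck_of_mult[OF i assms that] T_one[OF that] unfolding li by simp
  show "T c (T (inv\<^bsub>\<Gamma>\<^esub> c) u) = u" if "u \<in> Mt"
    using deck_of_mult[OF assms i that] T_one[OF that] unfolding ri by simp
  show "h (inv\<^bsub>\<Gamma>\<^esub> c) (h c y) = y" if "y \<in> topspace F"
    using h_mult[OF i assms that] h_one[OF that] unfolding li by simp
  show "h c (h (inv\<^bsub>\<Gamma>\<^esub> c) y) = y" if "y \<in> topspace F"
    using h_mult[OF assms i that] h_one[OF that] unfolding ri by simp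
qed

lemma fiber_transitive:
  assumes "u \<in> Mt" "v \<in> Mt" "p u = p v"
  obtains c where "c \<in> carrier \<Gamma>" "T c u = v"
  by (metis assms deck_transitive deck_of_surj)

end

section \<open>The topology of the suspension\<close>

lemma Hausdorff_separate:
  assumes "Hausdorff_space Y" "x \<in> topspace Y" "y \<in> topspace Y" "x \<noteq> y"
  obtains A B where "openin Y A" "openin Y B" "x \<in> A" "y \<in> B" "disjnt A B"
proof -
  have "\<exists>A B. openin Y A \<and> openin Y B \<and> x \<in> A \<and> y \<in> B \<and> disjnt A B"
    using assms(1)[unfolded Hausdorff_space_def, rule_format, of x y] assms(2-4) by simp
  then show thesis using that by (elim exE conjE)
qed

context suspension
begin

abbreviation "q \<equiv> suspension_proj M Mt p u0 F h"
abbreviation "X \<equiv> suspension_space M Mt p u0 F h"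
abbreviation "Z \<equiv> prod_topology (top_of_set Mt) F"

lemma hausdorff_F: "Hausdorff_space F" and second_countable_F: "second_countable F"
  using polish_F completely_metrizable_imp_metrizable_space metrizable_imp_Hausdorff_space
  unfolding Polish_space_def by blast+

lemma hausdorff_M: "Hausdorff_space (top_of_set M)"
  using manifold by (simp add: compact_manifold_def)

lemma q_eq: "u \<in> Mt \<Longrightarrow> y \<in> topspace F \<Longrightarrow> q (u, y) = {(T c u, h c y) | c. c \<in> carrier \<Gamma>}"
  by (auto simp: suspension_proj_def diagonal_rel_def)

lemma q_translate:
  assumes "c \<in> carrier \<Gamma>" "u \<in> Mt" "y \<in> topspace F"
  shows "q (T c u, h c y) = q (u, y)"
proof -
  interpret \<Gamma>: group \<Gamma> by (rule group_\<Gamma>)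
  have i: "inv\<^bsub>\<Gamma>\<^esub> c \<in> carrier \<Gamma>" using assms by simp
  have 1: "(T d (T c u), h d (h c y)) = (T (d \<otimes>\<^bsub>\<Gamma>\<^esub> c) u, h (d \<otimes>\<^bsub>\<Gamma>\<^esub> c) y)" if "d \<in> carrier \<Gamma>" for d
    using that assms by (simp add: deck_of_mult h_mult)
  have "q (T c u, h c y) = {(T d (T c u), h d (h c y)) | d. d \<in> carrier \<Gamma>}"
    using assms by (intro q_eq T_in h_in)
  also have "\<dots> = {(T d u, h d y) | d. d \<in> carrier \<Gamma>}"
  proof (intro equalityI subsetI)
    fix z assume "z \<in> {(T d (T c u), h d (h c y)) | d. d \<in> carrier \<Gamma>}"
    then obtain d where "d \<in> carrier \<Gamma>" "z = (T d (T c u), h d (h c y))" by blast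
    then show "z \<in> {(T d u, h d y) | d. d \<in> carrier \<Gamma>}" using 1[of d] assms(1) by auto
  next
    fix z assume "z \<in> {(T d u, h d y) | d. d \<in> carrier \<Gamma>}"
    then obtain d where d: "d \<in> carrier \<Gamma>" "z = (T d u, h d y)" by blast
    have "d \<otimes>\<^bsub>\<Gamma>\<^esub> inv\<^bsub>\<Gamma>\<^esub> c \<otimes>\<^bsub>\<Gamma>\<^esub> c = d" using d(1) assms(1) by (simp add: \<Gamma>.m_assoc)
    then have "z = (T (d \<otimes>\<^bsub>\<Gamma>\<^esub> inv\<^bsub>\<Gamma>\<^esub> c) (T c u), h (d \<otimes>\<^bsub>\<Gamma>\<^esub> inv\<^bsub>\<Gamma>\<^esub> c) (h c y))"
      using 1[of "d \<otimes>\<^bsub>\<Gamma>\<^esub> inv\<^bsub>\<Gamma>\<^esub> c"] d i by simp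
    then show "z \<in> {(T d (T c u), h d (h c y)) | d. d \<in> carrier \<Gamma>}" using d i by blast
  qed
  also have "\<dots> = q (u, y)" using q_eq assms by simp
  finally show ?thesis .
qed

lemma q_eq_iff:
  assumes "u \<in> Mt" "y \<in> topspace F" "v \<in> Mt" "z \<in> topspace F"
  shows "q (u, y) = q (v, z) \<longleftrightarrow> (\<exists>c\<in>carrier \<Gamma>. v = T c u \<and> z = h c y)"
proof
  assume "q (u, y) = q (v, z)"
  moreover have "(v, z) \<in> q (v, z)"
    using q_eq[OF assms(3,4)] T_one[OF assms(3)] h_one[OF assms(4)] group.is_monoid[OF group_\<Gamma>]
    by (fastforce intro!: exI[of _ "\<one>\<^bsub>\<Gamma>\<^esub>"] monoid.one_closed)
  ultimately have "(v, z) \<in> q (u, y)" by simp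
  then show "\<exists>c\<in>carrier \<Gamma>. v = T c u \<and> z = h c y" using q_eq[OF assms(1,2)] by auto
next
  assume "\<exists>c\<in>carrier \<Gamma>. v = T c u \<and> z = h c y"
  then show "q (u, y) = q (v, z)" using q_translate[OF _ assms(1,2)] by auto
qed

text \<open>Over a set on which \<open>p\<close> is injective the projection identifies no two points, because the
  deck group acts freely.\<close>

lemma q_inj:
  assumes W: "W \<subseteq> Mt" "inj_on p W" and uv: "u \<in> W" "v \<in> W" and yz: "y \<in> topspace F" "z \<in> topspace F"
    and eq: "q (u, y) = q (v, z)"
  shows "u = v \<and> y = z"
proof -
  obtain c where c: "c \<in> carrier \<Gamma>" "v = T c u" "z = h c y"
    using q_eq_iff[of u y v z] W uv yz eq by blast
  have "p u = p v" using c p_T W uv by auto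
  then have "u = v" using W uv by (auto dest: inj_onD)
  then have "c = \<one>\<^bsub>\<Gamma>\<^esub>" using deck_of_free[OF c(1), of u] c(2) W uv by auto
  then show ?thesis using \<open>u = v\<close> c(3) h_one[OF yz(1)] by simp
qed

lemma X_quotient: "openin X W \<longleftrightarrow> W \<subseteq> q ` (Mt \<times> topspace F) \<and> openin Z {z \<in> Mt \<times> topspace F. q z \<in> W}"
proof -
  have "topspace Z // diagonal_rel M Mt p u0 F h = q ` (Mt \<times> topspace F)"
    by (auto simp: quotient_def suspension_proj_def)
  then show ?thesis
    by (simp add: suspension_space_def openin_quotient_topology suspension_proj_def)
qed

lemma topspace_X: "topspace X = q ` (Mt \<times> topspace F)"
proof
  show "topspace X \<subseteq> q ` (Mt \<times> topspace F)"
    using X_quotient[of "topspace X"] by blast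
  have "{z \<in> Mt \<times> topspace F. q z \<in> q ` (Mt \<times> topspace F)} = topspace Z" by auto
  then have "openin X (q ` (Mt \<times> topspace F))" unfolding X_quotient by (metis openin_topspace order_refl)
  then show "q ` (Mt \<times> topspace F) \<subseteq> topspace X" by (rule openin_subset)
qed

lemma X_cases:
  assumes "x \<in> topspace X" obtains u y where "u \<in> Mt" "y \<in> topspace F" "x = q (u, y)"
  using assms unfolding topspace_X by blast

lemma q_in_X: "u \<in> Mt \<Longrightarrow> y \<in> topspace F \<Longrightarrow> q (u, y) \<in> topspace X"
  unfolding topspace_X by blast

lemma continuous_q: "continuous_map Z X q"
proof -
  have "openin Z {x \<in> topspace Z. q x \<in> U}" if "openin X U" for U
    using that unfolding X_quotient by simp
  then show ?thesis unfolding continuous_map by (auto simp: topspace_X)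
qed

lemma open_q:
  assumes "openin (top_of_set Mt) W" "openin F O'"
  shows "openin X (q ` (W \<times> O'))"
  unfolding X_quotient
proof
  have WM: "W \<subseteq> Mt" and OF: "O' \<subseteq> topspace F"
    using assms openin_imp_subset openin_subset by blast+
  then show "q ` (W \<times> O') \<subseteq> q ` (Mt \<times> topspace F)" by blast
  have "{z \<in> Mt \<times> topspace F. q z \<in> q ` (W \<times> O')} = (\<Union>c\<in>carrier \<Gamma>. (T c ` W) \<times> (h c ` O'))"
  proof (intro equalityI subsetI)
    fix z assume "z \<in> {z \<in> Mt \<times> topspace F. q z \<in> q ` (W \<times> O')}"
    then obtain u y w t where z: "z = (u, y)" "u \<in> Mt" "y \<in> topspace F" "w \<in> W" "t \<in> O'" "q (w, t) = q (u, y)"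
      by (force simp: image_iff)
    then obtain c where "c \<in> carrier \<Gamma>" "u = T c w" "y = h c t"
      using q_eq_iff[of w t u y] WM OF by blast
    then show "z \<in> (\<Union>c\<in>carrier \<Gamma>. (T c ` W) \<times> (h c ` O'))" using z by blast
  next
    fix z assume "z \<in> (\<Union>c\<in>carrier \<Gamma>. (T c ` W) \<times> (h c ` O'))"
    then obtain c w t where c: "c \<in> carrier \<Gamma>" "w \<in> W" "t \<in> O'" "z = (T c w, h c t)" by blast
    then have wt: "w \<in> Mt" "t \<in> topspace F" using WM OF by auto
    then have "q z = q (w, t)" using q_translate[OF c(1)] c(4) by simp
    moreover have "z \<in> Mt \<times> topspace F" using T_in[OF c(1) wt(1)] h_in[OF c(1) wt(2)] c(4) by simp
    ultimately show "z \<in> {z \<in> Mt \<times> topspace F. q z \<in> q ` (W \<times> O')}" using c by blast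
  qed
  moreover have "openin Z ((T c ` W) \<times> (h c ` O'))" if "c \<in> carrier \<Gamma>" for c
  proof -
    have "openin (top_of_set Mt) (T c ` W)" using deckD(5)[OF deck_of_deck[OF that] assms(1)] .
    moreover have "openin F (h c ` O')"
      using homeomorphic_imp_open_map[OF h_homeo[OF that]] assms(2) by (simp add: open_map_def)
    ultimately show ?thesis by (simp add: openin_prod_Times_iff)
  qed
  ultimately show "openin Z {z \<in> Mt \<times> topspace F. q z \<in> q ` (W \<times> O')}" by auto
qed

lemma open_map_q: "open_map Z X q"
  unfolding open_map_def
proof (intro allI impI)
  fix U assume U: "openin Z U"
  show "openin X (q ` U)"
  proof (subst openin_subopen, clarify)
    fix u y assume uy: "(u, y) \<in> U"
    obtain W O' where "openin (top_of_set Mt) W" "openin F O'" "u \<in> W" "y \<in> O'" "W \<times> O' \<subseteq> U"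
      using U[unfolded openin_prod_topology_alt, rule_format, OF uy] by (elim exE conjE)
    then show "\<exists>T. openin X T \<and> q (u, y) \<in> T \<and> T \<subseteq> q ` U"
      by (intro exI[of _ "q ` (W \<times> O')"]) (auto intro!: open_q)
  qed
qed

lemma X_box:
  assumes "openin X U" "u \<in> Mt" "y \<in> topspace F" "q (u, y) \<in> U"
  obtains W O' where "openin (top_of_set Mt) W" "openin F O'" "u \<in> W" "y \<in> O'" "q ` (W \<times> O') \<subseteq> U"
proof -
  have o: "openin Z {z \<in> Mt \<times> topspace F. q z \<in> U}" using assms(1) X_quotient by blast
  have uy: "(u, y) \<in> {z \<in> Mt \<times> topspace F. q z \<in> U}" using assms(2-4) by simp
  obtain W O' where "openin (top_of_set Mt) W" "openin F O'" "u \<in> W" "y \<in> O'"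
      "W \<times> O' \<subseteq> {z \<in> Mt \<times> topspace F. q z \<in> U}"
    using o[unfolded openin_prod_topology_alt, rule_format, OF uy] by (elim exE conjE)
  then show thesis using that by blast
qed

lemma q_homeomorphic:
  assumes W: "openin (top_of_set Mt) W" "inj_on p W" and O': "openin F O'"
  shows "homeomorphic_map (prod_topology (top_of_set W) (subtopology F O')) (subtopology X (q ` (W \<times> O'))) q"
proof -
  have WM: "W \<subseteq> Mt" and OF: "O' \<subseteq> topspace F"
    using W O' openin_imp_subset openin_subset by blast+
  have eq: "prod_topology (top_of_set W) (subtopology F O') = subtopology Z (W \<times> O')"
    using WM by (simp add: subtopology_Times subtopology_subtopology inf.absorb2)
  have inj: "inj_on q (W \<times> O')"
  proof (rule inj_onI, clarify)
    fix u y v z assume "u \<in> W" "y \<in> O'" "v \<in> W" "z \<in> O'" "q (u, y) = q (v, z)"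
    then show "u = v \<and> y = z" using q_inj[OF WM W(2), of u v y z] OF by blast
  qed
  have oWO: "openin Z (W \<times> O')" using W O' by (simp add: openin_prod_Times_iff)
  show ?thesis unfolding eq
  proof (rule bijective_open_imp_homeomorphic_map)
    show "continuous_map (subtopology Z (W \<times> O')) (subtopology X (q ` (W \<times> O'))) q"
      using continuous_q by (auto simp: continuous_map_in_subtopology intro: continuous_map_from_subtopology)
    show "open_map (subtopology Z (W \<times> O')) (subtopology X (q ` (W \<times> O'))) q"
      by (rule open_map_into_subtopology[OF open_map_from_subtopology[OF open_map_q oWO]]) auto
  next
    have eq': "topspace (subtopology Z (W \<times> O')) = W \<times> O'"
      using WM OF by (simp add: Times_Int_Times inf.absorb2)
    show "inj_on q (topspace (subtopology Z (W \<times> O')))" unfolding eq' by (rule inj)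
    have "q ` (W \<times> O') \<subseteq> topspace X" unfolding topspace_X using WM OF by blast
    then show "q ` topspace (subtopology Z (W \<times> O')) = topspace (subtopology X (q ` (W \<times> O')))"
      unfolding eq' by (simp add: inf.absorb2)
  qed
qed

lemma base_map:
  obtains \<pi> where "continuous_map X (top_of_set M) \<pi>" "\<And>u y. u \<in> Mt \<Longrightarrow> y \<in> topspace F \<Longrightarrow> \<pi> (q (u, y)) = p u"
proof -
  define \<pi> where "\<pi> x = p (fst (SOME z. z \<in> x))" for x :: "('u \<times> 'f) set"
  have \<pi>: "\<pi> (q (u, y)) = p u" if "u \<in> Mt" "y \<in> topspace F" for u y
  proof -
    have "q (u, y) \<noteq> {}" using q_eq[OF that] group.is_monoid[OF group_\<Gamma>] monoid.one_closed by blast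
    then have "(SOME z. z \<in> q (u, y)) \<in> q (u, y)" using some_in_eq by blast
    then show ?thesis using q_eq[OF that] p_T that by (auto simp: \<pi>_def)
  qed
  have "openin X {x \<in> topspace X. \<pi> x \<in> V}" if V: "openin (top_of_set M) V" for V
  proof -
    have "openin (top_of_set Mt) (Mt \<inter> p -` V)"
      using cont_p p_image V by (intro openin_preimage_on) auto
    then have "openin X (q ` ((Mt \<inter> p -` V) \<times> topspace F))" by (rule open_q) simp
    moreover have "q ` ((Mt \<inter> p -` V) \<times> topspace F) = {x \<in> topspace X. \<pi> x \<in> V}"
      unfolding topspace_X using \<pi> by auto
    ultimately show ?thesis by simp
  qed
  moreover have "\<pi> x \<in> M" if "x \<in> topspace X" for x
    using X_cases[OF that] \<pi> p_image by (metis imageI)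
  ultimately have "continuous_map X (top_of_set M) \<pi>" unfolding continuous_map by auto
  then show thesis using that \<pi> by blast
qed

lemma ball_at:
  assumes "openin (top_of_set Mt) O'" "u \<in> O'"
  obtains W \<psi> \<phi> c r where "coordinate_ball n Mt p W \<psi> \<phi> c r" "u \<in> W" "W \<subseteq> O'"
  by (rule coordinate_ball_exists[OF manifold cover assms]) (rule that)

text \<open>Points over different points of \<open>M\<close> are separated over \<open>M\<close>. Points over the same point are represented over
  the same point of the universal cover and separated by their fibre coordinates in a small box.\<close>

lemma hausdorff_X: "Hausdorff_space X"
  unfolding Hausdorff_space_def
proof (intro allI impI, elim conjE)
  fix x x' assume x: "x \<in> topspace X" "x' \<in> topspace X" "x \<noteq> x'"
  obtain u y where u: "u \<in> Mt" "y \<in> topspace F" "x = q (u, y)" using X_cases[OF x(1)] .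
  obtain v z where v: "v \<in> Mt" "z \<in> topspace F" "x' = q (v, z)" using X_cases[OF x(2)] .
  show "\<exists>U V. openin X U \<and> openin X V \<and> x \<in> U \<and> x' \<in> V \<and> disjnt U V"
  proof (cases "p u = p v")
    case False
    obtain \<pi> where \<pi>: "continuous_map X (top_of_set M) \<pi>" "\<And>u y. u \<in> Mt \<Longrightarrow> y \<in> topspace F \<Longrightarrow> \<pi> (q (u, y)) = p u"
      by (rule base_map) (rule that)
    have pM: "p u \<in> M" "p v \<in> M" using u v p_image by auto
    obtain A B where AB: "openin (top_of_set M) A" "openin (top_of_set M) B" "p u \<in> A" "p v \<in> B" "disjnt A B"
      using pM False by (auto intro: Hausdorff_separate[OF hausdorff_M])
    let ?U = "{x \<in> topspace X. \<pi> x \<in> A}" and ?V = "{x \<in> topspace X. \<pi> x \<in> B}"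
    have "openin X ?U" "openin X ?V"
      using AB \<pi>(1) by (auto intro: openin_continuous_map_preimage)
    moreover have "x \<in> ?U" "x' \<in> ?V" using u v \<pi>(2) AB x by auto
    moreover have "disjnt ?U ?V" using AB(5) by (auto simp: disjnt_def)
    ultimately show ?thesis by blast
  next
    case True
    obtain c where c: "c \<in> carrier \<Gamma>" "T c v = u" using fiber_transitive[OF v(1) u(1)] True by metis
    define z' where "z' = h c z"
    have z': "z' \<in> topspace F" "x' = q (u, z')" using c v h_in q_translate by (auto simp: z'_def)
    then have "y \<noteq> z'" using u x by auto
    then obtain A B where AB: "openin F A" "openin F B" "y \<in> A" "z' \<in> B" "disjnt A B"
      by (rule Hausdorff_separate[OF hausdorff_F u(2) z'(1)])
    have oMt: "openin (top_of_set Mt) Mt" by simp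
    obtain W \<psi> \<phi> c r where W: "coordinate_ball n Mt p W \<psi> \<phi> c r" "u \<in> W" "W \<subseteq> Mt"
      by (rule ball_at[OF oMt u(1)])
    have W': "openin (top_of_set Mt) W" "inj_on p W" "W \<subseteq> Mt"
      using W openin_imp_subset by (auto simp: coordinate_ball_def)
    have "disjnt (q ` (W \<times> A)) (q ` (W \<times> B))"
    proof (rule ccontr)
      assume "\<not> disjnt (q ` (W \<times> A)) (q ` (W \<times> B))"
      then obtain w a w' b where 1: "w \<in> W" "a \<in> A" "w' \<in> W" "b \<in> B" "q (w, a) = q (w', b)"
        by (auto simp: disjnt_def)
      then have "a = b" using q_inj[OF W'(3,2), of w w' a b] AB openin_subset by blast
      then show False using 1 AB(5) by (auto simp: disjnt_def)
    qed
    moreover have "openin X (q ` (W \<times> A))" "openin X (q ` (W \<times> B))"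
      using open_q W'(1) AB(1,2) by blast+
    moreover have "x \<in> q ` (W \<times> A)" "x' \<in> q ` (W \<times> B)"
      unfolding u(3) z'(2) using W(2) AB(3,4) by blast+
    ultimately show ?thesis by blast
  qed
qed

end

section \<open>The leaves of the suspension\<close>

lemma nat_set_injection: obtains \<iota> :: "nat set \<Rightarrow> real" where "inj \<iota>"
  using nat_sets_eqpoll_reals unfolding eqpoll_def bij_betw_def by blast

text \<open>A point is determined by the members of a countable base that contain it, and there are as many sets
  of naturals as reals.\<close>

lemma injection_to_reals:
  assumes "Hausdorff_space F" "second_countable F"
  obtains \<theta> :: "'f \<Rightarrow> real" where "inj_on \<theta> (topspace F)"
proof -
  obtain \<B> where \<B>: "countable \<B>" "\<And>V. V \<in> \<B> \<Longrightarrow> openin F V"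
      "\<And>U x. openin F U \<and> x \<in> U \<Longrightarrow> \<exists>V\<in>\<B>. x \<in> V \<and> V \<subseteq> U"
    using assms(2) unfolding second_countable_def by metis
  obtain \<iota> :: "nat set \<Rightarrow> real" where \<iota>: "inj \<iota>" by (rule nat_set_injection)
  define \<theta> where "\<theta> x = \<iota> {k. \<exists>V\<in>\<B>. to_nat_on \<B> V = k \<and> x \<in> V}" for x
  have "x = y" if xy: "x \<in> topspace F" "y \<in> topspace F" "\<theta> x = \<theta> y" for x y
  proof (rule ccontr)
    assume "x \<noteq> y"
    then obtain A B where AB: "openin F A" "openin F B" "x \<in> A" "y \<in> B" "disjnt A B"
      by (rule Hausdorff_separate[OF assms(1) xy(1,2)])
    then obtain V where V: "V \<in> \<B>" "x \<in> V" "V \<subseteq> A" using \<B>(3) by blast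
    have "{k. \<exists>V\<in>\<B>. to_nat_on \<B> V = k \<and> x \<in> V} = {k. \<exists>V\<in>\<B>. to_nat_on \<B> V = k \<and> y \<in> V}"
      using xy(3) \<iota> unfolding \<theta>_def by (simp add: inj_eq)
    then have "\<exists>V'\<in>\<B>. to_nat_on \<B> V' = to_nat_on \<B> V \<and> y \<in> V'" using V by blast
    then have "y \<in> V" using V(1) inj_on_to_nat_on[OF \<B>(1)] by (auto dest: inj_onD)
    then show False using V(3) AB by (auto simp: disjnt_def)
  qed
  then have "inj_on \<theta> (topspace F)" by (rule inj_onI)
  then show thesis using that by blast
qed

text \<open>The transversals of charts consist of reals, so the fibre has to be transported to a set of reals.\<close>

lemma real_copy:
  fixes F :: "'f topology"
  assumes "Hausdorff_space F" "second_countable F"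
  obtains R :: "real topology" and \<theta> where "homeomorphic_map F R \<theta>"
proof -
  obtain \<theta> :: "'f \<Rightarrow> real" where \<theta>: "inj_on \<theta> (topspace F)" using injection_to_reals[OF assms] by blast
  let ?g = "inv_into (topspace F) \<theta>"
  define R where "R = pullback_topology (\<theta> ` topspace F) ?g F"
  have g\<theta>: "?g (\<theta> x) = x" if "x \<in> topspace F" for x using \<theta> that by simp
  have "homeomorphic_maps F R \<theta> ?g"
    unfolding homeomorphic_maps_def
  proof (intro conjI ballI)
    show "continuous_map F R \<theta>" unfolding R_def
      by (rule continuous_map_pullback') (auto intro: continuous_map_eq[OF continuous_map_id] simp: g\<theta>)
    show "continuous_map R F ?g" unfolding R_def
      using continuous_map_pullback[OF continuous_map_id, of "\<theta> ` topspace F" ?g F] by simp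
  qed (auto simp: R_def topspace_pullback_topology g\<theta> f_inv_into_f)
  then show thesis using that homeomorphic_maps_map by blast
qed

lemma connected_component_subset_clopen:
  assumes "L \<in> connected_components_of Y" "openin Y S" "openin Y (topspace Y - S)" "x \<in> L" "x \<in> S"
  shows "L \<subseteq> S"
proof (rule ccontr)
  assume "\<not> L \<subseteq> S"
  have con: "connectedin Y L" using assms(1) by (rule connectedin_connected_components_of)
  have LY: "L \<subseteq> topspace Y" using assms(1) by (rule connected_components_of_subset)
  have "\<not> (openin Y S \<and> openin Y (topspace Y - S) \<and> L \<subseteq> S \<union> (topspace Y - S) \<and> S \<inter> (topspace Y - S) \<inter> L = {} \<and>
      S \<inter> L \<noteq> {} \<and> (topspace Y - S) \<inter> L \<noteq> {})"
    using con unfolding connectedin by blast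
  then show False using assms LY \<open>\<not> L \<subseteq> S\<close> by blast
qed

context suspension
begin

abbreviation "\<L> \<equiv> suspension_lamination n M Mt p u0 F h"
abbreviation "\<A> \<equiv> suspension_atlas n M Mt p u0 F h"

text \<open>Charts over a box \<open>W \<times> O'\<close> that need not contain whole fibres: they give foliated charts inside every
  open set, which the atlas of the suspension does not contain.\<close>

definition box_chart :: "('u \<times> 'f) set chart \<Rightarrow> 'u set \<Rightarrow> 'f set \<Rightarrow> ('u \<Rightarrow> nat \<Rightarrow> real) \<Rightarrow> ('f \<Rightarrow> real) \<Rightarrow> bool" where
  "box_chart c W O' \<psi> \<theta> \<longleftrightarrow> foliated_chart n X c \<and> openin (top_of_set Mt) W \<and> inj_on p W \<and> openin F O' \<and>
     inj_on \<psi> W \<and> inj_on \<theta> O' \<and> chart_dom c = q ` (W \<times> O') \<and>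
     (\<forall>w\<in>W. \<forall>y\<in>O'. chart_map c (q (w, y)) = (\<psi> w, \<theta> y))"

lemma box_chartD:
  assumes "box_chart c W O' \<psi> \<theta>"
  shows "foliated_chart n X c" "openin (top_of_set Mt) W" "inj_on p W" "openin F O'"
    "inj_on \<psi> W" "inj_on \<theta> O'" "chart_dom c = q ` (W \<times> O')"
    "\<And>w y. w \<in> W \<Longrightarrow> y \<in> O' \<Longrightarrow> chart_map c (q (w, y)) = (\<psi> w, \<theta> y)" "W \<subseteq> Mt" "O' \<subseteq> topspace F"
  using assms unfolding box_chart_def by (blast dest: openin_imp_subset openin_subset)+

lemma box_chart_change:
  assumes a: "box_chart a W O1 \<psi> \<theta>" and b: "box_chart b W' O2 \<psi>' \<theta>'"
  shows "foliated_change X a b"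
  unfolding foliated_change_def
proof
  note A = box_chartD[OF a] and B = box_chartD[OF b]
  fix x assume x: "x \<in> chart_dom a \<inter> chart_dom b"
  then obtain w y where wy: "w \<in> W" "y \<in> O1" "x = q (w, y)" using A(7) by blast
  obtain w' y' where wy': "w' \<in> W'" "y' \<in> O2" "x = q (w', y')" using x B(7) by blast
  obtain c where c: "c \<in> carrier \<Gamma>" "w' = T c w" "y' = h c y"
    using q_eq_iff[of w y w' y'] wy wy' A(9,10) B(9,10) by blast
  define Wn where "Wn = W \<inter> (Mt \<inter> T c -` W')"
  define On where "On = O1 \<inter> {t \<in> topspace F. h c t \<in> O2}"
  have oW: "openin (top_of_set Mt) Wn" unfolding Wn_def
    using deckD(1,2)[OF deck_of_deck[OF c(1)]] B(2) by (intro openin_Int A(2) openin_preimage_on) auto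
  have oO: "openin F On" unfolding On_def
    using homeomorphic_imp_continuous_map[OF h_homeo[OF c(1)]] B(4) A(4)
    by (intro openin_Int openin_continuous_map_preimage) auto
  define f where "f z = \<psi>' (T c (inv_into W \<psi> (fst z)))" for z :: "(nat \<Rightarrow> real) \<times> real"
  define g where "g s = \<theta>' (h c (inv_into O1 \<theta> s))" for s
  show "\<exists>N f g. openin X N \<and> x \<in> N \<and> N \<subseteq> chart_dom a \<inter> chart_dom b \<and>
      (\<forall>z\<in>N. chart_map b z = (f (chart_map a z), g (snd (chart_map a z))))"
  proof (intro exI conjI ballI)
    show "openin X (q ` (Wn \<times> On))" by (rule open_q[OF oW oO])
    have "w \<in> Wn" "y \<in> On" using wy wy' c A(9,10) by (auto simp: Wn_def On_def)
    then show "x \<in> q ` (Wn \<times> On)" using wy by blast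
    have tr: "q (v, t) = q (T c v, h c t)" if "v \<in> Wn" "t \<in> On" for v t
      using q_translate[OF c(1), of v t] that A(9) by (auto simp: Wn_def On_def)
    show "q ` (Wn \<times> On) \<subseteq> chart_dom a \<inter> chart_dom b"
    proof clarify
      fix v t assume vt: "v \<in> Wn" "t \<in> On"
      have "q (v, t) \<in> q ` (W \<times> O1)" using vt by (auto simp: Wn_def On_def)
      moreover have "q (T c v, h c t) \<in> q ` (W' \<times> O2)" using vt by (auto simp: Wn_def On_def)
      ultimately show "q (v, t) \<in> chart_dom a \<inter> chart_dom b" using tr[OF vt] A(7) B(7) by simp
    qed
    fix z assume "z \<in> q ` (Wn \<times> On)"
    then obtain v t where vt: "v \<in> Wn" "t \<in> On" "z = q (v, t)" by blast
    have in1: "v \<in> W" "t \<in> O1" "T c v \<in> W'" "h c t \<in> O2" using vt by (auto simp: Wn_def On_def)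
    have "chart_map a z = (\<psi> v, \<theta> t)" using A(8) in1 vt by simp
    moreover have "chart_map b z = (\<psi>' (T c v), \<theta>' (h c t))" using B(8) in1 vt tr by simp
    ultimately show "chart_map b z = (f (chart_map a z), g (snd (chart_map a z)))"
      using in1 A(5,6) by (simp add: f_def g_def)
  qed
qed

lemma suspension_chart_box:
  assumes "a \<in> \<A>" obtains W \<psi> \<theta> where "box_chart a W (topspace F) \<psi> \<theta>"
proof -
  obtain W \<psi> \<theta> where 1: "foliated_chart n X a" "openin (top_of_set Mt) W" "inj_on p W"
      "homeomorphic_map (top_of_set W) (subtopology (Euclidean_space n) (chart_ball a)) \<psi>"
      "homeomorphic_map F (chart_trans a) \<theta>" "chart_dom a = q ` (W \<times> topspace F)"
      "\<forall>w\<in>W. \<forall>y\<in>topspace F. chart_map a (q (w, y)) = (\<psi> w, \<theta> y)"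
    using assms[unfolded suspension_atlas_def mem_Collect_eq] by (elim exE conjE)
  have "inj_on \<psi> W" "inj_on \<theta> (topspace F)"
    using homeomorphic_imp_injective_map[OF 1(4)] homeomorphic_imp_injective_map[OF 1(5)] by simp_all
  then have "box_chart a W (topspace F) \<psi> \<theta>" using 1 unfolding box_chart_def by simp
  then show thesis by (rule that)
qed

lemma box_chart_in_lamination:
  assumes "box_chart c W O' \<psi> \<theta>" shows "c \<in> \<L>"
  unfolding suspension_lamination_def lamination_of_def
proof (intro CollectI conjI ballI)
  show "foliated_chart n X c" using box_chartD[OF assms] by blast
  fix a assume "a \<in> \<A>"
  then obtain V \<psi>' \<theta>' where "box_chart a V (topspace F) \<psi>' \<theta>'" by (rule suspension_chart_box)
  then show "foliated_change X a c" "foliated_change X c a"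
    using box_chart_change assms by blast+
qed

lemma box_chart_exists:
  assumes W: "coordinate_ball n Mt p W \<psi> \<phi> c r" and O': "openin F O'"
  obtains a \<theta> where "box_chart a W O' \<psi> \<theta>" "O' = topspace F \<Longrightarrow> a \<in> \<A>"
proof -
  have W': "openin (top_of_set Mt) W" "inj_on p W" "c \<in> topspace (Euclidean_space n)" "r > 0"
      "homeomorphism W (euclidean_ball n c r) \<psi> \<phi>"
    using W unfolding coordinate_ball_def by blast+
  have OF: "O' \<subseteq> topspace F" using O' openin_subset by blast
  obtain R :: "real topology" and \<theta> where \<theta>: "homeomorphic_map F R \<theta>"
    using real_copy[OF hausdorff_F second_countable_F] by blast
  have inj\<theta>: "inj_on \<theta> (topspace F)" and im\<theta>: "\<theta> ` topspace F = topspace R"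
    using \<theta> homeomorphic_imp_injective_map homeomorphic_imp_surjective_map by blast+
  let ?R = "subtopology R (\<theta> ` O')" and ?B = "euclidean_ball n c r"
  let ?A = "prod_topology (top_of_set W) (subtopology F O')"
  have \<theta>O: "homeomorphic_map (subtopology F O') ?R \<theta>"
    by (rule homeomorphic_map_subtopologies[OF \<theta>]) (use OF im\<theta> in auto)
  have "homeomorphic_maps (top_of_set W) (top_of_set ?B) \<psi> \<phi>"
    using W'(5) by (auto simp: homeomorphic_maps_def homeomorphism_def)
  then have \<psi>: "homeomorphic_map (top_of_set W) (subtopology (Euclidean_space n) ?B) \<psi>"
    using homeomorphic_maps_map subtopology_Euclidean_space[OF euclidean_ball_subset] by metis
  have k: "homeomorphic_map ?A (prod_topology (subtopology (Euclidean_space n) ?B) ?R) (\<lambda>(w, y). (\<psi> w, \<theta> y))"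
  proof -
    obtain \<psi>' \<theta>' where "homeomorphic_maps (top_of_set W) (subtopology (Euclidean_space n) ?B) \<psi> \<psi>'"
        "homeomorphic_maps (subtopology F O') ?R \<theta> \<theta>'"
      using \<psi> \<theta>O unfolding homeomorphic_map_maps by blast
    then show ?thesis
      unfolding homeomorphic_map_maps using homeomorphic_maps_prod by blast
  qed
  have hq: "homeomorphic_map ?A (subtopology X (q ` (W \<times> O'))) q" by (rule q_homeomorphic[OF W'(1,2) O'])
  then obtain g where g: "homeomorphic_maps ?A (subtopology X (q ` (W \<times> O'))) q g"
    by (auto simp: homeomorphic_map_maps)
  have gq: "g (q (w, y)) = (w, y)" if "w \<in> W" "y \<in> O'" for w y
    using g that OF by (auto simp: homeomorphic_maps_def)
  define m where "m = (\<lambda>(w, y). (\<psi> w, \<theta> y)) \<circ> g"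
  define a where "a = \<lparr>chart_dom = q ` (W \<times> O'), chart_map = m, chart_ball = ?B, chart_trans = ?R\<rparr>"
  have hg: "homeomorphic_map (subtopology X (q ` (W \<times> O'))) ?A g"
    using g homeomorphic_maps_map by blast
  have hm: "homeomorphic_map (subtopology X (q ` (W \<times> O'))) (prod_topology (subtopology (Euclidean_space n) ?B) ?R) m"
    unfolding m_def by (rule homeomorphic_map_compose[OF hg k])
  have "Polish_space (subtopology F O')"
    using polish_F O' completely_metrizable_space_openin second_countable_subtopology
    unfolding Polish_space_def by blast
  moreover have "subtopology F O' homeomorphic_space ?R"
    using \<theta>O homeomorphic_map_imp_homeomorphic_space by blast
  ultimately have pol: "Polish_space ?R"
    unfolding Polish_space_def
    using homeomorphic_completely_metrizable_space homeomorphic_space_second_countability by blast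
  have fc: "foliated_chart n X a"
    unfolding foliated_chart_def is_euclidean_ball_def using hm pol W' open_q[OF W'(1) O'] by (auto simp: a_def)
  have m: "chart_map a (q (w, y)) = (\<psi> w, \<theta> y)" if "w \<in> W" "y \<in> O'" for w y
    using gq[OF that] by (simp add: a_def m_def)
  have inj\<psi>: "inj_on \<psi> W" using W'(5) by (metis homeomorphism_apply1 inj_on_inverseI)
  have box: "box_chart a W O' \<psi> \<theta>"
    unfolding box_chart_def using fc W' O' m inj\<psi> inj_on_subset[OF inj\<theta> OF] by (simp add: a_def)
  have "a \<in> \<A>" if "O' = topspace F"
  proof -
    have "homeomorphic_map F (chart_trans a) \<theta>" using \<theta> im\<theta> that by (simp add: a_def)
    moreover have "homeomorphic_map (top_of_set W) (subtopology (Euclidean_space n) (chart_ball a)) \<psi>"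
      using \<psi> by (simp add: a_def)
    moreover have "chart_dom a = q ` (W \<times> topspace F)" using that by (simp add: a_def)
    ultimately show ?thesis unfolding suspension_atlas_def using fc W'(1,2) m that by blast
  qed
  with box show thesis by (rule that)
qed

text \<open>The changes of coordinates between \<open>c\<close> and a chart of the product atlas, in both directions, show that
  near a point the transverse coordinates of the two charts determine each other.\<close>

lemma chart_local_form:
  assumes c: "c \<in> \<L>" and u: "u \<in> Mt" "y \<in> topspace F" "q (u, y) \<in> chart_dom c"
    and O1: "openin (top_of_set Mt) O1" "u \<in> O1"
  obtains B \<psi> \<phi> b r O' where "coordinate_ball n Mt p B \<psi> \<phi> b r" "u \<in> B" "B \<subseteq> O1" "openin F O'" "y \<in> O'"
    "q ` (B \<times> O') \<subseteq> chart_dom c"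
    "\<And>v v' t t'. \<lbrakk>v \<in> B; v' \<in> B; t \<in> O'; t' \<in> O'\<rbrakk> \<Longrightarrow>
       snd (chart_map c (q (v, t))) = snd (chart_map c (q (v', t'))) \<longleftrightarrow> t = t'"
proof -
  obtain W \<psi> \<phi> b r where W: "coordinate_ball n Mt p W \<psi> \<phi> b r" "u \<in> W" "W \<subseteq> O1"
    by (rule ball_at[OF O1])
  have oF: "openin F (topspace F)" by simp
  obtain a \<theta> where a: "box_chart a W (topspace F) \<psi> \<theta>" "a \<in> \<A>"
    using box_chart_exists[OF W(1) oF] by blast
  note A = box_chartD[OF a(1)]
  have ch: "foliated_change X a c" "foliated_change X c a"
    using c a(2) unfolding suspension_lamination_def lamination_of_def by blast+
  let ?x = "q (u, y)"
  have x: "?x \<in> chart_dom a \<inter> chart_dom c" using A(7) W(2) u by auto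
  obtain N1 f1 g1 where 1: "openin X N1" "?x \<in> N1" "N1 \<subseteq> chart_dom a \<inter> chart_dom c"
      "\<forall>z\<in>N1. chart_map c z = (f1 (chart_map a z), g1 (snd (chart_map a z)))"
    using bspec[OF ch(1)[unfolded foliated_change_def] x] by (elim exE conjE)
  have x': "?x \<in> chart_dom c \<inter> chart_dom a" using x by blast
  obtain N2 f2 g2 where 2: "openin X N2" "?x \<in> N2" "N2 \<subseteq> chart_dom c \<inter> chart_dom a"
      "\<forall>z\<in>N2. chart_map a z = (f2 (chart_map c z), g2 (snd (chart_map c z)))"
    using bspec[OF ch(2)[unfolded foliated_change_def] x'] by (elim exE conjE)
  have oN: "openin X (N1 \<inter> N2)" "?x \<in> N1 \<inter> N2" using 1 2 by auto
  obtain B0 O' where B0: "openin (top_of_set Mt) B0" "openin F O'" "u \<in> B0" "y \<in> O'" "q ` (B0 \<times> O') \<subseteq> N1 \<inter> N2"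
    by (rule X_box[OF oN(1) u(1,2) oN(2)])
  have oBW: "openin (top_of_set Mt) (B0 \<inter> W)" "u \<in> B0 \<inter> W" using B0 A(2) W(2) by auto
  obtain B \<psi>' \<phi>' b' r' where B: "coordinate_ball n Mt p B \<psi>' \<phi>' b' r'" "u \<in> B" "B \<subseteq> B0 \<inter> W"
    by (rule ball_at[OF oBW])
  have OF: "O' \<subseteq> topspace F" using B0(2) openin_subset by blast
  have N: "q (v, t) \<in> N1" "q (v, t) \<in> N2" if "v \<in> B" "t \<in> O'" for v t
    using that B(3) B0(5) by blast+
  have sa: "snd (chart_map a (q (v, t))) = \<theta> t" if "v \<in> B" "t \<in> O'" for v t
  proof -
    have "v \<in> W" "t \<in> topspace F" using that B(3) OF by blast+
    then show ?thesis using A(8) by simp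
  qed
  have sc: "snd (chart_map c (q (v, t))) = g1 (\<theta> t)" "\<theta> t = g2 (snd (chart_map c (q (v, t))))"
    if "v \<in> B" "t \<in> O'" for v t
  proof -
    have "snd (chart_map c (q (v, t))) = g1 (snd (chart_map a (q (v, t))))"
      using arg_cong[OF bspec[OF 1(4) N(1)[OF that]], of snd] by (simp only: snd_conv)
    then show "snd (chart_map c (q (v, t))) = g1 (\<theta> t)" unfolding sa[OF that] .
    have "snd (chart_map a (q (v, t))) = g2 (snd (chart_map c (q (v, t))))"
      using arg_cong[OF bspec[OF 2(4) N(2)[OF that]], of snd] by (simp only: snd_conv)
    then show "\<theta> t = g2 (snd (chart_map c (q (v, t))))" unfolding sa[OF that] .
  qed
  have iff: "snd (chart_map c (q (v, t))) = snd (chart_map c (q (v', t'))) \<longleftrightarrow> t = t'"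
    if v: "v \<in> B" "v' \<in> B" "t \<in> O'" "t' \<in> O'" for v v' t t'
  proof
    assume "snd (chart_map c (q (v, t))) = snd (chart_map c (q (v', t')))"
    then have "\<theta> t = \<theta> t'" using sc(2)[OF v(1,3)] sc(2)[OF v(2,4)] by simp
    then show "t = t'" using A(6) v OF by (auto dest: inj_onD)
  qed (use sc(1) v in simp)
  have sub: "q ` (B \<times> O') \<subseteq> chart_dom c" using N(1) 1(3) by blast
  have BO: "B \<subseteq> O1" using B(3) W(3) by blast
  show thesis by (rule that[OF B(1,2) BO B0(2,4) sub iff])
qed

lemma restrict_lamination_X: "restrict_lamination \<L> (topspace X) = \<L>"
proof -
  have "chart_dom c \<subseteq> topspace X" if "c \<in> \<L>" for c
    using that openin_subset unfolding suspension_lamination_def lamination_of_def foliated_chart_def by blast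
  then show ?thesis unfolding restrict_lamination_def by blast
qed

abbreviation "leaf_top U \<equiv> leaf_topology (restrict_lamination \<L> U)"
abbreviation "leaves_in U \<equiv> leaves (restrict_lamination \<L> U)"

lemma box_plaque:
  assumes c: "box_chart c W O' \<psi> \<theta>" and y: "y \<in> O'" and w: "w \<in> W"
  shows "q ` (W \<times> {y}) \<in> plaques c"
proof -
  note A = box_chartD[OF c]
  have eq: "q ` (W \<times> {y}) = {x \<in> chart_dom c. snd (chart_map c x) = \<theta> y}"
  proof (intro equalityI subsetI)
    fix x assume "x \<in> q ` (W \<times> {y})"
    then show "x \<in> {x \<in> chart_dom c. snd (chart_map c x) = \<theta> y}" using A(7,8) y by auto
  next
    fix x assume x: "x \<in> {x \<in> chart_dom c. snd (chart_map c x) = \<theta> y}"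
    then obtain v t where wt: "v \<in> W" "t \<in> O'" "x = q (v, t)" using A(7) by blast
    then have "\<theta> t = \<theta> y" using x A(8) by simp
    then have "t = y" using A(6) wt y by (auto dest: inj_onD)
    then show "x \<in> q ` (W \<times> {y})" using wt by blast
  qed
  have hm: "homeomorphic_map (subtopology X (chart_dom c))
       (prod_topology (subtopology (Euclidean_space n) (chart_ball c)) (chart_trans c)) (chart_map c)"
    and o: "openin X (chart_dom c)"
    using A(1) by (auto simp: foliated_chart_def)
  have "q (w, y) \<in> chart_dom c" unfolding A(7) using w y by blast
  then have "q (w, y) \<in> topspace (subtopology X (chart_dom c))" using openin_subset[OF o] by auto
  then have "chart_map c (q (w, y)) \<in> topspace (prod_topology (subtopology (Euclidean_space n) (chart_ball c)) (chart_trans c))"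
    using homeomorphic_imp_surjective_map[OF hm] by blast
  then have "\<theta> y \<in> topspace (chart_trans c)" using A(8)[OF w y] by simp
  then show ?thesis unfolding eq plaques_def by blast
qed

lemma box_chart_at:
  assumes U: "openin X U" and u: "u \<in> Mt" "y \<in> topspace F" "q (u, y) \<in> U"
  obtains c W O' \<psi> \<theta> where "box_chart c W O' \<psi> \<theta>" "u \<in> W" "y \<in> O'" "c \<in> restrict_lamination \<L> U"
    "path_connected W"
proof -
  obtain W0 O' where 0: "openin (top_of_set Mt) W0" "openin F O'" "u \<in> W0" "y \<in> O'" "q ` (W0 \<times> O') \<subseteq> U"
    by (rule X_box[OF U u])
  obtain W \<psi> \<phi> b r where W: "coordinate_ball n Mt p W \<psi> \<phi> b r" "u \<in> W" "W \<subseteq> W0"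
    by (rule ball_at[OF 0(1,3)])
  obtain c \<theta> where c: "box_chart c W O' \<psi> \<theta>" using box_chart_exists[OF W(1) 0(2)] by blast
  have "chart_dom c \<subseteq> U" using box_chartD(7)[OF c] W(3) 0(5) by blast
  then have "c \<in> restrict_lamination \<L> U"
    using box_chart_in_lamination[OF c] by (simp add: restrict_lamination_def)
  then show thesis using that[OF c W(2) 0(4)] coordinate_ball_path_connected[OF W(1)] by blast
qed

lemma openin_leaf_top_plaque: "P \<in> plaques c \<Longrightarrow> c \<in> restrict_lamination \<L> U \<Longrightarrow> openin (leaf_top U) P"
  unfolding leaf_topology_def by (rule topology_generated_by_Basis) blast

lemma topspace_leaf_top:
  assumes U: "openin X U" shows "topspace (leaf_top U) = U"
proof -
  have "\<Union>(\<Union>c\<in>restrict_lamination \<L> U. plaques c) \<subseteq> U"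
    by (auto simp: restrict_lamination_def plaques_def)
  moreover have "x \<in> \<Union>(\<Union>c\<in>restrict_lamination \<L> U. plaques c)" if x: "x \<in> U" for x
  proof -
    have "x \<in> topspace X" using U x openin_subset by blast
    then obtain u y where u: "u \<in> Mt" "y \<in> topspace F" "x = q (u, y)" by (rule X_cases)
    have qU: "q (u, y) \<in> U" using x u by simp
    obtain c W O' \<psi> \<theta> where c: "box_chart c W O' \<psi> \<theta>" "u \<in> W" "y \<in> O'" "c \<in> restrict_lamination \<L> U"
      by (rule box_chart_at[OF U u(1,2) qU])
    have "q ` (W \<times> {y}) \<in> plaques c" by (rule box_plaque[OF c(1,3,2)])
    moreover have "x \<in> q ` (W \<times> {y})" using u c by blast
    ultimately show ?thesis using c(4) by blast
  qed
  ultimately show ?thesis unfolding leaf_topology_def by (auto simp: topology_generated_by_topspace)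
qed

text \<open>Near each of its points a slice lies in one plaque of every chart of the lamination, so it carries
  a topology at least as fine as the leaf topology.\<close>

lemma continuous_slice:
  assumes U: "openin X U" and B: "B \<subseteq> Mt" and y: "y \<in> topspace F" and BU: "q ` (B \<times> {y}) \<subseteq> U"
  shows "continuous_map (top_of_set B) (leaf_top U) (\<lambda>b. q (b, y))"
  unfolding leaf_topology_def
proof (rule continuous_on_generated_topo)
  fix P assume "P \<in> (\<Union>c\<in>restrict_lamination \<L> U. plaques c)"
  then obtain c s where c: "c \<in> \<L>" "P = {x \<in> chart_dom c. snd (chart_map c x) = s}"
    by (auto simp: restrict_lamination_def plaques_def)
  show "openin (top_of_set B) ((\<lambda>b. q (b, y)) -` P \<inter> topspace (top_of_set B))"
  proof (subst openin_subopen, clarify)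
    fix b assume b: "q (b, y) \<in> P" "b \<in> topspace (top_of_set B)"
    then have bM: "b \<in> Mt" "b \<in> B" "q (b, y) \<in> chart_dom c" using B c by auto
    have oM: "openin (top_of_set Mt) Mt" by simp
    obtain V \<psi> \<phi> b' r O' where V: "coordinate_ball n Mt p V \<psi> \<phi> b' r" "b \<in> V" "V \<subseteq> Mt" "openin F O'" "y \<in> O'"
      "q ` (V \<times> O') \<subseteq> chart_dom c"
      "\<And>v v' t t'. \<lbrakk>v \<in> V; v' \<in> V; t \<in> O'; t' \<in> O'\<rbrakk> \<Longrightarrow>
         snd (chart_map c (q (v, t))) = snd (chart_map c (q (v', t'))) \<longleftrightarrow> t = t'"
      by (rule chart_local_form[OF c(1) bM(1) y bM(3) oM bM(1)]) (rule that)
    have "openin (top_of_set Mt) V" using V(1) by (simp add: coordinate_ball_def)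
    then have "openin (top_of_set B) (B \<inter> V)"
      using B by (metis inf.absorb2 inf_commute openin_subtopology_Int2 subtopology_subtopology)
    moreover have "q (v, y) \<in> P" if "v \<in> V" for v
      using V(7)[OF that V(2,5,5)] V(5,6) that b(1) c(2) by auto
    ultimately show "\<exists>T. openin (top_of_set B) T \<and> b \<in> T \<and> T \<subseteq> (\<lambda>b. q (b, y)) -` P \<inter> topspace (top_of_set B)"
      using bM V(2) by (intro exI[of _ "B \<inter> V"]) auto
  qed
next
  have "\<Union>(\<Union>c\<in>restrict_lamination \<L> U. plaques c) = U"
    using topspace_leaf_top[OF U] unfolding leaf_topology_def by (simp add: topology_generated_by_topspace)
  then show "(\<lambda>b. q (b, y)) ` topspace (top_of_set B) \<subseteq> \<Union>(\<Union>c\<in>restrict_lamination \<L> U. plaques c)"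
    using BU by auto
qed

lemma connected_slice:
  assumes U: "openin X U" and B: "B \<subseteq> Mt" "connected B" and y: "y \<in> topspace F" and BU: "q ` (B \<times> {y}) \<subseteq> U"
  shows "connectedin (leaf_top U) (q ` (B \<times> {y}))"
proof -
  have "connectedin (top_of_set B) B" using B(2) by (simp add: connectedin_subtopology)
  then have "connectedin (leaf_top U) ((\<lambda>b. q (b, y)) ` B)"
    by (rule connectedin_continuous_map_image[OF continuous_slice[OF U B(1) y BU]])
  moreover have "(\<lambda>b. q (b, y)) ` B = q ` (B \<times> {y})" by auto
  ultimately show ?thesis by simp
qed

lemma leaf_exists:
  assumes U: "openin X U" and x: "x \<in> U" obtains L where "L \<in> leaves_in U" "x \<in> L"
proof -
  have "x \<in> \<Union>(connected_components_of (leaf_top U))" using Union_connected_components_of topspace_leaf_top[OF U] x by metis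
  then show thesis using that unfolding leaves_def by blast
qed

lemma slice_in_leaf:
  assumes U: "openin X U" and B: "B \<subseteq> Mt" "connected B" and y: "y \<in> topspace F" and BU: "q ` (B \<times> {y}) \<subseteq> U"
    and L: "L \<in> leaves_in U" "x \<in> L" "x \<in> q ` (B \<times> {y})"
  shows "q ` (B \<times> {y}) \<subseteq> L"
  using connected_components_of_maximal[of L "leaf_top U" "q ` (B \<times> {y})"] connected_slice[OF U B y BU] L
  unfolding leaves_def disjnt_def by blast

text \<open>Sets that are unions of slices over an open base are open in the leaf topology, whatever the slices are:
  so a union of slices of a box is also closed in it.\<close>

lemma openin_leaf_top_slice:
  assumes U: "openin X U" and C: "openin (top_of_set Mt) C" and S: "S \<subseteq> topspace F" and CU: "q ` (C \<times> S) \<subseteq> U"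
  shows "openin (leaf_top U) (q ` (C \<times> S))"
proof (subst openin_subopen, clarify)
  fix u y assume uy: "u \<in> C" "y \<in> S"
  have CM: "C \<subseteq> Mt" using C openin_imp_subset by blast
  have u: "u \<in> Mt" "y \<in> topspace F" "q (u, y) \<in> U" using uy CM S CU by blast+
  obtain W0 O' where 0: "openin (top_of_set Mt) W0" "openin F O'" "u \<in> W0" "y \<in> O'" "q ` (W0 \<times> O') \<subseteq> U"
    by (rule X_box[OF U u])
  have oC: "openin (top_of_set Mt) (W0 \<inter> C)" "u \<in> W0 \<inter> C" using 0 C uy by auto
  obtain W \<psi> \<phi> b r where W: "coordinate_ball n Mt p W \<psi> \<phi> b r" "u \<in> W" "W \<subseteq> W0 \<inter> C"
    by (rule ball_at[OF oC])
  obtain c \<theta> where c: "box_chart c W O' \<psi> \<theta>" using box_chart_exists[OF W(1) 0(2)] by blast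
  have "chart_dom c \<subseteq> U" using box_chartD(7)[OF c] W(3) 0(5) by blast
  then have cr: "c \<in> restrict_lamination \<L> U"
    using box_chart_in_lamination[OF c] by (simp add: restrict_lamination_def)
  have "openin (leaf_top U) (q ` (W \<times> {y}))" by (rule openin_leaf_top_plaque[OF box_plaque[OF c 0(4) W(2)] cr])
  moreover have "q (u, y) \<in> q ` (W \<times> {y})" "q ` (W \<times> {y}) \<subseteq> q ` (C \<times> S)" using W uy by blast+
  ultimately show "\<exists>T. openin (leaf_top U) T \<and> q (u, y) \<in> T \<and> T \<subseteq> q ` (C \<times> S)" by blast
qed

lemma leaf_subset:
  assumes L: "L \<in> leaves \<L>" and x: "q (u, y) \<in> L" "u \<in> Mt" "y \<in> topspace F"
  shows "L \<subseteq> q ` (Mt \<times> {y})"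
proof -
  let ?S = "q ` (Mt \<times> {y})" and ?Y = "leaf_top (topspace X)"
  have o: "openin X (topspace X)" by simp
  have L': "L \<in> connected_components_of ?Y" using L by (simp add: leaves_def restrict_lamination_X)
  define R where "R = {z \<in> topspace F. q ` (Mt \<times> {z}) \<inter> ?S = {}}"
  have 1: "openin ?Y ?S"
    by (rule openin_leaf_top_slice[OF o]) (use x q_in_X in auto)
  have "openin ?Y (q ` (Mt \<times> R))"
    by (rule openin_leaf_top_slice[OF o]) (use q_in_X in \<open>auto simp: R_def\<close>)
  moreover have "topspace ?Y - ?S = q ` (Mt \<times> R)"
    unfolding topspace_leaf_top[OF o]
  proof (intro equalityI subsetI)
    fix z assume z: "z \<in> topspace X - ?S"
    then obtain v t where v: "v \<in> Mt" "t \<in> topspace F" "z = q (v, t)" using X_cases[of z] by blast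
    have "q ` (Mt \<times> {t}) \<inter> ?S = {}"
    proof (rule ccontr)
      assume "q ` (Mt \<times> {t}) \<inter> ?S \<noteq> {}"
      then obtain a b where ab: "a \<in> Mt" "b \<in> Mt" "q (a, t) = q (b, y)" by blast
      then obtain c where c: "c \<in> carrier \<Gamma>" "y = h c t" using q_eq_iff[of a t b y] v x by blast
      have "z = q (T c v, y)" using q_translate[OF c(1) v(1,2)] c(2) v(3) by simp
      then have "z \<in> ?S" using T_in[OF c(1) v(1)] by blast
      then show False using z by blast
    qed
    then show "z \<in> q ` (Mt \<times> R)" using v unfolding R_def by blast
  next
    fix z assume "z \<in> q ` (Mt \<times> R)"
    then obtain v t where v: "v \<in> Mt" "t \<in> R" "z = q (v, t)" by blast
    then have "z \<notin> ?S" unfolding R_def by blast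
    then show "z \<in> topspace X - ?S" using v q_in_X by (auto simp: R_def)
  qed
  ultimately have 2: "openin ?Y (topspace ?Y - ?S)" by simp
  show ?thesis
    by (rule connected_component_subset_clopen[OF L' 1 2 x(1)]) (use x in blast)
qed

text \<open>A slice and the union of the other slices of a box are disjoint and open in its leaf topology.\<close>

lemma leaf_of_box:
  assumes W: "openin (top_of_set Mt) W" "inj_on p W" and O': "openin F O'"
    and L: "L \<in> leaves_in (q ` (W \<times> O'))" and x: "q (w, y) \<in> L" "w \<in> W" "y \<in> O'"
  shows "L \<subseteq> q ` (W \<times> {y})"
proof -
  let ?U = "q ` (W \<times> O')"
  have WM: "W \<subseteq> Mt" and OF: "O' \<subseteq> topspace F" using W O' openin_imp_subset openin_subset by blast+
  have o: "openin X ?U" by (rule open_q[OF W(1) O'])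
  have L': "L \<in> connected_components_of (leaf_top ?U)" using L by (simp add: leaves_def)
  have 1: "openin (leaf_top ?U) (q ` (W \<times> {y}))"
    by (rule openin_leaf_top_slice[OF o W(1)]) (use OF x in auto)
  have 2: "openin (leaf_top ?U) (q ` (W \<times> (O' - {y})))"
    by (rule openin_leaf_top_slice[OF o W(1)]) (use OF x in auto)
  have "topspace (leaf_top ?U) - q ` (W \<times> {y}) = q ` (W \<times> (O' - {y}))"
    unfolding topspace_leaf_top[OF o]
  proof (intro equalityI subsetI)
    fix z assume "z \<in> q ` (W \<times> (O' - {y}))"
    then obtain v t where v: "v \<in> W" "t \<in> O'" "t \<noteq> y" "z = q (v, t)" by blast
    have "z \<notin> q ` (W \<times> {y})"
    proof
      assume "z \<in> q ` (W \<times> {y})"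
      then obtain w' where w': "w' \<in> W" "q (v, t) = q (w', y)" using v by blast
      have "t = y" using q_inj[OF WM W(2) v(1) w'(1) _ _ w'(2)] v x OF by blast
      then show False using v by simp
    qed
    then show "z \<in> ?U - q ` (W \<times> {y})" using v by blast
  qed blast
  then have 3: "openin (leaf_top ?U) (topspace (leaf_top ?U) - q ` (W \<times> {y}))" using 2 by simp
  show ?thesis
    by (rule connected_component_subset_clopen[OF L' 1 3 x(1)]) (use x in blast)
qed

end

section \<open>Word balls and compactness of the base\<close>

context group
begin

abbreviation word :: "'a list \<Rightarrow> 'a" where "word xs \<equiv> foldr (\<lambda>a b. a \<otimes> b) xs \<one>"

lemma word_closed: "set xs \<subseteq> carrier G \<Longrightarrow> word xs \<in> carrier G"
  by (induction xs) auto

lemma word_append: "set xs \<subseteq> carrier G \<Longrightarrow> set ys \<subseteq> carrier G \<Longrightarrow> word (xs @ ys) = word xs \<otimes> word ys"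
  by (induction xs) (auto simp: word_closed m_assoc)

lemma word_inv: "set xs \<subseteq> carrier G \<Longrightarrow> inv (word xs) = word (rev (map (\<lambda>x. inv x) xs))"
proof (induction xs)
  case (Cons x xs)
  have s: "set (rev (map (\<lambda>x. inv x) xs)) \<subseteq> carrier G" using Cons.prems by auto
  have "inv (word (x # xs)) = inv (word xs) \<otimes> inv x"
    using Cons.prems word_closed[of xs] by (simp add: inv_mult_group)
  also have "\<dots> = word (rev (map (\<lambda>x. inv x) xs)) \<otimes> word [inv x]"
    using Cons by simp
  also have "\<dots> = word (rev (map (\<lambda>x. inv x) xs) @ [inv x])"
    by (rule word_append[OF s, symmetric]) (use Cons.prems in simp)
  finally show ?case by simp
qed simp

lemma word_ballI: "set xs \<subseteq> S \<Longrightarrow> length xs \<le> k \<Longrightarrow> word xs \<in> word_ball G S k"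
  unfolding word_ball_def by blast

lemma word_ballE:
  assumes "g \<in> word_ball G S k" obtains xs where "set xs \<subseteq> S" "length xs \<le> k" "g = word xs"
  using assms unfolding word_ball_def by blast

lemma word_ball_one: "\<one> \<in> word_ball G S k"
  using word_ballI[of "[]" S k] by simp

lemma word_ball_mono: "i \<le> j \<Longrightarrow> word_ball G S i \<subseteq> word_ball G S j"
  unfolding word_ball_def by (auto intro: order_trans)

lemma word_ball_carrier: "S \<subseteq> carrier G \<Longrightarrow> word_ball G S k \<subseteq> carrier G"
proof
  fix g assume S: "S \<subseteq> carrier G" and "g \<in> word_ball G S k"
  then obtain xs where "set xs \<subseteq> S" "g = word xs" by (meson word_ballE)
  then show "g \<in> carrier G" using word_closed[of xs] S by blast
qed

lemma word_ball_finite: "finite S \<Longrightarrow> finite (word_ball G S k)"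
proof -
  assume "finite S"
  then have "finite {xs. set xs \<subseteq> S \<and> length xs \<le> k}" by (rule finite_lists_length_le)
  moreover have "word_ball G S k = word ` {xs. set xs \<subseteq> S \<and> length xs \<le> k}" unfolding word_ball_def by blast
  ultimately show ?thesis by simp
qed

lemma word_ball_mult:
  assumes "S \<subseteq> carrier G" "a \<in> word_ball G S i" "b \<in> word_ball G S j"
  shows "a \<otimes> b \<in> word_ball G S (i + j)"
proof -
  obtain xs where x: "set xs \<subseteq> S" "length xs \<le> i" "a = word xs" using assms(2) by (rule word_ballE)
  obtain ys where y: "set ys \<subseteq> S" "length ys \<le> j" "b = word ys" using assms(3) by (rule word_ballE)
  have "a \<otimes> b = word (xs @ ys)" using word_append[of xs ys] x y assms(1) by auto
  then show ?thesis using word_ballI[of "xs @ ys" S "i + j"] x y by simp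
qed

lemma word_ball_inv:
  assumes S: "symmetric_generating_set G S" and a: "a \<in> word_ball G S i"
  shows "inv a \<in> word_ball G S i"
proof -
  obtain xs where x: "set xs \<subseteq> S" "length xs \<le> i" "a = word xs" using a by (rule word_ballE)
  have sub: "S \<subseteq> carrier G" "\<And>s. s \<in> S \<Longrightarrow> inv s \<in> S" using S by (auto simp: symmetric_generating_set_def)
  have "inv a = word (rev (map (\<lambda>x. inv x) xs))" using word_inv[of xs] x sub by auto
  moreover have "set (rev (map (\<lambda>x. inv x) xs)) \<subseteq> S" using x sub by auto
  ultimately show ?thesis using word_ballI[of "rev (map (\<lambda>x. inv x) xs)" S i] x by simp
qed

lemma word_ball_exhausts:
  assumes S: "symmetric_generating_set G S" and g: "g \<in> carrier G"
  obtains k where "g \<in> word_ball G S k"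
proof -
  have sub: "S \<subseteq> carrier G" "\<And>s. s \<in> S \<Longrightarrow> inv s \<in> S" "generate G S = carrier G"
    using S by (auto simp: symmetric_generating_set_def)
  have one: "s \<in> word_ball G S 1" if "s \<in> S" for s
    using word_ballI[of "[s]" S 1] that sub(1) by (auto simp: subset_iff)
  have "g \<in> generate G S" using g sub(3) by simp
  then have "\<exists>k. g \<in> word_ball G S k"
  proof induction
    case (eng g1 g2)
    then show ?case using word_ball_mult[OF sub(1)] by blast
  qed (use word_ball_one one sub(2) in blast)+
  then show thesis using that by blast
qed

lemma finite_in_word_ball:
  assumes S: "symmetric_generating_set G S" and Q: "finite Q" "Q \<subseteq> carrier G"
  obtains k where "Q \<subseteq> word_ball G S k"
proof -
  from Q have "\<exists>k. Q \<subseteq> word_ball G S k"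
  proof (induction Q)
    case (insert x Q)
    then obtain k where k: "Q \<subseteq> word_ball G S k" by blast
    have "x \<in> carrier G" using insert.prems by blast
    then obtain j where j: "x \<in> word_ball G S j" using word_ball_exhausts[OF S] by blast
    have "insert x Q \<subseteq> word_ball G S (max j k)"
      using k j word_ball_mono[of j "max j k" S] word_ball_mono[of k "max j k" S] by auto
    then show ?case by blast
  qed simp
  then show thesis using that by blast
qed

end

lemma path_connected_euclidean_ball:
  assumes "c \<in> topspace (Euclidean_space n)" "r > 0"
  shows "path_connected (euclidean_ball n c r)"
proof (rule coordinate_ball_path_connected[of n "topspace (Euclidean_space n)" "\<lambda>x. x" _ "\<lambda>x. x" "\<lambda>x. x" c r])
  have "openin (top_of_set (topspace (Euclidean_space n))) (euclidean_ball n c r)"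
    using openin_euclidean_ball by (metis Euclidean_space_eq)
  then show "coordinate_ball n (topspace (Euclidean_space n)) (\<lambda>x. x) (euclidean_ball n c r) (\<lambda>x. x) (\<lambda>x. x) c r"
    using assms by (auto simp: coordinate_ball_def homeomorphism_def)
qed

text \<open>Plaques are homeomorphic images of a Euclidean ball.\<close>

lemma plaque_connected:
  assumes c: "foliated_chart n Y c" and P: "P \<in> plaques c"
  shows "connectedin Y P"
proof -
  let ?E = "subtopology (Euclidean_space n) (chart_ball c)"
  obtain s where s: "s \<in> topspace (chart_trans c)" "P = {x \<in> chart_dom c. snd (chart_map c x) = s}"
    using P unfolding plaques_def by blast
  have o: "openin Y (chart_dom c)" and
    hm: "homeomorphic_map (subtopology Y (chart_dom c)) (prod_topology ?E (chart_trans c)) (chart_map c)"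
    using c by (auto simp: foliated_chart_def)
  obtain b r where b: "b \<in> topspace (Euclidean_space n)" "r > 0" "chart_ball c = euclidean_ball n b r"
    using c by (auto simp: foliated_chart_def is_euclidean_ball_def)
  have E: "?E = top_of_set (chart_ball c)" "chart_ball c \<subseteq> topspace (Euclidean_space n)"
    unfolding b(3) by (rule subtopology_Euclidean_space[OF euclidean_ball_subset], rule euclidean_ball_subset)
  obtain g where g: "homeomorphic_maps (subtopology Y (chart_dom c)) (prod_topology ?E (chart_trans c)) (chart_map c) g"
    using hm unfolding homeomorphic_map_maps by blast
  have cg: "continuous_map (prod_topology ?E (chart_trans c)) (subtopology Y (chart_dom c)) g"
    and gm: "\<And>x. x \<in> chart_dom c \<Longrightarrow> g (chart_map c x) = x"
    and mg: "\<And>b. b \<in> chart_ball c \<Longrightarrow> chart_map c (g (b, s)) = (b, s)"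
    using g openin_subset[OF o] s(1) E(2) by (auto simp: homeomorphic_maps_def)
  have "connectedin ?E (chart_ball c)"
  proof -
    have "connected (chart_ball c)"
      unfolding b(3) by (rule path_connected_imp_connected[OF path_connected_euclidean_ball[OF b(1,2)]])
    then show ?thesis unfolding E(1) by (simp add: connectedin_subtopology)
  qed
  moreover have "continuous_map ?E (prod_topology ?E (chart_trans c)) (\<lambda>b. (b, s))"
    using s(1) by (auto simp: continuous_map_pairedI)
  ultimately have con: "connectedin (prod_topology ?E (chart_trans c)) ((\<lambda>b. (b, s)) ` chart_ball c)"
    using connectedin_continuous_map_image by blast
  have "connectedin (subtopology Y (chart_dom c)) (g ` (\<lambda>b. (b, s)) ` chart_ball c)"
    by (rule connectedin_continuous_map_image[OF cg con])
  then have "connectedin Y (g ` (\<lambda>b. (b, s)) ` chart_ball c)" by (simp add: connectedin_subtopology)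
  moreover have "g ` (\<lambda>b. (b, s)) ` chart_ball c = P"
  proof (intro equalityI subsetI)
    fix x assume "x \<in> g ` (\<lambda>b. (b, s)) ` chart_ball c"
    then obtain a where a: "a \<in> chart_ball c" "x = g (a, s)" by blast
    have "(a, s) \<in> topspace (prod_topology ?E (chart_trans c))" using a(1) s(1) E(2) by auto
    then have "x \<in> chart_dom c" using cg a(2) by (auto simp: continuous_map_def)
    then show "x \<in> P" using mg[OF a(1)] a(2) s(2) by simp
  next
    fix x assume x: "x \<in> P"
    then have xd: "x \<in> chart_dom c" "snd (chart_map c x) = s" using s(2) by auto
    then have "x \<in> topspace (subtopology Y (chart_dom c))" using openin_subset[OF o] by auto
    then have "chart_map c x \<in> topspace (prod_topology ?E (chart_trans c))"
      using homeomorphic_imp_surjective_map[OF hm] by blast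
    then have "fst (chart_map c x) \<in> chart_ball c" by auto
    moreover have "x = g (fst (chart_map c x), s)" using gm[OF xd(1)] xd(2) by (metis prod.collapse)
    ultimately show "x \<in> g ` (\<lambda>b. (b, s)) ` chart_ball c" by blast
  qed
  ultimately show ?thesis by simp
qed

context suspension
begin

lemma open_p:
  assumes B: "openin (top_of_set Mt) B" shows "openin (top_of_set M) (p ` B)"
proof (subst openin_subopen, clarify)
  fix u assume u: "u \<in> B"
  then have uM: "u \<in> Mt" using B openin_imp_subset by blast
  obtain N V g where N: "u \<in> N" "openin (top_of_set Mt) N" "p u \<in> V" "openin (top_of_set M) V" "homeomorphism N V p g"
    using covering_space_local_homeomorphism[OF cover uM] .
  have "openin (top_of_set Mt) (B \<inter> N)" using B N(2) by blast
  moreover have "N \<subseteq> Mt" using N(2) openin_imp_subset by blast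
  ultimately have "openin (top_of_set N) (B \<inter> N)" by (rule openin_subset_trans[OF _ Int_lower2])
  then have "openin (top_of_set V) (p ` (B \<inter> N))" using homeomorphism_imp_open_map[OF N(5)] by blast
  then have "openin (top_of_set M) (p ` (B \<inter> N))" using N(4) openin_trans by blast
  then show "\<exists>T. openin (top_of_set M) T \<and> p u \<in> T \<and> T \<subseteq> p ` B" using u N(1) by blast
qed

lemma compact_base: "compact_space (top_of_set M)"
  using manifold by (simp add: compact_manifold_def)

lemma finite_subcover_M:
  assumes "\<And>u. u \<in> Mt \<Longrightarrow> openin (top_of_set Mt) (N u) \<and> u \<in> N u"
  obtains K where "finite K" "K \<subseteq> Mt" "M = (\<Union>u\<in>K. p ` N u)"
proof -
  have "\<exists>\<C>'. finite \<C>' \<and> \<C>' \<subseteq> (\<lambda>u. p ` N u) ` Mt \<and> topspace (top_of_set M) \<subseteq> \<Union>\<C>'"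
  proof (rule compactinD)
    show "compactin (top_of_set M) (topspace (top_of_set M))" using compact_base by (simp add: compact_space_def)
    show "\<And>U. U \<in> (\<lambda>u. p ` N u) ` Mt \<Longrightarrow> openin (top_of_set M) U" using assms open_p by blast
    show "topspace (top_of_set M) \<subseteq> \<Union>((\<lambda>u. p ` N u) ` Mt)" using assms p_image by fastforce
  qed
  then obtain \<C>' where \<C>': "finite \<C>'" "\<C>' \<subseteq> (\<lambda>u. p ` N u) ` Mt" "M \<subseteq> \<Union>\<C>'" by auto
  obtain K where K: "K \<subseteq> Mt" "finite K" "\<C>' = (\<lambda>u. p ` N u) ` K"
    using finite_subset_image[OF \<C>'(1,2)] by blast
  have "N u \<subseteq> Mt" if "u \<in> Mt" for u using assms[OF that] openin_imp_subset by blast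
  then have "M = (\<Union>u\<in>K. p ` N u)" using K \<C>'(3) p_image by blast
  then show thesis using that K by blast
qed

lemma continuous_fiber: "u \<in> Mt \<Longrightarrow> continuous_map F X (\<lambda>y. q (u, y))"
proof -
  assume u: "u \<in> Mt"
  have "continuous_map F Z (\<lambda>y. (u, y))" using u by (intro continuous_map_pairedI) auto
  then have "continuous_map F X (q \<circ> (\<lambda>y. (u, y)))" using continuous_q by (rule continuous_map_compose)
  then show ?thesis by (simp add: comp_def)
qed

lemma compact_slice: "u \<in> Mt \<Longrightarrow> compactin F K \<Longrightarrow> compactin X (q ` ({u} \<times> K))"
proof -
  assume "u \<in> Mt" "compactin F K"
  then have "compactin X ((\<lambda>y. q (u, y)) ` K)" using continuous_fiber image_compactin by blast
  moreover have "(\<lambda>y. q (u, y)) ` K = q ` ({u} \<times> K)" by auto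
  ultimately show ?thesis by simp
qed

lemma over_cover:
  assumes "M = (\<Union>u\<in>K. p ` N u)" "\<And>u. u \<in> K \<Longrightarrow> N u \<subseteq> Mt" "x \<in> topspace X"
  obtains u w y where "u \<in> K" "w \<in> N u" "y \<in> topspace F" "x = q (w, y)"
proof -
  obtain v t where v: "v \<in> Mt" "t \<in> topspace F" "x = q (v, t)" using assms(3) by (rule X_cases)
  have "p v \<in> M" using v p_image by blast
  then obtain u w where w: "u \<in> K" "w \<in> N u" "p v = p w" using assms(1) by blast
  have "w \<in> Mt" using w assms(2) by blast
  then obtain c where c: "c \<in> carrier \<Gamma>" "T c v = w" using fiber_transitive[OF v(1) _ w(3)] by blast
  have "x = q (w, h c t)" using q_translate[OF c(1) v(1,2)] c(2) v(3) by simp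
  then show thesis using that w h_in[OF c(1) v(2)] by blast
qed

text \<open>The fibre over a point is compact, and so is \<open>M\<close>. The boxes around the fibre over \<open>u0\<close> are kept, so
  that the points of this fibre have representatives over \<open>u0\<close> itself.\<close>

lemma finite_boxes:
  assumes ex: "\<And>u y. u \<in> Mt \<Longrightarrow> y \<in> topspace F \<Longrightarrow>
      \<exists>B O'. openin (top_of_set Mt) B \<and> openin F O' \<and> u \<in> B \<and> y \<in> O' \<and> P B O'"
  obtains \<B> where "finite \<B>" "\<And>B O'. (B, O') \<in> \<B> \<Longrightarrow> openin (top_of_set Mt) B \<and> openin F O' \<and> P B O'"
    "\<And>x. x \<in> topspace X \<Longrightarrow> \<exists>(B, O')\<in>\<B>. x \<in> q ` (B \<times> O')"
    "\<And>y. y \<in> topspace F \<Longrightarrow> \<exists>(B, O')\<in>\<B>. u0 \<in> B \<and> y \<in> O'"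
proof -
  let ?good = "\<lambda>B O'. openin (top_of_set Mt) B \<and> openin F O' \<and> P B O'"
  define fits where "fits u \<B> \<longleftrightarrow> finite \<B> \<and> (\<forall>(B, O')\<in>\<B>. ?good B O' \<and> u \<in> B) \<and>
      topspace F = (\<Union>(B, O')\<in>\<B>. O')" for u \<B>
  have fib: "\<exists>\<B>. fits u \<B>"
    if u: "u \<in> Mt" for u
  proof -
    define \<C> where "\<C> = {(B, O'). ?good B O' \<and> u \<in> B}"
    have "\<exists>\<C>'. finite \<C>' \<and> \<C>' \<subseteq> snd ` \<C> \<and> topspace F \<subseteq> \<Union>\<C>'"
    proof (rule compactinD)
      show "compactin F (topspace F)" using compact_F by (simp add: compact_space_def)
      show "\<And>U. U \<in> snd ` \<C> \<Longrightarrow> openin F U" by (auto simp: \<C>_def)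
      show "topspace F \<subseteq> \<Union>(snd ` \<C>)"
      proof
        fix y assume "y \<in> topspace F"
        then obtain B O' where "?good B O'" "u \<in> B" "y \<in> O'" using ex[OF u] by blast
        then have "(B, O') \<in> \<C>" by (simp add: \<C>_def)
        then show "y \<in> \<Union>(snd ` \<C>)" using \<open>y \<in> O'\<close> by force
      qed
    qed
    then obtain \<C>' where \<C>': "finite \<C>'" "\<C>' \<subseteq> snd ` \<C>" "topspace F \<subseteq> \<Union>\<C>'" by blast
    obtain \<B> where \<B>: "\<B> \<subseteq> \<C>" "finite \<B>" "\<C>' = snd ` \<B>" using finite_subset_image[OF \<C>'(1,2)] by blast
    have g: "\<forall>(B, O')\<in>\<B>. ?good B O' \<and> u \<in> B" using \<B>(1) unfolding \<C>_def by blast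
    have "(\<Union>(B, O')\<in>\<B>. O') = \<Union>\<C>'" using \<B>(3) by auto
    moreover have "\<Union>\<C>' \<subseteq> topspace F"
    proof
      fix y assume "y \<in> \<Union>\<C>'"
      then obtain B O' where "(B, O') \<in> \<B>" "y \<in> O'" using \<B>(3) by force
      then show "y \<in> topspace F" using g openin_subset[of F O'] by blast
    qed
    ultimately have "fits u \<B>" unfolding fits_def using g \<B>(2) \<C>'(3) by auto
    then show ?thesis by blast
  qed
  define bx where "bx u = (SOME \<B>. fits u \<B>)" for u
  have "fits u (bx u)" if "u \<in> Mt" for u using someI_ex[OF fib[OF that]] by (simp add: bx_def)
  then have bx: "\<And>u. u \<in> Mt \<Longrightarrow> finite (bx u)" "\<And>u. u \<in> Mt \<Longrightarrow> \<forall>(B, O')\<in>bx u. ?good B O' \<and> u \<in> B"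
      "\<And>u. u \<in> Mt \<Longrightarrow> topspace F = (\<Union>(B, O')\<in>bx u. O')" unfolding fits_def by blast+
  define N where "N u = (\<Inter>(B, O')\<in>bx u. B) \<inter> Mt" for u
  have N: "openin (top_of_set Mt) (N u) \<and> u \<in> N u" if u: "u \<in> Mt" for u
  proof
    have "openin (top_of_set Mt) (\<Inter>(insert Mt (fst ` bx u)))"
    proof (rule openin_Inter)
      fix B assume "B \<in> insert Mt (fst ` bx u)"
      then show "openin (top_of_set Mt) B" using bx(2)[OF u] by (auto simp: split_beta)
    qed (use bx(1)[OF u] in auto)
    moreover have "\<Inter>(insert Mt (fst ` bx u)) = N u" unfolding N_def by (auto simp: split_beta)
    ultimately show "openin (top_of_set Mt) (N u)" by simp
    show "u \<in> N u" using bx(2)[OF u] u unfolding N_def by (auto simp: split_beta)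
  qed
  obtain K where K: "finite K" "K \<subseteq> Mt" "M = (\<Union>u\<in>K. p ` N u)" using finite_subcover_M[of N] N by blast
  define \<B> where "\<B> = bx u0 \<union> (\<Union>u\<in>K. bx u)"
  have fin: "finite \<B>" unfolding \<B>_def using bx(1) K u0 by auto
  have good: "?good B O'" if "(B, O') \<in> \<B>" for B O'
    using that bx(2) K(2) u0 unfolding \<B>_def by blast
  have covX: "\<exists>(B, O')\<in>\<B>. x \<in> q ` (B \<times> O')" if x: "x \<in> topspace X" for x
  proof -
    obtain u w y where w: "u \<in> K" "w \<in> N u" "y \<in> topspace F" "x = q (w, y)"
      by (rule over_cover[OF K(3) _ x]) (auto simp: N_def)
    have uM: "u \<in> Mt" using w(1) K(2) by blast
    obtain B O' where b: "(B, O') \<in> bx u" "y \<in> O'" using bx(3)[OF uM] w(3) by blast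
    have "w \<in> B" using w(2) b(1) unfolding N_def by blast
    then show ?thesis using b w(1,4) unfolding \<B>_def by blast
  qed
  have cov0: "\<exists>(B, O')\<in>\<B>. u0 \<in> B \<and> y \<in> O'" if y: "y \<in> topspace F" for y
  proof -
    obtain B O' where b: "(B, O') \<in> bx u0" "y \<in> O'" using bx(3)[OF u0] y by blast
    moreover from this(1) have "u0 \<in> B" using bx(2)[OF u0] by blast
    ultimately show ?thesis unfolding \<B>_def by blast
  qed
  show thesis by (rule that[OF fin good covX cov0])
qed

text \<open>Near a point of the diagonal of \<open>M \<times> M\<close>, two connected sets over an evenly covered set lie in one sheet
  each, and only one deck transformation takes the one sheet to the other; off the diagonal, sets over
  disjoint sets never meet. By compactness of \<open>M \<times> M\<close> the choice can be made uniformly.\<close>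

lemma small_neighbourhoods:
  obtains V where "\<And>u. u \<in> Mt \<Longrightarrow> openin (top_of_set Mt) (V u) \<and> u \<in> V u"
    "\<And>u u' B B' c d. \<lbrakk>u \<in> Mt; u' \<in> Mt; B \<subseteq> V u; B' \<subseteq> V u'; connected B; connected B';
        c \<in> carrier \<Gamma>; d \<in> carrier \<Gamma>; T c ` B \<inter> B' \<noteq> {}; T d ` B \<inter> B' \<noteq> {}\<rbrakk> \<Longrightarrow> c = d"
proof -
  \<comment> \<open>\<open>sep A A'\<close>: connected sets over \<open>A\<close> and \<open>A'\<close> meet after at most one deck transformation.\<close>
  define sep where "sep A A' \<longleftrightarrow> (\<forall>B B' c d. B \<subseteq> Mt \<inter> p -` A \<and> B' \<subseteq> Mt \<inter> p -` A' \<and> connected B \<and> connected B' \<and>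
      c \<in> carrier \<Gamma> \<and> d \<in> carrier \<Gamma> \<and> T c ` B \<inter> B' \<noteq> {} \<and> T d ` B \<inter> B' \<noteq> {} \<longrightarrow> c = d)" for A A'
  have loc: "\<exists>A A'. openin (top_of_set M) A \<and> openin (top_of_set M) A' \<and> m \<in> A \<and> m' \<in> A' \<and> sep A A'"
    if m: "m \<in> M" "m' \<in> M" for m m'
  proof (cases "m = m'")
    case False
    obtain A A' where A: "openin (top_of_set M) A" "openin (top_of_set M) A'" "m \<in> A" "m' \<in> A'" "disjnt A A'"
      using m False by (auto intro: Hausdorff_separate[OF hausdorff_M])
    have "sep A A'" unfolding sep_def
    proof (intro allI impI, elim conjE)
      fix B B' c d assume as: "B \<subseteq> Mt \<inter> p -` A" "B' \<subseteq> Mt \<inter> p -` A'" "c \<in> carrier \<Gamma>" "T c ` B \<inter> B' \<noteq> {}"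
      then obtain b where b: "b \<in> B" "T c b \<in> B'" by blast
      have "b \<in> Mt" "p b \<in> A" "p (T c b) \<in> A'" using as(1,2) b by blast+
      then have "p b \<in> A \<inter> A'" using p_T[OF as(3)] by simp
      then show "c = d" using A(5) by (auto simp: disjnt_def)
    qed
    then show ?thesis using A by blast
  next
    case True
    obtain V where V: "m \<in> V" "openin (top_of_set M) V"
      "\<And>e. \<lbrakk>e \<in> Mt; p e \<in> V\<rbrakk> \<Longrightarrow> \<exists>N g. e \<in> N \<and> openin (top_of_set Mt) N \<and> homeomorphism N V p g \<and>
        openin (top_of_set Mt) (Mt \<inter> p -` V - N)"
      by (rule evenly_covered[OF cover m(1)]) (rule that)
    have "sep V V" unfolding sep_def
    proof (intro allI impI, elim conjE)
      fix B B' c d assume as: "B \<subseteq> Mt \<inter> p -` V" "B' \<subseteq> Mt \<inter> p -` V" "connected B" "connected B'"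
        "c \<in> carrier \<Gamma>" "d \<in> carrier \<Gamma>" "T c ` B \<inter> B' \<noteq> {}" "T d ` B \<inter> B' \<noteq> {}"
      obtain b1 where b1: "b1 \<in> B" "T c b1 \<in> B'" using as(7) by blast
      obtain b2 where b2: "b2 \<in> B" "T d b2 \<in> B'" using as(8) by blast
      have e: "T c b1 \<in> Mt" "p (T c b1) \<in> V" using as(2) b1 by blast+
      obtain N g where N: "T c b1 \<in> N" "openin (top_of_set Mt) N" "homeomorphism N V p g"
          "openin (top_of_set Mt) (Mt \<inter> p -` V - N)" using V(3)[OF e] by (elim exE conjE)
      have B'N: "B' \<subseteq> N" by (rule connected_in_sheet[OF as(4,2) N(2,4) b1(2) N(1)])
      have BM: "B \<subseteq> Mt" using as(1) by blast
      have sub: "T k ` B \<subseteq> Mt \<inter> p -` V" if k: "k \<in> carrier \<Gamma>" for k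
      proof clarify
        fix b assume "b \<in> B"
        then have "b \<in> Mt" "p b \<in> V" using as(1) by blast+
        then show "T k b \<in> Mt \<inter> p -` V" using T_in[OF k] p_T[OF k] by simp
      qed
      have con: "connected (T k ` B)" if k: "k \<in> carrier \<Gamma>" for k
        using connected_continuous_image[OF continuous_on_subset[OF deckD(1)[OF deck_of_deck[OF k]] BM] as(3)] .
      have c: "T c ` B \<subseteq> N"
        by (rule connected_in_sheet[OF con[OF as(5)] sub[OF as(5)] N(2,4)]) (use b1 N(1) in auto)
      have d: "T d ` B \<subseteq> N"
        by (rule connected_in_sheet[OF con[OF as(6)] sub[OF as(6)] N(2,4), of "T d b2"]) (use b2 B'N in auto)
      have b1M: "b1 \<in> Mt" using b1 BM by blast
      have "inj_on p N" using N(3) by (metis homeomorphism_apply1 inj_on_inverseI)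
      moreover have "T c b1 \<in> N" "T d b1 \<in> N" "p (T c b1) = p (T d b1)"
        using c d b1 p_T[OF as(5) b1M] p_T[OF as(6) b1M] by auto
      ultimately have "T c b1 = T d b1" by (auto dest: inj_onD)
      then have "T (inv\<^bsub>\<Gamma>\<^esub> d) (T c b1) = b1" using inv_simps(2)[OF as(6) b1M] by simp
      then have "T (inv\<^bsub>\<Gamma>\<^esub> d \<otimes>\<^bsub>\<Gamma>\<^esub> c) b1 = b1" using deck_of_mult[OF inv_simps(1)[OF as(6)] as(5) b1M] by simp
      moreover have icl: "inv\<^bsub>\<Gamma>\<^esub> d \<otimes>\<^bsub>\<Gamma>\<^esub> c \<in> carrier \<Gamma>"
        using group.is_monoid[OF group_\<Gamma>] monoid.m_closed inv_simps(1)[OF as(6)] as(5) by metis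
      ultimately have "inv\<^bsub>\<Gamma>\<^esub> d \<otimes>\<^bsub>\<Gamma>\<^esub> c = \<one>\<^bsub>\<Gamma>\<^esub>" using deck_of_free[OF icl b1M] by blast
      then show "c = d" using group.inv_equality[OF group_\<Gamma>, of "inv\<^bsub>\<Gamma>\<^esub> d" c] as(5,6) inv_simps(1)[OF as(6)]
        by (metis group.inv_inv[OF group_\<Gamma>])
    qed
    then show ?thesis using V True by blast
  qed
  let ?MM = "prod_topology (top_of_set M) (top_of_set M)"
  define \<C> where "\<C> = {(A, A'). openin (top_of_set M) A \<and> openin (top_of_set M) A' \<and> sep A A'}"
  have "\<exists>\<D>. finite \<D> \<and> \<D> \<subseteq> (\<lambda>(A, A'). A \<times> A') ` \<C> \<and> M \<times> M \<subseteq> \<Union>\<D>"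
  proof (rule compactinD)
    show "compactin ?MM (M \<times> M)"
      unfolding compactin_Times using compact_base by (simp add: compact_space_def)
    show "\<And>U. U \<in> (\<lambda>(A, A'). A \<times> A') ` \<C> \<Longrightarrow> openin ?MM U"
      by (auto simp: \<C>_def openin_prod_Times_iff simp del: prod_topology_subtopology_eu)
    show "M \<times> M \<subseteq> \<Union>((\<lambda>(A, A'). A \<times> A') ` \<C>)"
    proof clarify
      fix m m' assume "m \<in> M" "m' \<in> M"
      then obtain A A' where "openin (top_of_set M) A" "openin (top_of_set M) A'" "m \<in> A" "m' \<in> A'" "sep A A'"
        using loc by blast
      then show "(m, m') \<in> \<Union>((\<lambda>(A, A'). A \<times> A') ` \<C>)"
        by (intro UnionI[of "A \<times> A'"]) (auto simp: \<C>_def intro!: image_eqI[of _ _ "(A, A')"])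
    qed
  qed
  then obtain \<D> where \<D>: "finite \<D>" "\<D> \<subseteq> (\<lambda>(A, A'). A \<times> A') ` \<C>" "M \<times> M \<subseteq> \<Union>\<D>" by blast
  obtain \<E> where \<E>: "\<E> \<subseteq> \<C>" "finite \<E>" "\<D> = (\<lambda>(A, A'). A \<times> A') ` \<E>" using finite_subset_image[OF \<D>(1,2)] by blast
  define V where "V u = Mt \<inter> p -` (\<Inter>(insert M {A \<in> fst ` \<E> \<union> snd ` \<E>. p u \<in> A}))" for u
  show thesis
  proof (rule that[of V])
    fix u assume u: "u \<in> Mt"
    have "openin (top_of_set M) (\<Inter>(insert M {A \<in> fst ` \<E> \<union> snd ` \<E>. p u \<in> A}))"
    proof (rule openin_Inter)
      fix A assume "A \<in> insert M {A \<in> fst ` \<E> \<union> snd ` \<E>. p u \<in> A}"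
      then show "openin (top_of_set M) A" using \<E>(1) unfolding \<C>_def by auto
    qed (use \<E>(2) in auto)
    then have "openin (top_of_set Mt) (V u)" unfolding V_def
      using cont_p p_image by (intro openin_preimage_on) auto
    then show "openin (top_of_set Mt) (V u) \<and> u \<in> V u" using u p_image unfolding V_def by auto
  next
    fix u u' B B' c d
    assume as: "u \<in> Mt" "u' \<in> Mt" "B \<subseteq> V u" "B' \<subseteq> V u'" "connected B" "connected B'"
        "c \<in> carrier \<Gamma>" "d \<in> carrier \<Gamma>" "T c ` B \<inter> B' \<noteq> {}" "T d ` B \<inter> B' \<noteq> {}"
    have "(p u, p u') \<in> M \<times> M" using as p_image by auto
    then obtain A A' where A: "(A, A') \<in> \<E>" "p u \<in> A" "p u' \<in> A'" using \<D>(3) \<E>(3) by blast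
    have "sep A A'" using A(1) \<E>(1) unfolding \<C>_def by blast
    moreover have "A \<in> fst ` \<E>" "A' \<in> snd ` \<E>" using A(1) by force+
    then have "B \<subseteq> Mt \<inter> p -` A" "B' \<subseteq> Mt \<inter> p -` A'"
      using as(3,4) A(2,3) unfolding V_def by blast+
    ultimately show "c = d" using as unfolding sep_def by blast
  qed
qed

end

section \<open>Displacement along chains of plaques\<close>

lemma chain_nth:
  assumes "plaque_chain \<U> Ps" "i < length Ps"
  obtains c where "c \<in> \<U>" "Ps ! i \<in> plaques c"
proof -
  have "Ps ! i \<in> (\<Union>c\<in>\<U>. plaques c)" using assms nth_mem[of i Ps] unfolding plaque_chain_def by blast
  then show thesis using that by blast
qed

locale suspension_dynamics = suspension n M Mt p u0 F h
  for n :: nat and M :: "'m::topological_space set" and Mt :: "'u::topological_space set"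
    and p :: "'u \<Rightarrow> 'm" and u0 :: 'u and F :: "'f topology" and h :: "(real \<Rightarrow> 'm) set \<Rightarrow> 'f \<Rightarrow> 'f" +
  fixes G :: "('f \<Rightarrow> 'f) monoid" and S :: "('f \<Rightarrow> 'f) set"
    and \<U> :: "('u \<times> 'f) set chart set"
  assumes G_eq: "G = (homeo_group F)\<lparr>carrier := h ` carrier (fundamental_group M (p u0))\<rparr>"
    and free: "\<And>g y. g \<in> carrier G \<Longrightarrow> y \<in> topspace F \<Longrightarrow> g y = y \<Longrightarrow> g = \<one>\<^bsub>G\<^esub>"
    and generators: "finite S" "symmetric_generating_set G S"
    and atlas: "finite \<U>" "regular_atlas n (suspension_space M Mt p u0 F h)
        (suspension_lamination n M Mt p u0 F h) \<U>"
begin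

lemma group_G: "group G"
proof -
  have "subgroup (h ` carrier \<Gamma>) (homeo_group F)" by (rule group_hom.img_is_subgroup[OF group_hom_h])
  then show ?thesis unfolding G_eq by (rule subgroup.subgroup_is_group[OF _ group_homeo_group])
qed

sublocale G: group G by (rule group_G)

abbreviation "Sn \<equiv> word_ball G S"

lemma carrier_G: "carrier G = h ` carrier \<Gamma>"
  by (simp add: G_eq)

lemma h_G: "c \<in> carrier \<Gamma> \<Longrightarrow> h c \<in> carrier G"
  by (simp add: carrier_G)

lemma G_cases: assumes "g \<in> carrier G" obtains c where "c \<in> carrier \<Gamma>" "g = h c"
  using assms unfolding carrier_G by blast

lemma G_homeo: "g \<in> carrier G \<Longrightarrow> homeomorphic_map F F g"
  using h_homeo by (auto simp: carrier_G)

lemma G_in: "g \<in> carrier G \<Longrightarrow> y \<in> topspace F \<Longrightarrow> g y \<in> topspace F"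
  using h_in by (auto simp: carrier_G)

lemma G_mult: "g \<in> carrier G \<Longrightarrow> k \<in> carrier G \<Longrightarrow> y \<in> topspace F \<Longrightarrow> (g \<otimes>\<^bsub>G\<^esub> k) y = g (k y)"
  using homeo_group_mult[of g F k y] h_carrier by (auto simp: G_eq)

lemma G_one: "y \<in> topspace F \<Longrightarrow> \<one>\<^bsub>G\<^esub> y = y"
  using homeo_group_one[of y F] by (simp add: G_eq)

lemma G_inv:
  assumes "g \<in> carrier G" "y \<in> topspace F"
  shows "(inv\<^bsub>G\<^esub> g) (g y) = y" "g ((inv\<^bsub>G\<^esub> g) y) = y"
  using G_mult[of "inv\<^bsub>G\<^esub> g" g y] G_mult[of g "inv\<^bsub>G\<^esub> g" y] G_one assms by simp_all

lemma G_determined: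
  assumes "g \<in> carrier G" "k \<in> carrier G" "y \<in> topspace F" "g y = k y"
  shows "g = k"
proof -
  have "(inv\<^bsub>G\<^esub> k \<otimes>\<^bsub>G\<^esub> g) y = y" using G_mult[of "inv\<^bsub>G\<^esub> k" g y] G_inv(1)[of k y] assms by simp
  then have "inv\<^bsub>G\<^esub> k \<otimes>\<^bsub>G\<^esub> g = \<one>\<^bsub>G\<^esub>" using free[OF _ assms(3)] assms by simp
  then have "inv\<^bsub>G\<^esub> (inv\<^bsub>G\<^esub> k) = g" using assms by (intro G.inv_equality) (auto simp: G.inv_comm)
  then show ?thesis using assms by simp
qed

lemma S_sub: "S \<subseteq> carrier G"
  using generators by (simp add: symmetric_generating_set_def)

lemma Sn_carrier: "g \<in> Sn k \<Longrightarrow> g \<in> carrier G"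
  using G.word_ball_carrier[OF S_sub] by blast

lemma Sn_finite: "finite (Sn k)"
  by (rule G.word_ball_finite[OF generators(1)])

lemma Sn_card_pos: "card (Sn k) > 0"
  using Sn_finite G.word_ball_one by (auto simp: card_gt_0_iff)

lemma countable_G: "countable (carrier G)"
proof -
  have "carrier G \<subseteq> (\<Union>k. Sn k)"
  proof
    fix g assume "g \<in> carrier G"
    then obtain k where "g \<in> Sn k" by (rule G.word_ball_exhausts[OF generators(2)])
    then show "g \<in> (\<Union>k. Sn k)" by blast
  qed
  moreover have "countable (\<Union>k. Sn k)" using Sn_finite by (intro countable_UN) (auto intro: countable_finite)
  ultimately show ?thesis by (rule countable_subset)
qed

lemma atlas_lamination: "c \<in> \<U> \<Longrightarrow> c \<in> \<L>"
  using subsetD[OF atlas(2)[unfolded regular_atlas_def, THEN conjunct2, THEN conjunct1]] .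

lemma foliated_atlas: "foliated_atlas n X \<U>"
  using atlas(2)[unfolded regular_atlas_def, THEN conjunct1] .

lemma atlas_chart: "c \<in> \<U> \<Longrightarrow> foliated_chart n X c"
  using foliated_atlas[unfolded foliated_atlas_def, THEN conjunct1] by (rule bspec)

lemma atlas_cover: "x \<in> topspace X \<Longrightarrow> \<exists>c\<in>\<U>. x \<in> chart_dom c"
  using foliated_atlas[unfolded foliated_atlas_def, THEN conjunct2, THEN conjunct1, symmetric] by (simp only: UN_iff)

lemma atlas_plaque:
  assumes "a \<in> \<U>" "b \<in> \<U>" "P \<in> plaques a" "P \<inter> chart_dom b \<noteq> {}"
  obtains Q where "Q \<in> plaques b" "P \<inter> chart_dom b \<subseteq> Q"
proof -
  have ex: "\<forall>a\<in>\<U>. \<forall>b\<in>\<U>. \<forall>P\<in>plaques a. P \<inter> chart_dom b \<noteq> {} \<longrightarrow>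
      (\<exists>!Q. Q \<in> plaques b \<and> P \<inter> chart_dom b \<subseteq> Q)"
    using atlas(2)[unfolded regular_atlas_def] by (elim conjE)
  have "\<exists>!Q. Q \<in> plaques b \<and> P \<inter> chart_dom b \<subseteq> Q" by (rule ex[rule_format, OF assms])
  then show thesis using that by (elim ex1E conjE)
qed

lemma plaque_in_X: "c \<in> \<U> \<Longrightarrow> P \<in> plaques c \<Longrightarrow> P \<subseteq> topspace X"
proof -
  assume c: "c \<in> \<U>" "P \<in> plaques c"
  have "openin X (chart_dom c)" using atlas_chart[OF c(1)] by (simp add: foliated_chart_def)
  then have "chart_dom c \<subseteq> topspace X" by (rule openin_subset)
  then show ?thesis using c(2) unfolding plaques_def by blast
qed

text \<open>The plaques of \<open>c\<close> cut the box in exactly its slices.\<close>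

definition adapted :: "'u set \<Rightarrow> 'f set \<Rightarrow> ('u \<times> 'f) set chart \<Rightarrow> bool" where
  "adapted B O' c \<longleftrightarrow> q ` (B \<times> O') \<subseteq> chart_dom c \<and>
     (\<forall>v\<in>B. \<forall>v'\<in>B. \<forall>t\<in>O'. \<forall>t'\<in>O'.
        snd (chart_map c (q (v, t))) = snd (chart_map c (q (v', t'))) \<longleftrightarrow> t = t')"

lemma adapted_box_at:
  assumes u: "u \<in> Mt" "y \<in> topspace F" and V: "openin (top_of_set Mt) V" "u \<in> V"
  obtains B O' c where "openin (top_of_set Mt) B" "path_connected B" "openin F O'" "u \<in> B" "B \<subseteq> V" "y \<in> O'"
    "c \<in> \<U>" "adapted B O' c"
proof -
  obtain c where c: "c \<in> \<U>" "q (u, y) \<in> chart_dom c" using atlas_cover[OF q_in_X[OF u]] by blast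
  obtain B \<psi> \<phi> b r O' where B: "coordinate_ball n Mt p B \<psi> \<phi> b r" "u \<in> B" "B \<subseteq> V" "openin F O'" "y \<in> O'"
    "q ` (B \<times> O') \<subseteq> chart_dom c"
    "\<And>v v' t t'. \<lbrakk>v \<in> B; v' \<in> B; t \<in> O'; t' \<in> O'\<rbrakk> \<Longrightarrow>
       snd (chart_map c (q (v, t))) = snd (chart_map c (q (v', t'))) \<longleftrightarrow> t = t'"
    by (rule chart_local_form[OF atlas_lamination[OF c(1)] u c(2) V]) (rule that)
  have "adapted B O' c" unfolding adapted_def using B(6,7) by simp
  moreover have "openin (top_of_set Mt) B" using B(1) by (simp add: coordinate_ball_def)
  ultimately show thesis using that coordinate_ball_path_connected[OF B(1)] B(2-5) c(1) by blast
qed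

text \<open>By regularity the part of \<open>P\<close> in the domain of \<open>a\<close> lies in one plaque of \<open>a\<close>, which cuts the box in one
  slice.\<close>

lemma plaque_meets_slice:
  assumes c: "c \<in> \<U>" "P \<in> plaques c" and a: "a \<in> \<U>" "adapted B O' a"
    and z: "w \<in> B" "t \<in> O'" "q (w, t) \<in> P" and z': "w' \<in> B" "t' \<in> O'" "q (w', t') \<in> P"
  shows "t = t'"
proof -
  have d: "q (w, t) \<in> chart_dom a" "q (w', t') \<in> chart_dom a"
  proof -
    have "q ` (B \<times> O') \<subseteq> chart_dom a" by (rule conjunct1[OF a(2)[unfolded adapted_def]])
    moreover have "q (w, t) \<in> q ` (B \<times> O')" "q (w', t') \<in> q ` (B \<times> O')" using z z' by blast+
    ultimately show "q (w, t) \<in> chart_dom a" "q (w', t') \<in> chart_dom a" by blast+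
  qed
  then have "P \<inter> chart_dom a \<noteq> {}" using z by blast
  then obtain Q where Q: "Q \<in> plaques a" "P \<inter> chart_dom a \<subseteq> Q" by (rule atlas_plaque[OF c(1) a(1) c(2)])
  then have "q (w, t) \<in> Q" "q (w', t') \<in> Q" using d z z' by blast+
  then have "snd (chart_map a (q (w, t))) = snd (chart_map a (q (w', t')))"
    using Q(1) unfolding plaques_def by auto
  moreover have "\<forall>v\<in>B. \<forall>v'\<in>B. \<forall>t\<in>O'. \<forall>t'\<in>O'.
        snd (chart_map a (q (v, t))) = snd (chart_map a (q (v', t'))) \<longleftrightarrow> t = t'"
    by (rule conjunct2[OF a(2)[unfolded adapted_def]])
  ultimately show ?thesis using z z' by blast
qed

text \<open>Plaques of a regular atlas are coarsely bounded: a plaque is connected and covered by at most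
  one slice of each of finitely many boxes, and the slices of two boxes are joined by finitely many
  elements of the group.\<close>

lemma plaque_displacement:
  obtains E r where "E \<subseteq> Mt \<times> topspace F" "\<And>x. x \<in> topspace X \<Longrightarrow> \<exists>w t. (w, t) \<in> E \<and> x = q (w, t)"
    "\<And>y. y \<in> topspace F \<Longrightarrow> (u0, y) \<in> E"
    "\<And>c P w t w' t'. \<lbrakk>c \<in> \<U>; P \<in> plaques c; (w, t) \<in> E; (w', t') \<in> E; q (w, t) \<in> P; q (w', t') \<in> P\<rbrakk> \<Longrightarrow>
       \<exists>g\<in>Sn r. t' = g t"
proof -
  obtain V where V: "\<And>u. u \<in> Mt \<Longrightarrow> openin (top_of_set Mt) (V u) \<and> u \<in> V u"
    "\<And>u u' B B' c d. \<lbrakk>u \<in> Mt; u' \<in> Mt; B \<subseteq> V u; B' \<subseteq> V u'; connected B; connected B';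
        c \<in> carrier \<Gamma>; d \<in> carrier \<Gamma>; T c ` B \<inter> B' \<noteq> {}; T d ` B \<inter> B' \<noteq> {}\<rbrakk> \<Longrightarrow> c = d"
    by (rule small_neighbourhoods) (rule that)
  define P' where "P' B O' \<longleftrightarrow> connected B \<and> (\<exists>v\<in>Mt. B \<subseteq> V v) \<and> (\<exists>c\<in>\<U>. adapted B O' c)" for B O'
  have ex: "\<exists>B O'. openin (top_of_set Mt) B \<and> openin F O' \<and> u \<in> B \<and> y \<in> O' \<and> P' B O'"
    if u: "u \<in> Mt" "y \<in> topspace F" for u y
  proof -
    have Vu: "openin (top_of_set Mt) (V u)" "u \<in> V u" using V(1)[OF u(1)] by blast+
    obtain B O' c where B: "openin (top_of_set Mt) B" "path_connected B" "openin F O'" "u \<in> B" "B \<subseteq> V u" "y \<in> O'"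
        "c \<in> \<U>" "adapted B O' c" by (rule adapted_box_at[OF u Vu])
    then have "P' B O'" unfolding P'_def using u(1) path_connected_imp_connected by blast
    then show ?thesis using B by blast
  qed
  obtain \<B> where fin: "finite \<B>"
    and good: "\<And>B O'. (B, O') \<in> \<B> \<Longrightarrow> openin (top_of_set Mt) B \<and> openin F O' \<and> P' B O'"
    and covX: "\<And>x. x \<in> topspace X \<Longrightarrow> \<exists>(B, O')\<in>\<B>. x \<in> q ` (B \<times> O')"
    and cov0: "\<And>y. y \<in> topspace F \<Longrightarrow> \<exists>(B, O')\<in>\<B>. u0 \<in> B \<and> y \<in> O'"
    by (rule finite_boxes[OF ex]) (assumption | rule that)+
  have sub: "B \<subseteq> Mt" "O' \<subseteq> topspace F" if "(B, O') \<in> \<B>" for B O'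
    using good[OF that] openin_imp_subset openin_subset by blast+
  define E where "E = (\<Union>(B, O')\<in>\<B>. B \<times> O')"
  define J where "J b b' = {c \<in> carrier \<Gamma>. T c ` fst b \<inter> fst b' \<noteq> {}}" for b b' :: "'u set \<times> 'f set"
  have J: "finite (J b b')" if b: "b \<in> \<B>" "b' \<in> \<B>" for b b'
  proof -
    have g: "P' (fst b) (snd b)" "P' (fst b') (snd b')"
      using good[of "fst b" "snd b"] good[of "fst b'" "snd b'"] b by auto
    then obtain v v' where v: "v \<in> Mt" "fst b \<subseteq> V v" "v' \<in> Mt" "fst b' \<subseteq> V v'" "connected (fst b)" "connected (fst b')"
      unfolding P'_def by blast
    have "c = d" if "c \<in> J b b'" "d \<in> J b b'" for c d
      using V(2)[OF v(1,3,2,4,5,6), of c d] that unfolding J_def by blast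
    then have "J b b' = {} \<or> (\<exists>c. J b b' = {c})" by blast
    then show ?thesis by auto
  qed
  define Q where "Q = (\<Union>b\<in>\<B>. \<Union>b'\<in>\<B>. h ` J b b')"
  have "finite Q" unfolding Q_def using fin J by blast
  moreover have "Q \<subseteq> carrier G" unfolding Q_def J_def carrier_G by blast
  ultimately obtain k where k: "Q \<subseteq> Sn k" by (rule G.finite_in_word_ball[OF generators(2)])
  define r where "r = k * card (\<B> \<times> \<B>)"
  have disp: "\<exists>g\<in>Sn r. t' = g t"
    if c: "c \<in> \<U>" "P \<in> plaques c" and z: "(w, t) \<in> E" "(w', t') \<in> E" "q (w, t) \<in> P" "q (w', t') \<in> P"
    for c P w t w' t'
  proof -
    define box where "box b = q ` (fst b \<times> snd b)" for b :: "'u set \<times> 'f set"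
    have PX: "P \<subseteq> topspace X" by (rule plaque_in_X[OF c])
    have obox: "openin X (box b)" if "b \<in> \<B>" for b
      using open_q[of "fst b" "snd b"] good[of "fst b" "snd b"] that unfolding box_def by simp
    define R where "R = {(b, b'). b \<in> \<B> \<and> b' \<in> \<B> \<and> P \<inter> box b \<inter> box b' \<noteq> {}}"
    have RB: "R \<subseteq> \<B> \<times> \<B>" unfolding R_def by blast
    have finR: "finite R" using finite_subset[OF RB] fin by simp
    \<comment> \<open>Along a chain of \<open>i\<close> overlapping boxes the transverse coordinate moves in the ball of
      radius \<open>k * i\<close>.\<close>
    have walk: "\<exists>g\<in>Sn (k * i). s' = g s"
      if "(b, b') \<in> R ^^ i" "v \<in> fst b" "s \<in> snd b" "q (v, s) \<in> P" "v' \<in> fst b'" "s' \<in> snd b'" "q (v', s') \<in> P"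
        "b \<in> \<B>" for i b b' v s v' s'
      using that
    proof (induction i arbitrary: b' v' s')
      case 0
      then have "b' = b" by simp
      have g: "P' (fst b) (snd b)" using good[of "fst b" "snd b"] 0 by simp
      then obtain a where a: "a \<in> \<U>" "adapted (fst b) (snd b) a" unfolding P'_def by blast
      have "s = s'" by (rule plaque_meets_slice[OF c a]) (use 0 in auto)
      moreover have "s \<in> topspace F" using sub(2)[of "fst b" "snd b"] 0 by auto
      ultimately show ?case using G_one G.word_ball_one by (metis mult_0_right)
    next
      case (Suc i)
      then obtain b1 where b1: "(b, b1) \<in> R ^^ i" "(b1, b') \<in> R" by auto
      then have bB: "b1 \<in> \<B>" "b' \<in> \<B>" "P \<inter> box b1 \<inter> box b' \<noteq> {}" unfolding R_def by blast+
      then obtain x where x: "x \<in> P" "x \<in> box b1" "x \<in> box b'" by blast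
      obtain v1 s1 where 1: "v1 \<in> fst b1" "s1 \<in> snd b1" "x = q (v1, s1)" using x(2) unfolding box_def by blast
      obtain v2 s2 where 2: "v2 \<in> fst b'" "s2 \<in> snd b'" "x = q (v2, s2)" using x(3) unfolding box_def by blast
      have q1P: "q (v1, s1) \<in> P" and q2P: "q (v2, s2) \<in> P" using x(1) 1(3) 2(3) by auto
      obtain g where g: "g \<in> Sn (k * i)" "s1 = g s"
        using Suc.IH[OF b1(1) Suc.prems(2-4) 1(1,2) q1P Suc.prems(8)] by blast
      have m: "v1 \<in> Mt" "s1 \<in> topspace F" "v2 \<in> Mt" "s2 \<in> topspace F"
        using sub[of "fst b1" "snd b1"] sub[of "fst b'" "snd b'"] bB 1 2 by auto
      obtain d where d: "d \<in> carrier \<Gamma>" "v2 = T d v1" "s2 = h d s1"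
        using q_eq_iff[OF m] 1(3) 2(3) by auto
      have "d \<in> J b1 b'" unfolding J_def using d 1(1) 2(1) by auto
      then have hd: "h d \<in> Sn k" using k bB unfolding Q_def by blast
      have g': "P' (fst b') (snd b')" using good[of "fst b'" "snd b'"] bB by simp
      then obtain a where a: "a \<in> \<U>" "adapted (fst b') (snd b') a" unfolding P'_def by blast
      have s2: "s2 = s'" by (rule plaque_meets_slice[OF c a 2(1,2) q2P Suc.prems(5-7)])
      have sF: "s \<in> topspace F" using sub(2)[of "fst b" "snd b"] Suc.prems by auto
      have "s' = (h d \<otimes>\<^bsub>G\<^esub> g) s" using G_mult[OF h_G[OF d(1)] Sn_carrier[OF g(1)] sF] d(3) g(2) s2 by simp
      moreover have "h d \<otimes>\<^bsub>G\<^esub> g \<in> Sn (k + k * i)" by (rule G.word_ball_mult[OF S_sub hd g(1)])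
      ultimately show ?case by (metis mult_Suc_right)
    qed
    obtain b where b: "b \<in> \<B>" "w \<in> fst b" "t \<in> snd b" using z(1) unfolding E_def by force
    obtain b' where b': "b' \<in> \<B>" "w' \<in> fst b'" "t' \<in> snd b'" using z(2) unfolding E_def by force
    have reach: "(b, b') \<in> R\<^sup>*"
    proof (rule ccontr)
      assume n: "(b, b') \<notin> R\<^sup>*"
      define E1 where "E1 = (\<Union>e\<in>{e \<in> \<B>. (b, e) \<in> R\<^sup>*}. box e)"
      define E2 where "E2 = (\<Union>e\<in>{e \<in> \<B>. (b, e) \<notin> R\<^sup>*}. box e)"
      have o: "openin X E1" "openin X E2" unfolding E1_def E2_def using obox by blast+
      have cov: "P \<subseteq> E1 \<union> E2"
      proof
        fix x assume "x \<in> P"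
        then obtain B O' where "(B, O') \<in> \<B>" "x \<in> q ` (B \<times> O')" using covX PX by blast
        then have "x \<in> box (B, O')" by (simp add: box_def)
        then show "x \<in> E1 \<union> E2" using \<open>(B, O') \<in> \<B>\<close> unfolding E1_def E2_def by blast
      qed
      have dis: "E1 \<inter> E2 \<inter> P = {}"
      proof (rule ccontr)
        assume "E1 \<inter> E2 \<inter> P \<noteq> {}"
        then obtain x e e' where x: "x \<in> P" "e \<in> \<B>" "(b, e) \<in> R\<^sup>*" "x \<in> box e" "e' \<in> \<B>" "(b, e') \<notin> R\<^sup>*" "x \<in> box e'"
          unfolding E1_def E2_def by blast
        then have "(e, e') \<in> R" unfolding R_def by blast
        then show False using x(3,6) by (meson rtrancl.rtrancl_into_rtrancl)
      qed
      have "q (w, t) \<in> box b" "q (w', t') \<in> box b'" using b b' unfolding box_def by blast+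
      then have "q (w, t) \<in> E1" "q (w', t') \<in> E2" using b(1) b'(1) n unfolding E1_def E2_def by blast+
      then have ne: "E1 \<inter> P \<noteq> {}" "E2 \<inter> P \<noteq> {}" using z by blast+
      have "connectedin X P" by (rule plaque_connected[OF atlas_chart[OF c(1)] c(2)])
      then show False using o cov dis ne unfolding connectedin by blast
    qed
    then obtain i where i: "i \<le> card R" "(b, b') \<in> R ^^ i"
      unfolding rtrancl_finite_eq_relpow[OF finR] by blast
    have "card R \<le> card (\<B> \<times> \<B>)" using card_mono[OF _ RB] fin by simp
    then have "k * i \<le> r" unfolding r_def using i(1) by simp
    moreover obtain g where "g \<in> Sn (k * i)" "t' = g t"
      using walk[OF i(2) b(2,3) z(3) b'(2,3) z(4) b(1)] by blast
    ultimately show ?thesis using G.word_ball_mono[of "k * i" r S] by blast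
  qed
  show thesis
  proof (rule that[of E r])
    show "E \<subseteq> Mt \<times> topspace F" unfolding E_def using sub by blast
    show "\<exists>w t. (w, t) \<in> E \<and> x = q (w, t)" if "x \<in> topspace X" for x
      using covX[OF that] unfolding E_def by blast
    show "(u0, y) \<in> E" if "y \<in> topspace F" for y using cov0[OF that] unfolding E_def by blast
  qed (rule disp)
qed

text \<open>Each plaque of a chain displaces the fibre coordinate by an element of a fixed ball of the group. Two
  chains with a common point are followed one after the other, so the radii add up; one more than twice
  the bound for a single plaque keeps the factor positive.\<close>

lemma common_endpoint:
  obtains r where "r \<ge> 1" "\<And>m Ps Ps' y y' x.
    \<lbrakk>plaque_chain \<U> Ps; plaque_chain \<U> Ps'; length Ps \<le> m; length Ps' \<le> m; y \<in> topspace F; y' \<in> topspace F;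
     q (u0, y) \<in> \<Union>(set Ps); x \<in> \<Union>(set Ps); q (u0, y') \<in> \<Union>(set Ps'); x \<in> \<Union>(set Ps')\<rbrakk> \<Longrightarrow>
    \<exists>g\<in>Sn (r * m). y' = g y"
proof -
  obtain E r where E: "E \<subseteq> Mt \<times> topspace F" "\<And>x. x \<in> topspace X \<Longrightarrow> \<exists>w t. (w, t) \<in> E \<and> x = q (w, t)"
    "\<And>y. y \<in> topspace F \<Longrightarrow> (u0, y) \<in> E"
    "\<And>c P w t w' t'. \<lbrakk>c \<in> \<U>; P \<in> plaques c; (w, t) \<in> E; (w', t') \<in> E; q (w, t) \<in> P; q (w', t') \<in> P\<rbrakk> \<Longrightarrow>
       \<exists>g\<in>Sn r. t' = g t"
    by (rule plaque_displacement) (rule that)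
  have mult: "(g \<otimes>\<^bsub>G\<^esub> k) t = g (k t)" if "g \<in> Sn i" "k \<in> Sn j" "t \<in> topspace F" for g k i j t
    using G_mult[OF Sn_carrier[OF that(1)] Sn_carrier[OF that(2)] that(3)] .
  have step: "\<exists>g\<in>Sn (r * Suc k). t' = g t"
    if ch: "plaque_chain \<U> Ps" and "i + k < length Ps" "(w, t) \<in> E" "q (w, t) \<in> Ps ! i" "(w', t') \<in> E" "q (w', t') \<in> Ps ! (i + k)"
    for Ps k i w t w' t'
    using that(2-6)
  proof (induction k arbitrary: i w t)
    case 0
    have "i < length Ps" using 0 by simp
    then obtain c where "c \<in> \<U>" "Ps ! i \<in> plaques c" by (rule chain_nth[OF ch])
    then show ?case using E(4)[of c "Ps ! i" w t w' t'] 0 by simp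
  next
    case (Suc k)
    have "i < length Ps" using Suc.prems(1) by simp
    then obtain c where c: "c \<in> \<U>" "Ps ! i \<in> plaques c" by (rule chain_nth[OF ch])
    have "Ps ! i \<inter> Ps ! Suc i \<noteq> {}" using ch Suc.prems(1) unfolding plaque_chain_def by auto
    then obtain x where x: "x \<in> Ps ! i" "x \<in> Ps ! Suc i" by blast
    obtain v s where v: "(v, s) \<in> E" "x = q (v, s)" using E(2) plaque_in_X[OF c] x(1) by blast
    obtain g where g: "g \<in> Sn r" "s = g t" using E(4)[OF c Suc.prems(2) v(1) Suc.prems(3)] x(1) v(2) by blast
    have "Suc i + k < length Ps" "q (v, s) \<in> Ps ! Suc i" "q (w', t') \<in> Ps ! (Suc i + k)"
      using Suc.prems x v by auto
    then obtain g' where g': "g' \<in> Sn (r * Suc k)" "t' = g' s"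
      using Suc.IH[of "Suc i" v s] v(1) Suc.prems(4) by blast
    have "t \<in> topspace F" using E(1) Suc.prems(2) by blast
    then have "t' = (g' \<otimes>\<^bsub>G\<^esub> g) t" using mult[OF g'(1) g(1)] g(2) g'(2) by simp
    moreover have "g' \<otimes>\<^bsub>G\<^esub> g \<in> Sn (r * Suc k + r)" by (rule G.word_ball_mult[OF S_sub g'(1) g(1)])
    moreover have "r * Suc k + r = r * Suc (Suc k)" by simp
    ultimately show ?case by metis
  qed
  have chain: "\<exists>g\<in>Sn (r * m). t' = g t"
    if ch: "plaque_chain \<U> Ps" "length Ps \<le> m" and z: "(w, t) \<in> E" "q (w, t) \<in> \<Union>(set Ps)" "(w', t') \<in> E" "q (w', t') \<in> \<Union>(set Ps)"
    for Ps m w t w' t'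
  proof -
    obtain i where i: "i < length Ps" "q (w, t) \<in> Ps ! i" using z(2) by (auto simp: in_set_conv_nth)
    obtain j where j: "j < length Ps" "q (w', t') \<in> Ps ! j" using z(4) by (auto simp: in_set_conv_nth)
    have tF: "t \<in> topspace F" "t' \<in> topspace F" using E(1) z by blast+
    have mono: "Sn (r * Suc k) \<subseteq> Sn (r * m)" if "k < length Ps" for k
    proof (rule G.word_ball_mono)
      have "Suc k \<le> m" using that ch(2) by simp
      then show "r * Suc k \<le> r * m" by (rule mult_le_mono2)
    qed
    show ?thesis
    proof (cases "i \<le> j")
      case True
      then have "i + (j - i) < length Ps" "q (w', t') \<in> Ps ! (i + (j - i))" using j by auto
      then obtain g where "g \<in> Sn (r * Suc (j - i))" "t' = g t"
        using step[OF ch(1) _ z(1) i(2) z(3)] by blast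
      moreover have "j - i < length Ps" using j by simp
      ultimately show ?thesis using mono by blast
    next
      case False
      then have "j + (i - j) < length Ps" "q (w, t) \<in> Ps ! (j + (i - j))" using i by auto
      then obtain g where g: "g \<in> Sn (r * Suc (i - j))" "t = g t'"
        using step[OF ch(1) _ z(3) j(2) z(1)] by blast
      have "t' = (inv\<^bsub>G\<^esub> g) t" using G_inv(1)[OF Sn_carrier[OF g(1)] tF(2)] g(2) by simp
      moreover have "inv\<^bsub>G\<^esub> g \<in> Sn (r * Suc (i - j))" by (rule G.word_ball_inv[OF generators(2) g(1)])
      moreover have "i - j < length Ps" using i by simp
      ultimately show ?thesis using mono by blast
    qed
  qed
  show thesis
  proof (rule that[of "2 * r + 1"])
    fix m Ps Ps' y y' x
    assume as: "plaque_chain \<U> Ps" "plaque_chain \<U> Ps'" "length Ps \<le> m" "length Ps' \<le> m" "y \<in> topspace F" "y' \<in> topspace F"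
     "q (u0, y) \<in> \<Union>(set Ps)" "x \<in> \<Union>(set Ps)" "q (u0, y') \<in> \<Union>(set Ps')" "x \<in> \<Union>(set Ps')"
    obtain P where P: "P \<in> set Ps" "x \<in> P" using as(8) by blast
    then obtain c where c: "c \<in> \<U>" "P \<in> plaques c" using as(1) unfolding plaque_chain_def by blast
    obtain w t where w: "(w, t) \<in> E" "x = q (w, t)" using E(2) plaque_in_X[OF c] P(2) by blast
    have w': "q (w, t) \<in> \<Union>(set Ps)" "q (w, t) \<in> \<Union>(set Ps')" using w as by auto
    obtain g where g: "g \<in> Sn (r * m)" "t = g y" using chain[OF as(1,3) E(3)[OF as(5)] as(7) w(1) w'(1)] by blast
    obtain g' where g': "g' \<in> Sn (r * m)" "y' = g' t" using chain[OF as(2,4) w(1) w'(2) E(3)[OF as(6)] as(9)] by blast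
    have "y' = (g' \<otimes>\<^bsub>G\<^esub> g) y" using mult[OF g'(1) g(1) as(5)] g(2) g'(2) by simp
    moreover have "g' \<otimes>\<^bsub>G\<^esub> g \<in> Sn (r * m + r * m)" by (rule G.word_ball_mult[OF S_sub g'(1) g(1)])
    moreover have "r * m + r * m \<le> (2 * r + 1) * m" by simp
    ultimately show "\<exists>g\<in>Sn ((2 * r + 1) * m). y' = g y" using G.word_ball_mono by blast
  qed simp
qed

end

section \<open>Ends of tangential contractions\<close>

lemma second_countable_prod:
  assumes "second_countable Y1" "second_countable Y2"
  shows "second_countable (prod_topology Y1 Y2)"
proof -
  obtain B1 where B1: "countable B1" "\<And>V. V \<in> B1 \<Longrightarrow> openin Y1 V"
      "\<And>U x. openin Y1 U \<Longrightarrow> x \<in> U \<Longrightarrow> \<exists>V\<in>B1. x \<in> V \<and> V \<subseteq> U"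
    using assms(1) unfolding second_countable_def by metis
  obtain B2 where B2: "countable B2" "\<And>V. V \<in> B2 \<Longrightarrow> openin Y2 V"
      "\<And>U x. openin Y2 U \<Longrightarrow> x \<in> U \<Longrightarrow> \<exists>V\<in>B2. x \<in> V \<and> V \<subseteq> U"
    using assms(2) unfolding second_countable_def by metis
  let ?B = "(\<lambda>(V, W). V \<times> W) ` (B1 \<times> B2)"
  have "countable ?B" using B1(1) B2(1) by simp
  moreover have "openin (prod_topology Y1 Y2) V" if "V \<in> ?B" for V
    using that B1(2) B2(2) by (auto simp: openin_prod_Times_iff)
  moreover have "\<exists>V\<in>?B. x \<in> V \<and> V \<subseteq> U" if U': "openin (prod_topology Y1 Y2) U \<and> x \<in> U" for U x
  proof -
    have U: "openin (prod_topology Y1 Y2) U" "x \<in> U" using U' by blast+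
    obtain a b where x: "x = (a, b)" by (cases x)
    obtain V W where V: "openin Y1 V" "openin Y2 W" "a \<in> V" "b \<in> W" "V \<times> W \<subseteq> U"
      using U(1)[unfolded openin_prod_topology_alt, rule_format, of a b] U(2) x by blast
    obtain V' W' where "V' \<in> B1" "a \<in> V'" "V' \<subseteq> V" "W' \<in> B2" "b \<in> W'" "W' \<subseteq> W"
      using B1(3)[OF V(1,3)] B2(3)[OF V(2,4)] by blast
    then show ?thesis using V(5) x by (intro bexI[of _ "V' \<times> W'"]) auto
  qed
  ultimately show ?thesis unfolding second_countable_def
    by (intro exI[of _ ?B] conjI ballI allI impI) (simp_all only: simp_thms)
qed

lemma second_countable_top_of_set: "second_countable (top_of_set (S :: 'a::second_countable_topology set))"
proof -
  obtain B :: "'a set set" where B: "countable B" "topological_basis B" using ex_countable_basis by blast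
  have "openin euclidean V" if "V \<in> B" for V by (rule open_openin[THEN iffD1, OF topological_basis_open[OF B(2) that]])
  moreover have "\<exists>V\<in>B. x \<in> V \<and> V \<subseteq> U" if U: "openin euclidean U \<and> x \<in> U" for U and x :: 'a
  proof -
    have "open U" by (rule open_openin[THEN iffD2, OF conjunct1[OF U]])
    then obtain V where "V \<in> B" "x \<in> V" "V \<subseteq> U" using topological_basisE[OF B(2), of U x] U by blast
    then show ?thesis by blast
  qed
  ultimately have "second_countable (euclidean :: 'a topology)"
    unfolding second_countable_def using B(1) by (intro exI[of _ B] conjI ballI allI impI) simp_all
  then show ?thesis by (rule second_countable_subtopology)
qed

lemma coordinate_ball_second_countable:
  assumes "coordinate_ball n C p W \<psi> \<phi> c r" shows "second_countable (top_of_set W)"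
proof -
  have "homeomorphic_maps (top_of_set W) (top_of_set (euclidean_ball n c r)) \<psi> \<phi>"
    using assms by (auto simp: coordinate_ball_def homeomorphic_maps_def homeomorphism_def)
  then have "top_of_set W homeomorphic_space top_of_set (euclidean_ball n c r)"
    unfolding homeomorphic_space_def by blast
  then show ?thesis using homeomorphic_space_second_countability second_countable_top_of_set by blast
qed

lemma compact_neighbourhood:
  assumes F: "compact_space F" "Hausdorff_space F" and O': "openin F O'" "y \<in> O'"
  obtains V K where "openin F V" "y \<in> V" "V \<subseteq> K" "K \<subseteq> O'" "compactin F K"
proof -
  have "regular_space F" using F by (rule compact_Hausdorff_imp_regular_space)
  moreover have "closedin F (topspace F - O')" using O' by blast
  moreover have "y \<in> topspace F - (topspace F - O')" using O' openin_subset by blast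
  ultimately obtain U V where UV: "openin F U" "openin F V" "y \<in> U" "topspace F - O' \<subseteq> V" "disjnt U V"
    unfolding regular_space_def by metis
  have "compactin F (topspace F - V)" using closedin_compact_space[OF F(1)] UV(2) by blast
  moreover have "U \<subseteq> topspace F - V" using UV openin_subset unfolding disjnt_def by blast
  moreover have "topspace F - V \<subseteq> O'" using UV(4) by blast
  ultimately show thesis using that UV(1,3) by blast
qed

lemma sets_borel_of: "sets (borel_of Y) = sigma_sets (topspace Y) {U. openin Y U}"
  and space_borel_of: "space (borel_of Y) = topspace Y"
  unfolding borel_of_def using openin_subset by (auto intro!: sets_measure_of space_measure_of)

lemma borel_of_open: "openin Y U \<Longrightarrow> U \<in> sets (borel_of Y)"
  unfolding sets_borel_of by blast

lemma borel_of_closed: "closedin Y C \<Longrightarrow> C \<in> sets (borel_of Y)"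
proof -
  assume C: "closedin Y C"
  have "topspace Y - (topspace Y - C) \<in> sets (borel_of Y)"
    using borel_of_open[of Y "topspace Y - C"] C sets.compl_sets[of "topspace Y - C" "borel_of Y"]
    by (simp add: space_borel_of openin_diff)
  moreover have "topspace Y - (topspace Y - C) = C" using closedin_subset[OF C] by blast
  ultimately show ?thesis by simp
qed

lemma borel_of_compact: "Hausdorff_space Y \<Longrightarrow> compactin Y K \<Longrightarrow> K \<in> sets (borel_of Y)"
  using borel_of_closed compactin_imp_closedin by blast

lemma measurable_borel_of_restrict:
  assumes T: "T \<in> sets (borel_of Y)" and f: "continuous_map (subtopology Y T) Y f" "f ` T \<subseteq> T'"
  shows "f \<in> restrict_space (borel_of Y) T \<rightarrow>\<^sub>M restrict_space (borel_of Y) T'"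
proof -
  have TY: "T \<subseteq> topspace Y" using sets.sets_into_space[OF T] by (simp add: space_borel_of)
  have sp: "space (restrict_space (borel_of Y) T) = T" using TY by (simp add: space_restrict_space space_borel_of inf.absorb1)
  have "f \<in> restrict_space (borel_of Y) T \<rightarrow>\<^sub>M borel_of Y"
    unfolding borel_of_def[of Y, THEN eq_reflection, unfolded atomize_eq]
  proof -
    show "f \<in> restrict_space (sigma (topspace Y) {U. openin Y U}) T \<rightarrow>\<^sub>M sigma (topspace Y) {U. openin Y U}"
    proof (rule measurable_measure_of)
      show "{U. openin Y U} \<subseteq> Pow (topspace Y)" using openin_subset by blast
      show "f \<in> space (restrict_space (sigma (topspace Y) {U. openin Y U}) T) \<rightarrow> topspace Y"
        using f(1) sp TY unfolding borel_of_def by (auto simp: continuous_map_def)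
      fix U assume "U \<in> {U. openin Y U}"
      then have "openin (subtopology Y T) {x \<in> topspace (subtopology Y T). f x \<in> U}"
        using f(1) by (auto simp: continuous_map_def)
      moreover have "{x \<in> topspace (subtopology Y T). f x \<in> U} = f -` U \<inter> T" using TY by auto
      ultimately obtain V where V: "openin Y V" "f -` U \<inter> T = V \<inter> T" unfolding openin_subtopology by auto
      have "V \<inter> T \<in> sets (restrict_space (borel_of Y) T)"
        using T borel_of_open[OF V(1)] by (simp add: sets_restrict_space_iff space_borel_of TY inf.absorb1)
      then show "f -` U \<inter> space (restrict_space (sigma (topspace Y) {U. openin Y U}) T)
          \<in> sets (restrict_space (sigma (topspace Y) {U. openin Y U}) T)"
        using V(2) sp unfolding borel_of_def by simp
    qed
  qed
  then show ?thesis using f(2) sp by (intro measurable_restrict_space2) auto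
qed

context suspension
begin

lemma ball_cover:
  assumes ex: "\<And>u. u \<in> Mt \<Longrightarrow> \<exists>W \<psi> \<phi> c r. coordinate_ball n Mt p W \<psi> \<phi> c r \<and> u \<in> W \<and> P W"
  obtains \<W> where "finite \<W>" "\<And>W. W \<in> \<W> \<Longrightarrow> (\<exists>\<psi> \<phi> c r. coordinate_ball n Mt p W \<psi> \<phi> c r) \<and> P W"
    "\<And>x. x \<in> topspace X \<Longrightarrow> \<exists>W\<in>\<W>. x \<in> q ` (W \<times> topspace F)"
proof -
  define good where "good u W \<longleftrightarrow> (\<exists>\<psi> \<phi> c r. coordinate_ball n Mt p W \<psi> \<phi> c r) \<and> u \<in> W \<and> P W" for u W
  define N where "N u = (SOME W. good u W)" for u
  have N: "good u (N u)" if "u \<in> Mt" for u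
    unfolding N_def by (rule someI_ex) (use ex[OF that] in \<open>auto simp: good_def\<close>)
  have o: "openin (top_of_set Mt) (N u) \<and> u \<in> N u" if "u \<in> Mt" for u
    using N[OF that] unfolding good_def coordinate_ball_def by blast
  obtain K where K: "finite K" "K \<subseteq> Mt" "M = (\<Union>u\<in>K. p ` N u)" by (rule finite_subcover_M[OF o])
  have sub: "N u \<subseteq> Mt" if "u \<in> K" for u using o[of u] that K(2) openin_imp_subset by blast
  have cov: "\<exists>W\<in>N ` K. x \<in> q ` (W \<times> topspace F)" if x: "x \<in> topspace X" for x
  proof -
    obtain u w y where "u \<in> K" "w \<in> N u" "y \<in> topspace F" "x = q (w, y)"
      by (rule over_cover[OF K(3) sub x])
    then show ?thesis by blast
  qed
  have g: "(\<exists>\<psi> \<phi> c r. coordinate_ball n Mt p W \<psi> \<phi> c r) \<and> P W" if "W \<in> N ` K" for W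
    using that N K(2) unfolding good_def by blast
  have "finite (N ` K)" using K(1) by simp
  then show thesis using g cov by (rule that)
qed

text \<open>The leaf of \<open>U\<close> through \<open>x\<close> is carried into one leaf, which contains \<open>x = H (x, 0)\<close>.\<close>

lemma contraction_leaf:
  assumes H: "H \<in> tangential_contractions X \<L> U" and x: "x \<in> U"
  obtains L where "L \<in> leaves \<L>" "x \<in> L" "\<And>t. H (x, t) \<in> L"
proof -
  have D: "openin X U" "\<And>L. L \<in> leaves_in U \<Longrightarrow> \<exists>L'\<in>leaves \<L>. H ` (L \<times> UNIV) \<subseteq> L'" "H (x, 0) = x"
    using H x unfolding tangential_contractions_def tangential_deformation_def by blast+
  obtain L where L: "L \<in> leaves_in U" "x \<in> L" by (rule leaf_exists[OF D(1) x])
  obtain L' where L': "L' \<in> leaves \<L>" "H ` (L \<times> UNIV) \<subseteq> L'" using D(2)[OF L(1)] by blast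
  have "H (x, t) \<in> L'" for t using L'(2) L(2) by blast
  moreover from this[of 0] have "x \<in> L'" using D(3) by simp
  ultimately show thesis using that L'(1) by blast
qed

lemma contraction_constant:
  assumes H: "H \<in> tangential_contractions X \<L> U" and B: "B \<subseteq> Mt" "connected B" and y: "y \<in> topspace F"
    and BU: "q ` (B \<times> {y}) \<subseteq> U" and b: "b \<in> B" "b' \<in> B"
  shows "H (q (b, y), 1) = H (q (b', y), 1)"
proof -
  have D: "openin X U" "\<And>L. L \<in> leaves_in U \<Longrightarrow> \<exists>z. \<forall>x\<in>L. H (x, 1) = z"
    using H unfolding tangential_contractions_def tangential_deformation_def by blast+
  have qb: "q (b, y) \<in> U" "q (b, y) \<in> q ` (B \<times> {y})" "q (b', y) \<in> q ` (B \<times> {y})" using BU b by blast+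
  obtain L where L: "L \<in> leaves_in U" "q (b, y) \<in> L" by (rule leaf_exists[OF D(1) qb(1)])
  have "q ` (B \<times> {y}) \<subseteq> L" by (rule slice_in_leaf[OF D(1) B y BU L qb(2)])
  then have "q (b', y) \<in> L" using qb(3) by blast
  then show ?thesis using D(2)[OF L(1)] L(2) by metis
qed

lemma contraction_continuous:
  assumes H: "H \<in> tangential_contractions X \<L> U"
  shows "continuous_map (subtopology X U) X (\<lambda>x. H (x, t))"
proof -
  have c: "continuous_map (prod_topology (subtopology X U) euclideanreal) X H"
    using H unfolding tangential_contractions_def tangential_deformation_def by blast
  have "continuous_map (subtopology X U) (prod_topology (subtopology X U) euclideanreal) (\<lambda>x. (x, t))"
    by (intro continuous_map_pairedI) (auto simp: continuous_map_id[unfolded id_def])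
  then have "continuous_map (subtopology X U) X (H \<circ> (\<lambda>x. (x, t)))" using c by (rule continuous_map_compose)
  then show ?thesis by (simp add: comp_def)
qed

text \<open>The end of a tangential contraction is the union of countably many continuous images of compact
  subsets of fibres: since it is constant on the slices of small boxes, it takes the same values on a
  box as on one of its fibres.\<close>

lemma contraction_pieces:
  assumes H: "H \<in> tangential_contractions X \<L> U"
  obtains \<D> where "countable \<D>" "\<And>w K. (w, K) \<in> \<D> \<Longrightarrow> w \<in> Mt \<and> compactin F K \<and> q ` ({w} \<times> K) \<subseteq> U"
    "H ` (U \<times> {1}) = (\<Union>(w, K)\<in>\<D>. (\<lambda>x. H (x, 1)) ` q ` ({w} \<times> K))"
proof -
  let ?\<kappa> = "\<lambda>x. H (x, 1)"
  have U: "openin X U" using H unfolding tangential_contractions_def tangential_deformation_def by blast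
  define ok where "ok w K \<longleftrightarrow> w \<in> Mt \<and> compactin F K \<and> q ` ({w} \<times> K) \<subseteq> U" for w K
  have loc: "\<exists>\<D>. countable \<D> \<and> (\<forall>(w, K)\<in>\<D>. ok w K) \<and>
      ?\<kappa> ` (U \<inter> q ` (W \<times> topspace F)) \<subseteq> (\<Union>(w, K)\<in>\<D>. ?\<kappa> ` q ` ({w} \<times> K))"
    if W: "coordinate_ball n Mt p W \<psi> \<phi> c r" for W \<psi> \<phi> c r
  proof -
    have WM: "W \<subseteq> Mt" and oW: "openin (top_of_set Mt) W"
      using W openin_imp_subset unfolding coordinate_ball_def by blast+
    define U' where "U' = {z \<in> W \<times> topspace F. q z \<in> U}"
    let ?Y = "subtopology (prod_topology (top_of_set W) F) U'"
    have tY: "topspace ?Y = U'" unfolding U'_def by auto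
    have "Lindelof_space ?Y"
      by (intro second_countable_imp_Lindelof_space second_countable_subtopology second_countable_prod
          coordinate_ball_second_countable[OF W] second_countable_F)
    define cov where "cov V w K \<longleftrightarrow> ok w K \<and> ?\<kappa> ` q ` V \<subseteq> ?\<kappa> ` q ` ({w} \<times> K)" for V w K
    define \<C> where "\<C> = {V. openin ?Y V \<and> (\<exists>w K. cov V w K)}"
    have "topspace ?Y \<subseteq> \<Union>\<C>"
    proof
      fix z assume "z \<in> topspace ?Y"
      then have "z \<in> U'" using tY by simp
      then obtain w y where z: "z = (w, y)" "w \<in> W" "y \<in> topspace F" "q (w, y) \<in> U" unfolding U'_def by blast
      have wM: "w \<in> Mt" using z(2) WM by blast
      obtain A O' where A: "openin (top_of_set Mt) A" "openin F O'" "w \<in> A" "y \<in> O'" "q ` (A \<times> O') \<subseteq> U"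
        by (rule X_box[OF U wM z(3,4)])
      have oAW: "openin (top_of_set Mt) (A \<inter> W)" "w \<in> A \<inter> W" using A oW z by auto
      obtain B \<psi>' \<phi>' c' r' where B: "coordinate_ball n Mt p B \<psi>' \<phi>' c' r'" "w \<in> B" "B \<subseteq> A \<inter> W"
        by (rule ball_at[OF oAW])
      have BM: "B \<subseteq> Mt" and oB: "openin (top_of_set Mt) B" using B(1) openin_imp_subset unfolding coordinate_ball_def by blast+
      have conB: "connected B" by (rule path_connected_imp_connected[OF coordinate_ball_path_connected[OF B(1)]])
      obtain V K where V: "openin F V" "y \<in> V" "V \<subseteq> K" "K \<subseteq> O'" "compactin F K"
        by (rule compact_neighbourhood[OF compact_F hausdorff_F A(2,4)])
      have KF: "K \<subseteq> topspace F" using V(5) compactin_subset_topspace by blast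
      have sub: "q (b, t) \<in> U" if "b \<in> B" "t \<in> K" for b t using that B(3) V(4) A(5) by blast
      have oBW: "openin (top_of_set W) B"
        using openin_subset_trans[OF oB _ WM] B(3) by blast
      have "openin (prod_topology (top_of_set W) F) (B \<times> V)" using oBW V(1) by (simp add: openin_prod_Times_iff)
      moreover have "B \<times> V \<subseteq> U'" unfolding U'_def using B(3) V(3) KF sub by blast
      ultimately have "openin ?Y (B \<times> V)" by (metis inf.absorb_iff2 openin_subtopology_Int2)
      moreover have "cov (B \<times> V) w K" unfolding cov_def
      proof
        show "ok w K" unfolding ok_def using wM V(5) sub[OF B(2)] by blast
        show "?\<kappa> ` q ` (B \<times> V) \<subseteq> ?\<kappa> ` q ` ({w} \<times> K)"
        proof clarify
          fix b t assume bt: "b \<in> B" "t \<in> V"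
          have tK: "t \<in> K" "t \<in> topspace F" using bt V(3) KF by blast+
          have "q ` (B \<times> {t}) \<subseteq> U" using sub tK by blast
          then have "H (q (b, t), 1) = H (q (w, t), 1)"
            by (rule contraction_constant[OF H BM conB tK(2) _ bt(1) B(2)])
          then show "H (q (b, t), 1) \<in> ?\<kappa> ` q ` ({w} \<times> K)" using tK(1) by (auto simp: image_iff)
        qed
      qed
      ultimately have "B \<times> V \<in> \<C>" unfolding \<C>_def by blast
      then show "z \<in> \<Union>\<C>" using z(1) B(2) V(2) by blast
    qed
    moreover have "\<forall>V\<in>\<C>. openin ?Y V" unfolding \<C>_def by blast
    ultimately obtain \<V> where \<V>: "countable \<V>" "\<V> \<subseteq> \<C>" "topspace ?Y \<subseteq> \<Union>\<V>"
      using \<open>Lindelof_space ?Y\<close>[unfolded Lindelof_space_alt, rule_format, of \<C>] by blast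
    define f where "f V = (SOME z. cov V (fst z) (snd z))" for V
    have f: "cov V (fst (f V)) (snd (f V))" if "V \<in> \<V>" for V
    proof -
      have "\<exists>w K. cov V w K" using that \<V>(2) unfolding \<C>_def by blast
      then have "\<exists>z. cov V (fst z) (snd z)" by auto
      then show ?thesis unfolding f_def by (rule someI_ex)
    qed
    have "?\<kappa> ` (U \<inter> q ` (W \<times> topspace F)) \<subseteq> (\<Union>(w, K)\<in>f ` \<V>. ?\<kappa> ` q ` ({w} \<times> K))"
    proof clarify
      fix w y assume "q (w, y) \<in> U" "w \<in> W" "y \<in> topspace F"
      then have "(w, y) \<in> U'" unfolding U'_def by simp
      then have "(w, y) \<in> topspace ?Y" using tY by simp
      then obtain V where V: "V \<in> \<V>" "(w, y) \<in> V" using \<V>(3) by blast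
      then have "H (q (w, y), 1) \<in> ?\<kappa> ` q ` V" by blast
      then have "H (q (w, y), 1) \<in> ?\<kappa> ` q ` ({fst (f V)} \<times> snd (f V))" using f[OF V(1)] unfolding cov_def by blast
      then show "H (q (w, y), 1) \<in> (\<Union>(w, K)\<in>f ` \<V>. ?\<kappa> ` q ` ({w} \<times> K))"
        using V(1) by (intro UN_I[of "f V"]) (auto simp: split_beta)
    qed
    moreover have "\<forall>(w, K)\<in>f ` \<V>. ok w K" using f unfolding cov_def by (auto simp: split_beta)
    ultimately show ?thesis using \<V>(1) by (intro exI[of _ "f ` \<V>"]) auto
  qed
  have ballex: "\<exists>W \<psi> \<phi> c r. coordinate_ball n Mt p W \<psi> \<phi> c r \<and> u \<in> W \<and> True" if u: "u \<in> Mt" for u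
  proof -
    have oM: "openin (top_of_set Mt) Mt" by simp
    obtain W \<psi> \<phi> c r where "coordinate_ball n Mt p W \<psi> \<phi> c r" "u \<in> W" "W \<subseteq> Mt" by (rule ball_at[OF oM u])
    then show ?thesis by blast
  qed
  obtain \<W> where \<W>: "finite \<W>" "\<And>W. W \<in> \<W> \<Longrightarrow> (\<exists>\<psi> \<phi> c r. coordinate_ball n Mt p W \<psi> \<phi> c r) \<and> True"
    "\<And>x. x \<in> topspace X \<Longrightarrow> \<exists>W\<in>\<W>. x \<in> q ` (W \<times> topspace F)"
    by (rule ball_cover[of "\<lambda>_. True", OF ballex]) (assumption | rule that)+
  define fits where "fits W \<D> \<longleftrightarrow> countable \<D> \<and> (\<forall>(w, K)\<in>\<D>. ok w K) \<and>
      ?\<kappa> ` (U \<inter> q ` (W \<times> topspace F)) \<subseteq> (\<Union>(w, K)\<in>\<D>. ?\<kappa> ` q ` ({w} \<times> K))" for W \<D>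
  define d where "d W = (SOME \<D>. fits W \<D>)" for W
  have d: "fits W (d W)" if W: "W \<in> \<W>" for W
  proof -
    obtain \<psi> \<phi> c r where "coordinate_ball n Mt p W \<psi> \<phi> c r" using \<W>(2)[OF W] by blast
    then have "\<exists>\<D>. fits W \<D>" unfolding fits_def by (rule loc)
    then show ?thesis unfolding d_def by (rule someI_ex)
  qed
  define \<D> where "\<D> = (\<Union>W\<in>\<W>. d W)"
  have 1: "countable \<D>" unfolding \<D>_def
    by (rule countable_UN[OF countable_finite[OF \<W>(1)]]) (use d in \<open>auto simp: fits_def\<close>)
  have 2: "w \<in> Mt \<and> compactin F K \<and> q ` ({w} \<times> K) \<subseteq> U" if "(w, K) \<in> \<D>" for w K
    using that d unfolding \<D>_def fits_def ok_def by blast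
  have 3: "H ` (U \<times> {1}) = (\<Union>(w, K)\<in>\<D>. ?\<kappa> ` q ` ({w} \<times> K))"
  proof (intro equalityI subsetI)
    fix z assume "z \<in> H ` (U \<times> {1})"
    then obtain x where x: "x \<in> U" "z = ?\<kappa> x" by blast
    have "x \<in> topspace X" using x(1) U openin_subset by blast
    then obtain W where W: "W \<in> \<W>" "x \<in> q ` (W \<times> topspace F)" using \<W>(3) by blast
    have "z \<in> ?\<kappa> ` (U \<inter> q ` (W \<times> topspace F))" using x W(2) by blast
    then have "z \<in> (\<Union>(w, K)\<in>d W. ?\<kappa> ` q ` ({w} \<times> K))" using d[OF W(1)] unfolding fits_def by blast
    then show "z \<in> (\<Union>(w, K)\<in>\<D>. ?\<kappa> ` q ` ({w} \<times> K))" unfolding \<D>_def using W(1) by blast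
  next
    fix z assume "z \<in> (\<Union>(w, K)\<in>\<D>. ?\<kappa> ` q ` ({w} \<times> K))"
    then obtain w K y where w: "(w, K) \<in> \<D>" "y \<in> K" "z = H (q (w, y), 1)" by auto
    then have "q (w, y) \<in> U" using 2 by blast
    then show "z \<in> H ` (U \<times> {1})" using w(3) by blast
  qed
  show thesis by (rule that[OF 1 2 3])
qed

end

context suspension_dynamics
begin

text \<open>A leaf meets a fibre in one orbit of the countable group \<open>G\<close>.\<close>

lemma leaf_fiber_countable:
  assumes L: "L \<in> leaves \<L>" and w: "w \<in> Mt"
  shows "countable {y \<in> topspace F. q (w, y) \<in> L}"
proof (cases "{y \<in> topspace F. q (w, y) \<in> L} = {}")
  case False
  then obtain y0 where y0: "y0 \<in> topspace F" "q (w, y0) \<in> L" by blast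
  have "L \<subseteq> q ` (Mt \<times> {y0})" by (rule leaf_subset[OF L y0(2) w y0(1)])
  have "{y \<in> topspace F. q (w, y) \<in> L} \<subseteq> (\<lambda>g. g y0) ` carrier G"
  proof
    fix y assume "y \<in> {y \<in> topspace F. q (w, y) \<in> L}"
    then have y: "y \<in> topspace F" "q (w, y) \<in> q ` (Mt \<times> {y0})" using \<open>L \<subseteq> q ` (Mt \<times> {y0})\<close> by blast+
    then obtain v where v: "v \<in> Mt" "q (v, y0) = q (w, y)" by (auto simp: image_iff)
    obtain c where "c \<in> carrier \<Gamma>" "y = h c y0" using q_eq_iff[OF v(1) y0(1) w y(1)] v(2) by blast
    then show "y \<in> (\<lambda>g. g y0) ` carrier G" using h_G by blast
  qed
  then show ?thesis by (rule countable_subset[OF _ countable_image[OF countable_G]])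
next
  case True
  then show ?thesis by (simp only: countable_empty)
qed

lemma leaves_eq:
  assumes "L \<in> leaves \<L>" "L' \<in> leaves \<L>" "x \<in> L" "x \<in> L'" shows "L = L'"
  using assms connected_components_of_overlap[of L "leaf_topology \<L>" L'] unfolding leaves_def by blast

lemma piece_transverse:
  assumes w: "w \<in> Mt" "compactin F K" "q ` ({w} \<times> K) \<subseteq> U"
    and f: "continuous_map (subtopology X U) X f" "\<And>x. x \<in> U \<Longrightarrow> \<exists>L\<in>leaves \<L>. x \<in> L \<and> f x \<in> L"
  shows "transverse_set X \<L> (f ` q ` ({w} \<times> K))" "compactin X (f ` q ` ({w} \<times> K))"
proof -
  have KF: "K \<subseteq> topspace F" using w(2) compactin_subset_topspace by blast
  have "compactin (subtopology X U) (q ` ({w} \<times> K))"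
    using compact_slice[OF w(1,2)] w(3) by (simp add: compactin_subtopology)
  then show c: "compactin X (f ` q ` ({w} \<times> K))" using f(1) image_compactin by blast
  have "countable (f ` q ` ({w} \<times> K) \<inter> L)" if L: "L \<in> leaves \<L>" for L
  proof -
    have "f ` q ` ({w} \<times> K) \<inter> L \<subseteq> (\<lambda>y. f (q (w, y))) ` {y \<in> topspace F. q (w, y) \<in> L}"
    proof
      fix z assume "z \<in> f ` q ` ({w} \<times> K) \<inter> L"
      then obtain y where y: "y \<in> K" "z = f (q (w, y))" "z \<in> L" by blast
      then have "q (w, y) \<in> U" using w(3) by blast
      then obtain L' where L': "L' \<in> leaves \<L>" "q (w, y) \<in> L'" "f (q (w, y)) \<in> L'" using f(2) by blast
      then have "L' = L" using leaves_eq[OF L'(1) L, of z] y by simp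
      then show "z \<in> (\<lambda>y. f (q (w, y))) ` {y \<in> topspace F. q (w, y) \<in> L}" using L' y KF by blast
    qed
    then show ?thesis by (rule countable_subset[OF _ countable_image[OF leaf_fiber_countable[OF L w(1)]]])
  qed
  then show "transverse_set X \<L> (f ` q ` ({w} \<times> K))"
    unfolding transverse_set_def by (intro conjI ballI borel_of_compact[OF hausdorff_X c])
qed

lemma contraction_image_transverse:
  assumes H: "H \<in> tangential_contractions X \<L> U"
  shows "transverse_set X \<L> (H ` (U \<times> {1}))"
proof -
  obtain \<D> where D: "countable \<D>" "\<And>w K. (w, K) \<in> \<D> \<Longrightarrow> w \<in> Mt \<and> compactin F K \<and> q ` ({w} \<times> K) \<subseteq> U"
    "H ` (U \<times> {1}) = (\<Union>(w, K)\<in>\<D>. (\<lambda>x. H (x, 1)) ` q ` ({w} \<times> K))"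
    by (rule contraction_pieces[OF H]) (rule that)
  have lf: "\<exists>L\<in>leaves \<L>. x \<in> L \<and> H (x, 1) \<in> L" if "x \<in> U" for x
    by (rule contraction_leaf[OF H that]) blast
  define P where "P z = (\<lambda>x. H (x, 1)) ` q ` ({fst z} \<times> snd z)" for z :: "'u \<times> 'f set"
  have P: "transverse_set X \<L> (P z)" if "z \<in> \<D>" for z
    unfolding P_def using D(2)[of "fst z" "snd z"] that
    by (intro piece_transverse(1)[OF _ _ _ contraction_continuous[OF H] lf]) auto
  have eq: "H ` (U \<times> {1}) = (\<Union>z\<in>\<D>. P z)" unfolding D(3) P_def by (auto simp: split_beta)
  have "(\<Union>z\<in>\<D>. P z) \<in> sets (borel_of X)"
    using P D(1) unfolding transverse_set_def by (intro sets.countable_UN') auto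
  moreover have "countable ((\<Union>z\<in>\<D>. P z) \<inter> L)" if L: "L \<in> leaves \<L>" for L
  proof -
    have "(\<Union>z\<in>\<D>. P z) \<inter> L = (\<Union>z\<in>\<D>. P z \<inter> L)" by blast
    moreover have "countable (\<Union>z\<in>\<D>. P z \<inter> L)"
      using P D(1) L unfolding transverse_set_def by (intro countable_UN) auto
    ultimately show ?thesis by simp
  qed
  ultimately show ?thesis unfolding eq transverse_set_def by (intro conjI ballI)
qed

text \<open>By freeness a point and its image under a nontrivial element have disjoint neighbourhoods.\<close>

lemma free_cover:
  assumes Q: "finite Q" "Q \<subseteq> carrier G"
  obtains \<O> where "finite \<O>" "\<And>A. A \<in> \<O> \<Longrightarrow> openin F A" "topspace F = \<Union>\<O>"
    "\<And>A g y. \<lbrakk>A \<in> \<O>; g \<in> Q; y \<in> A; g y \<in> A\<rbrakk> \<Longrightarrow> g = \<one>\<^bsub>G\<^esub>"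
proof -
  define \<C> where "\<C> = {A. openin F A \<and> (\<forall>g\<in>Q. \<forall>y\<in>A. g y \<in> A \<longrightarrow> g = \<one>\<^bsub>G\<^esub>)}"
  have "topspace F \<subseteq> \<Union>\<C>"
  proof
    fix y assume y: "y \<in> topspace F"
    define good where "good g A \<longleftrightarrow> openin F A \<and> y \<in> A \<and> (\<forall>z\<in>A. g z \<notin> A)" for g A
    have "\<exists>A. good g A" if g: "g \<in> Q - {\<one>\<^bsub>G\<^esub>}" for g
    proof -
      have gG: "g \<in> carrier G" and gy: "g y \<noteq> y" using g Q(2) free[OF _ y] by blast+
      obtain A B where AB: "openin F A" "openin F B" "y \<in> A" "g y \<in> B" "disjnt A B"
        by (rule Hausdorff_separate[OF hausdorff_F y G_in[OF gG y] gy[symmetric]])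
      have "openin F {z \<in> topspace F. g z \<in> B}"
        using homeomorphic_imp_continuous_map[OF G_homeo[OF gG]] AB(2) by (rule openin_continuous_map_preimage)
      then have "openin F (A \<inter> {z \<in> topspace F. g z \<in> B})" using AB(1) by blast
      then have "good g (A \<inter> {z \<in> topspace F. g z \<in> B})"
        unfolding good_def using AB y by (auto simp: disjnt_def)
      then show ?thesis by blast
    qed
    define N where "N g = (SOME A. good g A)" for g
    have N: "good g (N g)" if "g \<in> Q - {\<one>\<^bsub>G\<^esub>}" for g
      unfolding N_def by (rule someI_ex[OF \<open>\<And>g. g \<in> Q - {\<one>\<^bsub>G\<^esub>} \<Longrightarrow> \<exists>A. good g A\<close>[OF that]])
    let ?A = "\<Inter>(insert (topspace F) (N ` (Q - {\<one>\<^bsub>G\<^esub>})))"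
    have "openin F ?A"
      by (rule openin_Inter) (use Q(1) N in \<open>auto simp: good_def\<close>)
    moreover have "g = \<one>\<^bsub>G\<^esub>" if "g \<in> Q" "z \<in> ?A" "g z \<in> ?A" for g z
    proof (rule ccontr)
      assume "g \<noteq> \<one>\<^bsub>G\<^esub>"
      then have "g \<in> Q - {\<one>\<^bsub>G\<^esub>}" using that by blast
      then show False using N[of g] that unfolding good_def by blast
    qed
    ultimately have "?A \<in> \<C>" unfolding \<C>_def by blast
    moreover have "y \<in> ?A" using y N unfolding good_def by blast
    ultimately show "y \<in> \<Union>\<C>" by blast
  qed
  moreover have "compactin F (topspace F)" using compact_F by (simp add: compact_space_def)
  moreover have "\<And>A. A \<in> \<C> \<Longrightarrow> openin F A" unfolding \<C>_def by blast
  ultimately obtain \<O> where \<O>: "finite \<O>" "\<O> \<subseteq> \<C>" "topspace F \<subseteq> \<Union>\<O>"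
    using compactinD[of F "topspace F" \<C>] by blast
  have "\<Union>\<O> \<subseteq> topspace F" using \<O>(2) openin_subset unfolding \<C>_def by blast
  then have eq: "topspace F = \<Union>\<O>" using \<O>(3) by blast
  show thesis
  proof (rule that[OF \<O>(1) _ eq])
    show "\<And>A. A \<in> \<O> \<Longrightarrow> openin F A" using \<O>(2) unfolding \<C>_def by blast
    show "\<And>A g y. \<lbrakk>A \<in> \<O>; g \<in> Q; y \<in> A; g y \<in> A\<rbrakk> \<Longrightarrow> g = \<one>\<^bsub>G\<^esub>" using \<O>(2) unfolding \<C>_def by blast
  qed
qed

end

section \<open>The lower bound for the category\<close>

lemma path_length_chain:
  assumes "leaf_path_length \<U> A \<le> enat m"
  obtains Ps where "plaque_chain \<U> Ps" "length Ps \<le> m" "A \<subseteq> \<Union>(set Ps)"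
proof -
  let ?S = "{enat (length Ps + 1) | Ps. plaque_chain \<U> Ps \<and> A \<subseteq> \<Union>(set Ps)}"
  have "\<exists>s\<in>?S. s \<le> enat m"
  proof (rule ccontr)
    assume n: "\<not> (\<exists>s\<in>?S. s \<le> enat m)"
    have "eSuc (enat m) \<le> Inf ?S"
    proof (rule Inf_greatest)
      fix s assume "s \<in> ?S"
      then have "enat m < s" using n by (blast intro: not_le_imp_less)
      then show "eSuc (enat m) \<le> s" by (rule ileI1)
    qed
    then have "eSuc (enat m) \<le> enat m" using assms unfolding leaf_path_length_def by (rule order_trans)
    then show False by (simp add: eSuc_enat)
  qed
  then obtain Ps where "plaque_chain \<U> Ps" "A \<subseteq> \<Union>(set Ps)" "enat (length Ps + 1) \<le> enat m" by blast
  then show thesis using that by simp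
qed

lemma ennreal_card_inverse:
  assumes "k > (0::nat)" "a \<le> of_nat k * (b::ennreal)" shows "inverse (of_nat k) * a \<le> b"
proof -
  have "inverse (of_nat k) * a \<le> inverse (of_nat k) * (of_nat k * b)" by (rule mult_left_mono[OF assms(2)]) simp
  also have "\<dots> = (of_nat k / of_nat k) * b" by (simp add: divide_ennreal_def mult_ac)
  also have "of_nat k / (of_nat k :: ennreal) = 1" using assms(1) by (intro ennreal_divide_self) (auto simp: of_nat_less_top)
  finally show ?thesis by simp
qed

locale suspension_measure = suspension_dynamics n M Mt p u0 F h G S \<U>
  for n :: nat and M :: "'m::topological_space set" and Mt :: "'u::topological_space set"
    and p :: "'u \<Rightarrow> 'm" and u0 :: 'u and F :: "'f topology" and h :: "(real \<Rightarrow> 'm) set \<Rightarrow> 'f \<Rightarrow> 'f"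
    and G :: "('f \<Rightarrow> 'f) monoid" and S :: "('f \<Rightarrow> 'f) set" and \<U> :: "('u \<times> 'f) set chart set" +
  fixes \<Lambda> :: "'f measure" and \<mu> :: "('u \<times> 'f) set set \<Rightarrow> ennreal"
  assumes measure: "sets \<Lambda> = sets (borel_of F)" "prob_space \<Lambda>" "regular_measure F \<Lambda>"
    and invariant: "\<And>g B. g \<in> carrier G \<Longrightarrow> B \<in> sets \<Lambda> \<Longrightarrow> emeasure \<Lambda> (g ` B) = emeasure \<Lambda> B"
    and transverse_measure: "suspension_transverse_measure n M Mt p u0 F h \<Lambda> \<mu>"
begin

sublocale \<Lambda>: prob_space \<Lambda> by (rule measure(2))

lemma space_\<Lambda>: "space \<Lambda> = topspace F"
  using sets_eq_imp_space_eq[OF measure(1)] by (simp add: space_borel_of)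

lemma \<Lambda>_open: "openin F U \<Longrightarrow> U \<in> sets \<Lambda>" and \<Lambda>_closed: "closedin F C \<Longrightarrow> C \<in> sets \<Lambda>"
  and \<Lambda>_compact: "compactin F K \<Longrightarrow> K \<in> sets \<Lambda>"
  unfolding measure(1) by (rule borel_of_open borel_of_closed borel_of_compact[OF hausdorff_F], assumption)+

lemma emeasure_F: "emeasure \<Lambda> (topspace F) = 1"
  using \<Lambda>.emeasure_space_1 by (simp add: space_\<Lambda>)

lemma \<mu>_fiber: "u \<in> Mt \<Longrightarrow> B \<in> sets \<Lambda> \<Longrightarrow> \<mu> (q ` ({u} \<times> B)) = emeasure \<Lambda> B"
  using transverse_measure unfolding suspension_transverse_measure_def by blast

lemma tim: "transverse_invariant_measure X \<L> \<mu>"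
  using transverse_measure unfolding suspension_transverse_measure_def by (rule conjunct1)

text \<open>On the compact piece of the fibre the injective continuous map \<open>f\<close> is a homeomorphism onto its image,
  hence an isomorphism of Borel spaces that keeps each point in its leaf.\<close>

lemma moved_measure:
  assumes K: "compactin F K" "q ` ({u0} \<times> K) \<subseteq> U"
    and f: "continuous_map (subtopology X U) X f" "\<And>x. x \<in> U \<Longrightarrow> \<exists>L\<in>leaves \<L>. x \<in> L \<and> f x \<in> L"
    and inj: "inj_on f (q ` ({u0} \<times> K))"
  shows "\<mu> (f ` q ` ({u0} \<times> K)) = emeasure \<Lambda> K"
proof -
  let ?T = "q ` ({u0} \<times> K)" and ?T' = "f ` q ` ({u0} \<times> K)"
  have KF: "K \<subseteq> topspace F" using K(1) compactin_subset_topspace by blast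
  have TX: "?T \<subseteq> topspace X" using q_in_X u0 KF by blast
  have id: "continuous_map (subtopology X (topspace X)) X (\<lambda>x. x)" by simp
  have idl: "\<exists>L\<in>leaves \<L>. x \<in> L \<and> x \<in> L" if x: "x \<in> topspace X" for x
  proof -
    have o: "openin X (topspace X)" by simp
    obtain L where "L \<in> leaves_in (topspace X)" "x \<in> L" by (rule leaf_exists[OF o x])
    then show ?thesis unfolding restrict_lamination_X by blast
  qed
  have t: "transverse_set X \<L> ?T" "compactin X ?T"
    using piece_transverse[OF u0 K(1) TX id idl] by simp_all
  have t': "transverse_set X \<L> ?T'" "compactin X ?T'"
    using piece_transverse[OF u0 K(1,2) f] by simp_all
  have T'X: "?T' \<subseteq> topspace X" using t'(2) compactin_subset_topspace by blast
  have cf: "continuous_map (subtopology X ?T) X f"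
    using continuous_map_from_subtopology_mono[OF f(1) K(2)] .
  have hm: "homeomorphic_map (subtopology X ?T) (subtopology X ?T') f"
  proof (rule continuous_imp_homeomorphic_map)
    show "compact_space (subtopology X ?T)" using t(2) by (simp add: compact_space_subtopology)
    show "Hausdorff_space (subtopology X ?T')" using hausdorff_X by (rule Hausdorff_space_subtopology)
    show "continuous_map (subtopology X ?T) (subtopology X ?T') f" using cf by (auto simp: continuous_map_in_subtopology)
    show "f ` topspace (subtopology X ?T) = topspace (subtopology X ?T')"
      using TX T'X by (simp add: inf.absorb2)
    show "inj_on f (topspace (subtopology X ?T))" using inj TX by (simp add: inf.absorb2)
  qed
  then obtain g where g: "homeomorphic_maps (subtopology X ?T) (subtopology X ?T') f g"
    unfolding homeomorphic_map_maps by blast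
  have cg: "continuous_map (subtopology X ?T') (subtopology X ?T) g" and gf: "\<And>x. x \<in> ?T \<Longrightarrow> g (f x) = x"
    using g TX by (auto simp: homeomorphic_maps_def)
  have gi: "g z = inv_into ?T f z" if z: "z \<in> topspace (subtopology X ?T')" for z
  proof -
    obtain x where x: "x \<in> ?T" "z = f x" using z by auto
    have "inv_into ?T f (f x) = x" by (rule inv_into_f_f[OF inj x(1)])
    then show ?thesis using gf[OF x(1)] x(2) by simp
  qed
  have ci: "continuous_map (subtopology X ?T') X (inv_into ?T f)"
    using continuous_map_eq[OF continuous_map_into_fulltopology[OF cg] gi] .
  have m1: "f \<in> restrict_space (borel_of X) ?T \<rightarrow>\<^sub>M restrict_space (borel_of X) ?T'"
    by (rule measurable_borel_of_restrict[OF borel_of_compact[OF hausdorff_X t(2)] cf]) simp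
  have m2: "inv_into ?T f \<in> restrict_space (borel_of X) ?T' \<rightarrow>\<^sub>M restrict_space (borel_of X) ?T"
    by (rule measurable_borel_of_restrict[OF borel_of_compact[OF hausdorff_X t'(2)] ci]) (blast intro: inv_into_into)
  have b: "bij_betw f ?T ?T'" using inj by (rule inj_on_imp_bij_betw)
  have lf: "\<forall>x\<in>?T. \<exists>L\<in>leaves \<L>. x \<in> L \<and> f x \<in> L" by (rule ballI) (rule f(2)[OF subsetD[OF K(2)]])
  have "\<mu> ?T = \<mu> ?T'"
    by (rule tim[unfolded transverse_invariant_measure_def, THEN conjunct2, THEN conjunct2, THEN spec, THEN spec, THEN spec, THEN mp, of ?T ?T' f]) (intro conjI t(1) t'(1) b m1 m2 lf)
  then show ?thesis using \<mu>_fiber[OF u0 \<Lambda>_compact[OF K(1)]] by simp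
qed

lemma transverse_subset:
  "transverse_set X \<L> A \<Longrightarrow> B \<in> sets (borel_of X) \<Longrightarrow> transverse_set X \<L> (B \<inter> A)"
proof -
  assume A: "transverse_set X \<L> A" and B: "B \<in> sets (borel_of X)"
  have "countable (B \<inter> A \<inter> L)" if "L \<in> leaves \<L>" for L
    using A that countable_subset[of "B \<inter> A \<inter> L" "A \<inter> L"] unfolding transverse_set_def by blast
  then show ?thesis using A B unfolding transverse_set_def by blast
qed

text \<open>The invariant measure is additive on transverse sets only, but the measures of the traces on \<open>A\<close> of all
  Borel sets form a measure, for which the sum of the indicator functions can be integrated.\<close>

lemma multiplicity:
  assumes A: "transverse_set X \<L> A" and I: "finite I" and B: "\<And>i. i \<in> I \<Longrightarrow> B i \<in> sets (borel_of X) \<and> B i \<subseteq> A"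
    and N: "\<And>z. card {i \<in> I. z \<in> B i} \<le> N"
  shows "(\<Sum>i\<in>I. \<mu> (B i)) \<le> of_nat N * \<mu> A"
proof -
  have A': "A \<in> sets (borel_of X)" using A by (simp add: transverse_set_def)
  define \<nu> where "\<nu> = measure_of (topspace X) (sets (borel_of X)) (\<lambda>B. \<mu> (B \<inter> A))"
  have sa: "sigma_algebra (topspace X) (sets (borel_of X))"
    using sets.sigma_algebra_axioms[of "borel_of X"] by (simp add: space_borel_of)
  have pos: "positive (sets (borel_of X)) (\<lambda>B. \<mu> (B \<inter> A))"
    using tim by (simp add: positive_def transverse_invariant_measure_def)
  have add: "countably_additive (sets (borel_of X)) (\<lambda>B. \<mu> (B \<inter> A))"
    unfolding countably_additive_def
  proof (intro allI impI)
    fix E :: "nat \<Rightarrow> _" assume E: "range E \<subseteq> sets (borel_of X)" "disjoint_family E"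
    have "\<forall>i. transverse_set X \<L> (E i \<inter> A)" using transverse_subset[OF A] E(1) by blast
    moreover have "disjoint_family (\<lambda>i. E i \<inter> A)" using E(2) unfolding disjoint_family_on_def by blast
    ultimately have "\<mu> (\<Union>i. E i \<inter> A) = (\<Sum>i. \<mu> (E i \<inter> A))"
      using tim[unfolded transverse_invariant_measure_def, THEN conjunct2, THEN conjunct1, rule_format, of "\<lambda>i. E i \<inter> A"] by blast
    moreover have "(\<Union>i. E i \<inter> A) = \<Union>(range E) \<inter> A" by blast
    ultimately show "(\<Sum>i. \<mu> (E i \<inter> A)) = \<mu> (\<Union>(range E) \<inter> A)" by simp
  qed
  have em: "emeasure \<nu> E = \<mu> (E \<inter> A)" if "E \<in> sets (borel_of X)" for E
    unfolding \<nu>_def by (rule emeasure_measure_of_sigma[OF sa pos add that])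
  have sn: "sets \<nu> = sets (borel_of X)"
    unfolding \<nu>_def by (rule sigma_algebra.sets_measure_of_eq[OF sa])
  have "(\<Sum>i\<in>I. \<mu> (B i)) = (\<Sum>i\<in>I. emeasure \<nu> (B i))"
    by (rule sum.cong) (use B em in \<open>auto simp: inf.absorb1\<close>)
  also have "\<dots> = (\<Sum>i\<in>I. \<integral>\<^sup>+ x. indicator (B i) x \<partial>\<nu>)"
    by (rule sum.cong) (use B sn in auto)
  also have "\<dots> = (\<integral>\<^sup>+ x. (\<Sum>i\<in>I. indicator (B i) x) \<partial>\<nu>)"
    by (rule nn_integral_sum[symmetric]) (use B sn in \<open>auto intro: borel_measurable_indicator\<close>)
  also have "\<dots> \<le> (\<integral>\<^sup>+ x. of_nat N * indicator A x \<partial>\<nu>)"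
  proof (rule nn_integral_mono)
    fix x
    show "(\<Sum>i\<in>I. indicator (B i) x) \<le> of_nat N * (indicator A x :: ennreal)"
    proof (cases "x \<in> A")
      case True
      have "(\<Sum>i\<in>I. indicator (B i) x :: ennreal) = of_nat (card {i \<in> I. x \<in> B i})"
        using I by (simp add: indicator_def sum.If_cases Int_def)
      also have "\<dots> \<le> of_nat N" using N[of x] by (simp only: of_nat_le_iff)
      finally show ?thesis using True by simp
    next
      case False
      then have "x \<notin> B i" if "i \<in> I" for i using B[OF that] by blast
      then show ?thesis by simp
    qed
  qed
  also have "\<dots> = of_nat N * emeasure \<nu> A"
    using A' sn by (simp add: nn_integral_cmult_indicator)
  also have "emeasure \<nu> A = \<mu> A" using em[OF A'] by simp
  finally show ?thesis .
qed

lemma inner_compacts: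
  assumes I: "finite I" and E: "\<And>i. i \<in> I \<Longrightarrow> E i \<in> sets \<Lambda>" and e: "e > (0::real)"
  obtains K where "\<And>i. i \<in> I \<Longrightarrow> compactin F (K i) \<and> K i \<subseteq> E i"
    "(\<Sum>i\<in>I. emeasure \<Lambda> (E i)) \<le> (\<Sum>i\<in>I. emeasure \<Lambda> (K i)) + ennreal e"
proof -
  \<comment> \<open>The summand 1 provides for empty \<open>I\<close>.\<close>
  define d where "d = e / (card I + 1)"
  have d: "d > 0" using e by (simp add: d_def)
  define ok where "ok i K \<longleftrightarrow> compactin F K \<and> K \<subseteq> E i \<and> emeasure \<Lambda> (E i) \<le> emeasure \<Lambda> K + ennreal d" for i K
  have ex: "\<exists>K. ok i K" if i: "i \<in> I" for i
  proof -
    have "emeasure \<Lambda> (E i) = (SUP K\<in>{K. compactin F K \<and> K \<subseteq> E i}. emeasure \<Lambda> K)"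
      using measure(3) E[OF i] unfolding regular_measure_def by blast
    moreover have "emeasure \<Lambda> (E i) \<noteq> \<infinity>" by simp
    moreover have "{} \<in> {K. compactin F K \<and> K \<subseteq> E i}" by simp
    ultimately have "\<exists>K\<in>{K. compactin F K \<and> K \<subseteq> E i}. emeasure \<Lambda> (E i) < emeasure \<Lambda> K + ennreal d"
      by (intro SUP_approx_ennreal[OF d]) (blast, assumption, assumption)
    then show ?thesis unfolding ok_def using less_imp_le by blast
  qed
  define K where "K i = (SOME K. ok i K)" for i
  have K: "ok i (K i)" if "i \<in> I" for i unfolding K_def by (rule someI_ex[OF ex[OF that]])
  have "(\<Sum>i\<in>I. emeasure \<Lambda> (E i)) \<le> (\<Sum>i\<in>I. emeasure \<Lambda> (K i) + ennreal d)"
    by (rule sum_mono) (use K in \<open>simp add: ok_def\<close>)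
  also have "\<dots> = (\<Sum>i\<in>I. emeasure \<Lambda> (K i)) + (\<Sum>i\<in>I. ennreal d)" by (rule sum.distrib)
  also have "(\<Sum>i\<in>I. ennreal d) = ennreal (card I * d)"
    using d by (simp add: ennreal_of_nat_eq_real_of_nat ennreal_mult)
  also have "\<dots> \<le> ennreal e" using e by (intro ennreal_leI) (simp add: d_def field_simps)
  finally have "(\<Sum>i\<in>I. emeasure \<Lambda> (E i)) \<le> (\<Sum>i\<in>I. emeasure \<Lambda> (K i)) + ennreal e"
    by (simp add: add_left_mono)
  moreover have "\<And>i. i \<in> I \<Longrightarrow> compactin F (K i) \<and> K i \<subseteq> E i" using K unfolding ok_def by blast
  ultimately show thesis using that by blast
qed

text \<open>A short contraction sends at most as many points of the base fibre to one point as the ball of the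
  corresponding radius has elements; so its end has at least the measure of the part of the base fibre
  in \<open>U\<close> divided by this number.\<close>

lemma contraction_lower:
  obtains r where "r \<ge> 1" "\<And>U H m. \<lbrakk>H \<in> tangential_contractions X \<L> U; deformation_length \<U> U H \<le> enat m\<rbrakk> \<Longrightarrow>
     emeasure \<Lambda> {y \<in> topspace F. q (u0, y) \<in> U} \<le> of_nat (card (Sn (r * m))) * \<mu> (H ` (U \<times> {1}))"
proof -
  obtain r where r: "r \<ge> 1" "\<And>m Ps Ps' y y' x.
    \<lbrakk>plaque_chain \<U> Ps; plaque_chain \<U> Ps'; length Ps \<le> m; length Ps' \<le> m; y \<in> topspace F; y' \<in> topspace F;
     q (u0, y) \<in> \<Union>(set Ps); x \<in> \<Union>(set Ps); q (u0, y') \<in> \<Union>(set Ps'); x \<in> \<Union>(set Ps')\<rbrakk> \<Longrightarrow>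
    \<exists>g\<in>Sn (r * m). y' = g y"
    by (rule common_endpoint) (rule that)
  have main: "emeasure \<Lambda> {y \<in> topspace F. q (u0, y) \<in> U} \<le> of_nat (card (Sn (r * m))) * \<mu> (H ` (U \<times> {1}))"
    if H: "H \<in> tangential_contractions X \<L> U" and len: "deformation_length \<U> U H \<le> enat m" for U H m
  proof -
    let ?\<kappa> = "\<lambda>x. H (x, 1)" and ?Q = "Sn (r * m)" and ?A = "H ` (U \<times> {1})"
    define U0 where "U0 = {y \<in> topspace F. q (u0, y) \<in> U}"
    have U: "openin X U" and H0: "\<And>x. x \<in> U \<Longrightarrow> H (x, 0) = x"
      using H unfolding tangential_contractions_def tangential_deformation_def by blast+
    have oU0: "openin F U0" unfolding U0_def by (rule openin_continuous_map_preimage[OF continuous_fiber[OF u0] U])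
    have lf: "\<exists>L\<in>leaves \<L>. x \<in> L \<and> ?\<kappa> x \<in> L" if "x \<in> U" for x
      by (rule contraction_leaf[OF H that]) blast
    have chain: "\<exists>Ps. plaque_chain \<U> Ps \<and> length Ps \<le> m \<and> x \<in> \<Union>(set Ps) \<and> ?\<kappa> x \<in> \<Union>(set Ps)" if x: "x \<in> U" for x
    proof -
      have "leaf_path_length \<U> ((\<lambda>t. H (x, t)) ` {0..1}) \<le> deformation_length \<U> U H"
        unfolding deformation_length_def using x by (rule SUP_upper)
      then have "leaf_path_length \<U> ((\<lambda>t. H (x, t)) ` {0..1}) \<le> enat m" using len by (rule order_trans)
      then obtain Ps where Ps: "plaque_chain \<U> Ps" "length Ps \<le> m" "(\<lambda>t. H (x, t)) ` {0..1} \<subseteq> \<Union>(set Ps)"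
        by (rule path_length_chain)
      have "(0::real) \<in> {0..1}" "(1::real) \<in> {0..1}" by auto
      then have "H (x, 0) \<in> \<Union>(set Ps)" "?\<kappa> x \<in> \<Union>(set Ps)" using Ps(3) by blast+
      then show ?thesis using Ps(1,2) H0[OF x] by auto
    qed
    have same: "\<exists>g\<in>?Q. y' = g y" if y: "y \<in> U0" "y' \<in> U0" "?\<kappa> (q (u0, y)) = ?\<kappa> (q (u0, y'))" for y y'
    proof -
      have yy: "y \<in> topspace F" "q (u0, y) \<in> U" "y' \<in> topspace F" "q (u0, y') \<in> U" using y unfolding U0_def by blast+
      obtain Ps where Ps: "plaque_chain \<U> Ps" "length Ps \<le> m" "q (u0, y) \<in> \<Union>(set Ps)" "?\<kappa> (q (u0, y)) \<in> \<Union>(set Ps)"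
        using chain[OF yy(2)] by blast
      obtain Ps' where Ps': "plaque_chain \<U> Ps'" "length Ps' \<le> m" "q (u0, y') \<in> \<Union>(set Ps')" "?\<kappa> (q (u0, y')) \<in> \<Union>(set Ps')"
        using chain[OF yy(4)] by blast
      show ?thesis
        by (rule r(2)[OF Ps(1) Ps'(1) Ps(2) Ps'(2) yy(1,3) Ps(3,4) Ps'(3)]) (use Ps'(4) y(3) in simp)
    qed
    have QG: "?Q \<subseteq> carrier G" using Sn_carrier by blast
    obtain \<O> where \<O>: "finite \<O>" "\<And>A. A \<in> \<O> \<Longrightarrow> openin F A" "topspace F = \<Union>\<O>"
      "\<And>A g y. \<lbrakk>A \<in> \<O>; g \<in> ?Q; y \<in> A; g y \<in> A\<rbrakk> \<Longrightarrow> g = \<one>\<^bsub>G\<^esub>"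
      by (rule free_cover[OF Sn_finite QG]) (rule that)
    obtain A and k :: nat where A: "\<O> = A ` {i. i < k}"
      using finite_imp_nat_seg_image_inj_on[OF \<O>(1)] by blast
    \<comment> \<open>Disjoint pieces of the part of the base fibre in \<open>U\<close>. On each of them the end map is injective:
      two points with the same end differ by an element of the ball, which is trivial as it does not move
      the first point out of the piece.\<close>
    define E where "E i = (A i - (\<Union>j<i. A j)) \<inter> U0" for i
    have AO: "A i \<in> \<O>" if "i < k" for i using A that by blast
    have E: "E i \<in> sets \<Lambda>" if "i \<in> {..<k}" for i
      unfolding E_def using that \<Lambda>_open[OF \<O>(2)[OF AO]] \<Lambda>_open[OF oU0]
      by (intro sets.Int sets.Diff sets.finite_UN) auto
    have "U0 \<subseteq> (\<Union>i\<in>{..<k}. E i)"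
    proof
      fix y assume y: "y \<in> U0"
      then have "y \<in> \<Union>\<O>" using \<O>(3) unfolding U0_def by blast
      then have ex: "\<exists>i. i < k \<and> y \<in> A i" using A by blast
      define i where "i = (LEAST i. i < k \<and> y \<in> A i)"
      have i: "i < k" "y \<in> A i" using LeastI_ex[OF ex] unfolding i_def by blast+
      have "y \<notin> A j" if "j < i" for j using not_less_Least[of j "\<lambda>i. i < k \<and> y \<in> A i"] that i(1) unfolding i_def by auto
      then show "y \<in> (\<Union>i\<in>{..<k}. E i)" using i y unfolding E_def by auto
    qed
    then have "emeasure \<Lambda> U0 \<le> emeasure \<Lambda> (\<Union>i\<in>{..<k}. E i)" by (rule emeasure_mono) (use E in auto)
    also have "\<dots> \<le> (\<Sum>i\<in>{..<k}. emeasure \<Lambda> (E i))"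
      by (rule emeasure_subadditive_finite) (use E in auto)
    finally have sumD: "emeasure \<Lambda> U0 \<le> (\<Sum>i\<in>{..<k}. emeasure \<Lambda> (E i))" .
    have disD: "i = j" if "y \<in> E i" "y \<in> E j" for i j y
      using that unfolding E_def by (metis DiffD1 DiffD2 IntD1 UN_I lessThan_iff linorder_neqE_nat)
    show ?thesis
    proof (rule ennreal_le_epsilon)
      fix e :: real assume e: "0 < e"
      obtain K where K: "\<And>i. i \<in> {..<k} \<Longrightarrow> compactin F (K i) \<and> K i \<subseteq> E i"
        "(\<Sum>i\<in>{..<k}. emeasure \<Lambda> (E i)) \<le> (\<Sum>i\<in>{..<k}. emeasure \<Lambda> (K i)) + ennreal e"
        by (rule inner_compacts[OF finite_lessThan E e]) (assumption, rule that)
      define B where "B i = ?\<kappa> ` q ` ({u0} \<times> K i)" for i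
      have KU: "q ` ({u0} \<times> K i) \<subseteq> U" "K i \<subseteq> U0" "K i \<subseteq> A i" if "i < k" for i
        using K(1)[of i] that unfolding E_def U0_def by auto
      have inj: "inj_on ?\<kappa> (q ` ({u0} \<times> K i))" if i: "i < k" for i
      proof (rule inj_onI, clarify)
        fix y y' assume y: "y \<in> K i" "y' \<in> K i" "?\<kappa> (q (u0, y)) = ?\<kappa> (q (u0, y'))"
        have yU: "y \<in> U0" "y' \<in> U0" "y \<in> A i" "y' \<in> A i" using y KU[OF i] by blast+
        then obtain g where g: "g \<in> ?Q" "y' = g y" using same[OF yU(1,2) y(3)] by blast
        have gA: "g y \<in> A i" using yU(4) g(2) by simp
        have "g = \<one>\<^bsub>G\<^esub>" by (rule \<O>(4)[OF AO[OF i] g(1) yU(3) gA])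
        moreover have "y \<in> topspace F" using yU(1) unfolding U0_def by blast
        ultimately have "y' = y" using g(2) G_one by simp
        then show "q (u0, y) = q (u0, y')" by simp
      qed
      have \<mu>B: "\<mu> (B i) = emeasure \<Lambda> (K i)" if i: "i < k" for i
        unfolding B_def
        by (rule moved_measure[OF _ KU(1)[OF i] contraction_continuous[OF H] lf inj[OF i]]) (use K(1)[of i] i in auto)
      have Bb: "B i \<in> sets (borel_of X) \<and> B i \<subseteq> ?A" if "i \<in> {..<k}" for i
      proof
        have i: "i < k" "compactin F (K i)" using that K(1)[OF that] by auto
        have "compactin X (B i)" unfolding B_def
          by (rule piece_transverse(2)[OF u0 i(2) KU(1)[OF i(1)] contraction_continuous[OF H] lf])
        then show "B i \<in> sets (borel_of X)" by (rule borel_of_compact[OF hausdorff_X])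
        show "B i \<subseteq> ?A" unfolding B_def using KU(1)[OF i(1)] by blast
      qed
      \<comment> \<open>The points with end \<open>z\<close> are translates of one of them by elements of the ball, different ones
        for points in different pieces.\<close>
      have mult: "card {i \<in> {..<k}. z \<in> B i} \<le> card ?Q" for z
      proof (cases "{i \<in> {..<k}. z \<in> B i} = {}")
        case False
        then obtain i0 where "i0 < k" "z \<in> B i0" by blast
        then obtain y0 where y0: "y0 \<in> U0" "z = ?\<kappa> (q (u0, y0))" unfolding B_def using KU by blast
        define \<gamma> where "\<gamma> i = (SOME g. g \<in> ?Q \<and> g y0 \<in> K i)" for i
        have \<gamma>: "\<gamma> i \<in> ?Q \<and> \<gamma> i y0 \<in> K i" if i: "i \<in> {i \<in> {..<k}. z \<in> B i}" for i
        proof -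
          obtain y where y: "y \<in> K i" "z = ?\<kappa> (q (u0, y))" using i unfolding B_def by blast
          have "y \<in> U0" using y(1) KU(2) i by blast
          then obtain g where "g \<in> ?Q" "y = g y0" using same[OF y0(1), of y] y0(2) y(2) by auto
          then have "\<exists>g. g \<in> ?Q \<and> g y0 \<in> K i" using y(1) by blast
          then show ?thesis unfolding \<gamma>_def by (rule someI_ex)
        qed
        have "inj_on \<gamma> {i \<in> {..<k}. z \<in> B i}"
        proof (rule inj_onI)
          fix i j assume ij: "i \<in> {i \<in> {..<k}. z \<in> B i}" "j \<in> {i \<in> {..<k}. z \<in> B i}" "\<gamma> i = \<gamma> j"
          have "\<gamma> i y0 \<in> E i" "\<gamma> i y0 \<in> E j" using \<gamma>[OF ij(1)] \<gamma>[OF ij(2)] K(1)[of i] K(1)[of j] ij by auto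
          then show "i = j" by (rule disD)
        qed
        moreover have "\<gamma> ` {i \<in> {..<k}. z \<in> B i} \<subseteq> ?Q" using \<gamma> by blast
        ultimately show ?thesis by (rule card_inj_on_le[OF _ _ Sn_finite])
      next
        case True
        then show ?thesis by (simp only: card.empty le0)
      qed
      have "(\<Sum>i\<in>{..<k}. emeasure \<Lambda> (K i)) = (\<Sum>i\<in>{..<k}. \<mu> (B i))" using \<mu>B by simp
      also have "\<dots> \<le> of_nat (card ?Q) * \<mu> ?A"
        by (rule multiplicity[OF contraction_image_transverse[OF H] _ Bb mult]) auto
      finally have "(\<Sum>i\<in>{..<k}. emeasure \<Lambda> (K i)) + ennreal e \<le> of_nat (card ?Q) * \<mu> ?A + ennreal e"
        by (rule add_right_mono)
      then have "emeasure \<Lambda> U0 \<le> of_nat (card ?Q) * \<mu> ?A + ennreal e"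
        using order_trans[OF sumD order_trans[OF K(2)]] by blast
      then show "emeasure \<Lambda> {y \<in> topspace F. q (u0, y) \<in> U} \<le> of_nat (card ?Q) * \<mu> ?A + ennreal e"
        unfolding U0_def .
    qed
  qed
  show thesis by (rule that[OF r(1) main])
qed

text \<open>The base fibre is compact, so finitely many members of a covering cover it; the parts of the fibre in
  them have measures with sum at least 1, and each of them bounds the measure of an end.\<close>

lemma lower_bound:
  obtains r where "r \<ge> 1" "\<And>m. inverse (of_nat (card (Sn (r * m)))) \<le> Cat_bounded X \<L> \<mu> m \<U>"
proof -
  obtain r where r: "r \<ge> 1" "\<And>U H m. \<lbrakk>H \<in> tangential_contractions X \<L> U; deformation_length \<U> U H \<le> enat m\<rbrakk> \<Longrightarrow>
     emeasure \<Lambda> {y \<in> topspace F. q (u0, y) \<in> U} \<le> of_nat (card (Sn (r * m))) * \<mu> (H ` (U \<times> {1}))"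
    by (rule contraction_lower) (rule that)
  have main: "inverse (of_nat (card (Sn (r * m)))) \<le> Cat_bounded X \<L> \<mu> m \<U>" for m
    unfolding Cat_bounded_def Cat_using_def
  proof (rule INF_greatest)
    let ?C = "\<lambda>U. {H \<in> tangential_contractions X \<L> U. deformation_length \<U> U H \<le> enat m}"
    let ?i = "inverse (of_nat (card (Sn (r * m)))) :: ennreal"
    fix \<V> assume "\<V> \<in> {\<V>. (\<forall>U\<in>\<V>. openin X U \<and> ?C U \<noteq> {}) \<and> \<Union>\<V> = topspace X}"
    then have \<V>: "\<And>U. U \<in> \<V> \<Longrightarrow> openin X U" "\<Union>\<V> = topspace X" by blast+
    define U0 where "U0 U = {y \<in> topspace F. q (u0, y) \<in> U}" for U
    have cF: "compactin X (q ` ({u0} \<times> topspace F))"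
      by (rule compact_slice[OF u0]) (use compact_F in \<open>simp add: compact_space_def\<close>)
    have sub: "q ` ({u0} \<times> topspace F) \<subseteq> \<Union>\<V>" unfolding \<V>(2) using q_in_X u0 by blast
    obtain \<W> where \<W>: "finite \<W>" "\<W> \<subseteq> \<V>" "q ` ({u0} \<times> topspace F) \<subseteq> \<Union>\<W>"
      using compactinD[OF cF \<V>(1) sub] by blast
    have oU0: "U0 U \<in> sets \<Lambda>" if "U \<in> \<W>" for U
      unfolding U0_def using \<V>(1) \<W>(2) that by (intro \<Lambda>_open openin_continuous_map_preimage[OF continuous_fiber[OF u0]]) blast
    have tau: "?i * emeasure \<Lambda> (U0 U) \<le> tau_using \<mu> ?C U" for U
      unfolding tau_using_def
    proof (rule INF_greatest)
      fix H assume "H \<in> ?C U"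
      then have "emeasure \<Lambda> (U0 U) \<le> of_nat (card (Sn (r * m))) * \<mu> (H ` (U \<times> {1}))"
        unfolding U0_def using r(2) by blast
      then show "?i * emeasure \<Lambda> (U0 U) \<le> \<mu> (H ` (U \<times> {1}))" by (rule ennreal_card_inverse[OF Sn_card_pos])
    qed
    have "topspace F \<subseteq> (\<Union>U\<in>\<W>. U0 U)" using \<W>(3) unfolding U0_def by blast
    then have "emeasure \<Lambda> (topspace F) \<le> emeasure \<Lambda> (\<Union>U\<in>\<W>. U0 U)"
      by (rule emeasure_mono) (use \<W>(1) oU0 in auto)
    also have "\<dots> \<le> (\<Sum>U\<in>\<W>. emeasure \<Lambda> (U0 U))"
      by (rule emeasure_subadditive_finite) (use \<W>(1) oU0 in auto)
    finally have "1 \<le> (\<Sum>U\<in>\<W>. emeasure \<Lambda> (U0 U))" unfolding emeasure_F .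
    then have "?i * 1 \<le> ?i * (\<Sum>U\<in>\<W>. emeasure \<Lambda> (U0 U))" by (rule mult_left_mono) simp
    also have "\<dots> = (\<Sum>U\<in>\<W>. ?i * emeasure \<Lambda> (U0 U))" by (rule sum_distrib_left)
    also have "\<dots> \<le> (\<Sum>U\<in>\<W>. tau_using \<mu> ?C U)" by (rule sum_mono) (rule tau)
    also have "\<dots> \<le> (\<Sum>\<^sub>\<infinity>U\<in>\<V>. tau_using \<mu> ?C U)"
    proof -
      have "(\<Sum>\<^sub>\<infinity>U\<in>\<V>. tau_using \<mu> ?C U) = (SUP A\<in>{A. finite A \<and> A \<subseteq> \<V>}. \<Sum>U\<in>A. tau_using \<mu> ?C U)"
        by (rule nonneg_infsum_complete) simp
      then show ?thesis using SUP_upper[of \<W> "{A. finite A \<and> A \<subseteq> \<V>}" "\<lambda>A. \<Sum>U\<in>A. tau_using \<mu> ?C U"] \<W>(1,2) by simp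
    qed
    finally show "?i \<le> (\<Sum>\<^sub>\<infinity>U\<in>\<V>. tau_using \<mu> ?C U)" by simp
  qed
  show thesis by (rule that[OF r(1) main])
qed

section \<open>Separated sets in the fibre\<close>

lemma \<Lambda>_preimage:
  assumes g: "g \<in> carrier G" and B: "B \<in> sets \<Lambda>" shows "{y \<in> topspace F. g y \<in> B} \<in> sets \<Lambda>"
proof -
  have "g \<in> \<Lambda> \<rightarrow>\<^sub>M sigma (topspace F) {U. openin F U}"
  proof (rule measurable_measure_of)
    show "{U. openin F U} \<subseteq> Pow (topspace F)" using openin_subset by blast
    show "g \<in> space \<Lambda> \<rightarrow> topspace F" using G_in[OF g] by (simp add: space_\<Lambda>)
    fix U assume "U \<in> {U. openin F U}"
    then have "openin F {y \<in> topspace F. g y \<in> U}"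
      using openin_continuous_map_preimage[OF homeomorphic_imp_continuous_map[OF G_homeo[OF g]]] by blast
    moreover have "{y \<in> topspace F. g y \<in> U} = g -` U \<inter> space \<Lambda>" unfolding space_\<Lambda> by blast
    ultimately show "g -` U \<inter> space \<Lambda> \<in> sets \<Lambda>" using \<Lambda>_open by simp
  qed
  moreover have "B \<in> sets (sigma (topspace F) {U. openin F U})" using B measure(1) by (simp add: borel_of_def)
  ultimately have "g -` B \<inter> space \<Lambda> \<in> sets \<Lambda>" by (rule measurable_sets)
  moreover have "g -` B \<inter> space \<Lambda> = {y \<in> topspace F. g y \<in> B}" unfolding space_\<Lambda> by blast
  ultimately show ?thesis by simp
qed

text \<open>A maximal set whose translates by the ball of radius \<open>k\<close> are disjoint, built greedily over the
  members of a finite cover that are moved off themselves. By disjointness it has measure at most one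
  over the number of elements of the ball; by maximality every point gets into it by an element of the
  ball of radius \<open>2 k\<close>.\<close>

lemma separated_set:
  obtains Z where "Z \<in> sets \<Lambda>" "of_nat (card (Sn k)) * emeasure \<Lambda> Z \<le> 1"
    "\<And>y. y \<in> topspace F \<Longrightarrow> \<exists>g\<in>Sn (k + k). g y \<in> Z"
proof -
  let ?Q = "Sn (k + k)"
  have QG: "?Q \<subseteq> carrier G" using Sn_carrier by blast
  obtain \<O> where \<O>: "finite \<O>" "\<And>A. A \<in> \<O> \<Longrightarrow> openin F A" "topspace F = \<Union>\<O>"
    "\<And>A g y. \<lbrakk>A \<in> \<O>; g \<in> ?Q; y \<in> A; g y \<in> A\<rbrakk> \<Longrightarrow> g = \<one>\<^bsub>G\<^esub>"
    by (rule free_cover[OF Sn_finite QG]) (rule that)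
  obtain A and N :: nat where A: "\<O> = A ` {i. i < N}"
    using finite_imp_nat_seg_image_inj_on[OF \<O>(1)] by blast
  have AO: "A i \<in> \<O>" if "i < N" for i using A that by blast
  define Z where "Z = rec_nat {} (\<lambda>i Z. Z \<union> (A i - (\<Union>g\<in>?Q. {y \<in> topspace F. g y \<in> Z})))"
  have Z0: "Z 0 = {}" and ZS: "Z (Suc i) = Z i \<union> (A i - (\<Union>g\<in>?Q. {y \<in> topspace F. g y \<in> Z i}))" for i
    by (simp_all add: Z_def)
  have Zset: "Z i \<in> sets \<Lambda>" if "i \<le> N" for i
    using that
  proof (induction i)
    case (Suc i)
    have "A i \<in> sets \<Lambda>" using \<Lambda>_open[OF \<O>(2)[OF AO]] Suc.prems by simp
    moreover have "(\<Union>g\<in>?Q. {y \<in> topspace F. g y \<in> Z i}) \<in> sets \<Lambda>"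
      by (rule sets.finite_UN[OF Sn_finite]) (use Suc Sn_carrier in \<open>auto intro: \<Lambda>_preimage\<close>)
    ultimately show ?case unfolding ZS using Suc by auto
  qed (simp add: Z0)
  have sep: "g = \<one>\<^bsub>G\<^esub>" if "i \<le> N" "g \<in> ?Q" "y \<in> Z i" "g y \<in> Z i" for i g y
    using that
  proof (induction i arbitrary: g y)
    case (Suc i)
    have i: "i < N" using Suc.prems(1) by simp
    have F: "y \<in> topspace F" "g y \<in> topspace F"
      using sets.sets_into_space[OF Zset[OF Suc.prems(1)]] Suc.prems(3,4) unfolding space_\<Lambda> by blast+
    have gi: "inv\<^bsub>G\<^esub> g \<in> ?Q" by (rule G.word_ball_inv[OF generators(2) Suc.prems(2)])
    have back_y: "(inv\<^bsub>G\<^esub> g) (g y) = y" by (rule G_inv(1)[OF Sn_carrier[OF Suc.prems(2)] F(1)])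
    consider "y \<in> Z i" "g y \<in> Z i" | "y \<in> A i" "g y \<in> A i" | "y \<notin> Z i" "g y \<in> Z i" | "y \<in> Z i" "g y \<notin> Z i"
      using Suc.prems(3,4) unfolding ZS by blast
    then show ?case
    proof cases
      case 1
      then show ?thesis using Suc.IH Suc.prems by simp
    next
      case 2
      then show ?thesis using \<O>(4)[OF AO[OF i] Suc.prems(2)] by blast
    next
      case 3
      then show ?thesis using Suc.prems(2,3) F unfolding ZS by blast
    next
      case 4
      then have "g y \<notin> (\<Union>g\<in>?Q. {y \<in> topspace F. g y \<in> Z i})" using Suc.prems(4) unfolding ZS by blast
      moreover have "g y \<in> (\<Union>g\<in>?Q. {y \<in> topspace F. g y \<in> Z i})"
        by (rule UN_I[OF gi]) (use F back_y 4 in simp)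
      ultimately show ?thesis by blast
    qed
  qed (simp add: Z0)
  have mono: "Z i \<subseteq> Z j" if "i \<le> j" for i j
    using that by (induction j) (auto simp: ZS le_Suc_eq)
  have one: "\<one>\<^bsub>G\<^esub> \<in> ?Q" by (rule G.word_ball_one)
  have cover: "\<exists>g\<in>?Q. g y \<in> Z N" if y: "y \<in> topspace F" for y
  proof -
    obtain i where i: "i < N" "y \<in> A i" using y \<O>(3) A by blast
    show ?thesis
    proof (cases "\<exists>g\<in>?Q. g y \<in> Z i")
      case True
      then show ?thesis using mono[of i N] i(1) by auto
    next
      case False
      then have "y \<in> Z (Suc i)" unfolding ZS using i(2) by blast
      then have "\<one>\<^bsub>G\<^esub> y \<in> Z N" using mono[of "Suc i" N] i(1) G_one[OF y] by auto
      then show ?thesis using one by blast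
    qed
  qed
  have ZF: "Z N \<subseteq> topspace F" using sets.sets_into_space[OF Zset[of N]] by (simp add: space_\<Lambda>)
  have img: "g ` Z N \<in> sets \<Lambda>" if g: "g \<in> Sn k" for g
  proof -
    have gG: "g \<in> carrier G" using Sn_carrier[OF g] .
    have "g ` Z N = {y \<in> topspace F. (inv\<^bsub>G\<^esub> g) y \<in> Z N}"
    proof (intro equalityI subsetI)
      fix z assume "z \<in> g ` Z N"
      then obtain y where y: "y \<in> Z N" "z = g y" by blast
      then have "y \<in> topspace F" using ZF by blast
      then show "z \<in> {y \<in> topspace F. (inv\<^bsub>G\<^esub> g) y \<in> Z N}" using y G_in[OF gG] G_inv(1)[OF gG] by simp
    next
      fix z assume z: "z \<in> {y \<in> topspace F. (inv\<^bsub>G\<^esub> g) y \<in> Z N}"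
      then have "z = g ((inv\<^bsub>G\<^esub> g) z)" using G_inv(2)[OF gG] by simp
      then show "z \<in> g ` Z N" using z by blast
    qed
    then show ?thesis using \<Lambda>_preimage[OF G.inv_closed[OF gG] Zset[of N]] by simp
  qed
  have dis: "disjoint_family_on (\<lambda>g. g ` Z N) (Sn k)"
    unfolding disjoint_family_on_def
  proof (intro ballI impI, rule ccontr)
    fix g g' assume g: "g \<in> Sn k" "g' \<in> Sn k" "g \<noteq> g'" "g ` Z N \<inter> g' ` Z N \<noteq> {}"
    then obtain y y' where y: "y \<in> Z N" "y' \<in> Z N" "g y = g' y'" by blast
    have yF: "y \<in> topspace F" "y' \<in> topspace F" using y ZF by blast+
    have G: "g \<in> carrier G" "g' \<in> carrier G" using Sn_carrier g by blast+
    have "(inv\<^bsub>G\<^esub> g' \<otimes>\<^bsub>G\<^esub> g) y = y'" using G_mult[OF G.inv_closed[OF G(2)] G(1) yF(1)] y(3) G_inv(1)[OF G(2) yF(2)] by simp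
    moreover have "inv\<^bsub>G\<^esub> g' \<otimes>\<^bsub>G\<^esub> g \<in> ?Q"
      by (rule G.word_ball_mult[OF S_sub G.word_ball_inv[OF generators(2) g(2)] g(1)])
    ultimately have "inv\<^bsub>G\<^esub> g' \<otimes>\<^bsub>G\<^esub> g = \<one>\<^bsub>G\<^esub>" using sep[of N _ y] y by simp
    then have "y' = y" using \<open>(inv\<^bsub>G\<^esub> g' \<otimes>\<^bsub>G\<^esub> g) y = y'\<close> G_one[OF yF(1)] by simp
    then show False using G_determined[OF G yF(1)] y(3) g(3) by simp
  qed
  have "of_nat (card (Sn k)) * emeasure \<Lambda> (Z N) = (\<Sum>g\<in>Sn k. emeasure \<Lambda> (Z N))" by simp
  also have "\<dots> = (\<Sum>g\<in>Sn k. emeasure \<Lambda> (g ` Z N))"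
    by (rule sum.cong) (use invariant Sn_carrier Zset[of N] in auto)
  also have "\<dots> = emeasure \<Lambda> (\<Union>g\<in>Sn k. g ` Z N)"
    by (rule sum_emeasure[OF _ dis Sn_finite]) (use img in blast)
  also have "\<dots> \<le> 1" by (rule \<Lambda>.emeasure_le_1)
  finally show thesis using that[of "Z N"] Zset[of N] cover by blast
qed

lemma outer_open:
  assumes B: "B \<in> sets \<Lambda>" and d: "d > (0::real)"
  obtains V where "openin F V" "B \<subseteq> V" "emeasure \<Lambda> V \<le> emeasure \<Lambda> B + ennreal d"
proof -
  have "emeasure \<Lambda> B = (INF U\<in>{U. openin F U \<and> B \<subseteq> U}. emeasure \<Lambda> U)"
    using measure(3) B unfolding regular_measure_def by blast
  moreover have "emeasure \<Lambda> B \<noteq> \<infinity>" by simp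
  ultimately have "\<exists>U\<in>{U. openin F U \<and> B \<subseteq> U}. emeasure \<Lambda> U < emeasure \<Lambda> B + ennreal d"
    by (rule INF_approx_ennreal[OF d])
  then show thesis using that less_imp_le by blast
qed

text \<open>Up to an open set of small measure, the fibre is a disjoint union of open sets, each moved into a
  small open neighbourhood of the separated set by an element of its own.\<close>

lemma open_partition:
  assumes d: "d > (0::real)"
  obtains O' Z' R where "\<And>g. g \<in> Sn (k + k) \<Longrightarrow> openin F (O' g) \<and> g ` O' g \<subseteq> Z'"
    "disjoint_family_on O' (Sn (k + k))" "openin F Z'" "openin F R"
    "topspace F = (\<Union>g\<in>Sn (k + k). O' g) \<union> R"
    "emeasure \<Lambda> Z' \<le> inverse (of_nat (card (Sn k))) + ennreal d" "emeasure \<Lambda> R \<le> ennreal (2 * d)"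
proof -
  let ?Q = "Sn (k + k)"
  obtain Z where Z: "Z \<in> sets \<Lambda>" "of_nat (card (Sn k)) * emeasure \<Lambda> Z \<le> 1"
    "\<And>y. y \<in> topspace F \<Longrightarrow> \<exists>g\<in>?Q. g y \<in> Z" by (rule separated_set) (rule that)
  have "emeasure \<Lambda> Z \<le> inverse (of_nat (card (Sn k)))"
  proof -
    have "of_nat (card (Sn k)) * inverse (of_nat (card (Sn k)) :: ennreal) = 1"
      using Sn_card_pos[of k] ennreal_divide_self[of "of_nat (card (Sn k))"] by (simp add: divide_ennreal_def of_nat_less_top)
    then have "of_nat (card (Sn k)) * emeasure \<Lambda> Z \<le> of_nat (card (Sn k)) * inverse (of_nat (card (Sn k)))" using Z(2) by simp
    then have "inverse (of_nat (card (Sn k))) * (of_nat (card (Sn k)) * emeasure \<Lambda> Z) \<le> inverse (of_nat (card (Sn k)))"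
      by (rule ennreal_card_inverse[OF Sn_card_pos])
    moreover have "inverse (of_nat (card (Sn k))) * (of_nat (card (Sn k)) * emeasure \<Lambda> Z) = emeasure \<Lambda> Z"
      using \<open>of_nat (card (Sn k)) * inverse (of_nat (card (Sn k)) :: ennreal) = 1\<close> by (metis mult.assoc mult.commute mult_1)
    ultimately show ?thesis by simp
  qed
  moreover obtain Z' where Z': "openin F Z'" "Z \<subseteq> Z'" "emeasure \<Lambda> Z' \<le> emeasure \<Lambda> Z + ennreal d"
    by (rule outer_open[OF Z(1) d])
  ultimately have Z'le: "emeasure \<Lambda> Z' \<le> inverse (of_nat (card (Sn k))) + ennreal d"
    by (meson add_right_mono order_trans)
  obtain idx :: "('f \<Rightarrow> 'f) \<Rightarrow> nat" where idx: "inj_on idx ?Q"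
    using finite_imp_inj_to_nat_seg[OF Sn_finite, of "k + k"] by blast
  define P where "P g = {y \<in> topspace F. g y \<in> Z}" for g
  \<comment> \<open>Each point is allotted to the first element of the ball that takes it into \<open>Z\<close>.\<close>
  define E where "E g = P g - (\<Union>g'\<in>{g' \<in> ?Q. idx g' < idx g}. P g')" for g
  have P: "P g \<in> sets \<Lambda>" if "g \<in> ?Q" for g unfolding P_def by (rule \<Lambda>_preimage[OF Sn_carrier[OF that] Z(1)])
  have E: "E g \<in> sets \<Lambda>" if "g \<in> ?Q" for g unfolding E_def
    by (intro sets.Diff P that sets.finite_UN) (use Sn_finite P in auto)
  have disD: "g = g'" if "g \<in> ?Q" "g' \<in> ?Q" "y \<in> E g" "y \<in> E g'" for g g' y
  proof (rule ccontr)
    assume "g \<noteq> g'"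
    then have "idx g < idx g' \<or> idx g' < idx g" using idx that by (metis inj_onD linorder_neqE_nat)
    then show False using that unfolding E_def by blast
  qed
  have covD: "topspace F \<subseteq> (\<Union>g\<in>?Q. E g)"
  proof
    fix y assume y: "y \<in> topspace F"
    obtain g0 where g0: "g0 \<in> ?Q \<and> y \<in> P g0" using Z(3)[OF y] y unfolding P_def by blast
    obtain g where g: "g \<in> ?Q \<and> y \<in> P g" "\<And>g'. g' \<in> ?Q \<and> y \<in> P g' \<Longrightarrow> idx g \<le> idx g'"
      using ex_has_least_nat[of "\<lambda>g. g \<in> ?Q \<and> y \<in> P g" g0 idx] g0 by blast
    then have "y \<in> E g" unfolding E_def by (auto simp: not_less[symmetric])
    then show "y \<in> (\<Union>g\<in>?Q. E g)" using g(1) by blast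
  qed
  \<comment> \<open>The Borel pieces have no disjoint open neighbourhoods in general, but compact subsets of almost full
    measure do.\<close>
  obtain K where K: "\<And>g. g \<in> ?Q \<Longrightarrow> compactin F (K g) \<and> K g \<subseteq> E g"
    "(\<Sum>g\<in>?Q. emeasure \<Lambda> (E g)) \<le> (\<Sum>g\<in>?Q. emeasure \<Lambda> (K g)) + ennreal d"
    by (rule inner_compacts[OF Sn_finite E d]) (auto intro: that)
  define sp where "sp g g' AB \<longleftrightarrow> openin F (fst AB) \<and> openin F (snd AB) \<and> K g \<subseteq> fst AB \<and> K g' \<subseteq> snd AB \<and> fst AB \<inter> snd AB = {}"
    for g g' and AB :: "'f set \<times> 'f set"
  have exsp: "\<exists>AB. sp g g' AB" if g: "g \<in> ?Q" "g' \<in> ?Q" "g \<noteq> g'" for g g'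
  proof -
    have cl: "closedin F (K g)" "closedin F (K g')" using K(1) g compactin_imp_closedin[OF hausdorff_F] by blast+
    have dj: "disjnt (K g) (K g')" using disD[OF g(1,2)] K(1) g unfolding disjnt_def by blast
    have nF: "normal_space F" using compact_F hausdorff_F by (blast intro: compact_Hausdorff_or_regular_imp_normal_space)
    have "\<exists>A B. openin F A \<and> openin F B \<and> K g \<subseteq> A \<and> K g' \<subseteq> B \<and> disjnt A B"
      using nF[unfolded normal_space_def, rule_format, of "K g" "K g'"] cl dj by simp
    then obtain A B where "openin F A" "openin F B" "K g \<subseteq> A" "K g' \<subseteq> B" "disjnt A B" by blast
    then have "sp g g' (A, B)" unfolding sp_def disjnt_def by simp
    then show ?thesis by blast
  qed
  define s where "s g g' = (SOME AB. sp g g' AB)" for g g'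
  have s: "sp g g' (s g g')" if "g \<in> ?Q" "g' \<in> ?Q" "g \<noteq> g'" for g g'
    unfolding s_def by (rule someI_ex[OF exsp[OF that]])
  define O' where "O' g = \<Inter>(insert {y \<in> topspace F. g y \<in> Z'} ((\<lambda>g'. fst (s g g') \<inter> snd (s g' g)) ` (?Q - {g})))" for g
  have oO: "openin F (O' g)" if g: "g \<in> ?Q" for g
    unfolding O'_def
  proof (rule openin_Inter)
    fix V assume "V \<in> insert {y \<in> topspace F. g y \<in> Z'} ((\<lambda>g'. fst (s g g') \<inter> snd (s g' g)) ` (?Q - {g}))"
    then consider "V = {y \<in> topspace F. g y \<in> Z'}" | g' where "g' \<in> ?Q" "g' \<noteq> g" "V = fst (s g g') \<inter> snd (s g' g)" by blast
    then show "openin F V"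
    proof cases
      case 1
      then show ?thesis
        using openin_continuous_map_preimage[OF homeomorphic_imp_continuous_map[OF G_homeo[OF Sn_carrier[OF g]]] Z'(1)] by simp
    next
      case 2
      then show ?thesis using s[of g g'] s[of g' g] g unfolding sp_def by blast
    qed
  qed (use Sn_finite in auto)
  have KO: "K g \<subseteq> O' g" if g: "g \<in> ?Q" for g
  proof -
    have "K g \<subseteq> {y \<in> topspace F. g y \<in> Z'}" using K(1)[OF g] Z'(2) unfolding E_def P_def by blast
    moreover have "K g \<subseteq> fst (s g g') \<inter> snd (s g' g)" if "g' \<in> ?Q - {g}" for g'
      using s[of g g'] s[of g' g] g that unfolding sp_def by blast
    ultimately show ?thesis unfolding O'_def by blast
  qed
  have gO: "g ` O' g \<subseteq> Z'" for g unfolding O'_def by blast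
  have disO: "disjoint_family_on O' ?Q"
    unfolding disjoint_family_on_def
  proof (intro ballI impI equals0I)
    fix g g' y assume g: "g \<in> ?Q" "g' \<in> ?Q" "g \<noteq> g'" "y \<in> O' g \<inter> O' g'"
    have "y \<in> fst (s g g')" using g unfolding O'_def by blast
    moreover have "y \<in> snd (s g g')" using g unfolding O'_def by blast
    ultimately show False using s[OF g(1-3)] unfolding sp_def by blast
  qed
  define R0 where "R0 = topspace F - (\<Union>g\<in>?Q. O' g)"
  have clR: "closedin F R0" unfolding R0_def using oO by blast
  have Kd: "disjoint_family_on K ?Q" unfolding disjoint_family_on_def using disD K(1) by blast
  have Ks: "K g \<in> sets \<Lambda>" if "g \<in> ?Q" for g using \<Lambda>_compact K(1)[OF that] by blast
  have "emeasure \<Lambda> R0 \<le> emeasure \<Lambda> (topspace F - (\<Union>g\<in>?Q. K g))"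
  proof (rule emeasure_mono)
    show "R0 \<subseteq> topspace F - (\<Union>g\<in>?Q. K g)" unfolding R0_def using KO by blast
    show "topspace F - (\<Union>g\<in>?Q. K g) \<in> sets \<Lambda>"
      by (intro sets.Diff sets.finite_UN Sn_finite Ks \<Lambda>_open) auto
  qed
  also have "\<dots> = 1 - emeasure \<Lambda> (\<Union>g\<in>?Q. K g)"
  proof -
    have "(\<Union>g\<in>?Q. K g) \<in> sets \<Lambda>" by (intro sets.finite_UN Sn_finite Ks)
    then show ?thesis using emeasure_compl[of "\<Union>g\<in>?Q. K g" \<Lambda>] by (simp add: space_\<Lambda> emeasure_F)
  qed
  also have "\<dots> \<le> ennreal d"
  proof -
    have "1 = emeasure \<Lambda> (topspace F)" by (simp add: emeasure_F)
    also have "\<dots> \<le> emeasure \<Lambda> (\<Union>g\<in>?Q. E g)"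
      by (rule emeasure_mono[OF covD]) (intro sets.finite_UN Sn_finite E)
    also have "\<dots> \<le> (\<Sum>g\<in>?Q. emeasure \<Lambda> (E g))"
      by (rule emeasure_subadditive_finite) (use Sn_finite E in auto)
    also have "\<dots> \<le> (\<Sum>g\<in>?Q. emeasure \<Lambda> (K g)) + ennreal d" by (rule K(2))
    also have "(\<Sum>g\<in>?Q. emeasure \<Lambda> (K g)) = emeasure \<Lambda> (\<Union>g\<in>?Q. K g)"
      by (rule sum_emeasure[OF _ Kd Sn_finite]) (use Ks in blast)
    finally have "1 \<le> ennreal d + emeasure \<Lambda> (\<Union>g\<in>?Q. K g)" by (simp add: add.commute)
    then show ?thesis using ennreal_minus_le_iff[of 1] by (simp add: add.commute)
  qed
  finally have R0: "emeasure \<Lambda> R0 \<le> ennreal d" .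
  obtain R where R: "openin F R" "R0 \<subseteq> R" "emeasure \<Lambda> R \<le> emeasure \<Lambda> R0 + ennreal d"
    by (rule outer_open[OF \<Lambda>_closed[OF clR] d])
  have "emeasure \<Lambda> R \<le> ennreal d + ennreal d" using R(3) R0 by (meson add_right_mono order_trans)
  also have "\<dots> = ennreal (2 * d)" using d by (simp add: ennreal_plus[symmetric])
  finally have R2: "emeasure \<Lambda> R \<le> ennreal (2 * d)" .
  have "(\<Union>g\<in>?Q. O' g) \<union> R \<subseteq> topspace F" using oO openin_subset R(1) by blast
  then have eq: "topspace F = (\<Union>g\<in>?Q. O' g) \<union> R" using R(2) unfolding R0_def by blast
  show thesis
    by (rule that[OF _ disO Z'(1) R(1) eq Z'le R2]) (use oO gO in blast)
qed

end

section \<open>Chains of plaques along paths of the universal cover\<close>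

lemma plaque_chain_append:
  assumes "plaque_chain \<U> Ps" "plaque_chain \<U> Qs" "x \<in> last Ps" "x \<in> hd Qs"
  shows "plaque_chain \<U> (Ps @ Qs)"
  unfolding plaque_chain_def
proof (intro conjI allI impI)
  have ne: "Ps \<noteq> []" "Qs \<noteq> []" using assms(1,2) unfolding plaque_chain_def by simp_all
  then show "Ps @ Qs \<noteq> []" by simp
  show "set (Ps @ Qs) \<subseteq> (\<Union>c\<in>\<U>. plaques c)" using assms(1,2) unfolding plaque_chain_def by simp
  fix i assume i: "Suc i < length (Ps @ Qs)"
  consider "Suc i < length Ps" | "Suc i = length Ps" | "Suc i > length Ps" by linarith
  then show "(Ps @ Qs) ! i \<inter> (Ps @ Qs) ! Suc i \<noteq> {}"
  proof cases
    case 1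
    then show ?thesis using assms(1) unfolding plaque_chain_def by (simp add: nth_append)
  next
    case 2
    then have "i = length Ps - 1" "i < length Ps" by simp_all
    then have "(Ps @ Qs) ! i = last Ps" using ne by (simp add: nth_append last_conv_nth)
    moreover have "(Ps @ Qs) ! Suc i = hd Qs" using 2 ne by (simp add: nth_append hd_conv_nth)
    ultimately show ?thesis using assms(3,4) by blast
  next
    case 3
    then have "Suc (i - length Ps) < length Qs" using i by simp
    then have "Qs ! (i - length Ps) \<inter> Qs ! Suc (i - length Ps) \<noteq> {}" using assms(2) unfolding plaque_chain_def by blast
    then show ?thesis using 3 by (simp add: nth_append Suc_diff_le)
  qed
qed

context suspension_dynamics
begin

text \<open>The plaque depends on the point of the fibre, but the base does not.\<close>

definition plaque_small :: "'u set \<Rightarrow> bool" where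
  "plaque_small N \<longleftrightarrow> (\<forall>y\<in>topspace F. \<exists>c\<in>\<U>. \<exists>P\<in>plaques c. q ` (N \<times> {y}) \<subseteq> P)"

lemma plaque_small_subset: "plaque_small N \<Longrightarrow> N' \<subseteq> N \<Longrightarrow> plaque_small N'"
  unfolding plaque_small_def
proof (intro ballI)
  fix y assume N: "\<forall>y\<in>topspace F. \<exists>c\<in>\<U>. \<exists>P\<in>plaques c. q ` (N \<times> {y}) \<subseteq> P" "N' \<subseteq> N" "y \<in> topspace F"
  obtain c P where "c \<in> \<U>" "P \<in> plaques c" "q ` (N \<times> {y}) \<subseteq> P" using N(1)[rule_format, OF N(3)] by (elim bexE)
  moreover have "q ` (N' \<times> {y}) \<subseteq> q ` (N \<times> {y})" using N(2) by blast
  ultimately show "\<exists>c\<in>\<U>. \<exists>P\<in>plaques c. q ` (N' \<times> {y}) \<subseteq> P" by (meson order_trans)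
qed

lemma adapted_slice:
  assumes c: "c \<in> \<U>" "adapted B O' c" and u: "u \<in> B" and y: "y \<in> O'"
  obtains P where "P \<in> plaques c" "q ` (B \<times> {y}) \<subseteq> P"
proof -
  let ?s = "snd (chart_map c (q (u, y)))"
  have d: "q (v, y) \<in> chart_dom c" and s: "snd (chart_map c (q (v, y))) = ?s" if "v \<in> B" for v
    using c(2) that u y unfolding adapted_def by auto
  have o: "openin X (chart_dom c)" and
    hm: "homeomorphic_map (subtopology X (chart_dom c))
       (prod_topology (subtopology (Euclidean_space n) (chart_ball c)) (chart_trans c)) (chart_map c)"
    using atlas_chart[OF c(1)] unfolding foliated_chart_def by blast+
  have "q (u, y) \<in> topspace (subtopology X (chart_dom c))" using d[OF u] openin_subset[OF o] by auto
  then have "chart_map c (q (u, y)) \<in> topspace (prod_topology (subtopology (Euclidean_space n) (chart_ball c)) (chart_trans c))"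
    using homeomorphic_imp_surjective_map[OF hm] by blast
  then have "?s \<in> topspace (chart_trans c)" by (cases "chart_map c (q (u, y))") auto
  then have "{x \<in> chart_dom c. snd (chart_map c x) = ?s} \<in> plaques c" unfolding plaques_def by blast
  moreover have "q ` (B \<times> {y}) \<subseteq> {x \<in> chart_dom c. snd (chart_map c x) = ?s}" using d s by auto
  ultimately show thesis by (rule that)
qed

text \<open>By compactness the fibre over \<open>u\<close> is covered by finitely many adapted boxes; the intersection of their
  bases serves for all points of the fibre.\<close>

lemma plaque_small_at:
  assumes u: "u \<in> Mt"
  obtains N where "openin (top_of_set Mt) N" "u \<in> N" "plaque_small N"
proof -
  define good where "good O' B \<longleftrightarrow> openin (top_of_set Mt) B \<and> u \<in> B \<and> (\<exists>c\<in>\<U>. adapted B O' c)" for O' B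
  define \<O> where "\<O> = {O'. openin F O' \<and> (\<exists>B. good O' B)}"
  have "topspace F \<subseteq> \<Union>\<O>"
  proof
    fix y assume y: "y \<in> topspace F"
    obtain B O' c where B: "openin (top_of_set Mt) B" "path_connected B" "openin F O'" "u \<in> B" "B \<subseteq> Mt" "y \<in> O'"
      "c \<in> \<U>" "adapted B O' c"
      by (rule adapted_box_at[OF u y openin_topspace[of "top_of_set Mt", unfolded topspace_euclidean_subtopology] u]) (rule that)
    have "good O' B" unfolding good_def using B(1,4,7,8) by blast
    then show "y \<in> \<Union>\<O>" unfolding \<O>_def using B(3,6) by blast
  qed
  moreover have "compactin F (topspace F)" using compact_F by (simp add: compact_space_def)
  ultimately obtain \<Q> where \<Q>: "finite \<Q>" "\<Q> \<subseteq> \<O>" "topspace F \<subseteq> \<Union>\<Q>"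
    by (rule_tac compactinD[of F "topspace F" \<O>, THEN exE]) (auto simp: \<O>_def)
  define B where "B O' = (SOME B. good O' B)" for O'
  have B: "good O' (B O')" if "O' \<in> \<Q>" for O'
    unfolding B_def by (rule someI_ex) (use that \<Q>(2) in \<open>auto simp: \<O>_def\<close>)
  define N where "N = \<Inter>(insert Mt (B ` \<Q>))"
  have oM: "openin (top_of_set Mt) Mt" by simp
  have "openin (top_of_set Mt) N"
    unfolding N_def by (rule openin_Inter) (use \<Q>(1) B oM in \<open>auto simp: good_def\<close>)
  moreover have "u \<in> N" unfolding N_def using u B unfolding good_def by blast
  moreover have "plaque_small N"
    unfolding plaque_small_def
  proof
    fix y assume "y \<in> topspace F"
    then obtain O' where O': "O' \<in> \<Q>" "y \<in> O'" using \<Q>(3) by blast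
    obtain c where c: "c \<in> \<U>" "adapted (B O') O' c" using B[OF O'(1)] unfolding good_def by blast
    have "u \<in> B O'" using B[OF O'(1)] unfolding good_def by blast
    then obtain P where P: "P \<in> plaques c" "q ` (B O' \<times> {y}) \<subseteq> P" by (rule adapted_slice[OF c _ O'(2)])
    have "N \<subseteq> B O'" unfolding N_def using O'(1) by blast
    then have "q ` (N \<times> {y}) \<subseteq> P" using P(2) by blast
    then show "\<exists>c\<in>\<U>. \<exists>P\<in>plaques c. q ` (N \<times> {y}) \<subseteq> P" using c(1) P(1) by blast
  qed
  ultimately show thesis by (rule that)
qed

text \<open>The chain depends on the point \<open>y\<close> of the fibre, but the bound for its length does not.\<close>

definition chained :: "nat \<Rightarrow> 'u set \<Rightarrow> 'u \<Rightarrow> 'u \<Rightarrow> bool" where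
  "chained m A a b \<longleftrightarrow> (\<forall>y\<in>topspace F. \<exists>Ps. plaque_chain \<U> Ps \<and> length Ps \<le> m \<and>
     q ` (A \<times> {y}) \<subseteq> \<Union>(set Ps) \<and> q (a, y) \<in> hd Ps \<and> q (b, y) \<in> last Ps)"

lemma chainedE:
  assumes "chained m A a b" "y \<in> topspace F"
  obtains Ps where "plaque_chain \<U> Ps" "length Ps \<le> m" "q ` (A \<times> {y}) \<subseteq> \<Union>(set Ps)" "q (a, y) \<in> hd Ps" "q (b, y) \<in> last Ps"
proof -
  note ex = bspec[OF assms(1)[unfolded chained_def] assms(2)]
  show thesis by (rule exE[OF ex]) (elim conjE, rule that)
qed

lemma chained_mono: "chained m A a b \<Longrightarrow> m \<le> m' \<Longrightarrow> A' \<subseteq> A \<Longrightarrow> chained m' A' a b"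
  unfolding chained_def
proof (intro ballI)
  fix y assume H: "\<forall>y\<in>topspace F. \<exists>Ps. plaque_chain \<U> Ps \<and> length Ps \<le> m \<and>
     q ` (A \<times> {y}) \<subseteq> \<Union>(set Ps) \<and> q (a, y) \<in> hd Ps \<and> q (b, y) \<in> last Ps" "m \<le> m'" "A' \<subseteq> A" "y \<in> topspace F"
  obtain Ps where Ps: "plaque_chain \<U> Ps" "length Ps \<le> m" "q ` (A \<times> {y}) \<subseteq> \<Union>(set Ps)" "q (a, y) \<in> hd Ps" "q (b, y) \<in> last Ps"
    using bspec[OF H(1) H(4)] by (elim exE conjE)
  have "q ` (A' \<times> {y}) \<subseteq> \<Union>(set Ps)" using Ps(3) H(3) by blast
  moreover have "length Ps \<le> m'" using Ps(2) H(2) by simp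
  ultimately show "\<exists>Ps. plaque_chain \<U> Ps \<and> length Ps \<le> m' \<and>
     q ` (A' \<times> {y}) \<subseteq> \<Union>(set Ps) \<and> q (a, y) \<in> hd Ps \<and> q (b, y) \<in> last Ps" using Ps(1,4,5)
    by (intro exI[of _ Ps] conjI)
qed

lemma chained_join:
  assumes "chained m A a b" "chained m' A' b c"
  shows "chained (m + m') (A \<union> A') a c"
  unfolding chained_def
proof
  fix y assume y: "y \<in> topspace F"
  obtain Ps where Ps: "plaque_chain \<U> Ps" "length Ps \<le> m" "q ` (A \<times> {y}) \<subseteq> \<Union>(set Ps)" "q (a, y) \<in> hd Ps" "q (b, y) \<in> last Ps"
    by (rule chainedE[OF assms(1) y])
  obtain Qs where Qs: "plaque_chain \<U> Qs" "length Qs \<le> m'" "q ` (A' \<times> {y}) \<subseteq> \<Union>(set Qs)" "q (b, y) \<in> hd Qs" "q (c, y) \<in> last Qs"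
    by (rule chainedE[OF assms(2) y])
  have ne: "Ps \<noteq> []" "Qs \<noteq> []" using Ps(1) Qs(1) unfolding plaque_chain_def by simp_all
  have "q ` ((A \<union> A') \<times> {y}) \<subseteq> \<Union>(set (Ps @ Qs))"
  proof -
    have "q ` ((A \<union> A') \<times> {y}) = q ` (A \<times> {y}) \<union> q ` (A' \<times> {y})" by blast
    moreover have "\<Union>(set (Ps @ Qs)) = \<Union>(set Ps) \<union> \<Union>(set Qs)" by simp
    ultimately show ?thesis using Un_mono[OF Ps(3) Qs(3)] by (simp only:)
  qed
  moreover have "plaque_chain \<U> (Ps @ Qs)" by (rule plaque_chain_append[OF Ps(1) Qs(1) Ps(5) Qs(4)])
  moreover have "length (Ps @ Qs) \<le> m + m'" using Ps(2) Qs(2) by simp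
  moreover have "q (a, y) \<in> hd (Ps @ Qs)" "q (c, y) \<in> last (Ps @ Qs)" using Ps(4) Qs(5) ne by simp_all
  ultimately show "\<exists>Ps. plaque_chain \<U> Ps \<and> length Ps \<le> m + m' \<and>
     q ` ((A \<union> A') \<times> {y}) \<subseteq> \<Union>(set Ps) \<and> q (a, y) \<in> hd Ps \<and> q (c, y) \<in> last Ps" by (intro exI[of _ "Ps @ Qs"] conjI)
qed

lemma q_translate_left:
  assumes "c \<in> carrier \<Gamma>" "u \<in> Mt" "y \<in> topspace F"
  shows "q (T c u, y) = q (u, h (inv\<^bsub>\<Gamma>\<^esub> c) y)"
proof -
  have "h (inv\<^bsub>\<Gamma>\<^esub> c) y \<in> topspace F" by (rule h_in[OF inv_simps(1)[OF assms(1)] assms(3)])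
  from q_translate[OF assms(1,2) this] show ?thesis unfolding inv_simps(5)[OF assms(1,3)] .
qed

lemma chained_translate:
  assumes c: "c \<in> carrier \<Gamma>" and A: "A \<subseteq> Mt" "a \<in> Mt" "b \<in> Mt" and ch: "chained m A a b"
  shows "chained m (T c ` A) (T c a) (T c b)"
  unfolding chained_def
proof
  fix y assume y: "y \<in> topspace F"
  let ?y = "h (inv\<^bsub>\<Gamma>\<^esub> c) y"
  have y': "?y \<in> topspace F" by (rule h_in[OF inv_simps(1)[OF c] y])
  obtain Ps where Ps: "plaque_chain \<U> Ps" "length Ps \<le> m" "q ` (A \<times> {?y}) \<subseteq> \<Union>(set Ps)" "q (a, ?y) \<in> hd Ps" "q (b, ?y) \<in> last Ps"
    by (rule chainedE[OF ch y'])
  have "q ` (T c ` A \<times> {y}) \<subseteq> q ` (A \<times> {?y})" using q_translate_left[OF c _ y] A(1) by auto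
  then have "q ` (T c ` A \<times> {y}) \<subseteq> \<Union>(set Ps)" using Ps(3) by (rule order_trans)
  moreover have "q (T c a, y) \<in> hd Ps" "q (T c b, y) \<in> last Ps"
    using Ps(4,5) q_translate_left[OF c A(2) y] q_translate_left[OF c A(3) y] by simp_all
  ultimately show "\<exists>Ps. plaque_chain \<U> Ps \<and> length Ps \<le> m \<and>
     q ` (T c ` A \<times> {y}) \<subseteq> \<Union>(set Ps) \<and> q (T c a, y) \<in> hd Ps \<and> q (T c b, y) \<in> last Ps" using Ps(1,2)
    by (intro exI[of _ Ps] conjI)
qed

lemma chained_small:
  assumes "plaque_small N" "a \<in> N" "b \<in> N"
  shows "chained 1 N a b"
  unfolding chained_def
proof
  fix y assume y: "y \<in> topspace F"
  obtain c P where P: "c \<in> \<U>" "P \<in> plaques c" "q ` (N \<times> {y}) \<subseteq> P"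
    using bspec[OF assms(1)[unfolded plaque_small_def] y] by (elim bexE)
  have "plaque_chain \<U> [P]" using P(1,2) unfolding plaque_chain_def by auto
  moreover have "q (a, y) \<in> P" "q (b, y) \<in> P" using P(3) assms(2,3) by auto
  ultimately show "\<exists>Ps. plaque_chain \<U> Ps \<and> length Ps \<le> 1 \<and>
     q ` (N \<times> {y}) \<subseteq> \<Union>(set Ps) \<and> q (a, y) \<in> hd Ps \<and> q (b, y) \<in> last Ps"
    using P(3) by (intro exI[of _ "[P]"] conjI) simp_all
qed

text \<open>By compactness of the interval: the number of plaques needed along a path of the universal cover is
  bounded independently of the point of the fibre.\<close>

lemma path_chained:
  assumes \<sigma>: "path \<sigma>" "path_image \<sigma> \<subseteq> Mt"
  obtains m where "chained m (path_image \<sigma>) (pathstart \<sigma>) (pathfinish \<sigma>)"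
proof -
  define P where "P a b \<longleftrightarrow> 0 \<le> a \<longrightarrow> b \<le> 1 \<longrightarrow> (\<exists>m. chained m (\<sigma> ` {a..b}) (\<sigma> a) (\<sigma> b))" for a b
  have "P 0 1"
  proof (rule Bolzano)
    fix a b c :: real assume H: "P a b" "P b c" "a \<le> b" "b \<le> c"
    show "P a c" unfolding P_def
    proof (intro impI)
      assume ac: "0 \<le> a" "c \<le> 1"
      obtain m where m: "chained m (\<sigma> ` {a..b}) (\<sigma> a) (\<sigma> b)"
        using H(1)[unfolded P_def, rule_format, OF ac(1)] order_trans[OF H(4) ac(2)] by blast
      obtain m' where m': "chained m' (\<sigma> ` {b..c}) (\<sigma> b) (\<sigma> c)"
        using H(2)[unfolded P_def, rule_format, OF order_trans[OF ac(1) H(3)] ac(2)] by blast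
      have "\<sigma> ` {a..b} \<union> \<sigma> ` {b..c} = \<sigma> ` {a..c}" using ivl_disj_un_two_touch(4)[OF H(3,4)] by (simp add: image_Un[symmetric])
      then show "\<exists>m. chained m (\<sigma> ` {a..c}) (\<sigma> a) (\<sigma> c)" using chained_join[OF m m'] by (intro exI[of _ "m + m'"]) simp
    qed
  next
    fix x :: real assume x: "0 \<le> x" "x \<le> 1"
    have xM: "\<sigma> x \<in> Mt" using \<sigma>(2) x unfolding path_image_def by auto
    obtain N where N: "openin (top_of_set Mt) N" "\<sigma> x \<in> N" "plaque_small N" by (rule plaque_small_at[OF xM])
    obtain V where V: "open V" "N = Mt \<inter> V" using N(1) unfolding openin_open by blast
    have "continuous_on {0..1} \<sigma>" using \<sigma>(1) unfolding path_def .
    then obtain d where d: "d > 0" "\<And>s. s \<in> {0..1} \<Longrightarrow> dist s x < d \<Longrightarrow> \<sigma> s \<in> V"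
    proof -
      assume c: "continuous_on {0..1} \<sigma>"
      assume *: "\<And>d. d > 0 \<Longrightarrow> (\<And>s. s \<in> {0..1} \<Longrightarrow> dist s x < d \<Longrightarrow> \<sigma> s \<in> V) \<Longrightarrow> thesis"
      obtain A where A: "open A" "x \<in> A" "\<forall>s\<in>{0..1}. s \<in> A \<longrightarrow> \<sigma> s \<in> V"

      proof -
        have "x \<in> {0..1}" "\<sigma> x \<in> V" using x N(2) V(2) by auto
        then show thesis using c[unfolded continuous_on_topological, rule_format, OF _ V(1)] that by blast
      qed
      obtain d where "d > 0" "ball x d \<subseteq> A" using A(1,2) openE by blast
      then show thesis using A(3) by (intro *[of d]) (auto simp: dist_commute subset_iff)
    qed
    show "\<exists>d>0. \<forall>a b. a \<le> x \<and> x \<le> b \<and> b - a < d \<longrightarrow> P a b"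
    proof (intro exI[of _ d] conjI allI impI d(1))
      fix a b assume ab: "a \<le> x \<and> x \<le> b \<and> b - a < d"
      show "P a b" unfolding P_def
      proof (intro impI)
        assume "0 \<le> a" "b \<le> 1"
        then have sub: "\<sigma> s \<in> N" if "s \<in> {a..b}" for s
          using that ab d(2)[of s] \<sigma>(2) unfolding V(2) path_image_def by (auto simp: dist_real_def)
        have "plaque_small (\<sigma> ` {a..b})" by (rule plaque_small_subset[OF N(3)]) (use sub in blast)
        then have "chained 1 (\<sigma> ` {a..b}) (\<sigma> a) (\<sigma> b)" by (rule chained_small) (use ab in auto)
        then show "\<exists>m. chained m (\<sigma> ` {a..b}) (\<sigma> a) (\<sigma> b)" by (rule exI)
      qed
    qed
  qed simp
  then obtain m where "chained m (\<sigma> ` {0..1}) (\<sigma> 0) (\<sigma> 1)" unfolding P_def by auto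
  then show thesis using that unfolding path_image_def pathstart_def pathfinish_def by blast
qed

text \<open>A path that realizes \<open>g\<close> as holonomy: its end point over the fibre point \<open>y\<close> is also the point over \<open>w\<close>
  with the fibre coordinate moved by the inverse of \<open>g\<close>.\<close>

definition word_path :: "'u \<Rightarrow> nat \<Rightarrow> ('f \<Rightarrow> 'f) \<Rightarrow> (real \<Rightarrow> 'u) \<Rightarrow> (real \<Rightarrow> 'm) set \<Rightarrow> bool" where
  "word_path w m g \<sigma> c \<longleftrightarrow> c \<in> carrier \<Gamma> \<and> h c = g \<and> path \<sigma> \<and> path_image \<sigma> \<subseteq> Mt \<and> pathstart \<sigma> = w \<and>
     pathfinish \<sigma> = T c w \<and> chained m (path_image \<sigma>) w (T c w)"

lemma word_path_one:
  assumes w: "w \<in> Mt" shows "word_path w 1 \<one>\<^bsub>G\<^esub> (\<lambda>_. w) \<one>\<^bsub>\<Gamma>\<^esub>"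
proof -
  obtain N where N: "openin (top_of_set Mt) N" "w \<in> N" "plaque_small N" by (rule plaque_small_at[OF w])
  have "chained 1 N w w" by (rule chained_small[OF N(3,2,2)])
  then have "chained 1 {w} w w" by (rule chained_mono) (use N(2) in auto)
  moreover have "h \<one>\<^bsub>\<Gamma>\<^esub> = \<one>\<^bsub>G\<^esub>" using group_hom.hom_one[OF group_hom_h] by (simp add: G_eq)
  moreover have "\<one>\<^bsub>\<Gamma>\<^esub> \<in> carrier \<Gamma>" using group_\<Gamma> by (rule group.is_monoid[THEN monoid.one_closed])
  ultimately show ?thesis unfolding word_path_def using w T_one[OF w] by (simp only: const_path) simp
qed

lemma word_path_mult:
  assumes w: "w \<in> Mt" and s: "word_path w m s \<sigma> c" and g: "word_path w m' g \<tau> d"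
  shows "word_path w (m + m') (s \<otimes>\<^bsub>G\<^esub> g) (\<sigma> +++ (T c \<circ> \<tau>)) (c \<otimes>\<^bsub>\<Gamma>\<^esub> d)"
proof -
  have c: "c \<in> carrier \<Gamma>" "h c = s" "path \<sigma>" "path_image \<sigma> \<subseteq> Mt" "pathstart \<sigma> = w" "pathfinish \<sigma> = T c w"
    "chained m (path_image \<sigma>) w (T c w)" using s unfolding word_path_def by blast+
  have d: "d \<in> carrier \<Gamma>" "h d = g" "path \<tau>" "path_image \<tau> \<subseteq> Mt" "pathstart \<tau> = w" "pathfinish \<tau> = T d w"
    "chained m' (path_image \<tau>) w (T d w)" using g unfolding word_path_def by blast+
  have cd: "c \<otimes>\<^bsub>\<Gamma>\<^esub> d \<in> carrier \<Gamma>" using group_\<Gamma> c(1) d(1) by (simp add: group.is_monoid monoid.m_closed)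
  have hcd: "h (c \<otimes>\<^bsub>\<Gamma>\<^esub> d) = s \<otimes>\<^bsub>G\<^esub> g" using group_hom.hom_mult[OF group_hom_h c(1) d(1)] c(2) d(2) by (simp add: G_eq)
  have Tcd: "T (c \<otimes>\<^bsub>\<Gamma>\<^esub> d) w = T c (T d w)" by (rule deck_of_mult[OF c(1) d(1) w])
  have dw: "T d w \<in> Mt" by (rule T_in[OF d(1) w])
  have ct: "continuous_on (path_image \<tau>) (T c)"
    using deckD(1)[OF deck_of_deck[OF c(1)]] d(4) by (rule continuous_on_subset)
  have p2: "path (T c \<circ> \<tau>)" by (rule path_continuous_image[OF d(3) ct])
  have i2: "path_image (T c \<circ> \<tau>) = T c ` path_image \<tau>" by (simp add: path_image_compose)
  have e2: "pathstart (T c \<circ> \<tau>) = T c w" "pathfinish (T c \<circ> \<tau>) = T c (T d w)"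
    using d(5,6) by (simp_all add: pathstart_compose pathfinish_compose)
  have "chained m' (T c ` path_image \<tau>) (T c w) (T c (T d w))"
    by (rule chained_translate[OF c(1) d(4) w dw d(7)])
  then have "chained (m + m') (path_image \<sigma> \<union> path_image (T c \<circ> \<tau>)) w (T c (T d w))"
    unfolding i2 by (rule chained_join[OF c(7)])
  then have ch: "chained (m + m') (path_image (\<sigma> +++ (T c \<circ> \<tau>))) w (T c (T d w))"
    by (rule chained_mono[OF _ order_refl]) (rule path_image_join_subset)
  have img: "path_image (T c \<circ> \<tau>) \<subseteq> Mt" unfolding i2 using d(4) T_in[OF c(1)] by blast
  have pj: "path (\<sigma> +++ (T c \<circ> \<tau>))" using c(3,6) p2 e2 by (simp add: path_join_imp)
  have ij: "path_image (\<sigma> +++ (T c \<circ> \<tau>)) \<subseteq> Mt" using path_image_join_subset[of \<sigma> "T c \<circ> \<tau>"] c(4) img by blast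
  show ?thesis unfolding word_path_def Tcd
    using cd hcd pj ij ch c(5) e2 by simp
qed

text \<open>A path from a point to its translate by a generator has a chain; concatenating translates of these
  paths along a word gives chains of length linear in the length of the word.\<close>

lemma word_paths:
  assumes w: "w \<in> Mt"
  obtains L where "\<And>k g. g \<in> Sn k \<Longrightarrow> \<exists>\<sigma> c. word_path w (1 + L * k) g \<sigma> c"
proof -
  have ex: "\<exists>m \<sigma> c. word_path w m s \<sigma> c" if s: "s \<in> S" for s
  proof -
    obtain c where c: "c \<in> carrier \<Gamma>" "s = h c" by (rule G_cases[OF subsetD[OF S_sub s]])
    obtain \<sigma> where \<sigma>: "path \<sigma>" "path_image \<sigma> \<subseteq> Mt" "pathstart \<sigma> = w" "pathfinish \<sigma> = T c w"
      by (rule path_connectedE[OF path_connected_Mt w T_in[OF c(1) w]])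
    obtain m where "chained m (path_image \<sigma>) (pathstart \<sigma>) (pathfinish \<sigma>)" by (rule path_chained[OF \<sigma>(1,2)])
    then have "word_path w m s \<sigma> c" unfolding word_path_def using c \<sigma> by simp
    then show ?thesis by blast
  qed
  define m where "m s = (SOME m. \<exists>\<sigma> c. word_path w m s \<sigma> c)" for s
  have m: "\<exists>\<sigma> c. word_path w (m s) s \<sigma> c" if "s \<in> S" for s unfolding m_def by (rule someI_ex[OF ex[OF that]])
  define L where "L = sum m S"
  have mono: "word_path w j g \<sigma> c \<Longrightarrow> j \<le> j' \<Longrightarrow> word_path w j' g \<sigma> c" for j j' g \<sigma> c
    unfolding word_path_def using chained_mono[of j _ w "T c w" j'] by blast
  have words: "\<exists>\<sigma> c. word_path w (1 + L * length xs) (G.word xs) \<sigma> c" if "set xs \<subseteq> S" for xs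
    using that
  proof (induction xs)
    case Nil
    then show ?case using word_path_one[OF w] by (intro exI) simp
  next
    case (Cons s xs)
    obtain \<tau> d where g: "word_path w (1 + L * length xs) (G.word xs) \<tau> d" using Cons by auto
    have "s \<in> S" using Cons.prems by simp
    then obtain \<sigma> c where s: "word_path w (m s) s \<sigma> c" using m by blast
    have "m s \<le> L" unfolding L_def using generators(1) \<open>s \<in> S\<close> by (simp add: member_le_sum)
    then have "m s + (1 + L * length xs) \<le> 1 + L * length (s # xs)" by simp
    then have "word_path w (1 + L * length (s # xs)) (s \<otimes>\<^bsub>G\<^esub> G.word xs) (\<sigma> +++ (T c \<circ> \<tau>)) (c \<otimes>\<^bsub>\<Gamma>\<^esub> d)"
      by (rule mono[OF word_path_mult[OF w s g]])
    then show ?case by (intro exI) simp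
  qed
  have "\<exists>\<sigma> c. word_path w (1 + L * k) g \<sigma> c" if g: "g \<in> Sn k" for k g
  proof -
    obtain xs where xs: "set xs \<subseteq> S" "length xs \<le> k" "g = G.word xs" by (rule G.word_ballE[OF g])
    obtain \<sigma> c where "word_path w (1 + L * length xs) (G.word xs) \<sigma> c" using words[OF xs(1)] by blast
    then have "word_path w (1 + L * k) g \<sigma> c" unfolding xs(3) by (rule mono) (use xs(2) in simp)
    then show ?thesis by blast
  qed
  then show thesis by (rule that)
qed

end

section \<open>Contractions of boxes\<close>

text \<open>First contract to the centre of the ball, then follow a path from there. Deformations are defined for all
  real times, so the motion rests outside the unit interval.\<close>

definition contract_then_move ::
    "('u \<Rightarrow> nat \<Rightarrow> real) \<Rightarrow> ((nat \<Rightarrow> real) \<Rightarrow> 'u) \<Rightarrow> (nat \<Rightarrow> real) \<Rightarrow> (real \<Rightarrow> 'u) \<Rightarrow> 'u \<Rightarrow> real \<Rightarrow> 'u" where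
  "contract_then_move \<psi> \<phi> b \<sigma> w t =
     (if t \<le> 1 / 2 then radial \<psi> \<phi> b w (max 0 (2 * t)) else \<sigma> (min 1 (2 * t - 1)))"

lemma contract_then_move:
  assumes W: "coordinate_ball n C p W \<psi> \<phi> b r" and \<sigma>: "path \<sigma>" "pathstart \<sigma> = \<phi> b"
  shows "continuous_on (W \<times> UNIV) (\<lambda>(w, t). contract_then_move \<psi> \<phi> b \<sigma> w t)"
    "\<And>w. w \<in> W \<Longrightarrow> contract_then_move \<psi> \<phi> b \<sigma> w 0 = w"
    "\<And>w. contract_then_move \<psi> \<phi> b \<sigma> w 1 = pathfinish \<sigma>"
    "\<And>w t. w \<in> W \<Longrightarrow> contract_then_move \<psi> \<phi> b \<sigma> w t \<in> W \<union> path_image \<sigma>"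
    "\<And>w. contract_then_move \<psi> \<phi> b \<sigma> w (1 / 2) = \<phi> b"
proof -
  note rad = radial[OF W]
  let ?A = "W \<times> {..1 / 2 :: real}" and ?B = "W \<times> {1 / 2 :: real..}"
  have ca: "continuous_on ?A (\<lambda>z. radial \<psi> \<phi> b (fst z) (max 0 (2 * snd z)))"
  proof -
    have "continuous_on ?A (\<lambda>z. (fst z, max 0 (2 * snd z)))" by (intro continuous_intros)
    moreover have "(\<lambda>z. (fst z, max 0 (2 * snd z))) ` ?A \<subseteq> W \<times> {0..1}" by auto
    ultimately have "continuous_on ?A ((\<lambda>(w, t). radial \<psi> \<phi> b w t) \<circ> (\<lambda>z. (fst z, max 0 (2 * snd z))))"
      by (rule continuous_on_compose[OF _ continuous_on_subset[OF rad(1)]])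
    then show ?thesis by (simp add: o_def)
  qed
  have cb: "continuous_on ?B (\<lambda>z. \<sigma> (min 1 (2 * snd z - 1)))"
  proof -
    have "continuous_on ?B (\<lambda>z. min 1 (2 * snd z - 1))" by (intro continuous_intros)
    moreover have "(\<lambda>z. min 1 (2 * snd z - 1)) ` ?B \<subseteq> {0..1}" by auto
    ultimately have "continuous_on ?B (\<sigma> \<circ> (\<lambda>z. min 1 (2 * snd z - 1)))"
      by (rule continuous_on_compose[OF _ continuous_on_subset[OF \<sigma>(1)[unfolded path_def]]])
    then show ?thesis by (simp add: o_def)
  qed
  have agree: "radial \<psi> \<phi> b w (max 0 (2 * t)) = \<sigma> (min 1 (2 * t - 1))" if "t = 1 / 2" for w t
  proof -
    have "max 0 (2 * t) = 1" "min 1 (2 * t - 1) = 0" using that by simp_all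
    then show ?thesis using rad(4) \<sigma>(2) by (simp only: pathstart_def)
  qed
  have "closedin (top_of_set (W \<times> UNIV)) ?A" "closedin (top_of_set (W \<times> UNIV)) ?B"
    by (simp_all add: closedin_Times)
  moreover have "W \<times> UNIV = ?A \<union> ?B" by auto
  ultimately have "continuous_on (?A \<union> ?B) (\<lambda>z. if snd z \<le> 1 / 2 then radial \<psi> \<phi> b (fst z) (max 0 (2 * snd z))
      else \<sigma> (min 1 (2 * snd z - 1)))"
    by (intro continuous_on_cases_local ca cb) (auto intro!: agree)
  then show "continuous_on (W \<times> UNIV) (\<lambda>(w, t). contract_then_move \<psi> \<phi> b \<sigma> w t)"
    using \<open>W \<times> UNIV = ?A \<union> ?B\<close> by (simp add: contract_then_move_def case_prod_beta)
  show "contract_then_move \<psi> \<phi> b \<sigma> w 0 = w" if "w \<in> W" for w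
    using rad(3)[OF that] by (simp add: contract_then_move_def)
  show "contract_then_move \<psi> \<phi> b \<sigma> w 1 = pathfinish \<sigma>" for w
    by (simp add: contract_then_move_def pathfinish_def)
  show "contract_then_move \<psi> \<phi> b \<sigma> w (1 / 2) = \<phi> b" for w
    using rad(4) by (simp add: contract_then_move_def)
  show "contract_then_move \<psi> \<phi> b \<sigma> w t \<in> W \<union> path_image \<sigma>" if "w \<in> W" for w t
  proof (cases "t \<le> 1 / 2")
    case True
    then show ?thesis using rad(2)[OF that, of "max 0 (2 * t)"] by (simp add: contract_then_move_def)
  next
    case False
    then have "min 1 (2 * t - 1) \<in> {0..1}" by auto
    then show ?thesis using False unfolding contract_then_move_def path_image_def by auto
  qed
qed

context suspension_dynamics
begin

lemma box_subset_X: "W \<subseteq> Mt \<Longrightarrow> O' \<subseteq> topspace F \<Longrightarrow> q ` (W \<times> O') \<subseteq> topspace X"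
  using q_in_X by blast

text \<open>The box is homeomorphic to \<open>W \<times> O'\<close>, so a motion of \<open>W\<close> can be applied to its first coordinate.\<close>

lemma box_motion_continuous:
  assumes W: "openin (top_of_set Mt) W" "inj_on p W" and O': "openin F O'"
    and K: "continuous_on (W \<times> UNIV) (\<lambda>(w, t). K w (t :: real))" "\<And>w t. w \<in> W \<Longrightarrow> K w t \<in> Mt"
    and f: "\<And>w y t. w \<in> W \<Longrightarrow> y \<in> O' \<Longrightarrow> f (q (w, y), t) = q (K w t, y)"
  shows "continuous_map (prod_topology (subtopology X (q ` (W \<times> O'))) euclideanreal) X f"
proof -
  let ?P = "prod_topology (top_of_set W) (subtopology F O')" and ?Q = "subtopology X (q ` (W \<times> O'))"
  have OF: "O' \<subseteq> topspace F" using O' openin_subset by blast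
  obtain s where s: "homeomorphic_maps ?P ?Q q s"
    using q_homeomorphic[OF W O'] unfolding homeomorphic_map_maps by blast
  have cs: "continuous_map ?Q ?P s" and qs: "\<And>x. x \<in> topspace ?Q \<Longrightarrow> q (s x) = x"
    using s unfolding homeomorphic_maps_def by blast+
  let ?R = "prod_topology ?Q euclideanreal"
  have c1: "continuous_map ?R (top_of_set W) (\<lambda>z. fst (s (fst z)))"
    and c2: "continuous_map ?R (subtopology F O') (\<lambda>z. snd (s (fst z)))"
    using continuous_map_compose[OF continuous_map_compose[OF continuous_map_fst cs] continuous_map_fst]
      continuous_map_compose[OF continuous_map_compose[OF continuous_map_fst cs] continuous_map_snd]
    by (simp_all add: o_def)
  have c3: "continuous_map ?R (top_of_set (W \<times> UNIV)) (\<lambda>z. (fst (s (fst z)), snd z))"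
  proof -
    have "continuous_map ?R (prod_topology (top_of_set W) euclideanreal) (\<lambda>z. (fst (s (fst z)), snd z))"
      by (intro continuous_map_pairedI c1 continuous_map_snd)
    then show ?thesis by (simp add: prod_topology_subtopology_eu[symmetric] subtopology_Times[symmetric] euclidean_product_topology)
  qed
  have c4: "continuous_map (top_of_set (W \<times> UNIV)) (top_of_set Mt) (\<lambda>(w, t). K w t)"
    using K by (auto simp: continuous_map_in_subtopology)
  have c5: "continuous_map ?R (top_of_set Mt) (\<lambda>z. K (fst (s (fst z))) (snd z))"
    using continuous_map_compose[OF c3 c4] by (simp add: o_def)
  have c6: "continuous_map ?R F (\<lambda>z. snd (s (fst z)))" using c2 by (simp add: continuous_map_in_subtopology)
  have c7: "continuous_map ?R X (\<lambda>z. q (K (fst (s (fst z))) (snd z), snd (s (fst z))))"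
    using continuous_map_compose[OF continuous_map_pairedI[OF c5 c6] continuous_q] by (simp add: o_def)
  show ?thesis
  proof (rule continuous_map_eq[OF c7])
    fix z assume z: "z \<in> topspace ?R"
    then have x: "fst z \<in> topspace ?Q" by auto
    have "s (fst z) \<in> topspace ?P" using cs x unfolding continuous_map_def by blast
    then obtain w y where wy: "s (fst z) = (w, y)" "w \<in> W" "y \<in> O'" by (cases "s (fst z)") auto
    have "f z = f (q (w, y), snd z)" using qs[OF x] wy(1) by (cases z) simp
    then show "q (K (fst (s (fst z))) (snd z), snd (s (fst z))) = f z" using f[OF wy(2,3)] wy(1) by simp
  qed
qed

text \<open>The pieces of the box over the disjoint open sets \<open>O' i\<close> can be moved along different paths without losing
  continuity. First each slice is contracted inside a single plaque, and then it follows the path of its piece;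
  so one plaque is added to the chain of the path.\<close>

lemma contraction_exists:
  assumes W: "coordinate_ball n Mt p W \<psi> \<phi> b r" "plaque_small W"
    and O': "\<And>i. i \<in> I \<Longrightarrow> openin F (O' i)" "disjoint_family_on O' I"
    and \<sigma>: "\<And>i. i \<in> I \<Longrightarrow> path (\<sigma> i) \<and> path_image (\<sigma> i) \<subseteq> Mt \<and> pathstart (\<sigma> i) = \<phi> b \<and>
        chained m (path_image (\<sigma> i)) (\<phi> b) (pathfinish (\<sigma> i))"
  obtains H where "H \<in> tangential_contractions X \<L> (q ` (W \<times> (\<Union>i\<in>I. O' i)))"
    "deformation_length \<U> (q ` (W \<times> (\<Union>i\<in>I. O' i))) H \<le> enat (m + 2)"
    "H ` (q ` (W \<times> (\<Union>i\<in>I. O' i)) \<times> {1}) = (\<Union>i\<in>I. q ` ({pathfinish (\<sigma> i)} \<times> O' i))"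
proof -
  let ?O = "\<Union>i\<in>I. O' i"
  let ?U = "q ` (W \<times> ?O)"
  have oW: "openin (top_of_set Mt) W" and inj: "inj_on p W" using W(1) unfolding coordinate_ball_def by blast+
  have WM: "W \<subseteq> Mt" using oW openin_imp_subset by blast
  have cW: "connected W" using coordinate_ball_path_connected[OF W(1)] by (rule path_connected_imp_connected)
  have bW: "\<phi> b \<in> W" by (rule radial(5)[OF W(1)])
  have oO: "openin F ?O" using O'(1) by blast
  have OF: "?O \<subseteq> topspace F" using oO openin_subset by blast
  have oU: "openin X ?U" by (rule open_q[OF oW oO])
  define K where "K i = contract_then_move \<psi> \<phi> b (\<sigma> i)" for i
  have K: "continuous_on (W \<times> UNIV) (\<lambda>(w, t). K i w t)" "\<And>w. w \<in> W \<Longrightarrow> K i w 0 = w"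
    "\<And>w. K i w 1 = pathfinish (\<sigma> i)" "\<And>w t. w \<in> W \<Longrightarrow> K i w t \<in> W \<union> path_image (\<sigma> i)"
    "\<And>w. K i w (1 / 2) = \<phi> b" if "i \<in> I" for i
    unfolding K_def using contract_then_move[OF W(1), of "\<sigma> i"] \<sigma>[OF that] by blast+
  have KM: "K i w t \<in> Mt" if "i \<in> I" "w \<in> W" for i w t using K(4)[OF that] \<sigma>[OF that(1)] WM by blast
  define idx where "idx y = (THE i. i \<in> I \<and> y \<in> O' i)" for y
  have idx: "idx y = i" if i: "i \<in> I" "y \<in> O' i" for i y
    unfolding idx_def
  proof (rule the_equality)
    fix j assume "j \<in> I \<and> y \<in> O' j"
    then show "j = i" using O'(2) i unfolding disjoint_family_on_def by blast
  qed (use i in blast)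
  define s where "s = inv_into (W \<times> ?O) q"
  have injq: "inj_on q (W \<times> ?O)"
  proof (rule inj_onI)
    fix a c assume ac: "a \<in> W \<times> ?O" "c \<in> W \<times> ?O" "q a = q c"
    obtain u y where u: "a = (u, y)" by (cases a)
    obtain v z where v: "c = (v, z)" by (cases c)
    have "u = v \<and> y = z" by (rule q_inj[OF WM inj]) (use ac u v OF in auto)
    then show "a = c" using u v by simp
  qed
  have s: "s (q (w, y)) = (w, y)" if "w \<in> W" "y \<in> O' i" "i \<in> I" for w y i
    unfolding s_def by (rule inv_into_f_f[OF injq]) (use that in blast)
  define H where "H z = q (K (idx (snd (s (fst z)))) (fst (s (fst z))) (snd z), snd (s (fst z)))" for z
  have H: "H (q (w, y), t) = q (K i w t, y)" if "w \<in> W" "y \<in> O' i" "i \<in> I" for w y i t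
    unfolding H_def using s[OF that] idx[OF that(3,2)] by simp
  have Ucases: "\<exists>w i y. w \<in> W \<and> i \<in> I \<and> y \<in> O' i \<and> x = q (w, y)" if "x \<in> ?U" for x using that by blast
  have OiF: "O' i \<subseteq> topspace F" if "i \<in> I" for i using O'(1)[OF that] openin_subset by blast
  have cont: "continuous_map (prod_topology (subtopology X ?U) euclideanreal) X H"
  proof (rule pasting_lemma[where I = I and T = "\<lambda>i. q ` (W \<times> O' i) \<times> UNIV" and f = "\<lambda>i. H"])
    fix i assume i: "i \<in> I"
    let ?V = "q ` (W \<times> O' i)"
    have oV: "openin X ?V" by (rule open_q[OF oW O'(1)[OF i]])
    have sub: "?V \<subseteq> ?U" using i by blast
    show "openin (prod_topology (subtopology X ?U) euclideanreal) (?V \<times> UNIV)"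
    proof -
      have "openin (subtopology X ?U) ?V" unfolding openin_open_subtopology[OF oU] using oV sub by (rule conjI)
      then show ?thesis by (simp add: openin_prod_Times_iff)
    qed
    have "subtopology (prod_topology (subtopology X ?U) euclideanreal) (?V \<times> UNIV) =
        prod_topology (subtopology X ?V) euclideanreal"
      using sub by (simp add: subtopology_Times subtopology_subtopology inf.absorb2)
    moreover have "continuous_map (prod_topology (subtopology X ?V) euclideanreal) X H"
      by (rule box_motion_continuous[OF oW inj O'(1)[OF i] K(1)[OF i] KM[OF i]]) (assumption, rule H[OF _ _ i])
    ultimately show "continuous_map (subtopology (prod_topology (subtopology X ?U) euclideanreal) (?V \<times> UNIV)) X H" by simp
  next
    fix x assume x: "x \<in> topspace (prod_topology (subtopology X ?U) euclideanreal)"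
    then have "fst x \<in> ?U" by auto
    then obtain w i y where "w \<in> W" "i \<in> I" "y \<in> O' i" "fst x = q (w, y)" using Ucases by blast
    then show "\<exists>j. j \<in> I \<and> x \<in> q ` (W \<times> O' j) \<times> UNIV \<and> H x = H x"
      by (intro exI[of _ i]) (cases x, auto)
  qed simp
  have leafU: "\<exists>i y. i \<in> I \<and> y \<in> O' i \<and> L \<subseteq> q ` (W \<times> {y})" if L: "L \<in> leaves_in ?U" for L
  proof -
    have "L \<noteq> {}" using L unfolding leaves_def by (rule nonempty_connected_components_of)
    moreover have "L \<subseteq> ?U" using connected_components_of_subset[OF L[unfolded leaves_def]] topspace_leaf_top[OF oU] by simp
    ultimately obtain x where x: "x \<in> L" "x \<in> ?U" by blast
    obtain w i y where wy: "w \<in> W" "i \<in> I" "y \<in> O' i" "x = q (w, y)" using Ucases[OF x(2)] by (elim exE conjE)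
    have yO: "y \<in> ?O" using wy(2,3) by blast
    have "L \<subseteq> q ` (W \<times> {y})" by (rule leaf_of_box[OF oW inj oO L _ wy(1) yO]) (use x(1) wy(4) in simp)
    then show ?thesis using wy(2,3) by blast
  qed
  have along: "\<exists>L'\<in>leaves \<L>. H ` (L \<times> UNIV) \<subseteq> L'" if L: "L \<in> leaves_in ?U" for L
  proof -
    obtain i y where y: "i \<in> I" "y \<in> O' i" "L \<subseteq> q ` (W \<times> {y})" using leafU[OF L] by (elim exE conjE)
    have yF: "y \<in> topspace F" using OiF y(1,2) by blast
    define C where "C = (\<lambda>(w, t). K i w t) ` (W \<times> UNIV)"
    have CM: "C \<subseteq> Mt" unfolding C_def using KM[OF y(1)] by auto
    have "connected (W \<times> (UNIV :: real set))" using cW connected_UNIV by (rule connected_Times)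
    then have cC: "connected C" unfolding C_def by (rule connected_continuous_image[OF K(1)[OF y(1)]])
    have bC: "\<phi> b \<in> C" unfolding C_def using K(5)[OF y(1)] bW by (intro image_eqI[of _ _ "(\<phi> b, 1 / 2)"]) simp_all
    have oX: "openin X (topspace X)" by simp
    have bX: "q (\<phi> b, y) \<in> topspace X" using q_in_X[OF _ yF] bW WM by blast
    obtain L' where L': "L' \<in> leaves_in (topspace X)" "q (\<phi> b, y) \<in> L'" by (rule leaf_exists[OF oX bX])
    have CX: "q ` (C \<times> {y}) \<subseteq> topspace X" by (rule box_subset_X[OF CM]) (use yF in simp)
    have bqC: "q (\<phi> b, y) \<in> q ` (C \<times> {y})" using bC by (intro imageI) simp
    have "q ` (C \<times> {y}) \<subseteq> L'" by (rule slice_in_leaf[OF oX CM cC yF CX L' bqC])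
    moreover have "H ` (L \<times> UNIV) \<subseteq> q ` (C \<times> {y})"
    proof
      fix z assume "z \<in> H ` (L \<times> UNIV)"
      then obtain x t where x: "x \<in> L" "z = H (x, t)" by blast
      then obtain w where w: "w \<in> W" "x = q (w, y)" using y(3) by blast
      have "K i w t \<in> C" unfolding C_def using w(1) by (intro image_eqI[of _ _ "(w, t)"]) simp_all
      then have "q (K i w t, y) \<in> q ` (C \<times> {y})" by (intro imageI) simp
      then show "z \<in> q ` (C \<times> {y})" using H[OF w(1) y(2,1)] x(2) w(2) by simp
    qed
    moreover have "L' \<in> leaves \<L>" using L'(1) unfolding restrict_lamination_X .
    ultimately show ?thesis by (meson order_trans)
  qed
  have const: "\<exists>z. \<forall>x\<in>L. H (x, 1) = z" if L: "L \<in> leaves_in ?U" for L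
  proof -
    obtain i y where y: "i \<in> I" "y \<in> O' i" "L \<subseteq> q ` (W \<times> {y})" using leafU[OF L] by (elim exE conjE)
    have "H (x, 1) = q (pathfinish (\<sigma> i), y)" if x: "x \<in> L" for x
    proof -
      obtain w where "w \<in> W" "x = q (w, y)" using y(3) x by blast
      then show ?thesis using H[OF _ y(2,1)] K(3)[OF y(1)] by simp
    qed
    then show ?thesis by blast
  qed
  have H0: "H (x, 0) = x" if x: "x \<in> ?U" for x
  proof -
    obtain w i y where wy: "w \<in> W" "i \<in> I" "y \<in> O' i" "x = q (w, y)" using Ucases[OF x] by (elim exE conjE)
    then show ?thesis using H[OF wy(1,3,2)] K(2)[OF wy(2,1)] by simp
  qed
  have contr: "H \<in> tangential_contractions X \<L> ?U"
    unfolding tangential_contractions_def tangential_deformation_def mem_Collect_eq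
    by (intro conjI ballI oU cont H0 along const)
  have len: "deformation_length \<U> ?U H \<le> enat (m + 2)"
    unfolding deformation_length_def
  proof (rule SUP_least)
    fix x assume x: "x \<in> ?U"
    obtain w i y where wy: "w \<in> W" "i \<in> I" "y \<in> O' i" "x = q (w, y)" using Ucases[OF x] by (elim exE conjE)
    have yF: "y \<in> topspace F" using OiF wy(2,3) by blast
    have "chained 1 W (\<phi> b) (\<phi> b)" by (rule chained_small[OF W(2) bW bW])
    then have "chained (1 + m) (W \<union> path_image (\<sigma> i)) (\<phi> b) (pathfinish (\<sigma> i))"
      by (rule chained_join) (use \<sigma>[OF wy(2)] in blast)
    then obtain Ps where Ps: "plaque_chain \<U> Ps" "length Ps \<le> 1 + m" "q ` ((W \<union> path_image (\<sigma> i)) \<times> {y}) \<subseteq> \<Union>(set Ps)"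
      using yF by (rule chainedE)
    have "(\<lambda>t. H (x, t)) ` {0..1} \<subseteq> q ` ((W \<union> path_image (\<sigma> i)) \<times> {y})"
    proof
      fix z assume "z \<in> (\<lambda>t. H (x, t)) ` {0..1}"
      then obtain t where "z = H (x, t)" by blast
      then have "z = q (K i w t, y)" using H[OF wy(1,3,2)] wy(4) by simp
      then show "z \<in> q ` ((W \<union> path_image (\<sigma> i)) \<times> {y})" using K(4)[OF wy(2,1)] by blast
    qed
    then have "(\<lambda>t. H (x, t)) ` {0..1} \<subseteq> \<Union>(set Ps)" using Ps(3) by (rule order_trans)
    then have "leaf_path_length \<U> ((\<lambda>t. H (x, t)) ` {0..1}) \<le> enat (length Ps + 1)"
      unfolding leaf_path_length_def using Ps(1) by (intro Inf_lower) blast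
    also have "\<dots> \<le> enat (m + 2)" using Ps(2) by simp
    finally show "leaf_path_length \<U> ((\<lambda>t. H (x, t)) ` {0..1}) \<le> enat (m + 2)" .
  qed
  have img: "H ` (?U \<times> {1}) = (\<Union>i\<in>I. q ` ({pathfinish (\<sigma> i)} \<times> O' i))"
  proof (intro equalityI subsetI)
    fix z assume "z \<in> H ` (?U \<times> {1})"
    then obtain x where x: "x \<in> ?U" "z = H (x, 1)" by blast
    obtain w i y where wy: "w \<in> W" "i \<in> I" "y \<in> O' i" "x = q (w, y)" using Ucases[OF x(1)] by (elim exE conjE)
    have "z = q (pathfinish (\<sigma> i), y)" using H[OF wy(1,3,2)] K(3)[OF wy(2)] wy(4) x(2) by simp
    then show "z \<in> (\<Union>i\<in>I. q ` ({pathfinish (\<sigma> i)} \<times> O' i))" using wy(2,3) by blast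
  next
    fix z assume "z \<in> (\<Union>i\<in>I. q ` ({pathfinish (\<sigma> i)} \<times> O' i))"
    then obtain i y where y: "i \<in> I" "y \<in> O' i" "z = q (pathfinish (\<sigma> i), y)" by blast
    have "z = H (q (\<phi> b, y), 1)" using H[OF bW y(2,1)] K(3)[OF y(1)] y(3) by simp
    moreover have "q (\<phi> b, y) \<in> ?U" using bW y(1,2) by blast
    ultimately show "z \<in> H ` (?U \<times> {1})" by blast
  qed
  show thesis by (rule that[OF contr len img])
qed

end

section \<open>Growth types\<close>

lemma growth_le_trans: "growth_le a b \<Longrightarrow> growth_le b c \<Longrightarrow> growth_le a c"
  unfolding growth_le_def
proof (elim exE conjE)
  fix B B' :: nat and A A' :: real
  assume H: "1 \<le> B" "0 < A" "\<forall>n\<ge>1. a n \<le> ennreal A * b (B * n)" "1 \<le> B'" "0 < A'" "\<forall>n\<ge>1. b n \<le> ennreal A' * c (B' * n)"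
  have "a n \<le> ennreal (A * A') * c ((B' * B) * n)" if n: "1 \<le> n" for n
  proof -
    have "1 \<le> B * n" using H(1) n by simp
    then have "b (B * n) \<le> ennreal A' * c (B' * (B * n))" using H(6) by blast
    then have "ennreal A * b (B * n) \<le> ennreal A * (ennreal A' * c (B' * (B * n)))" by (rule mult_left_mono) simp
    then have "a n \<le> ennreal A * (ennreal A' * c (B' * (B * n)))" using H(3) n by (blast intro: order_trans)
    then show ?thesis using H(2,5) by (simp add: ennreal_mult' mult.assoc)
  qed
  then show "\<exists>B\<ge>1. \<exists>A>0. \<forall>n\<ge>1. a n \<le> ennreal A * c (B * n)"
    using H(1,2,4,5) by (intro exI[of _ "B' * B"] conjI exI[of _ "A * A'"]) simp_all
qed

lemma growth_type_eqI:
  assumes "growth_le a b" "growth_le b a" shows "growth_type a = growth_type b"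
proof -
  have "growth_le a k \<and> growth_le k a \<longleftrightarrow> growth_le b k \<and> growth_le k b" for k
    using growth_le_trans[of a b k] growth_le_trans[of k a b] growth_le_trans[of b a k] growth_le_trans[of k b a] assms
    by (intro iffI conjI) (elim conjE, simp)+
  then show ?thesis unfolding growth_type_def by simp
qed

lemma ennreal_inverse_le:
  assumes "inverse a \<le> (b :: ennreal)" "0 < a" "a < top_class.top" shows "inverse b \<le> a"
proof (cases "b = top_class.top")
  case False
  have ia: "inverse a * a = 1" using ennreal_divide_self[of a] assms(2,3) by (simp add: divide_ennreal_def mult.commute)
  have b0: "b \<noteq> 0" using assms(1,3) by auto
  have ib: "inverse b * b = 1" using ennreal_divide_self[of b] b0 False by (simp add: divide_ennreal_def mult.commute less_top)
  have "inverse b = inverse b * (inverse a * a)" using ia by simp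
  also have "\<dots> \<le> inverse b * (b * a)" by (intro mult_left_mono mult_right_mono assms(1)) simp_all
  also have "\<dots> = a" using ib by (simp add: mult.assoc[symmetric])
  finally show ?thesis .
qed simp

section \<open>The upper bound for the category\<close>

context suspension_measure
begin

text \<open>The set over \<open>W\<close> is contracted onto the fibre over one point, and the piece over \<open>O' g\<close> is then taken by the
  holonomy \<open>g\<close> into \<open>Z'\<close>. The length of the contraction is linear in the word length \<open>k\<close>, with a rate \<open>L\<close>
  that depends on \<open>W\<close> only.\<close>

definition linear_contractions :: "'u set \<Rightarrow> nat \<Rightarrow> bool" where
  "linear_contractions W L \<longleftrightarrow> (\<forall>k P O' Z'. P \<subseteq> Sn k \<longrightarrow> (\<forall>g\<in>P. openin F (O' g) \<and> g ` O' g \<subseteq> Z') \<longrightarrow>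
      disjoint_family_on O' P \<longrightarrow> openin F Z' \<longrightarrow>
    (\<exists>H\<in>tangential_contractions X \<L> (q ` (W \<times> (\<Union>g\<in>P. O' g))).
      deformation_length \<U> (q ` (W \<times> (\<Union>g\<in>P. O' g))) H \<le> enat (1 + L * k + 2) \<and>
      \<mu> (H ` (q ` (W \<times> (\<Union>g\<in>P. O' g)) \<times> {1})) \<le> emeasure \<Lambda> Z'))"

lemma ball_contractions:
  assumes W: "coordinate_ball n Mt p W \<psi> \<phi> b r" "plaque_small W"
  obtains L where "linear_contractions W L"
proof -
  have "openin (top_of_set Mt) W" using W(1) unfolding coordinate_ball_def by blast
  then have bM: "\<phi> b \<in> Mt" using radial(5)[OF W(1)] openin_imp_subset by blast
  obtain L where L: "\<And>k g. g \<in> Sn k \<Longrightarrow> \<exists>\<sigma> c. word_path (\<phi> b) (1 + L * k) g \<sigma> c"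
    by (rule word_paths[OF bM]) (rule that)
  have main: "\<exists>H\<in>tangential_contractions X \<L> (q ` (W \<times> (\<Union>g\<in>P. O' g))).
      deformation_length \<U> (q ` (W \<times> (\<Union>g\<in>P. O' g))) H \<le> enat (1 + L * k + 2) \<and>
      \<mu> (H ` (q ` (W \<times> (\<Union>g\<in>P. O' g)) \<times> {1})) \<le> emeasure \<Lambda> Z'"
    if P: "P \<subseteq> Sn k" and O': "\<And>g. g \<in> P \<Longrightarrow> openin F (O' g) \<and> g ` O' g \<subseteq> Z'"
      and dis: "disjoint_family_on O' P" and Z': "openin F Z'" for k P O' Z'
  proof -
    define wp where "wp g s \<longleftrightarrow> word_path (\<phi> b) (1 + L * k) (inv\<^bsub>G\<^esub> g) (fst s) (snd s)" for g and s :: "(real \<Rightarrow> 'u) \<times> (real \<Rightarrow> 'm) set"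
    have exwp: "\<exists>s. wp g s" if g: "g \<in> P" for g
    proof -
      have "inv\<^bsub>G\<^esub> g \<in> Sn k" by (rule G.word_ball_inv[OF generators(2)]) (use P g in blast)
      then obtain \<sigma> c where "word_path (\<phi> b) (1 + L * k) (inv\<^bsub>G\<^esub> g) \<sigma> c" using L by blast
      then have "wp g (\<sigma>, c)" unfolding wp_def by simp
      then show ?thesis by (rule exI)
    qed
    define s where "s g = (SOME s. wp g s)" for g
    have s: "wp g (s g)" if "g \<in> P" for g unfolding s_def by (rule someI_ex[OF exwp[OF that]])
    define \<sigma> where "\<sigma> g = fst (s g)" for g
    define c where "c g = snd (s g)" for g
    have wps: "c g \<in> carrier \<Gamma>" "h (c g) = inv\<^bsub>G\<^esub> g" "path (\<sigma> g)" "path_image (\<sigma> g) \<subseteq> Mt" "pathstart (\<sigma> g) = \<phi> b"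
      "pathfinish (\<sigma> g) = T (c g) (\<phi> b)" "chained (1 + L * k) (path_image (\<sigma> g)) (\<phi> b) (T (c g) (\<phi> b))" if "g \<in> P" for g
      using s[OF that] unfolding wp_def word_path_def \<sigma>_def c_def by blast+
    have oO: "openin F (O' g)" if "g \<in> P" for g using O'[OF that] by blast
    have ok: "path (\<sigma> g) \<and> path_image (\<sigma> g) \<subseteq> Mt \<and> pathstart (\<sigma> g) = \<phi> b \<and>
        chained (1 + L * k) (path_image (\<sigma> g)) (\<phi> b) (pathfinish (\<sigma> g))" if "g \<in> P" for g
      unfolding wps(6)[OF that] by (intro conjI wps(3,4,5,7)[OF that])
    obtain H where H: "H \<in> tangential_contractions X \<L> (q ` (W \<times> (\<Union>g\<in>P. O' g)))"
      "deformation_length \<U> (q ` (W \<times> (\<Union>g\<in>P. O' g))) H \<le> enat (1 + L * k + 2)"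
      "H ` (q ` (W \<times> (\<Union>g\<in>P. O' g)) \<times> {1}) = (\<Union>g\<in>P. q ` ({pathfinish (\<sigma> g)} \<times> O' g))"
      by (rule contraction_exists[OF W oO dis ok])
    let ?B = "\<Union>g\<in>P. g ` O' g"
    have PG: "g \<in> carrier G" if "g \<in> P" for g using Sn_carrier subsetD[OF P that] .
    have "q (pathfinish (\<sigma> g), y) = q (\<phi> b, g y)" if g: "g \<in> P" and y: "y \<in> O' g" for g y
    proof -
      have yF: "y \<in> topspace F" using openin_subset[OF oO[OF g]] y by blast
      have gy: "g y \<in> topspace F" by (rule G_in[OF PG[OF g] yF])
      have "h (inv\<^bsub>\<Gamma>\<^esub> (c g)) y = h (inv\<^bsub>\<Gamma>\<^esub> (c g)) (h (c g) (g y))"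
        unfolding wps(2)[OF g] using G_inv(1)[OF PG[OF g] yF] by simp
      also have "\<dots> = g y" by (rule inv_simps(4)[OF wps(1)[OF g] gy])
      finally show ?thesis unfolding wps(6)[OF g] using q_translate_left[OF wps(1)[OF g] bM yF] by simp
    qed
    then have "H ` (q ` (W \<times> (\<Union>g\<in>P. O' g)) \<times> {1}) = q ` ({\<phi> b} \<times> ?B)"
      unfolding H(3) by (auto simp: image_iff) force+
    moreover have oB: "openin F ?B"
    proof -
      have "openin F (g ` O' g)" if g: "g \<in> P" for g
        using homeomorphic_imp_open_map[OF G_homeo[OF PG[OF g]]] oO[OF g] unfolding open_map_def by blast
      then show ?thesis by blast
    qed
    moreover have "?B \<subseteq> Z'" using O' by blast
    ultimately have "\<mu> (H ` (q ` (W \<times> (\<Union>g\<in>P. O' g)) \<times> {1})) \<le> emeasure \<Lambda> Z'"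
      using \<mu>_fiber[OF bM \<Lambda>_open[OF oB]] emeasure_mono[OF _ \<Lambda>_open[OF Z']] by simp
    then show ?thesis using H(1,2) by blast
  qed
  have "linear_contractions W L"
    unfolding linear_contractions_def by (intro allI impI) (rule main, simp_all)
  then show thesis by (rule that)
qed

text \<open>The suspension is covered by the boxes of finitely many balls of the universal cover with the two parts of
  the fibre given by \<open>open_partition\<close>. The end of the first box has at most the measure of a neighbourhood of a
  separated set, and the part of the fibre in the second box has small measure itself.\<close>

lemma upper_bound:
  obtains B A where "B \<ge> 1" "A > (0::real)"
    "\<And>k. k \<ge> 1 \<Longrightarrow> Cat_bounded X \<L> \<mu> (B * k) \<U> \<le> ennreal A * inverse (of_nat (card (Sn k)))"
proof -
  have small: "\<exists>W \<psi> \<phi> c r. coordinate_ball n Mt p W \<psi> \<phi> c r \<and> u \<in> W \<and> plaque_small W" if u: "u \<in> Mt" for u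
  proof -
    obtain N where N: "openin (top_of_set Mt) N" "u \<in> N" "plaque_small N" by (rule plaque_small_at[OF u])
    obtain W \<psi> \<phi> c r where W: "coordinate_ball n Mt p W \<psi> \<phi> c r" "u \<in> W" "W \<subseteq> N" by (rule ball_at[OF N(1,2)])
    show ?thesis by (intro exI conjI) (rule W(1), rule W(2), rule plaque_small_subset[OF N(3) W(3)])
  qed
  obtain \<W> where \<W>: "finite \<W>" "\<And>W. W \<in> \<W> \<Longrightarrow> (\<exists>\<psi> \<phi> c r. coordinate_ball n Mt p W \<psi> \<phi> c r) \<and> plaque_small W"
    "\<And>x. x \<in> topspace X \<Longrightarrow> \<exists>W\<in>\<W>. x \<in> q ` (W \<times> topspace F)"
    by (rule ball_cover[of plaque_small, OF small]) (assumption, rule that)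
  define l where "l W = (SOME L. linear_contractions W L)" for W
  have l: "linear_contractions W (l W)" if WW: "W \<in> \<W>" for W
  proof -
    obtain \<psi> \<phi> b r where W: "coordinate_ball n Mt p W \<psi> \<phi> b r" "plaque_small W" using \<W>(2)[OF WW] by (elim conjE exE)
    obtain L where "linear_contractions W L" by (rule ball_contractions[OF W])
    then show ?thesis unfolding l_def by (rule someI)
  qed
  define L where "L = sum l \<W>"
  define B where "B = 3 + 2 * L"
  \<comment> \<open>There are two boxes over each ball, and the ends have measure at most \<open>2 / card (Sn k)\<close>; the
    summand 1 keeps the constant positive.\<close>
  define A where "A = 4 * real (card \<W>) + 1"
  have bound: "Cat_bounded X \<L> \<mu> (B * k) \<U> \<le> ennreal A * inverse (of_nat (card (Sn k)))" if k: "k \<ge> 1" for k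
  proof -
    define N where "N = card (Sn k)"
    have N: "N > 0" unfolding N_def by (rule Sn_card_pos)
    let ?d = "1 / real N" and ?Q = "Sn (k + k)"
    let ?C = "\<lambda>U. {H \<in> tangential_contractions X \<L> U. deformation_length \<U> U H \<le> enat (B * k)}"
    have d: "?d > 0" using N by simp
    obtain O' Z' R where O': "\<And>g. g \<in> ?Q \<Longrightarrow> openin F (O' g) \<and> g ` O' g \<subseteq> Z'"
      "disjoint_family_on O' ?Q" "openin F Z'" "openin F R" "topspace F = (\<Union>g\<in>?Q. O' g) \<union> R"
      "emeasure \<Lambda> Z' \<le> inverse (of_nat (card (Sn k))) + ennreal ?d" "emeasure \<Lambda> R \<le> ennreal (2 * ?d)"
      by (rule open_partition[OF d, of k]) (rule that)
    have iN: "inverse (of_nat N :: ennreal) = ennreal ?d"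
      using N by (simp add: ennreal_of_nat_eq_real_of_nat inverse_ennreal inverse_eq_divide)
    have Zb: "emeasure \<Lambda> Z' \<le> ennreal (2 * ?d)"
    proof -
      have "inverse (of_nat (card (Sn k))) + ennreal ?d = ennreal (2 * ?d)"
        unfolding N_def[symmetric] iN using d by (simp add: ennreal_plus[symmetric] del: ennreal_plus)
      then show ?thesis using O'(6) by simp
    qed
    define U1 where "U1 W = q ` (W \<times> (\<Union>g\<in>?Q. O' g))" for W
    define U2 where "U2 W = q ` (W \<times> (\<Union>g\<in>{\<one>\<^bsub>G\<^esub>}. R))" for W
    have lB: "enat (1 + l W * (k + k) + 2) \<le> enat (B * k)" if W: "W \<in> \<W>" for W
    proof -
      have "l W \<le> L" unfolding L_def using \<W>(1) W by (simp add: member_le_sum)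
      then have "l W * (k + k) \<le> L * (k + k)" by simp
      moreover have "B * k = 3 * k + L * (k + k)" unfolding B_def by (simp add: algebra_simps)
      ultimately have "1 + l W * (k + k) + 2 \<le> B * k" using k by linarith
      then show ?thesis by (simp only: enat_ord_simps)
    qed
    have e1: "\<exists>H\<in>?C (U1 W). \<mu> (H ` (U1 W \<times> {1})) \<le> ennreal (2 * ?d)" if W: "W \<in> \<W>" for W
    proof -
      obtain H where H: "H \<in> tangential_contractions X \<L> (U1 W)"
        "deformation_length \<U> (U1 W) H \<le> enat (1 + l W * (k + k) + 2)" "\<mu> (H ` (U1 W \<times> {1})) \<le> emeasure \<Lambda> Z'"
        using l[OF W, unfolded linear_contractions_def, THEN spec, THEN spec, THEN spec, THEN spec, THEN mp, THEN mp, THEN mp, THEN mp,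
          OF order_refl ballI[OF O'(1)] O'(2,3)] unfolding U1_def by blast
      show ?thesis using H(1) order_trans[OF H(2) lB[OF W]] order_trans[OF H(3) Zb] by blast
    qed
    have e2: "\<exists>H\<in>?C (U2 W). \<mu> (H ` (U2 W \<times> {1})) \<le> ennreal (2 * ?d)" if W: "W \<in> \<W>" for W
    proof -
      have o: "{\<one>\<^bsub>G\<^esub>} \<subseteq> ?Q" using G.word_ball_one by blast
      have R: "\<forall>g\<in>{\<one>\<^bsub>G\<^esub>}. openin F R \<and> g ` R \<subseteq> R"
        using O'(4) G_one openin_subset[OF O'(4)] by (auto simp: subset_iff)
      have dR: "disjoint_family_on (\<lambda>g. R) {\<one>\<^bsub>G\<^esub>}" by (simp add: disjoint_family_on_def)
      obtain H where H: "H \<in> tangential_contractions X \<L> (U2 W)"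
        "deformation_length \<U> (U2 W) H \<le> enat (1 + l W * (k + k) + 2)" "\<mu> (H ` (U2 W \<times> {1})) \<le> emeasure \<Lambda> R"
        using l[OF W, unfolded linear_contractions_def, THEN spec, THEN spec, THEN spec, THEN spec, THEN mp, THEN mp, THEN mp, THEN mp,
          OF o R dR O'(4)] unfolding U2_def by blast
      show ?thesis using H(1) order_trans[OF H(2) lB[OF W]] order_trans[OF H(3) O'(7)] by blast
    qed
    define \<V> where "\<V> = U1 ` \<W> \<union> U2 ` \<W>"
    have fV: "finite \<V>" unfolding \<V>_def using \<W>(1) by simp
    have cV: "card \<V> \<le> 2 * card \<W>"
      using card_Un_le[of "U1 ` \<W>" "U2 ` \<W>"] card_image_le[OF \<W>(1), of U1] card_image_le[OF \<W>(1), of U2]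
      unfolding \<V>_def by linarith
    have eV: "\<exists>H\<in>?C U. \<mu> (H ` (U \<times> {1})) \<le> ennreal (2 * ?d)" if "U \<in> \<V>" for U
      using that e1 e2 unfolding \<V>_def by (elim UnE imageE) simp_all
    have oV: "openin X U \<and> ?C U \<noteq> {}" if U: "U \<in> \<V>" for U
    proof -
      obtain H where H: "H \<in> ?C U" using eV[OF U] by (elim bexE)
      then have "openin X U" unfolding tangential_contractions_def tangential_deformation_def by blast
      then show ?thesis using H by blast
    qed
    have tV: "tau_using \<mu> ?C U \<le> ennreal (2 * ?d)" if U: "U \<in> \<V>" for U
    proof -
      obtain H where H: "H \<in> ?C U" "\<mu> (H ` (U \<times> {1})) \<le> ennreal (2 * ?d)" using eV[OF U] by (elim bexE)
      show ?thesis unfolding tau_using_def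
        by (rule order_trans[OF INF_lower[where f = "\<lambda>H. \<mu> (H ` (U \<times> {1}))", OF H(1)] H(2)])
    qed
    have covV: "\<Union>\<V> = topspace X"
    proof (intro equalityI subsetI)
      fix x assume "x \<in> \<Union>\<V>"
      then obtain U where U: "U \<in> \<V>" "x \<in> U" by blast
      then show "x \<in> topspace X" using oV[OF U(1)] openin_subset by blast
    next
      fix x assume "x \<in> topspace X"
      then obtain W where W: "W \<in> \<W>" "x \<in> q ` (W \<times> topspace F)" using \<W>(3) by blast
      have "q ` (W \<times> topspace F) = U1 W \<union> U2 W" unfolding U1_def U2_def O'(5) by blast
      then have "x \<in> U1 W \<or> x \<in> U2 W" using W(2) by simp
      moreover have "U1 W \<in> \<V>" "U2 W \<in> \<V>" using W(1) unfolding \<V>_def by simp_all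
      ultimately show "x \<in> \<Union>\<V>" by (elim disjE) (rule UnionI, assumption+)+
    qed
    have "Cat_bounded X \<L> \<mu> (B * k) \<U> \<le> (\<Sum>\<^sub>\<infinity>U\<in>\<V>. tau_using \<mu> ?C U)"
      unfolding Cat_bounded_def Cat_using_def
      by (rule INF_lower[where f = "\<lambda>\<V>. \<Sum>\<^sub>\<infinity>U\<in>\<V>. tau_using \<mu> ?C U"]) (use oV covV in blast)
    also have "\<dots> = (\<Sum>U\<in>\<V>. tau_using \<mu> ?C U)" using fV by simp
    also have "\<dots> \<le> of_nat (card \<V>) * ennreal (2 * ?d)" by (rule sum_bounded_above[OF tV])
    also have "\<dots> \<le> of_nat (2 * card \<W>) * ennreal (2 * ?d)"
      by (rule mult_right_mono) (use cV in \<open>simp_all only: of_nat_le_iff zero_le\<close>)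
    also have "\<dots> = ennreal (4 * real (card \<W>)) * ennreal ?d"
      by (simp add: ennreal_of_nat_eq_real_of_nat ennreal_mult'[symmetric])
    also have "\<dots> \<le> ennreal A * ennreal ?d"
      unfolding A_def by (intro mult_right_mono ennreal_leI) simp_all
    finally show ?thesis unfolding N_def[symmetric] iN .
  qed
  show thesis by (rule that[OF _ _ bound]) (simp_all add: A_def B_def)
qed

lemma Cat_II_eq_growth: "Cat_II X \<L> \<mu> \<U> = group_growth G S"
  unfolding Cat_II_def group_growth_def
proof (rule growth_type_eqI)
  obtain r where r: "r \<ge> 1" "\<And>m. inverse (of_nat (card (Sn (r * m)))) \<le> Cat_bounded X \<L> \<mu> m \<U>"
    by (rule lower_bound) (rule that)
  have "inverse (Cat_bounded X \<L> \<mu> m \<U>) \<le> ennreal 1 * of_nat (card (Sn (r * m)))" for m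
    using ennreal_inverse_le[OF r(2)[of m]] Sn_card_pos[of "r * m"] by (simp add: of_nat_less_top)
  then show "growth_le (\<lambda>n. inverse (Cat_bounded X \<L> \<mu> n \<U>)) (\<lambda>n. of_nat (card (Sn n)))"
    unfolding growth_le_def using r(1) by (intro exI[of _ r] conjI exI[of _ "1::real"]) simp_all
next
  obtain B A where B: "B \<ge> 1" "A > (0::real)"
    "\<And>k. k \<ge> 1 \<Longrightarrow> Cat_bounded X \<L> \<mu> (B * k) \<U> \<le> ennreal A * inverse (of_nat (card (Sn k)))"
    by (rule upper_bound) (rule that)
  have "of_nat (card (Sn k)) \<le> ennreal A * inverse (Cat_bounded X \<L> \<mu> (B * k) \<U>)" if k: "k \<ge> 1" for k
  proof -
    let ?c = "Cat_bounded X \<L> \<mu> (B * k) \<U>" and ?N = "of_nat (card (Sn k)) :: ennreal"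
    have N: "inverse ?N * ?N = 1"
      using ennreal_divide_self[of ?N] Sn_card_pos[of k] by (simp add: divide_ennreal_def mult.commute of_nat_less_top)
    show ?thesis
    proof (cases "?c = 0")
      case True
      then show ?thesis using B(2) by (simp add: ennreal_mult_top)
    next
      case False
      have "ennreal A * inverse ?N < top_class.top" using Sn_card_pos[of k] by (simp add: less_top[symmetric] ennreal_mult_eq_top_iff)
      then have "?c < top_class.top" using B(3)[OF k] by (rule le_less_trans[rotated])
      then have c: "?c * inverse ?c = 1" using ennreal_divide_self[of ?c] False by (simp add: divide_ennreal_def)
      have "?N = ?c * inverse ?c * ?N" using c by simp
      also have "\<dots> = ?c * (inverse ?c * ?N)" by (simp only: mult.assoc)
      also have "\<dots> \<le> (ennreal A * inverse ?N) * (inverse ?c * ?N)" by (rule mult_right_mono[OF B(3)[OF k]]) simp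
      also have "\<dots> = ennreal A * inverse ?c * (inverse ?N * ?N)" by (simp only: mult_ac)
      finally show ?thesis unfolding N by simp
    qed
  qed
  then show "growth_le (\<lambda>n. of_nat (card (Sn n))) (\<lambda>n. inverse (Cat_bounded X \<L> \<mu> n \<U>))"
    unfolding growth_le_def using B(1,2) by (intro exI[of _ B] conjI exI[of _ A]) simp_all
qed

end

section \<open>Suspensions of free actions\<close>

theorem corollary6p5:
  fixes n :: nat
    and M :: "'m::topological_space set"
    and Mt :: "'u::topological_space set"
    and p :: "'u \<Rightarrow> 'm"
    and u0 :: 'u
    and F :: "'f topology"
    and h :: "(real \<Rightarrow> 'm) set \<Rightarrow> 'f \<Rightarrow> 'f"
    and G :: "('f \<Rightarrow> 'f) monoid"
    and S :: "('f \<Rightarrow> 'f) set"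
    and \<Lambda> :: "'f measure"
    and X :: "('u \<times> 'f) set topology"
    and \<F> \<U> :: "('u \<times> 'f) set chart set"
    and \<mu> :: "('u \<times> 'f) set set \<Rightarrow> ennreal"
  assumes manifold: "compact_manifold n (top_of_set M)"
    and universal_cover: "covering_space Mt p M" "simply_connected Mt" "u0 \<in> Mt"
    and fiber: "compact_space F" "Polish_space F"
    and h_hom: "h \<in> hom (fundamental_group M (p u0)) (homeo_group F)"
    and G_eq: "G = (homeo_group F)\<lparr>carrier := h ` carrier (fundamental_group M (p u0))\<rparr>"
    and free: "\<And>g y. g \<in> carrier G \<Longrightarrow> y \<in> topspace F \<Longrightarrow> g y = y \<Longrightarrow> g = \<one>\<^bsub>G\<^esub>"
    and measure: "sets \<Lambda> = sets (borel_of F)" "prob_space \<Lambda>" "regular_measure F \<Lambda>"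
    and invariant: "\<And>g B. g \<in> carrier G \<Longrightarrow> B \<in> sets \<Lambda> \<Longrightarrow> emeasure \<Lambda> (g ` B) = emeasure \<Lambda> B"
    and X_eq: "X = suspension_space M Mt p u0 F h"
    and F_eq: "\<F> = suspension_lamination n M Mt p u0 F h"
    and transverse_measure: "suspension_transverse_measure n M Mt p u0 F h \<Lambda> \<mu>"
    and Cat_zero: "Cat X \<F> \<mu> = 0"
    and atlas: "finite \<U>" "regular_atlas n X \<F> \<U>"
    and generators: "finite S" "symmetric_generating_set G S"
    and growth_ne: "Cat_II X \<F> \<mu> \<U> \<noteq> group_growth G S"
  shows "\<not> Rohlin_group G (discrete_topology (carrier G))"
proof -
  have "suspension n M Mt p u0 F h"
    using manifold universal_cover fiber h_hom by (rule suspension.intro)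
  then have "suspension_dynamics n M Mt p u0 F h G S \<U>"
  proof (rule suspension_dynamics.intro)
    show "suspension_dynamics_axioms n M Mt p u0 F h G S \<U>"
      using G_eq free generators atlas unfolding X_eq F_eq by (rule suspension_dynamics_axioms.intro)
  qed
  then interpret suspension_measure n M Mt p u0 F h G S \<U> \<Lambda> \<mu>
  proof (rule suspension_measure.intro)
    show "suspension_measure_axioms n M Mt p u0 F h G \<Lambda> \<mu>"
      using measure invariant transverse_measure by (rule suspension_measure_axioms.intro)
  qed
  have "Cat_II X \<F> \<mu> \<U> = group_growth G S"
    unfolding X_eq F_eq by (rule Cat_II_eq_growth)
  then show ?thesis using growth_ne by contradiction
qed

end
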